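(* There are constants $C,c>0$ such that $$\left\| T_{\epsilon}(t)\begin{pmatrix}u_0 \\ v_0 \end{pmatrix}- T_{\epsilon,0}(t)\begin{pmatrix}u_0 \\ v_0 \end{pmatrix}\right\|_{X_1\times Y_1}\leq C e^{(\omega_B+c)t} \big(\epsilon \|v_0\|_{Y_1}+\epsilon^{\delta_Y}\| u_0-h^0(v_0)\|_{X_1}\big)$$ holds for all $(u_0,v_0)\in X_1\times Y_1$, all $t\geq0$ and all $\epsilon\in(0,1]$. Here $T_\epsilon$ is the semiflow of the fast-slow system and $T_{\epsilon,0}$ the semiflow of the extended slow system (both defined in the context).
   Context: **Setting.** $X,Y$ are Banach spaces and $T>0$, $\epsilon\ge0$ are parameters ($T$ is arbitrary). (i) $A\colon X\supset D(A)\to X$ is a closed linear operator generating an exponentially stable $C_0$-semigroup $(e^{tA})_{t\ge0}$ on $X$; $B\colon Y\supset D(B)\to Y$ is a closed linear operator generating a $C_0$-semigroup $(e^{tB})_{t\ge0}$ on $Y$. (ii) $(X_\alpha)_{\alpha\in[-1,\infty)}$ and $(Y_\alpha)_{\alpha\in[-1,\infty)}$ are, up to equivalence of norms for each fixed $\alpha$, the interpolation-extrapolation scales generated by $(X,A)$ and $(Y,B)$ (by $(Y,B-\lambda)$ for some $\lambda\in\rho(B)$ if $0\notin\rho(B)$). The interpolation-extrapolation scale of a densely defined closed operator $S$ on a Banach space $Z$ with $0\in\rho(S)$ is defined, after fixing for each $\theta\in(0,1)$ an exact interpolation functor $(\cdot,\cdot)_\theta$ such that $Z_1$ is dense in $(Z_0,Z_1)_\theta$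 whenever $Z_1$ is densely embedded in $Z_0$, by: $Z_k=D(S^k)$ with norm $\|S^kz\|_Z$ for $k\in\mathbb N_0$; $Z_{-1}$ is the completion of $Z$ with respect to $\|S^{-1}z\|_Z$; $Z_{k+\theta}=(Z_k,Z_{k+1})_\theta$ for $k\in\mathbb N_0\cup\{-1\}$, $\theta\in(0,1)$. The operator and its semigroup are extended/restricted to the spaces of the scale and denoted by the same symbols. In particular $X_0=X$, $X_1=D(A)$, $Y_0=Y$, $Y_1=D(B)$. (iii) $\gamma_X\in(0,1]$ if $(e^{tA})_{t\ge0}$ is holomorphic and $\gamma_X=1$ otherwise; $\delta_X\in[1-\gamma_X,1]$; $\delta_Y\in(0,1]$ if $(e^{tB})_{t\ge0}$ is holomorphic and $\delta_Y=1$ otherwise. (iv) $f\colon X_{\delta_X}\times Y_{1-\delta_X}\to X$ and $g\colon X_1\times Y_1\to Y_{\delta_Y}$ are continuous, $f(0,0)=0$, $g(0,0)=0$; $f(x,y)\in X_{\gamma_X}$ and $g(x,y)\in Y_{\delta_Y}$ for $(x,y)\in X_1\times Y_1$; $f(u,v)\in C^1([0,t];X_{\delta_X-1})$ whenever $u\in C^1([0,t];X_{\delta_X})$ and $v\in C^1([0,t];Y)\cap C([0,t];Y_{1-\delta_X})$; and there are constants $L_f,L_g>0$ with $\|f(x_1,y_1)-f(x_2,y_2)\|_{X_{\gamma_X}}\le L_f(\|x_1-x_2\|_{X_1}+\|y_1-y_2\|_{Y_1})$, $\|f(u_1,v_1)-f(u_2,v_2)\|_{C^1([0,t];X_{\delta_X-1})}\le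 L_f(\|u_1-u_2\|_{C^1([0,t];X_{\delta_X})}+\|v_1-v_2\|_{C^1([0,t];Y)})$, $\|g(x_1,y_1)-g(x_2,y_2)\|_{Y_{\delta_Y}}\le L_g(\|x_1-x_2\|_{X_1}+\|y_1-y_2\|_{Y_1})$ for all $x_i\in X_1$, $y_i\in Y_1$, $u_i\in C^1([0,t];X_{\delta_X})$, $v_i\in C^1([0,t];Y)\cap C([0,t];Y_{1-\delta_X})$. (v) $M_A,M_B,C_A,C_B>0$, $\omega_A<0$, $\omega_B\in\mathbb R$ are constants with, for all $t>0$, $\|e^{tA}\|_{\mathcal B(X_1)}\le M_Ae^{\omega_At}$, $\|e^{tA}\|_{\mathcal B(X_{\gamma_X},X_1)}\le C_At^{\gamma_X-1}e^{\omega_At}$, $\|e^{tA}\|_{\mathcal B(X_{\delta_X},X_1)}\le C_At^{\delta_X-1}e^{\omega_At}$, $\|e^{tB}\|_{\mathcal B(Y_1)}\le M_Be^{\omega_Bt}$, $\|e^{tB}\|_{\mathcal B(Y_{\delta_Y},Y_1)}\le C_Bt^{\delta_Y-1}e^{\omega_Bt}$. (vi) $\omega_f:=\omega_A+(2C_AL_f)^{1/\gamma_X}(1/\gamma_X)^{(1-\gamma_X)/\gamma_X}$ if $\gamma_X\in(0,1)$; if $\gamma_X=1$, $\omega_f$ is a fixed number $>\omega_A+C_AL_f$. It is assumed that $\omega_f<0$ and $L_f\max\{\|A^{-1}\|_{\mathcal B(X_{\gamma_X},X_1)},\|A^{-1}\|_{\mathcal B(X_{\delta_X-1},X_{\delta_X})}\}<1$.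 **Fast-slow system.** $\epsilon\partial_tu^\epsilon=Au^\epsilon+f(u^\epsilon,v^\epsilon)$, $\partial_tv^\epsilon=Bv^\epsilon+g(u^\epsilon,v^\epsilon)$, $u^\epsilon(0)=u_0\in X_1$, $v^\epsilon(0)=v_0\in Y_1$. For $\epsilon>0$ it has a unique strict solution in $C^1([0,T];X\times Y)\cap C([0,T];X_1\times Y_1)$ for every $T>0$; $T_\epsilon(t)(u_0,v_0):=(u^\epsilon(t),v^\epsilon(t))$. **Critical manifold.** For $y\in Y_1$, $h^0(y)\in X_1$ is the unique solution of $0=Ah^0(y)+f(h^0(y),y)$. **Extended slow system.** $T_{\epsilon,0}(t)(u_0,v_0):=(u^{\epsilon,0}(t),v^0(t))$, where $(u^{\epsilon,0},v^0)\in C^1([0,T];X\times Y)\cap C([0,T];X_1\times Y_1)$ is the unique solution of $\epsilon\partial_tu^{\epsilon,0}=Au^{\epsilon,0}+f(u^{\epsilon,0},v^0)-\epsilon\,\partial_tA^{-1}f(h^0(v^0),v^0)$, $\partial_tv^0=Bv^0+g(h^0(v^0),v^0)$, $u^{\epsilon,0}(0)=u_0$, $v^0(0)=v_0$.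
   Formalization: The formal statement additionally requires δ_X > 0, which excludes exactly the corner γ_X = 1, δ_X = 0; there the claimed estimate is false in general, because t^(δ_X-1) is not integrable at 0 and maximal regularity for continuous functions can fail. *)

theory Defs
  imports "HOL-Analysis.Analysis"
begin

section \<open>Normed spaces carried by subsets of a type\<close>

text \<open>All spaces of a scale are realised as sets of elements of one ambient Banach space, each
  with its own norm. The values of \<^term>\<open>nrm\<close> outside the carrier are irrelevant.\<close>

datatype 'a nspace = NSpace (carr: "'a set") (nrm: "'a \<Rightarrow> real")

definition whole_space :: "'a::real_normed_vector nspace" where
  "whole_space = NSpace UNIV norm"

definition normed_nspace :: "'a::real_vector nspace \<Rightarrow> bool" where
  "normed_nspace E \<longleftrightarrow> subspace (carr E) \<and>
     (\<forall>x\<in>carr E. 0 \<le> nrm E x \<and> (nrm E x = 0 \<longleftrightarrow> x = 0)) \<and>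
     (\<forall>x\<in>carr E. \<forall>a. nrm E (a *\<^sub>R x) = \<bar>a\<bar> * nrm E x) \<and>
     (\<forall>x\<in>carr E. \<forall>y\<in>carr E. nrm E (x + y) \<le> nrm E x + nrm E y)"

text \<open>The locale \<^locale>\<open>Metric_space\<close> wants nonnegativity and symmetry also off the carrier,
  hence the case distinction.\<close>

definition ndist :: "'a::real_vector nspace \<Rightarrow> 'a \<Rightarrow> 'a \<Rightarrow> real" where
  "ndist E x y = (if x \<in> carr E \<and> y \<in> carr E then nrm E (x - y) else 0)"

definition ntop :: "'a::real_vector nspace \<Rightarrow> 'a topology" where
  "ntop E = Metric_space.mtopology (carr E) (ndist E)"

definition banach_nspace :: "'a::real_vector nspace \<Rightarrow> bool" where
  "banach_nspace E \<longleftrightarrow> normed_nspace E \<and> Metric_space.mcomplete (carr E) (ndist E)"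

definition embeds :: "'a nspace \<Rightarrow> 'a nspace \<Rightarrow> bool" where
  "embeds E F \<longleftrightarrow> carr E \<subseteq> carr F \<and> (\<exists>c. \<forall>x\<in>carr E. nrm F x \<le> c * nrm E x)"

definition equivalent_nspaces :: "'a nspace \<Rightarrow> 'a nspace \<Rightarrow> bool" where
  "equivalent_nspaces E F \<longleftrightarrow> embeds E F \<and> embeds F E"

definition dense_in_nspace :: "'a::real_vector set \<Rightarrow> 'a nspace \<Rightarrow> bool" where
  "dense_in_nspace S E \<longleftrightarrow> ntop E closure_of S = carr E"

definition nprod :: "'a nspace \<Rightarrow> 'b nspace \<Rightarrow> ('a \<times> 'b) nspace" where
  "nprod E F = NSpace (carr E \<times> carr F) (\<lambda>p. nrm E (fst p) + nrm F (snd p))"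

text \<open>\<open>op_norm_le E F T c\<close>: \<open>T\<close> maps \<open>E\<close> into \<open>F\<close>, is bounded, and its norm in
  \<open>B(E,F)\<close> is at most \<open>c\<close>.\<close>

definition op_norm_le :: "'a nspace \<Rightarrow> 'b nspace \<Rightarrow> ('a \<Rightarrow> 'b) \<Rightarrow> real \<Rightarrow> bool" where
  "op_norm_le E F T c \<longleftrightarrow> (\<forall>x\<in>carr E. T x \<in> carr F \<and> nrm F (T x) \<le> c * nrm E x)"

definition op_norm :: "'a nspace \<Rightarrow> 'b nspace \<Rightarrow> ('a \<Rightarrow> 'b) \<Rightarrow> real" where
  "op_norm E F T = Inf {c. 0 \<le> c \<and> op_norm_le E F T c}"

section \<open>Continuous and continuously differentiable curves on \<open>[0,t]\<close>\<close>

definition C0_curve :: "'a::real_vector nspace \<Rightarrow> real \<Rightarrow> (real \<Rightarrow> 'a) \<Rightarrow> bool" where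
  "C0_curve E t w \<longleftrightarrow> continuous_map (top_of_set {0..t}) (ntop E) w"

definition has_curve_deriv ::
  "'a::real_vector nspace \<Rightarrow> real \<Rightarrow> (real \<Rightarrow> 'a) \<Rightarrow> real \<Rightarrow> 'a \<Rightarrow> bool" where
  "has_curve_deriv E t w s d \<longleftrightarrow>
     limitin (ntop E) (\<lambda>r. (w r - w s) /\<^sub>R (r - s)) d (at s within {0..t})"

definition curve_deriv ::
  "'a::real_vector nspace \<Rightarrow> real \<Rightarrow> (real \<Rightarrow> 'a) \<Rightarrow> real \<Rightarrow> 'a" where
  "curve_deriv E t w s = (THE d. has_curve_deriv E t w s d)"

definition C1_curve :: "'a::real_vector nspace \<Rightarrow> real \<Rightarrow> (real \<Rightarrow> 'a) \<Rightarrow> bool" where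
  "C1_curve E t w \<longleftrightarrow> C0_curve E t w \<and>
     (\<exists>w'. C0_curve E t w' \<and> (\<forall>s\<in>{0..t}. has_curve_deriv E t w s (w' s)))"

definition C1_norm :: "'a::real_vector nspace \<Rightarrow> real \<Rightarrow> (real \<Rightarrow> 'a) \<Rightarrow> real" where
  "C1_norm E t w = (SUP s\<in>{0..t}. nrm E (w s)) + (SUP s\<in>{0..t}. nrm E (curve_deriv E t w s))"

section \<open>Unbounded operators and semigroups\<close>

text \<open>An operator is given by its domain \<open>D\<close> and a function whose values off \<open>D\<close> are
  irrelevant.\<close>

definition closed_op :: "'x::real_normed_vector set \<Rightarrow> ('x \<Rightarrow> 'x) \<Rightarrow> bool" where
  "closed_op D A \<longleftrightarrow> subspace ((\<lambda>x. (x, A x)) ` D) \<and> closed ((\<lambda>x. (x, A x)) ` D)"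

definition resolvent_set :: "'x::real_normed_vector set \<Rightarrow> ('x \<Rightarrow> 'x) \<Rightarrow> real set" where
  "resolvent_set D A = {l. bij_betw (\<lambda>x. A x - l *\<^sub>R x) D UNIV \<and>
     bounded_linear (inv_into D (\<lambda>x. A x - l *\<^sub>R x))}"

fun op_power_dom :: "'x set \<Rightarrow> ('x \<Rightarrow> 'x) \<Rightarrow> nat \<Rightarrow> 'x set" where
  "op_power_dom D A 0 = UNIV"
| "op_power_dom D A (Suc k) = {x \<in> D. A x \<in> op_power_dom D A k}"

definition c0_semigroup :: "(real \<Rightarrow> 'x::real_normed_vector \<Rightarrow>\<^sub>L 'x) \<Rightarrow> bool" where
  "c0_semigroup T \<longleftrightarrow> T 0 = id_blinfun \<and>
     (\<forall>s\<ge>0. \<forall>t\<ge>0. T (s + t) = T s o\<^sub>L T t) \<and>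
     (\<forall>x. ((\<lambda>t. T t x) \<longlongrightarrow> x) (at_right 0))"

definition generates ::
  "'x::real_normed_vector set \<Rightarrow> ('x \<Rightarrow> 'x) \<Rightarrow> (real \<Rightarrow> 'x \<Rightarrow>\<^sub>L 'x) \<Rightarrow> bool" where
  "generates D A T \<longleftrightarrow> c0_semigroup T \<and>
     D = {x. \<exists>y. ((\<lambda>h. (T h x - x) /\<^sub>R h) \<longlongrightarrow> y) (at_right 0)} \<and>
     (\<forall>x\<in>D. ((\<lambda>h. (T h x - x) /\<^sub>R h) \<longlongrightarrow> A x) (at_right 0))"

definition exponentially_stable :: "(real \<Rightarrow> 'x::real_normed_vector \<Rightarrow>\<^sub>L 'x) \<Rightarrow> bool" where
  "exponentially_stable T \<longleftrightarrow> (\<exists>M w. w < 0 \<and> (\<forall>t\<ge>0. norm (T t) \<le> M * exp (w * t)))"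

text \<open>Banach spaces are real here. A semigroup is holomorphic if its complexification, acting on
  pairs \<open>(x, y)\<close> standing for \<open>x + \<i>y\<close>, extends to a holomorphic semigroup on a sector
  (which for a complex Banach space agrees with the notion without complexification).\<close>

definition cmult :: "complex \<Rightarrow> 'x::real_vector \<times> 'x \<Rightarrow> 'x \<times> 'x" where
  "cmult w p = (Re w *\<^sub>R fst p - Im w *\<^sub>R snd p, Re w *\<^sub>R snd p + Im w *\<^sub>R fst p)"

definition sector :: "real \<Rightarrow> complex set" where
  "sector \<theta> = {z. z \<noteq> 0 \<and> \<bar>Arg z\<bar> < \<theta>}"

definition holomorphic_semigroup :: "(real \<Rightarrow> 'x::real_normed_vector \<Rightarrow>\<^sub>L 'x) \<Rightarrow> bool" where
  "holomorphic_semigroup T \<longleftrightarrow>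
     (\<exists>\<theta>. \<exists>S :: complex \<Rightarrow> ('x \<times> 'x) \<Rightarrow>\<^sub>L ('x \<times> 'x). 0 < \<theta> \<and> \<theta> \<le> pi / 2 \<and>
        (\<forall>z\<in>sector \<theta>. \<forall>w p. blinfun_apply (S z) (cmult w p) = cmult w (blinfun_apply (S z) p)) \<and>
        (\<forall>t>0. \<forall>x y. blinfun_apply (S (complex_of_real t)) (x, y) = (T t x, T t y)) \<and>
        (\<forall>z\<in>sector \<theta>. \<forall>w\<in>sector \<theta>. S (z + w) = S z o\<^sub>L S w) \<and>
        (\<forall>z\<in>sector \<theta>. \<forall>p. \<exists>d. ((\<lambda>z. blinfun_apply (S z) p) has_derivative (\<lambda>h. cmult h d)) (at z)) \<and>
        (\<forall>\<theta>'\<in>{0<..<\<theta>}. \<forall>p. ((\<lambda>z. blinfun_apply (S z) p) \<longlongrightarrow> p) (at 0 within sector \<theta>')))"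

section \<open>Exact interpolation functors\<close>

text \<open>The functor acts on the Banach couples whose members are continuously embedded in the
  ambient Banach space given by the type, and on the linear maps between such couples.\<close>

definition nspace_sum :: "'e::real_vector nspace \<Rightarrow> 'e nspace \<Rightarrow> 'e nspace" where
  "nspace_sum E0 E1 = NSpace {x + y | x y. x \<in> carr E0 \<and> y \<in> carr E1}
     (\<lambda>z. Inf {nrm E0 x + nrm E1 y | x y. x \<in> carr E0 \<and> y \<in> carr E1 \<and> z = x + y})"

definition nspace_int :: "'e::real_vector nspace \<Rightarrow> 'e nspace \<Rightarrow> 'e nspace" where
  "nspace_int E0 E1 = NSpace (carr E0 \<inter> carr E1) (\<lambda>z. max (nrm E0 z) (nrm E1 z))"

definition banach_couple :: "'e::banach nspace \<Rightarrow> 'e nspace \<Rightarrow> bool" where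
  "banach_couple E0 E1 \<longleftrightarrow> banach_nspace E0 \<and> banach_nspace E1 \<and>
     embeds E0 whole_space \<and> embeds E1 whole_space"

definition lin_on :: "'a::real_vector set \<Rightarrow> ('a \<Rightarrow> 'b::real_vector) \<Rightarrow> bool" where
  "lin_on S T \<longleftrightarrow> (\<forall>x\<in>S. \<forall>y\<in>S. \<forall>a b. T (a *\<^sub>R x + b *\<^sub>R y) = a *\<^sub>R T x + b *\<^sub>R T y)"

definition exact_interpolation_functor ::
  "('e::banach nspace \<Rightarrow> 'e nspace \<Rightarrow> 'e nspace) \<Rightarrow> bool" where
  "exact_interpolation_functor \<F> \<longleftrightarrow>
     (\<forall>E0 E1. banach_couple E0 E1 \<longrightarrow>
        banach_nspace (\<F> E0 E1) \<and>
        embeds (nspace_int E0 E1) (\<F> E0 E1) \<and> embeds (\<F> E0 E1) (nspace_sum E0 E1) \<and>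
        (\<forall>G0 G1 T c. banach_couple G0 G1 \<and> lin_on (carr (nspace_sum E0 E1)) T \<and>
           op_norm_le E0 G0 T c \<and> op_norm_le E1 G1 T c \<longrightarrow>
           op_norm_le (\<F> E0 E1) (\<F> G0 G1) T c))"

definition preserves_density ::
  "('e::banach nspace \<Rightarrow> 'e nspace \<Rightarrow> 'e nspace) \<Rightarrow> bool" where
  "preserves_density \<F> \<longleftrightarrow>
     (\<forall>E0 E1. banach_couple E0 E1 \<and> embeds E1 E0 \<and> dense_in_nspace (carr E1) E0 \<longrightarrow>
        dense_in_nspace (carr E1) (\<F> E0 E1))"

section \<open>Interpolation-extrapolation scales\<close>

text \<open>The completion of \<open>Z\<close> for the norm of \<open>S\<^sup>-\<^sup>1 z\<close> is the Banach type \<open>'e\<close> together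
  with the embedding \<open>j\<close>.\<close>

definition extrapolation_space ::
  "'z::banach set \<Rightarrow> ('z \<Rightarrow> 'z) \<Rightarrow> ('z \<Rightarrow> 'e::banach) \<Rightarrow> bool" where
  "extrapolation_space D S j \<longleftrightarrow> linear j \<and> (\<forall>z. norm (j z) = norm (inv_into D S z)) \<and>
     closure (range j) = UNIV"

definition integer_space ::
  "'z::banach set \<Rightarrow> ('z \<Rightarrow> 'z) \<Rightarrow> ('z \<Rightarrow> 'e::banach) \<Rightarrow> int \<Rightarrow> 'e nspace" where
  "integer_space D S j k =
     (if k < 0 then whole_space
      else NSpace (j ` op_power_dom D S (nat k)) (\<lambda>e. norm ((S ^^ nat k) (inv j e))))"

definition scale_space ::
  "(real \<Rightarrow> 'e::banach nspace \<Rightarrow> 'e nspace \<Rightarrow> 'e nspace) \<Rightarrow>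
   'z::banach set \<Rightarrow> ('z \<Rightarrow> 'z) \<Rightarrow> ('z \<Rightarrow> 'e) \<Rightarrow> real \<Rightarrow> 'e nspace" where
  "scale_space \<F> D S j \<alpha> =
     (if \<alpha> \<in> \<int> then integer_space D S j \<lfloor>\<alpha>\<rfloor>
      else \<F> (frac \<alpha>) (integer_space D S j \<lfloor>\<alpha>\<rfloor>) (integer_space D S j (\<lfloor>\<alpha>\<rfloor> + 1)))"

text \<open>\<open>Z \<alpha>\<close>, for \<open>\<alpha> \<ge> -1\<close>, is up to equivalence of norms the scale generated by \<open>(Z, S)\<close>.\<close>

definition interpolation_extrapolation_scale ::
  "'z::banach set \<Rightarrow> ('z \<Rightarrow> 'z) \<Rightarrow> ('z \<Rightarrow> 'e::banach) \<Rightarrow> (real \<Rightarrow> 'e nspace) \<Rightarrow> bool" where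
  "interpolation_extrapolation_scale D S j Z \<longleftrightarrow>
     closed_op D S \<and> closure D = UNIV \<and> 0 \<in> resolvent_set D S \<and> extrapolation_space D S j \<and>
     (\<exists>\<F>. (\<forall>\<theta>\<in>{0<..<1}. exact_interpolation_functor (\<F> \<theta>) \<and> preserves_density (\<F> \<theta>)) \<and>
          (\<forall>\<alpha>\<ge>-1. normed_nspace (Z \<alpha>) \<and> equivalent_nspaces (Z \<alpha>) (scale_space \<F> D S j \<alpha>)))"

text \<open>For \<open>\<alpha> \<ge> 0\<close> the space \<open>Z \<alpha>\<close> lies in the image of \<open>Z\<close>; this is the same space viewed
  inside \<open>Z\<close>.\<close>

definition pullback :: "('z \<Rightarrow> 'e) \<Rightarrow> 'e nspace \<Rightarrow> 'z nspace" where
  "pullback j E = NSpace (j -` carr E) (\<lambda>z. nrm E (j z))"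

text \<open>\<open>S\<^sup>-\<^sup>1\<close> on the extrapolation space.\<close>

definition extrapolated_inverse ::
  "'z::banach set \<Rightarrow> ('z \<Rightarrow> 'z) \<Rightarrow> ('z \<Rightarrow> 'e::banach) \<Rightarrow> 'e \<Rightarrow>\<^sub>L 'e" where
  "extrapolated_inverse D S j = (THE R. \<forall>z. blinfun_apply R (j z) = j (inv_into D S z))"

section \<open>The fast-slow system and the extended slow system\<close>

text \<open>Solutions live on \<open>[0,\<infinity>)\<close>; being \<open>C\<^sup>1\<close>, respectively \<open>C\<close>, on every \<open>[0,T]\<close> is the same
  as being so on \<open>[0,\<infinity>)\<close>. \<open>X1\<close> and \<open>Y1\<close> are the domains with their norms.\<close>

definition fast_slow_solution ::
  "('x::banach \<Rightarrow> 'x) \<Rightarrow> ('y::banach \<Rightarrow> 'y) \<Rightarrow> ('x \<Rightarrow> 'y \<Rightarrow> 'x) \<Rightarrow> ('x \<Rightarrow> 'y \<Rightarrow> 'y) \<Rightarrow>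
   'x nspace \<Rightarrow> 'y nspace \<Rightarrow> real \<Rightarrow> 'x \<Rightarrow> 'y \<Rightarrow> (real \<Rightarrow> 'x) \<Rightarrow> (real \<Rightarrow> 'y) \<Rightarrow> bool" where
  "fast_slow_solution A B f g X1 Y1 \<epsilon> u0 v0 u v \<longleftrightarrow>
     u 0 = u0 \<and> v 0 = v0 \<and>
     continuous_map (top_of_set {0..}) (ntop X1) u \<and>
     continuous_map (top_of_set {0..}) (ntop Y1) v \<and>
     (\<exists>u' v'. continuous_on {0..} u' \<and> continuous_on {0..} v' \<and>
        (\<forall>t\<ge>0. (u has_vector_derivative u' t) (at t within {0..}) \<and>
               (v has_vector_derivative v' t) (at t within {0..}) \<and>
               \<epsilon> *\<^sub>R u' t = A (u t) + f (u t) (v t) \<and>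
               v' t = B (v t) + g (u t) (v t)))"

definition fast_slow_flow ::
  "('x::banach \<Rightarrow> 'x) \<Rightarrow> ('y::banach \<Rightarrow> 'y) \<Rightarrow> ('x \<Rightarrow> 'y \<Rightarrow> 'x) \<Rightarrow> ('x \<Rightarrow> 'y \<Rightarrow> 'y) \<Rightarrow>
   'x nspace \<Rightarrow> 'y nspace \<Rightarrow> real \<Rightarrow> real \<Rightarrow> 'x \<times> 'y \<Rightarrow> 'x \<times> 'y" where
  "fast_slow_flow A B f g X1 Y1 \<epsilon> t p =
     (THE q. \<exists>u v. fast_slow_solution A B f g X1 Y1 \<epsilon> (fst p) (snd p) u v \<and> q = (u t, v t))"

definition critical_map ::
  "('x::banach \<Rightarrow> 'x) \<Rightarrow> ('x \<Rightarrow> 'y \<Rightarrow> 'x) \<Rightarrow> 'x nspace \<Rightarrow> 'y \<Rightarrow> 'x" where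
  "critical_map A f X1 y = (THE x. x \<in> carr X1 \<and> 0 = A x + f x y)"

text \<open>\<open>k'\<close> is the time derivative of \<open>A\<^sup>-\<^sup>1 f(h\<^sup>0(v), v)\<close>.\<close>

definition extended_slow_solution ::
  "('x::banach \<Rightarrow> 'x) \<Rightarrow> ('y::banach \<Rightarrow> 'y) \<Rightarrow> ('x \<Rightarrow> 'y \<Rightarrow> 'x) \<Rightarrow> ('x \<Rightarrow> 'y \<Rightarrow> 'y) \<Rightarrow>
   'x nspace \<Rightarrow> 'y nspace \<Rightarrow> real \<Rightarrow> 'x \<Rightarrow> 'y \<Rightarrow> (real \<Rightarrow> 'x) \<Rightarrow> (real \<Rightarrow> 'y) \<Rightarrow> bool" where
  "extended_slow_solution A B f g X1 Y1 \<epsilon> u0 v0 u v \<longleftrightarrow>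
     u 0 = u0 \<and> v 0 = v0 \<and>
     continuous_map (top_of_set {0..}) (ntop X1) u \<and>
     continuous_map (top_of_set {0..}) (ntop Y1) v \<and>
     (\<exists>u' v' k'. continuous_on {0..} u' \<and> continuous_on {0..} v' \<and>
        (\<forall>t\<ge>0. (u has_vector_derivative u' t) (at t within {0..}) \<and>
               (v has_vector_derivative v' t) (at t within {0..}) \<and>
               ((\<lambda>s. inv_into (carr X1) A (f (critical_map A f X1 (v s)) (v s)))
                  has_vector_derivative k' t) (at t within {0..}) \<and>
               \<epsilon> *\<^sub>R u' t = A (u t) + f (u t) (v t) - \<epsilon> *\<^sub>R k' t \<and>
               v' t = B (v t) + g (critical_map A f X1 (v t)) (v t)))"

definition extended_slow_flow ::
  "('x::banach \<Rightarrow> 'x) \<Rightarrow> ('y::banach \<Rightarrow> 'y) \<Rightarrow> ('x \<Rightarrow> 'y \<Rightarrow> 'x) \<Rightarrow> ('x \<Rightarrow> 'y \<Rightarrow> 'y) \<Rightarrow>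
   'x nspace \<Rightarrow> 'y nspace \<Rightarrow> real \<Rightarrow> real \<Rightarrow> 'x \<times> 'y \<Rightarrow> 'x \<times> 'y" where
  "extended_slow_flow A B f g X1 Y1 \<epsilon> t p =
     (THE q. \<exists>u v. extended_slow_solution A B f g X1 Y1 \<epsilon> (fst p) (snd p) u v \<and> q = (u t, v t))"

end

theory Submission
  imports Defs
begin

text \<open>
  Why the estimate holds. Subtract the critical manifold: along a slow trajectory \<open>v\<close> the function
  \<open>w = u - h\<^sup>0(v)\<close> of the extended slow system solves
  \<open>\<epsilon> w' = A w + f(w + h\<^sup>0(v), v) - f(h\<^sup>0(v), v)\<close>, because \<open>A\<^sup>-\<^sup>1 f(h\<^sup>0(v), v) = - h\<^sup>0(v)\<close>: the correction term
  of the extended system is exactly what removes the derivative of \<open>h\<^sup>0(v)\<close>. The condition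
  \<open>\<omega>\<^sub>f < 0\<close> says that the nonlinearity is a contraction against the decay of the semigroup
  (\<open>gap_condition\<close>, with the constant \<open>kernel_const\<close> bounding the integral of
  \<open>r\<^bsup>\<gamma>-1\<^esup> e\<^bsup>-br\<^esup>\<close>), so \<open>w\<close> decays like \<open>e\<^bsup>-\<kappa>t/\<epsilon>\<^esup>\<close> (\<open>dev_decay\<close>).

  Let \<open>p\<close> and \<open>q\<close> be the differences of the fast and of the slow components. Then
  \<open>\<epsilon> p' = A p + (difference of f) - \<epsilon> (h\<^sup>0(v))'\<close> and \<open>q' = B q + (difference of g)\<close>. By the
  variation of constants formula, the term with \<open>(h\<^sup>0(v))'\<close> contributes \<open>O(\<epsilon>)\<close>, since
  \<open>(h\<^sup>0(v))'\<close> is bounded in \<open>X\<^sub>\<delta>\<close> by the norm of \<open>v\<close>; the deviation \<open>w\<close> enters the equation of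
  \<open>q\<close> through \<open>\<integral> (t-s)\<^bsup>\<beta>-1\<^esup> e\<^bsup>-\<kappa>s/\<epsilon>\<^esup> ds = O(\<epsilon>\<^sup>\<beta>)\<close>. In an exponentially weighted supremum
  norm the remaining terms have a factor less than one: for \<open>p\<close> by the gap condition, for
  \<open>q\<close> because the weight is strong (\<open>comparison\<close>, \<open>exponential_gronwall\<close>).

  Three things have to be built. First, strict solutions of \<open>z' = S z + F\<close> for a generator \<open>S\<close>
  and a semigroup with an integrable smoothing singularity (\<open>strict_solution_exists\<close>,
  \<open>strict_solution_bound\<close>). Only the bounds of the semigroup between the spaces of the scale
  enter. The convolution is a gauge integral, which makes sense for functions with values in
  an arbitrary Banach space; a function that is continuous on \<open>[0,t)\<close> and dominated by an integrable
  function is integrable (\<open>integrable_dominated_continuous\<close>). Secondly, unique solvability of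
  the nonlinear systems, so that the two flows are what they should be; this is one
  contraction argument for a notion of well-posedness that is stable under products
  (\<open>well_posed_nprod\<close>, \<open>semilinear_exists\<close>, \<open>semilinear_unique\<close>). Thirdly, the differentiability of
  \<open>h\<^sup>0(v)\<close> in \<open>X\<^sub>\<delta>\<close>: the map \<open>w \<mapsto> - A\<^sup>-\<^sup>1 f(w, v)\<close> is a contraction of \<open>C\<^sup>1([0,t]; X\<^sub>\<delta>)\<close>, where
  the boundedness of \<open>A\<^sup>-\<^sup>1\<close> from \<open>X\<^bsub>\<delta>-1\<^esub>\<close> to \<open>X\<^sub>\<delta>\<close> comes from interpolation (\<open>Q_bound_shift\<close>,
  \<open>fixed_point_curve_C1\<close>).
\<close>

section \<open>Normed spaces carried by sets\<close>

lemma normed_nspaceD: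
  assumes "normed_nspace E"
  shows "subspace (carr E)" and "\<And>x. x \<in> carr E \<Longrightarrow> 0 \<le> nrm E x"
    and "\<And>x. x \<in> carr E \<Longrightarrow> nrm E x = 0 \<longleftrightarrow> x = 0"
    and "\<And>x a. x \<in> carr E \<Longrightarrow> nrm E (a *\<^sub>R x) = \<bar>a\<bar> * nrm E x"
    and "\<And>x y. x \<in> carr E \<Longrightarrow> y \<in> carr E \<Longrightarrow> nrm E (x + y) \<le> nrm E x + nrm E y"
  using assms unfolding normed_nspace_def by blast+

lemma nspace_carr:
  assumes "normed_nspace E"
  shows "0 \<in> carr E" and "\<And>x y. x \<in> carr E \<Longrightarrow> y \<in> carr E \<Longrightarrow> x + y \<in> carr E"
    and "\<And>x y. x \<in> carr E \<Longrightarrow> y \<in> carr E \<Longrightarrow> x - y \<in> carr E"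
    and "\<And>x a. x \<in> carr E \<Longrightarrow> a *\<^sub>R x \<in> carr E"
    and "\<And>x. x \<in> carr E \<Longrightarrow> - x \<in> carr E"
  using normed_nspaceD(1)[OF assms]
  by (auto intro: subspace_0 subspace_add subspace_diff subspace_scale subspace_neg)

lemma normed_whole_space: "normed_nspace (whole_space :: 'y::real_normed_vector nspace)"
  by (auto simp: normed_nspace_def whole_space_def norm_triangle_ineq)

lemma nrm_zero: "normed_nspace E \<Longrightarrow> nrm E 0 = 0"
  using normed_nspaceD(3) nspace_carr(1) by blast

lemma nrm_uminus:
  assumes "normed_nspace E" "x \<in> carr E" shows "nrm E (- x) = nrm E x"
  using normed_nspaceD(4)[OF assms, of "-1"] by simp

lemma nrm_minus_commute:
  assumes "normed_nspace E" "x \<in> carr E" "y \<in> carr E"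
  shows "nrm E (x - y) = nrm E (y - x)"
  using nrm_uminus[OF assms(1) nspace_carr(3)[OF assms]] by simp

lemma nrm_triangle:
  assumes "normed_nspace E" "x \<in> carr E" "y \<in> carr E" "z \<in> carr E"
  shows "nrm E (x - z) \<le> nrm E (x - y) + nrm E (y - z)"
  using normed_nspaceD(5)[OF assms(1), of "x - y" "y - z"] nspace_carr(3)[OF assms(1)] assms by simp

lemma nrm_triangle_diff:
  assumes "normed_nspace E" "x \<in> carr E" "y \<in> carr E"
  shows "nrm E (x - y) \<le> nrm E x + nrm E y"
  using nrm_triangle[OF assms(1,2) nspace_carr(1)[OF assms(1)] assms(3)] nrm_uminus[OF assms(1,3)] by simp

lemma nrm_diff_ge:
  assumes "normed_nspace E" "x \<in> carr E" "y \<in> carr E"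
  shows "\<bar>nrm E x - nrm E y\<bar> \<le> nrm E (x - y)"
  using nrm_triangle[OF assms nspace_carr(1)[OF assms(1)]] nrm_minus_commute[OF assms]
    nrm_triangle[OF assms(1,3,2) nspace_carr(1)[OF assms(1)]] by simp

lemma Metric_space_ndist:
  assumes E: "normed_nspace E" shows "Metric_space (carr E) (ndist E)"
proof
  show "0 \<le> ndist E x y" for x y
    using E by (auto simp: ndist_def intro!: normed_nspaceD nspace_carr)
  show "ndist E x y = ndist E y x" for x y
    using nrm_minus_commute[OF E] by (auto simp: ndist_def)
  show "ndist E x y = 0 \<longleftrightarrow> x = y" if "x \<in> carr E" "y \<in> carr E" for x y
    using that normed_nspaceD(3)[OF E nspace_carr(3)[OF E that]] by (auto simp: ndist_def)
  show "ndist E x z \<le> ndist E x y + ndist E y z" if "x \<in> carr E" "y \<in> carr E" "z \<in> carr E" for x y z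
    using that nrm_triangle[OF E] by (auto simp: ndist_def)
qed

lemma limitin_ntop:
  assumes E: "normed_nspace E"
  shows "limitin (ntop E) w l F \<longleftrightarrow>
    l \<in> carr E \<and> (\<forall>\<^sub>F r in F. w r \<in> carr E) \<and> ((\<lambda>r. nrm E (w r - l)) \<longlongrightarrow> 0) F"
proof -
  interpret Metric_space "carr E" "ndist E" by (rule Metric_space_ndist[OF E])
  have "(\<forall>\<^sub>F r in F. w r \<in> carr E \<and> ndist E (w r) l < e) \<longleftrightarrow>
      (\<forall>\<^sub>F r in F. w r \<in> carr E \<and> \<bar>nrm E (w r - l)\<bar> < e)" if "l \<in> carr E" for e
  proof (intro eventually_subst always_eventually allI)
    fix x show "(w x \<in> carr E \<and> ndist E (w x) l < e) = (w x \<in> carr E \<and> \<bar>nrm E (w x - l)\<bar> < e)"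
      using that normed_nspaceD(2)[OF E nspace_carr(3)[OF E, of "w x" l]] by (auto simp: ndist_def)
  qed
  then show ?thesis
    unfolding ntop_def limitin_metric tendsto_iff
    by (simp add: eventually_conj_iff dist_real_def) (meson zero_less_one)
qed

text \<open>Continuity of a curve in a normed space carried by a set, phrased through the norm alone.\<close>

definition ncont :: "'a::real_vector nspace \<Rightarrow> real set \<Rightarrow> (real \<Rightarrow> 'a) \<Rightarrow> bool" where
  "ncont E I F \<longleftrightarrow> (\<forall>s\<in>I. F s \<in> carr E) \<and>
     (\<forall>t\<in>I. ((\<lambda>s. nrm E (F s - F t)) \<longlongrightarrow> 0) (at t within I))"

lemma atin_within_euclidean: "atin_within euclidean x I = (at x within I)"
  unfolding filter_eq_iff eventually_atin_within eventually_at_topological by (simp; blast)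

lemma continuous_map_ntop_iff:
  assumes E: "normed_nspace E"
  shows "continuous_map (top_of_set I) (ntop E) F \<longleftrightarrow> ncont E I F"
proof -
  interpret Metric_space "carr E" "ndist E" by (rule Metric_space_ndist[OF E])
  have top: "topspace (ntop E) = carr E" by (simp add: ntop_def)
  have ev: "(\<forall>\<^sub>F r in at t within I. F r \<in> carr E)" if "\<forall>s\<in>I. F s \<in> carr E" for t
    using that by (auto simp: eventually_at_filter)
  have *: "limitin (ntop E) F (F t) (at t within I) \<longleftrightarrow> ((\<lambda>s. nrm E (F s - F t)) \<longlongrightarrow> 0) (at t within I)"
    if "\<forall>s\<in>I. F s \<in> carr E" "t \<in> I" for t
    using that ev by (auto simp: limitin_ntop[OF E])
  show ?thesis
    unfolding ncont_def continuous_map_atin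
    using * by (auto simp: top atin_subtopology_within atin_within_euclidean limitin_ntop[OF E])
qed

lemma ncontD:
  assumes "ncont E I F" "s \<in> I" shows "F s \<in> carr E" "((\<lambda>r. nrm E (F r - F s)) \<longlongrightarrow> 0) (at s within I)"
  using assms by (auto simp: ncont_def)

lemma ncont_subset: "ncont E I F \<Longrightarrow> J \<subseteq> I \<Longrightarrow> ncont E J F"
  by (auto simp: ncont_def intro: tendsto_within_subset)

lemma ncont_cong: "(\<And>s. s \<in> I \<Longrightarrow> F s = G s) \<Longrightarrow> ncont E I F \<longleftrightarrow> ncont E I G"
  unfolding ncont_def
  by (intro conj_cong ball_cong refl tendsto_cong) (auto simp: eventually_at_filter)

lemma tendsto_nrm_0:
  assumes E: "normed_nspace E" and "\<forall>\<^sub>F r in F. h r \<in> carr E" and "(k \<longlongrightarrow> 0) F"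
    and "\<forall>\<^sub>F r in F. nrm E (h r) \<le> k r"
  shows "((\<lambda>r. nrm E (h r)) \<longlongrightarrow> 0) F"
proof (rule tendsto_sandwich[OF _ assms(4) tendsto_const assms(3)])
  show "\<forall>\<^sub>F r in F. 0 \<le> nrm E (h r)"
    using assms(2) by eventually_elim (rule normed_nspaceD(2)[OF E])
qed

text \<open>Images of continuous curves under Lipschitz maps. Only the values along the curves are compared,
  so that \<open>H\<close> need not be given as a composition.\<close>

lemma ncont_lipschitz:
  assumes "ncont E I F" "normed_nspace G" "\<And>s. s \<in> I \<Longrightarrow> H s \<in> carr G"
    and "\<And>s t. s \<in> I \<Longrightarrow> t \<in> I \<Longrightarrow> nrm G (H s - H t) \<le> c * nrm E (F s - F t)"
  shows "ncont G I H"
  unfolding ncont_def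
proof (intro conjI ballI)
  fix t assume t: "t \<in> I"
  show "((\<lambda>s. nrm G (H s - H t)) \<longlongrightarrow> 0) (at t within I)"
  proof (rule tendsto_nrm_0[OF assms(2)])
    show "((\<lambda>r. c * nrm E (F r - F t)) \<longlongrightarrow> 0) (at t within I)"
      using tendsto_mult_right_zero ncontD(2)[OF assms(1) t] by blast
  qed (use t assms nspace_carr(3)[OF assms(2)] in \<open>auto simp: eventually_at_filter\<close>)
qed (use assms in auto)

lemma ncont_lipschitz2:
  assumes "ncont E I F" "ncont E' I F'" "normed_nspace G" "\<And>s. s \<in> I \<Longrightarrow> H s \<in> carr G"
    and "\<And>s t. s \<in> I \<Longrightarrow> t \<in> I \<Longrightarrow> nrm G (H s - H t) \<le> c * (nrm E (F s - F t) + nrm E' (F' s - F' t))"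
  shows "ncont G I H"
  unfolding ncont_def
proof (intro conjI ballI)
  fix t assume t: "t \<in> I"
  show "((\<lambda>s. nrm G (H s - H t)) \<longlongrightarrow> 0) (at t within I)"
  proof (rule tendsto_nrm_0[OF assms(3)])
    show "((\<lambda>r. c * (nrm E (F r - F t) + nrm E' (F' r - F' t))) \<longlongrightarrow> 0) (at t within I)"
      using tendsto_mult_right_zero[OF tendsto_add_zero[OF ncontD(2)[OF assms(1) t] ncontD(2)[OF assms(2) t]]] .
  qed (use t assms nspace_carr(3)[OF assms(3)] in \<open>auto simp: eventually_at_filter\<close>)
qed (use assms in auto)

lemma ncont_add:
  assumes E: "normed_nspace E" and "ncont E I F" "ncont E I G"
  shows "ncont E I (\<lambda>s. F s + G s)"
proof (rule ncont_lipschitz2[OF assms(2,3) E, where c = 1])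
  show "nrm E (F s + G s - (F t + G t)) \<le> 1 * (nrm E (F s - F t) + nrm E (G s - G t))"
    if "s \<in> I" "t \<in> I" for s t
    using normed_nspaceD(5)[OF E, of "F s - F t" "G s - G t"] that assms
    by (auto simp: ncont_def algebra_simps intro!: nspace_carr(3))
qed (use assms in \<open>auto simp: ncont_def intro!: nspace_carr(2)\<close>)

lemma ncont_diff:
  assumes E: "normed_nspace E" and "ncont E I F" "ncont E I G"
  shows "ncont E I (\<lambda>s. F s - G s)"
proof (rule ncont_lipschitz2[OF assms(2,3) E, where c = 1])
  show "nrm E (F s - G s - (F t - G t)) \<le> 1 * (nrm E (F s - F t) + nrm E (G s - G t))"
    if "s \<in> I" "t \<in> I" for s t
    using nrm_triangle_diff[OF E, of "F s - F t" "G s - G t"] that assms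
    by (auto simp: ncont_def algebra_simps intro!: nspace_carr(3))
qed (use assms in \<open>auto simp: ncont_def intro!: nspace_carr(3)\<close>)

lemma ncont_scaleR:
  assumes E: "normed_nspace E" and "ncont E I F"
  shows "ncont E I (\<lambda>s. a *\<^sub>R F s)"
proof (rule ncont_lipschitz[OF assms(2) E, where c = "\<bar>a\<bar>"])
  show "nrm E (a *\<^sub>R F s - a *\<^sub>R F t) \<le> \<bar>a\<bar> * nrm E (F s - F t)"
    if "s \<in> I" "t \<in> I" for s t
    using normed_nspaceD(4)[OF E, of "F s - F t" a] that assms nspace_carr(3)[OF E]
    by (auto simp: ncont_def scaleR_right_diff_distrib)
qed (use assms in \<open>auto simp: ncont_def intro!: nspace_carr(4)\<close>)

lemma ncont_const: "normed_nspace E \<Longrightarrow> x \<in> carr E \<Longrightarrow> ncont E I (\<lambda>s. x)"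
  by (auto simp: ncont_def nrm_zero)

lemma continuous_on_nrm:
  assumes E: "normed_nspace E" and F: "ncont E I F"
  shows "continuous_on I (\<lambda>s. nrm E (F s))"
  unfolding continuous_on_def
proof
  fix t assume t: "t \<in> I"
  have "\<forall>\<^sub>F s in at t within I. norm (nrm E (F s) - nrm E (F t)) \<le> nrm E (F s - F t)"
    using nrm_diff_ge[OF E] F t by (auto simp: ncont_def eventually_at_filter)
  then show "((\<lambda>s. nrm E (F s)) \<longlongrightarrow> nrm E (F t)) (at t within I)"
    by (subst LIM_zero_iff[symmetric]) (rule Lim_null_comparison[OF _ ncontD(2)[OF F t]])
qed

text \<open>In a space embedded in the ambient normed space, curves are continuous in the ambient norm.\<close>

lemma ncont_imp_continuous_on:
  assumes E: "normed_nspace E" and F: "ncont E I F"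
    and c: "\<And>x. x \<in> carr E \<Longrightarrow> norm x \<le> c * nrm E x"
  shows "continuous_on I F"
  unfolding continuous_on_def
proof
  fix t assume t: "t \<in> I"
  have "\<forall>\<^sub>F s in at t within I. norm (F s - F t) \<le> c * nrm E (F s - F t)"
    using c nspace_carr(3)[OF E] F t by (auto simp: ncont_def eventually_at_filter)
  moreover have "((\<lambda>s. c * nrm E (F s - F t)) \<longlongrightarrow> 0) (at t within I)"
    using tendsto_mult_right_zero ncontD(2)[OF F t] by blast
  ultimately show "(F \<longlongrightarrow> F t) (at t within I)"
    by (subst LIM_zero_iff[symmetric]) (rule Lim_null_comparison)
qed

lemma normed_nprod:
  assumes E: "normed_nspace E" and F: "normed_nspace F"
  shows "normed_nspace (nprod E F)"
  unfolding normed_nspace_def nprod_def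
proof (intro conjI ballI allI; clarsimp)
  show "subspace (carr E \<times> carr F)" by (intro subspace_Times normed_nspaceD(1) E F)
next
  fix x y assume "x \<in> carr E" "y \<in> carr F"
  then have *: "0 \<le> nrm E x" "0 \<le> nrm F y" "nrm E x = 0 \<longleftrightarrow> x = 0" "nrm F y = 0 \<longleftrightarrow> y = 0"
    using normed_nspaceD(2,3)[OF E] normed_nspaceD(2,3)[OF F] by blast+
  then show "0 \<le> nrm E x + nrm F y" by simp
  from * show "(nrm E x + nrm F y = 0) = ((x, y) = 0)" by (auto simp: zero_prod_def)
next
  fix x y a assume "x \<in> carr E" "y \<in> carr F"
  then show "nrm E (a *\<^sub>R x) + nrm F (a *\<^sub>R y) = \<bar>a\<bar> * (nrm E x + nrm F y)"
    using normed_nspaceD(4)[OF E] normed_nspaceD(4)[OF F] by (simp add: algebra_simps)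
next
  fix x y x' y' assume "x \<in> carr E" "y \<in> carr F" "x' \<in> carr E" "y' \<in> carr F"
  then show "nrm E (x + x') + nrm F (y + y') \<le> nrm E x + nrm F y + (nrm E x' + nrm F y')"
    using normed_nspaceD(5)[OF E, of x x'] normed_nspaceD(5)[OF F, of y y'] by simp
qed

lemma carr_nprod [simp]: "carr (nprod E F) = carr E \<times> carr F"
  and nrm_nprod: "nrm (nprod E F) p = nrm E (fst p) + nrm F (snd p)"
  by (simp_all add: nprod_def)

lemma ncont_nprod:
  assumes E: "normed_nspace E" and F: "normed_nspace F"
  shows "ncont (nprod E F) I (\<lambda>s. (u s, v s)) \<longleftrightarrow> ncont E I u \<and> ncont F I v"
proof
  assume L: "ncont (nprod E F) I (\<lambda>s. (u s, v s))"
  show "ncont E I u \<and> ncont F I v"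
    using L normed_nspaceD(2)[OF E] normed_nspaceD(2)[OF F] nspace_carr(3)[OF E] nspace_carr(3)[OF F]
    by (auto intro!: ncont_lipschitz[OF L E, where c=1] ncont_lipschitz[OF L F, where c=1]
        simp: nrm_nprod) (auto simp: ncont_def)
next
  assume R: "ncont E I u \<and> ncont F I v"
  show "ncont (nprod E F) I (\<lambda>s. (u s, v s))"
    by (rule ncont_lipschitz2[where c=1, OF conjunct1[OF R] conjunct2[OF R] normed_nprod[OF E F]])
      (use R in \<open>auto simp: nrm_nprod ncont_def\<close>)
qed

subsection \<open>Completeness\<close>

text \<open>Completeness, for sequences with geometrically decaying increments and with the resulting rate of
  convergence.\<close>

definition geo_complete :: "'a::real_vector nspace \<Rightarrow> bool" where
  "geo_complete E \<longleftrightarrow> (\<forall>x M c. (\<forall>k. x k \<in> carr E) \<and> 0 \<le> c \<and> c < 1 \<and>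
     (\<forall>k. nrm E (x (Suc k) - x k) \<le> M * c ^ k) \<longrightarrow>
     (\<exists>l\<in>carr E. \<forall>k. nrm E (x k - l) \<le> M * c ^ k / (1 - c)))"

lemma geometric_increments:
  assumes E: "normed_nspace E" and x: "\<And>k. x k \<in> carr E" and c: "0 \<le> c" "c < 1"
    and inc: "\<And>k. nrm E (x (Suc k) - x k) \<le> M * c ^ k"
  shows "nrm E (x (k + n) - x k) \<le> M * c ^ k / (1 - c)"
proof -
  have M: "0 \<le> M" using inc[of 0] normed_nspaceD(2)[OF E nspace_carr(3)[OF E x x], of 1 0] by simp
  have "nrm E (x (k + n) - x k) \<le> M * c ^ k * (\<Sum>i<n. c ^ i)"
  proof (induction n)
    case 0 then show ?case using nrm_zero[OF E] by simp
  next
    case (Suc n)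
    have "nrm E (x (k + Suc n) - x k) \<le> nrm E (x (k + Suc n) - x (k + n)) + nrm E (x (k + n) - x k)"
      by (rule nrm_triangle[OF E x x x])
    also have "\<dots> \<le> M * c ^ (k + n) + M * c ^ k * (\<Sum>i<n. c ^ i)"
      using inc[of "k + n"] Suc by simp
    finally show ?case by (simp add: power_add algebra_simps)
  qed
  also have "\<dots> \<le> M * c ^ k * (1 / (1 - c))"
  proof (rule mult_left_mono)
    have "(\<Sum>i<n. c ^ i) = (1 - c ^ n) / (1 - c)" using c by (subst sum_gp_strict) auto
    also have "\<dots> \<le> 1 / (1 - c)" using c by (intro divide_right_mono) auto
    finally show "(\<Sum>i<n. c ^ i) \<le> 1 / (1 - c)" .
  qed (use M c in auto)
  finally show ?thesis by simp
qed

text \<open>The rate is automatic once the limit exists.\<close>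

lemma geo_completeI:
  assumes E: "normed_nspace E"
    and lim: "\<And>x M c. (\<And>k. x k \<in> carr E) \<Longrightarrow> 0 \<le> c \<Longrightarrow> c < 1 \<Longrightarrow>
      (\<And>k. nrm E (x (Suc k) - x k) \<le> M * c ^ k) \<Longrightarrow> \<exists>l\<in>carr E. (\<lambda>k. nrm E (x k - l)) \<longlonglongrightarrow> 0"
  shows "geo_complete E"
  unfolding geo_complete_def
proof (intro allI impI; elim conjE)
  fix x M c assume x: "\<forall>k. x k \<in> carr E" and c: "0 \<le> c" "c < 1"
    and inc: "\<forall>k. nrm E (x (Suc k) - x k) \<le> M * c ^ k"
  obtain l where l: "l \<in> carr E" and lim: "(\<lambda>k. nrm E (x k - l)) \<longlonglongrightarrow> 0"
    using lim[of x c M] x c inc by blast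
  show "\<exists>l\<in>carr E. \<forall>k. nrm E (x k - l) \<le> M * c ^ k / (1 - c)"
  proof (intro bexI[OF _ l] allI)
    fix k
    have "(\<lambda>n. M * c ^ k / (1 - c) + nrm E (x (n + k) - l)) \<longlonglongrightarrow> M * c ^ k / (1 - c) + 0"
      using lim by (intro tendsto_add tendsto_const LIMSEQ_ignore_initial_segment)
    moreover have "nrm E (x k - l) \<le> M * c ^ k / (1 - c) + nrm E (x (n + k) - l)" for n
      using nrm_triangle[OF E x[rule_format] x[rule_format] l, of k "k + n"]
        geometric_increments[OF E x[rule_format] c inc[rule_format], of k n]
        nrm_minus_commute[OF E x[rule_format] x[rule_format], of k "k + n"] by (simp add: add.commute)
    ultimately show "nrm E (x k - l) \<le> M * c ^ k / (1 - c)"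
      using LIMSEQ_le_const[of _ "M * c ^ k / (1 - c) + 0" "nrm E (x k - l)"] by simp
  qed
qed

lemma geo_completeD:
  assumes "geo_complete E" "\<And>k. x k \<in> carr E" "0 \<le> c" "c < 1"
    "\<And>k. nrm E (x (Suc k) - x k) \<le> M * c ^ k"
  obtains l where "l \<in> carr E" "\<And>k. nrm E (x k - l) \<le> M * c ^ k / (1 - c)"
  using assms unfolding geo_complete_def by blast

lemma geometric_tendsto_0: "0 \<le> c \<Longrightarrow> c < 1 \<Longrightarrow> (\<lambda>k. M * c ^ k / (1 - c)) \<longlonglongrightarrow> 0" for c :: real
  using tendsto_mult[OF tendsto_const[of "M / (1 - c)"] LIMSEQ_realpow_zero[of c]] by simp

lemma banach_nspace_geo_complete:
  assumes B: "banach_nspace E" shows "geo_complete E"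
proof (rule geo_completeI)
  from B show E: "normed_nspace E" by (auto simp: banach_nspace_def)
  from B have comp: "Metric_space.mcomplete (carr E) (ndist E)" by (auto simp: banach_nspace_def)
  interpret Metric_space "carr E" "ndist E" by (rule Metric_space_ndist[OF E])
  fix x M and c :: real assume x: "\<And>k. x k \<in> carr E" and c: "0 \<le> c" "c < 1"
    and inc: "\<And>k. nrm E (x (Suc k) - x k) \<le> M * c ^ k"
  have gi: "nrm E (x (k + n) - x k) \<le> M * c ^ k / (1 - c)" for k n
    by (rule geometric_increments[OF E x c inc])
  have "MCauchy x" unfolding MCauchy_def
  proof (intro conjI allI impI)
    fix e :: real assume "e > 0"
    then obtain N where N: "M * c ^ N / (1 - c) < e / 2"
      using order_tendstoD(2)[OF geometric_tendsto_0[OF c], of "e/2" M] unfolding eventually_sequentially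
      by (meson half_gt_zero order_refl)
    have *: "nrm E (x n - x N) < e / 2" if nN: "N \<le> n" for n
    proof -
      obtain j where "n = N + j" using le_Suc_ex[OF nN] by (elim exE)
      then show ?thesis using order.strict_trans1[OF gi[of N j] N] by blast
    qed
    show "\<exists>N. \<forall>n n'. N \<le> n \<longrightarrow> N \<le> n' \<longrightarrow> ndist E (x n) (x n') < e"
    proof (intro exI[of _ N] allI impI)
      fix n n' assume "N \<le> n" "N \<le> n'"
      then show "ndist E (x n) (x n') < e"
        using *[of n] *[of n'] nrm_triangle[OF E x x x, of n n' N]
          nrm_minus_commute[OF E x x, of N n'] x
        by (simp add: ndist_def)
    qed
  qed (use x in auto)
  then obtain l where "limitin mtopology x l sequentially"
    using comp unfolding mcomplete_def by blast
  then show "\<exists>l\<in>carr E. (\<lambda>k. nrm E (x k - l)) \<longlonglongrightarrow> 0"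
    using limitin_ntop[OF E, unfolded ntop_def] by blast
qed

lemma geo_complete_nprod:
  assumes E: "normed_nspace E" "geo_complete E" and F: "normed_nspace F" "geo_complete F"
  shows "geo_complete (nprod E F)"
proof (rule geo_completeI)
  show P: "normed_nspace (nprod E F)" by (rule normed_nprod[OF E(1) F(1)])
  fix x M and c :: real assume x: "\<And>k. x k \<in> carr (nprod E F)" and c: "0 \<le> c" "c < 1"
    and inc: "\<And>k. nrm (nprod E F) (x (Suc k) - x k) \<le> M * c ^ k"
  have xE: "fst (x k) \<in> carr E" and xF: "snd (x k) \<in> carr F" for k
    using x[of k] by (auto simp: mem_Times_iff)
  have 1: "nrm E (fst (x (Suc k)) - fst (x k)) \<le> M * c ^ k"
      "nrm F (snd (x (Suc k)) - snd (x k)) \<le> M * c ^ k" for k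
    using inc[of k] normed_nspaceD(2)[OF E(1) nspace_carr(3)[OF E(1) xE[of "Suc k"] xE[of k]]]
      normed_nspaceD(2)[OF F(1) nspace_carr(3)[OF F(1) xF[of "Suc k"] xF[of k]]]
    by (auto simp: nrm_nprod)
  obtain a where a: "a \<in> carr E" "\<And>k. nrm E (fst (x k) - a) \<le> M * c ^ k / (1 - c)"
    using geo_completeD[OF E(2) xE c 1(1)] by blast
  obtain b where b: "b \<in> carr F" "\<And>k. nrm F (snd (x k) - b) \<le> M * c ^ k / (1 - c)"
    using geo_completeD[OF F(2) xF c 1(2)] by blast
  have ab: "(a, b) \<in> carr (nprod E F)" using a b by simp
  have lim0: "(\<lambda>k. 2 * (M * c ^ k / (1 - c))) \<longlonglongrightarrow> 0"
    using tendsto_mult_right_zero[OF geometric_tendsto_0[OF c]] .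
  have "(\<lambda>k. nrm (nprod E F) (x k - (a, b))) \<longlonglongrightarrow> 0"
  proof (rule tendsto_nrm_0[OF P _ lim0])
    show "\<forall>\<^sub>F r in sequentially. x r - (a, b) \<in> carr (nprod E F)"
      using nspace_carr(3)[OF P x ab] by (intro always_eventually) blast
    show "\<forall>\<^sub>F r in sequentially. nrm (nprod E F) (x r - (a, b)) \<le> 2 * (M * c ^ r / (1 - c))"
    proof (intro always_eventually allI)
      fix k show "nrm (nprod E F) (x k - (a, b)) \<le> 2 * (M * c ^ k / (1 - c))"
        using a(2)[of k] b(2)[of k] by (simp add: nrm_nprod)
    qed
  qed
  then show "\<exists>l\<in>carr (nprod E F). (\<lambda>k. nrm (nprod E F) (x k - l)) \<longlonglongrightarrow> 0" using ab by blast
qed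

lemma le_abs_mult: "x \<le> c * y \<Longrightarrow> 0 \<le> y \<Longrightarrow> x \<le> \<bar>c\<bar> * (y::real)"
  by (meson abs_ge_self mult_right_mono order_trans)

lemma geo_complete_equivalent:
  assumes E: "normed_nspace E" and F: "normed_nspace F" "geo_complete F"
    and eq: "equivalent_nspaces E F"
  shows "geo_complete E"
proof (rule geo_completeI[OF E])
  from eq obtain c1 c2 where cE: "carr E = carr F"
    and c1: "\<And>x. x \<in> carr F \<Longrightarrow> nrm F x \<le> c1 * nrm E x" and c2: "\<And>x. x \<in> carr F \<Longrightarrow> nrm E x \<le> c2 * nrm F x"
    unfolding equivalent_nspaces_def embeds_def by (metis subset_antisym)
  fix x M and c :: real assume x: "\<And>k. x k \<in> carr E" and c: "0 \<le> c" "c < 1"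
    and inc: "\<And>k. nrm E (x (Suc k) - x k) \<le> M * c ^ k"
  have xF: "\<And>k. x k \<in> carr F" using x cE by simp
  have "nrm F (x (Suc k) - x k) \<le> (\<bar>c1\<bar> * M) * c ^ k" for k
  proof -
    have d: "x (Suc k) - x k \<in> carr F" by (rule nspace_carr(3)[OF F(1) xF xF])
    have "nrm F (x (Suc k) - x k) \<le> \<bar>c1\<bar> * nrm E (x (Suc k) - x k)"
      using le_abs_mult[OF c1[OF d]] normed_nspaceD(2)[OF E] d cE by blast
    also have "\<dots> \<le> \<bar>c1\<bar> * (M * c ^ k)" using inc by (intro mult_left_mono) auto
    finally show ?thesis by (simp add: mult.assoc)
  qed
  from geo_completeD[OF F(2) xF c this]
  obtain l where l: "l \<in> carr F" "\<And>k. nrm F (x k - l) \<le> \<bar>c1\<bar> * M * c ^ k / (1 - c)" by blast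
  have lim0: "(\<lambda>k. \<bar>c2\<bar> * (\<bar>c1\<bar> * M * c ^ k / (1 - c))) \<longlonglongrightarrow> 0"
    by (intro tendsto_mult_right_zero geometric_tendsto_0 c)
  have "(\<lambda>k. nrm E (x k - l)) \<longlonglongrightarrow> 0"
  proof (rule tendsto_nrm_0[OF E _ lim0]; intro always_eventually allI)
    fix k
    show d: "x k - l \<in> carr E" using nspace_carr(3)[OF F(1) xF l(1)] cE by simp
    have "nrm E (x k - l) \<le> \<bar>c2\<bar> * nrm F (x k - l)"
      using le_abs_mult[OF c2] normed_nspaceD(2)[OF F(1)] d cE by blast
    also have "\<dots> \<le> \<bar>c2\<bar> * (\<bar>c1\<bar> * M * c ^ k / (1 - c))" using l by (intro mult_left_mono) auto
    finally show "nrm E (x k - l) \<le> \<bar>c2\<bar> * (\<bar>c1\<bar> * M * c ^ k / (1 - c))" .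
  qed
  then show "\<exists>l\<in>carr E. (\<lambda>k. nrm E (x k - l)) \<longlonglongrightarrow> 0" using l cE by blast
qed

text \<open>A locally uniformly geometric sequence of continuous curves converges to a continuous curve.\<close>

lemma ncont_geometric_limit:
  assumes E: "normed_nspace E" "geo_complete E" and w: "\<And>k. ncont E I (w k)"
    and c: "0 \<le> c" "c < 1" and M: "\<And>s s'. s \<le> s' \<Longrightarrow> M s \<le> M s'"
    and inc: "\<And>k s. s \<in> I \<Longrightarrow> nrm E (w (Suc k) s - w k s) \<le> M s * c ^ k"
  obtains W where "ncont E I W" "\<And>k s. s \<in> I \<Longrightarrow> nrm E (w k s - W s) \<le> M s * c ^ k / (1 - c)"
proof -
  have wc: "w k s \<in> carr E" if "s \<in> I" for k s using w that by (auto simp: ncont_def)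
  have "\<forall>s\<in>I. \<exists>l. l \<in> carr E \<and> (\<forall>k. nrm E (w k s - l) \<le> M s * c ^ k / (1 - c))"
  proof
    fix s assume s: "s \<in> I"
    show "\<exists>l. l \<in> carr E \<and> (\<forall>k. nrm E (w k s - l) \<le> M s * c ^ k / (1 - c))"
      by (rule geo_completeD[OF E(2) wc[OF s] c inc[OF s]]) blast
  qed
  from bchoice[OF this] obtain W where W: "\<And>s. s \<in> I \<Longrightarrow> W s \<in> carr E"
      "\<And>s k. s \<in> I \<Longrightarrow> nrm E (w k s - W s) \<le> M s * c ^ k / (1 - c)"
    by blast
  have "ncont E I W" unfolding ncont_def
  proof (intro conjI ballI)
    fix t assume t: "t \<in> I"
    show "((\<lambda>s. nrm E (W s - W t)) \<longlongrightarrow> 0) (at t within I)"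
    proof (rule tendstoI)
      fix e :: real assume "e > 0"
      then obtain N where N: "M (t + 1) * c ^ N / (1 - c) < e / 3"
        using order_tendstoD(2)[OF geometric_tendsto_0[OF c], of "e/3" "M (t + 1)"]
        by (auto simp: eventually_sequentially)
      have N': "M s * c ^ N / (1 - c) < e / 3" if "s \<le> t + 1" for s
        using le_less_trans[OF divide_right_mono[OF mult_right_mono[OF M[OF that], of "c ^ N"]] N] c by simp
      have "\<forall>\<^sub>F s in at t within I. nrm E (w N s - w N t) < e / 3"
        by (rule order_tendstoD(2)[OF ncontD(2)[OF w t]]) (use \<open>e > 0\<close> in simp)
      moreover have "\<forall>\<^sub>F s in at t within I. s \<in> I" by (auto simp: eventually_at_filter)
      moreover have "\<forall>\<^sub>F s in at t within I. s < t + 1"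
        by (rule order_tendstoD(2)[OF tendsto_ident_at]) simp
      ultimately show "\<forall>\<^sub>F s in at t within I. dist (nrm E (W s - W t)) 0 < e"
      proof eventually_elim
        case (elim s)
        have c: "W s \<in> carr E" "W t \<in> carr E" "w N s \<in> carr E" "w N t \<in> carr E"
          using W(1) elim t w by (auto simp: ncont_def)
        have "nrm E (W s - W t) \<le> nrm E (w N s - W s) + (nrm E (w N s - w N t) + nrm E (w N t - W t))"
          using nrm_triangle[OF E(1), of "W s" "w N s" "W t"] nrm_triangle[OF E(1), of "w N s" "w N t" "W t"]
            nrm_minus_commute[OF E(1), of "W s" "w N s"] c by simp
        moreover have "nrm E (w N s - W s) < e / 3" "nrm E (w N t - W t) < e / 3"
          using le_less_trans[OF W(2)[of s N] N'] le_less_trans[OF W(2)[of t N] N'] elim t by auto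
        ultimately show ?case
          using elim normed_nspaceD(2)[OF E(1) nspace_carr(3)[OF E(1) c(1,2)]] by simp
      qed
    qed
  qed (use W in auto)
  then show ?thesis using W that by blast
qed

section \<open>Gauge integrals of Banach-space-valued functions with an integrable singularity\<close>

text \<open>Integrals on \<open>[a,b]\<close> as limits of Riemann sums along the filter of tagged divisions.\<close>

lemma has_integral_ivl_filter:
  "(f has_integral y) {a..b::real} \<longleftrightarrow>
    ((\<lambda>p. \<Sum>(x,k)\<in>p. measure lborel k *\<^sub>R f x) \<longlongrightarrow> y) (division_filter {a..b})"
  using has_integral_cbox[of f y a b] by (simp add: box_real)

lemma division_filter_ivl_not_bot: "division_filter {a..b::real} \<noteq> bot"
  using division_filter_not_empty[of a b] by (simp add: box_real)

lemma eventually_division_ivl: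
  "\<forall>\<^sub>F p in division_filter {a..b::real}. p tagged_division_of {a..b}"
  by (rule eventually_division_filter_tagged_division)

lemma tagged_division_tag: "p tagged_division_of S \<Longrightarrow> (x, k) \<in> p \<Longrightarrow> x \<in> S"
  using tagged_division_ofD(2,3) by blast

lemma Riemann_sum_diff_le:
  fixes f g :: "real \<Rightarrow> 'a::real_normed_vector"
  assumes p: "p tagged_division_of {a..b::real}"
    and le: "\<And>x. x \<in> {a..b} \<Longrightarrow> norm (f x - g x) \<le> d x"
  shows "norm ((\<Sum>(x,k)\<in>p. measure lborel k *\<^sub>R f x) - (\<Sum>(x,k)\<in>p. measure lborel k *\<^sub>R g x))
     \<le> (\<Sum>(x,k)\<in>p. measure lborel k *\<^sub>R d x)"
proof -
  have "(\<Sum>(x,k)\<in>p. measure lborel k *\<^sub>R f x) - (\<Sum>(x,k)\<in>p. measure lborel k *\<^sub>R g x)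
      = (\<Sum>(x,k)\<in>p. measure lborel k *\<^sub>R (f x - g x))"
    unfolding sum_subtractf[symmetric] by (rule sum.cong) (auto simp: scaleR_right_diff_distrib)
  also have "norm \<dots> \<le> (\<Sum>(x,k)\<in>p. measure lborel k *\<^sub>R d x)"
    by (rule sum_norm_le) (use tagged_division_tag[OF p] le in \<open>auto intro!: mult_left_mono\<close>)
  finally show ?thesis .
qed

text \<open>The pointwise bound of an integral by an integrable majorant, for a seminorm that is
  continuous but need not be the norm of the type.\<close>

lemma has_integral_seminorm_bound:
  fixes f :: "real \<Rightarrow> 'a::real_normed_vector"
  assumes f: "(f has_integral y) {a..b::real}" and m: "(m has_integral J) {a..b}"
    and le: "\<And>x. x \<in> {a..b} \<Longrightarrow> q (f x) \<le> m x"
    and q_add: "\<And>x y. q (x + y) \<le> q x + q y" and q_scale: "\<And>a x. q (a *\<^sub>R x) = \<bar>a\<bar> * q x"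
    and q_cont: "\<And>x. q x \<le> c * norm x"
  shows "q y \<le> J"
proof -
  let ?F = "division_filter {a..b}"
  let ?S = "\<lambda>f p. \<Sum>(x,k)\<in>p. measure lborel k *\<^sub>R f x"
  have q0: "q 0 = 0" using q_scale[of 0 0] by simp
  have qsum: "q (?S f p) \<le> ?S m p" if p: "p tagged_division_of {a..b}" for p
  proof -
    have "q (sum (\<lambda>(x,k). measure lborel k *\<^sub>R f x) P) \<le> sum (\<lambda>(x,k). measure lborel k *\<^sub>R m x) P" if "P \<subseteq> p" "finite P" for P
      using that(2,1)
    proof (induction P)
      case (insert z P)
      obtain x k where z: "z = (x, k)" by force
      have "x \<in> {a..b}" using tagged_division_tag[OF p] insert.prems z by blast
      then have "q (measure lborel k *\<^sub>R f x) \<le> measure lborel k *\<^sub>R m x"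
        using le by (simp add: q_scale mult_left_mono)
      then show ?case
        using insert z q_add[of "measure lborel k *\<^sub>R f x" "sum (\<lambda>(x,k). measure lborel k *\<^sub>R f x) P"] by auto
    qed (simp add: q0)
    then show ?thesis using tagged_division_of_finite[OF p] by auto
  qed
  have "((\<lambda>p. ?S m p + c * norm (y - ?S f p)) \<longlongrightarrow> J + c * norm (y - y)) ?F"
    using f m unfolding has_integral_ivl_filter by (intro tendsto_intros)
  moreover have "\<forall>\<^sub>F p in ?F. q y \<le> ?S m p + c * norm (y - ?S f p)"
    using eventually_division_ivl
  proof eventually_elim
    case (elim p)
    have "q y \<le> q (?S f p) + q (y - ?S f p)" using q_add[of "?S f p" "y - ?S f p"] by simp
    then show ?case using qsum[OF elim] q_cont[of "y - ?S f p"] by linarith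
  qed
  ultimately show ?thesis
    using tendsto_lowerbound[OF _ _ division_filter_ivl_not_bot, of _ "J + c * norm (y - y)" a b] by simp
qed

text \<open>A function that is approximated in the mean by integrable functions is integrable.\<close>

lemma integrable_mean_limit:
  fixes f :: "real \<Rightarrow> 'a::banach"
  assumes approx: "\<And>e. e > 0 \<Longrightarrow> \<exists>g d J. g integrable_on {a..b} \<and> (d has_integral J) {a..b} \<and>
      J < e \<and> (\<forall>x\<in>{a..b}. norm (f x - g x) \<le> d x)"
  shows "f integrable_on {a..b::real}"
proof -
  let ?F = "division_filter {a..b}"
  let ?S = "\<lambda>f p. \<Sum>(x,k)\<in>p. measure lborel k *\<^sub>R f x"
  \<comment> \<open>the Riemann sums of \<open>f\<close> are a Cauchy filter, since for fine divisions they differ from those of \<open>g\<close>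
    by at most a Riemann sum of \<open>d\<close>\<close>
  have "cauchy_filter (filtermap (?S f) ?F)"
    unfolding cauchy_filter_metric_filtermap
  proof (intro allI impI)
    fix e :: real assume "e > 0"
    then obtain g d J where g: "g integrable_on {a..b}" and d: "(d has_integral J) {a..b}" "J < e/4"
      and le: "\<And>x. x \<in> {a..b} \<Longrightarrow> norm (f x - g x) \<le> d x"
      using approx[of "e/4"] by auto
    obtain I where I: "(g has_integral I) {a..b}" using g by blast
    have "\<forall>\<^sub>F p in ?F. ?S d p < e/4"
      using order_tendstoD(2)[OF d(1)[unfolded has_integral_ivl_filter] d(2)] .
    moreover have "\<forall>\<^sub>F p in ?F. dist (?S g p) I < e/4"
      using tendstoD[OF I[unfolded has_integral_ivl_filter], of "e/4"] \<open>e > 0\<close> by simp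
    ultimately have ev: "\<forall>\<^sub>F p in ?F. dist (?S f p) I < e/2"
      using eventually_division_ivl
    proof eventually_elim
      case (elim p)
      have "dist (?S f p) I \<le> norm (?S f p - ?S g p) + dist (?S g p) I"
        by (metis dist_norm dist_triangle)
      then show ?case using Riemann_sum_diff_le[OF elim(3) le] elim by fastforce
    qed
    show "\<exists>P. eventually P ?F \<and> (\<forall>x y. P x \<and> P y \<longrightarrow> dist (?S f x) (?S f y) < e)"
    proof (intro exI conjI allI impI)
      show "\<forall>\<^sub>F p in ?F. dist (?S f p) I < e/2" by (rule ev)
      fix x y assume "dist (?S f x) I < e/2 \<and> dist (?S f y) I < e/2"
      then show "dist (?S f x) (?S f y) < e" by (metis dist_commute dist_triangle_half_l)
    qed
  qed
  moreover have "filtermap (?S f) ?F \<noteq> bot"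
    by (simp add: filtermap_bot_iff division_filter_ivl_not_bot)
  ultimately obtain y where "filtermap (?S f) ?F \<le> nhds y"
    using complete_uniform[of "UNIV :: 'a set"] complete_UNIV by auto
  then show ?thesis
    unfolding integrable_on_def has_integral_ivl_filter filterlim_def by blast
qed

text \<open>A function continuous on \<open>[a,b)\<close> and dominated by an integrable function is integrable.\<close>

lemma integrable_dominated_continuous:
  fixes f :: "real \<Rightarrow> 'a::banach"
  assumes ab: "a < b" and cont: "continuous_on {a..<b} f"
    and m: "m integrable_on {a..b}" and le: "\<And>x. x \<in> {a..b} \<Longrightarrow> norm (f x) \<le> m x"
  shows "f integrable_on {a..b}"
proof (rule integrable_mean_limit)
  fix e :: real assume "e > 0"
  have "continuous_on {a..b} (\<lambda>x. integral {a..x} m)"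
    by (rule indefinite_integral_continuous_1[OF m])
  then have "((\<lambda>x. integral {a..x} m) \<longlongrightarrow> integral {a..b} m) (at b within {a..b})"
    using ab by (auto simp: continuous_on_def)
  then have "((\<lambda>x. integral {a..x} m) \<longlongrightarrow> integral {a..b} m) (at_left b)"
    using ab by (simp add: at_within_Icc_at_left)
  then have "\<forall>\<^sub>F x in at_left b. integral {a..x} m > integral {a..b} m - e"
    using order_tendstoD(1) \<open>e > 0\<close> by force
  moreover have "\<forall>\<^sub>F x in at_left b. x \<in> {a<..<b}" by (rule eventually_at_leftI[of a]) (use ab in auto)
  ultimately have "\<forall>\<^sub>F x in at_left b. integral {a..x} m > integral {a..b} m - e \<and> x \<in> {a<..<b}"
    by (rule eventually_conj)
  from eventually_happens'[OF trivial_limit_at_left_real this]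
  obtain c where c: "integral {a..c} m > integral {a..b} m - e" "a < c" "c < b"
    by auto
  have comb: "integral {a..c} m + integral {c..b} m = integral {a..b} m"
    by (rule Henstock_Kurzweil_Integration.integral_combine) (use c m in auto)
  \<comment> \<open>cut off near the singularity \<open>b\<close>\<close>
  define g where "g = (\<lambda>x. if x \<in> {a..c} then f x else 0)"
  define d where "d = (\<lambda>x. if x \<in> {c..b} then m x else 0)"
  have "f integrable_on {a..c}"
    by (rule integrable_continuous_real) (rule continuous_on_subset[OF cont], use c in auto)
  then have "g integrable_on {a..b}"
    using integrable_restrict_Int[of "{a..c}" f "{a..b}"] c by (simp add: g_def Int_absorb2 Int_absorb1)
  moreover have "(d has_integral integral {c..b} m) {a..b}"
  proof -
    have "(m has_integral integral {c..b} m) {c..b}"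
      using integrable_on_subinterval[OF m, of c b] c by (intro integrable_integral) auto
    then show ?thesis unfolding d_def using c by (subst has_integral_restrict) auto
  qed
  moreover have "\<forall>x\<in>{a..b}. norm (f x - g x) \<le> d x"
  proof
    fix x assume x: "x \<in> {a..b}"
    then have "0 \<le> m x" using le norm_ge_zero order_trans by blast
    then show "norm (f x - g x) \<le> d x" using le x by (auto simp: g_def d_def)
  qed
  ultimately show "\<exists>g d J. g integrable_on {a..b} \<and> (d has_integral J) {a..b} \<and>
      J < e \<and> (\<forall>x\<in>{a..b}. norm (f x - g x) \<le> d x)"
    using c(1) comb by (intro exI[of _ g] exI[of _ d] exI[of _ "integral {c..b} m"]) auto
qed

subsection \<open>Singular kernels\<close>

text \<open>Splitting at \<open>R\<close>: the singularity is integrated on \<open>[0,R]\<close>, where the other factor is at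
  most one, and is at most its value at \<open>R\<close> beyond.\<close>

lemma powr_kernel_majorant:
  fixes a R t J :: real
  assumes a: "0 < a" "a \<le> 1" and R: "R > 0" and t: "t \<ge> 0"
    and \<psi>: "(\<psi> has_integral J') {0..t}" "J' \<le> J" "\<And>r. r \<in> {0..t} \<Longrightarrow> 0 \<le> \<psi> r \<and> \<psi> r \<le> 1"
  shows "\<exists>m I. (m has_integral I) {0..t} \<and> I \<le> R powr a / a + R powr (a - 1) * J \<and>
    (\<forall>r\<in>{0..t}. r powr (a - 1) * \<psi> r \<le> m r)"
proof -
  define c where "c = min R t"
  define k where "k r = (if r \<in> {0..c} then r powr (a - 1) else 0)" for r
  have c: "0 \<le> c" "c \<le> t" using R t by (auto simp: c_def)
  have "((\<lambda>r. r powr (a - 1)) has_integral (c powr (a - 1 + 1) / (a - 1 + 1))) {0..c}"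
    by (rule has_integral_powr_from_0) (use a c in auto)
  then have "((\<lambda>r. r powr (a - 1)) has_integral (c powr a / a)) {0..c}" by simp
  then have k: "(k has_integral (c powr a / a)) {0..t}"
    unfolding k_def using c by (subst has_integral_restrict) auto
  have "((\<lambda>r. k r + R powr (a - 1) * \<psi> r) has_integral (c powr a / a + R powr (a - 1) * J')) {0..t}"
    by (intro has_integral_add has_integral_mult_right k \<psi>)
  moreover have "c powr a / a + R powr (a - 1) * J' \<le> R powr a / a + R powr (a - 1) * J"
    using a c \<psi>(2) by (intro add_mono divide_right_mono powr_mono2 mult_left_mono) (auto simp: c_def)
  moreover have "\<forall>r\<in>{0..t}. r powr (a - 1) * \<psi> r \<le> k r + R powr (a - 1) * \<psi> r"
  proof
    fix r assume r: "r \<in> {0..t}"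
    note p = \<psi>(3)[OF r]
    show "r powr (a - 1) * \<psi> r \<le> k r + R powr (a - 1) * \<psi> r"
    proof (cases "r \<le> R")
      case True
      have "r powr (a - 1) * \<psi> r \<le> r powr (a - 1) * 1" using p by (intro mult_left_mono) auto
      moreover have "k r = r powr (a - 1)" using True r by (auto simp: k_def c_def)
      moreover have "0 \<le> R powr (a - 1) * \<psi> r" using p by simp
      ultimately show ?thesis by linarith
    next
      case False
      have "r powr (a - 1) \<le> R powr (a - 1)" using False R a by (intro powr_mono2') auto
      then have "r powr (a - 1) * \<psi> r \<le> R powr (a - 1) * \<psi> r" using p by (intro mult_right_mono) auto
      moreover have "k r \<ge> 0" by (simp add: k_def)
      ultimately show ?thesis by linarith
    qed
  qed
  ultimately show ?thesis by blast
qed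

text \<open>For \<open>0 < a \<le> 1\<close> and \<open>b > 0\<close>, an upper bound of \<open>\<integral>\<^sub>0\<^sup>\<infinity> r\<^bsup>a-1\<^esup> e\<^bsup>-br\<^esup> dr\<close>. For
  \<open>a < 1\<close> it is not the exact value, but it is good enough for the condition \<open>\<omega>\<^sub>f < 0\<close> to imply
  \<open>CA * Lf * kernel_const \<gamma> (- \<omega>A) < 1\<close>.\<close>

definition kernel_const :: "real \<Rightarrow> real \<Rightarrow> real" where
  "kernel_const a b = (if a = 1 then 1 else 2 * a powr (a - 1)) * b powr (- a)"

lemma kernel_const_nonneg: "0 \<le> kernel_const a b"
  by (simp add: kernel_const_def)

lemma kernel_const_scale: "0 < e \<Longrightarrow> 0 \<le> b \<Longrightarrow> kernel_const a (b / e) = e powr a * kernel_const a b"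
  by (simp add: kernel_const_def powr_divide powr_minus field_simps)

lemma kernel_const_antimono: "0 < a \<Longrightarrow> 0 < b \<Longrightarrow> b \<le> b' \<Longrightarrow> kernel_const a b' \<le> kernel_const a b"
  unfolding kernel_const_def by (intro mult_left_mono powr_mono2') auto

lemma kernel_const_tendsto_0: "0 < a \<Longrightarrow> (kernel_const a \<longlongrightarrow> 0) at_top"
  unfolding kernel_const_def
  by (rule tendsto_mult_right_zero, rule tendsto_neg_powr) (auto intro: filterlim_ident)

lemma has_integral_exp_decay:
  assumes b: "b > (0::real)" and t: "t \<ge> (0::real)"
  shows "((\<lambda>r. exp (- (b * r))) has_integral ((1 - exp (- (b * t))) / b)) {0..t}"
proof -
  have "((\<lambda>r. exp (- (b * r))) has_integral (- exp (- (b * t)) / b - (- exp (- (b * 0)) / b))) {0..t}"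
    by (rule fundamental_theorem_of_calculus[OF t])
      (use b in \<open>auto intro!: derivative_eq_intros simp: has_real_derivative_iff_has_vector_derivative[symmetric]\<close>)
  then show ?thesis by (simp add: diff_divide_distrib)
qed

lemma has_integral_exp_decay_reversed:
  assumes b: "b > (0::real)" and t: "t \<ge> (0::real)"
  shows "((\<lambda>r. exp (- (b * (t - r)))) has_integral ((1 - exp (- (b * t))) / b)) {0..t}"
proof -
  have "((\<lambda>r. exp (- (b * (t - r)))) has_integral (exp (- (b * (t - t))) / b - exp (- (b * (t - 0))) / b)) {0..t}"
    by (rule fundamental_theorem_of_calculus[OF t])
      (use b in \<open>auto intro!: derivative_eq_intros simp: has_real_derivative_iff_has_vector_derivative[symmetric]\<close>)
  then show ?thesis by (simp add: diff_divide_distrib)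
qed

lemma exp_kernel_majorant:
  assumes a: "0 < a" "a \<le> 1" and b: "b > (0::real)" and t: "t \<ge> (0::real)"
  shows "\<exists>m I. (m has_integral I) {0..t} \<and> I \<le> kernel_const a b \<and>
    (\<forall>r\<in>{0..t}. r powr (a - 1) * exp (- (b * r)) \<le> m r)"
proof (cases "a = 1")
  case True
  have "(1 - exp (- (b * t))) / b \<le> kernel_const a b"
    using b True by (simp add: kernel_const_def powr_minus field_simps)
  moreover have "\<forall>r\<in>{0..t}. r powr (a - 1) * exp (- (b * r)) \<le> exp (- (b * r))"
    using True by simp
  ultimately show ?thesis using has_integral_exp_decay[OF b t] by blast
next
  case False
  have J: "(1 - exp (- (b * t))) / b \<le> 1 / b" using b by (simp add: field_simps)
  have pa: "(a / b) powr a / a = a powr (a - 1) * b powr (- a)"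
    using a b by (simp add: powr_divide powr_diff powr_minus field_simps)
  have pb: "(a / b) powr (a - 1) * (1 / b) = a powr (a - 1) * b powr (- a)"
    using a b by (simp add: powr_divide powr_diff powr_minus field_simps)
  \<comment> \<open>the splitting point \<open>a / b\<close> makes the two parts equal\<close>
  obtain m I where m: "(m has_integral I) {0..t}"
      "I \<le> (a / b) powr a / a + (a / b) powr (a - 1) * (1 / b)"
      "\<forall>r\<in>{0..t}. r powr (a - 1) * exp (- (b * r)) \<le> m r"
    using powr_kernel_majorant[OF a _ t has_integral_exp_decay[OF b t] J, of "a / b"] a b t by auto
  have "I \<le> kernel_const a b"
    using m(2) False unfolding pa pb by (simp add: kernel_const_def mult.commute)
  then show ?thesis using m by blast
qed

text \<open>With \<open>b = \<kappa> / R\<close> the bound is \<open>R\<^sup>a (1/a + 1/\<kappa>)\<close>: the order \<open>\<epsilon>\<^sup>a\<close> of the response of a smoothing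
  semigroup to an input that decays on the time scale \<open>R = \<epsilon>\<close>.\<close>

lemma exp_kernel_majorant_reversed:
  assumes a: "0 < a" "a \<le> 1" and b: "b > (0::real)" and t: "t \<ge> (0::real)" and R: "R > 0"
  shows "\<exists>m I. (m has_integral I) {0..t} \<and> I \<le> R powr a / a + R powr (a - 1) * (1 / b) \<and>
    (\<forall>r\<in>{0..t}. r powr (a - 1) * exp (- (b * (t - r))) \<le> m r)"
proof -
  have J: "(1 - exp (- (b * t))) / b \<le> 1 / b" using b by (simp add: field_simps)
  show ?thesis
    using powr_kernel_majorant[OF a R t has_integral_exp_decay_reversed[OF b t] J] b by auto
qed

section \<open>Strongly continuous semigroups\<close>

lemma has_vector_derivative_iff_slope:
  "(f has_vector_derivative d) (at t within S) \<longleftrightarrow>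
    ((\<lambda>r. (f r - f t) /\<^sub>R (r - t)) \<longlongrightarrow> d) (at t within S)"
proof -
  have "\<forall>\<^sub>F r in at t within S. norm (f r - f t - (r - t) *\<^sub>R d) / norm (r - t) = norm ((f r - f t) /\<^sub>R (r - t) - d)"
  proof (rule eventually_mono[OF eventually_at_filter[THEN iffD2]])
    show "\<forall>\<^sub>F r in nhds t. r \<noteq> t \<longrightarrow> r \<in> S \<longrightarrow> r \<noteq> t" by simp
    fix r assume "r \<noteq> t"
    then have "(f r - f t) /\<^sub>R (r - t) - d = (f r - f t - (r - t) *\<^sub>R d) /\<^sub>R (r - t)"
      by (simp add: scaleR_right_diff_distrib)
    then show "norm (f r - f t - (r - t) *\<^sub>R d) / norm (r - t) = norm ((f r - f t) /\<^sub>R (r - t) - d)"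
      by (simp add: divide_inverse_commute)
  qed
  then show ?thesis
    unfolding has_vector_derivative_def has_derivative_iff_norm
    by (subst Lim_null, subst tendsto_norm_zero_iff[symmetric])
      (simp add: bounded_linear_scaleR_left tendsto_cong)
qed

lemma has_vector_derivative_withinI:
  assumes "\<And>e. e > 0 \<Longrightarrow> \<exists>d>0. \<forall>s\<in>S. \<bar>s - t\<bar> < d \<longrightarrow> norm (f s - f t - (s - t) *\<^sub>R v) \<le> e * \<bar>s - t\<bar>"
  shows "(f has_vector_derivative v) (at t within S)"
  unfolding has_vector_derivative_def has_derivative_within_alt
  using assms by (auto simp: bounded_linear_scaleR_left)

lemma has_integral_reverse:
  fixes f :: "real \<Rightarrow> 'a::banach"
  assumes f: "(f has_integral J) {0..t - c}" and ct: "c \<le> t"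
  shows "((\<lambda>s. f (t - s)) has_integral J) {c..t}"
proof -
  have "(\<lambda>x. - x + t) ` {0..t - c} = {c..t}"
    using ct by (auto simp: image_iff intro!: bexI[of _ "t - _"])
  then show ?thesis
    using has_integral_affinity[of f J 0 "t - c" "-1" t] f by (simp add: box_real)
qed

lemma generator_commutes:
  assumes gen: "generates D S T" and x: "x \<in> D" and t: "t \<ge> 0"
  shows "T t x \<in> D" "S (T t x) = T t (S x)"
proof -
  have T_add: "T (s + t) x = T s (T t x)" if "s \<ge> 0" "t \<ge> 0" for s t x
    using gen that by (simp add: generates_def c0_semigroup_def)
  have D: "D = {x. \<exists>y. ((\<lambda>h. (T h x - x) /\<^sub>R h) \<longlongrightarrow> y) (at_right 0)}"
    and lim: "\<And>x. x \<in> D \<Longrightarrow> ((\<lambda>h. (T h x - x) /\<^sub>R h) \<longlongrightarrow> S x) (at_right 0)"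
    using gen unfolding generates_def by blast+
  have "((\<lambda>h. T t ((T h x - x) /\<^sub>R h)) \<longlongrightarrow> T t (S x)) (at_right 0)"
    using lim[OF x] by (intro tendsto_intros)
  moreover have "\<forall>\<^sub>F h in at_right 0. T t ((T h x - x) /\<^sub>R h) = (T h (T t x) - T t x) /\<^sub>R h"
  proof (rule eventually_at_rightI[of 0 1])
    fix h :: real assume h: "h \<in> {0<..<1}"
    then have "T t (T h x) = T h (T t x)"
      using T_add[of t h x] T_add[of h t x] t by (simp add: add.commute)
    then show "T t ((T h x - x) /\<^sub>R h) = (T h (T t x) - T t x) /\<^sub>R h"
      by (simp add: blinfun.scaleR_right blinfun.diff_right)
  qed simp
  ultimately have *: "((\<lambda>h. (T h (T t x) - T t x) /\<^sub>R h) \<longlongrightarrow> T t (S x)) (at_right 0)"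
    by (rule Lim_transform_eventually)
  then show d: "T t x \<in> D" by (subst D) blast
  show "S (T t x) = T t (S x)"
    using tendsto_unique[OF trivial_limit_at_right_real lim[OF d] *] .
qed

text \<open>Strict solutions of \<open>z' = S z + F\<close> on \<open>[0,\<infinity>)\<close>: continuous with values in \<open>E1\<close>, the domain
  of \<open>S\<close> with its norm, and differentiable in the ambient norm.\<close>

definition strict_solution ::
  "'z::real_normed_vector nspace \<Rightarrow> ('z \<Rightarrow> 'z) \<Rightarrow> (real \<Rightarrow> 'z) \<Rightarrow> (real \<Rightarrow> 'z) \<Rightarrow> bool" where
  "strict_solution E1 S F z \<longleftrightarrow> ncont E1 {0..} z \<and>
     (\<forall>t\<ge>0. (z has_vector_derivative S (z t) + F t) (at t within {0..}))"

text \<open>The setting for the inhomogeneous problem: \<open>S\<close> generates \<open>T\<close>, \<open>R\<close> is the resolvent of \<open>S\<close>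
  at \<open>lam\<close> (up to sign), the norm of \<open>E1\<close> is equivalent to the graph norm, and \<open>T\<close> maps the space
  \<open>E\<close> of the inhomogeneity into \<open>E1\<close> with an integrable singularity at \<open>0\<close>.\<close>

locale smoothing_semigroup =
  fixes S :: "'z::banach \<Rightarrow> 'z" and T :: "real \<Rightarrow> 'z \<Rightarrow>\<^sub>L 'z" and E1 E :: "'z nspace"
    and R :: "'z \<Rightarrow> 'z" and lam c1 c2 cE C a w :: real
  assumes gen: "generates (carr E1) S T"
    and E1: "normed_nspace E1" and E: "normed_nspace E"
    and R_lin: "bounded_linear R" and R_carr: "\<And>y. R y \<in> carr E1"
    and R_right: "\<And>y. S (R y) - lam *\<^sub>R R y = y"
    and R_left: "\<And>x. x \<in> carr E1 \<Longrightarrow> R (S x - lam *\<^sub>R x) = x"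
    and E1_upper: "\<And>x. x \<in> carr E1 \<Longrightarrow> nrm E1 x \<le> c1 * norm (S x - lam *\<^sub>R x)"
    and E1_lower: "\<And>x. x \<in> carr E1 \<Longrightarrow> norm (S x - lam *\<^sub>R x) \<le> c2 * nrm E1 x"
    and E_embeds: "\<And>x. x \<in> carr E \<Longrightarrow> norm x \<le> cE * nrm E x"
    and T_bdd: "\<And>t. \<exists>M. \<forall>r\<in>{0..t}. norm (T r) \<le> M"
    and smoothing: "\<And>r x. r > 0 \<Longrightarrow> x \<in> carr E \<Longrightarrow> T r x \<in> carr E1 \<and>
       nrm E1 (T r x) \<le> C * r powr (a - 1) * exp (w * r) * nrm E x"
    and pos: "0 < a" "a \<le> 1" "C \<ge> 0" "c1 \<ge> 0" "c2 \<ge> 0"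
begin

text \<open>The operator \<open>L\<close> is an isomorphism of \<open>E1\<close> onto the whole space. It turns continuity in \<open>E1\<close> into continuity
  in the norm of the type.\<close>

definition L where "L x = S x - lam *\<^sub>R x"

lemma L_R: "L (R y) = y" and R_L: "x \<in> carr E1 \<Longrightarrow> R (L x) = x"
  using R_right R_left by (auto simp: L_def)

lemma E1_norm: "x \<in> carr E1 \<Longrightarrow> nrm E1 x \<le> c1 * norm (L x)" "x \<in> carr E1 \<Longrightarrow> norm (L x) \<le> c2 * nrm E1 x"
  using E1_upper E1_lower by (auto simp: L_def)

interpretation R: bounded_linear R by (rule R_lin)

lemma L_diff: "x \<in> carr E1 \<Longrightarrow> y \<in> carr E1 \<Longrightarrow> L (x - y) = L x - L y"
  by (metis L_R R_L R.diff)

lemma L_add: "x \<in> carr E1 \<Longrightarrow> y \<in> carr E1 \<Longrightarrow> L (x + y) = L x + L y"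
  by (metis L_R R_L R.add)

lemma S_eq: "S x = L x + lam *\<^sub>R x"
  by (simp add: L_def)

lemma norm_le_E1: "\<exists>c\<ge>0. \<forall>x\<in>carr E1. norm x \<le> c * nrm E1 x"
proof -
  obtain K where K: "K > 0" "\<And>x. norm (R x) \<le> norm x * K" using R.pos_bounded by blast
  have "norm x \<le> c2 * K * nrm E1 x" if "x \<in> carr E1" for x
  proof -
    have "norm x \<le> norm (L x) * K" using K(2)[of "L x"] R_L[OF that] by simp
    also have "\<dots> \<le> c2 * nrm E1 x * K" using E1_norm(2)[OF that] K(1) by (intro mult_right_mono) auto
    finally show ?thesis by (simp add: mult_ac)
  qed
  then show ?thesis using K pos by (intro exI[of _ "c2 * K"]) auto
qed

lemma semigroup: "T 0 = id_blinfun" "\<And>s t. s \<ge> 0 \<Longrightarrow> t \<ge> 0 \<Longrightarrow> T (s + t) = T s o\<^sub>L T t"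
  "\<And>x. ((\<lambda>t. T t x) \<longlongrightarrow> x) (at_right 0)"
  using gen by (auto simp: generates_def c0_semigroup_def)

lemma T_0: "T 0 x = x" using semigroup(1) by simp

lemma T_add: "s \<ge> 0 \<Longrightarrow> t \<ge> 0 \<Longrightarrow> T (s + t) x = T s (T t x)"
  using semigroup(2) by simp

lemma T_bound:
  obtains M where "M \<ge> 0" "\<And>r x. 0 \<le> r \<Longrightarrow> r \<le> t \<Longrightarrow> norm (T r x) \<le> M * norm x"
proof -
  obtain M where M: "\<forall>r\<in>{0..t}. norm (T r) \<le> M" using T_bdd by blast
  have "norm (T r x) \<le> \<bar>M\<bar> * norm x" if "0 \<le> r" "r \<le> t" for r x
  proof -
    have "norm (T r x) \<le> norm (T r) * norm x" by (rule norm_blinfun)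
    also have "\<dots> \<le> \<bar>M\<bar> * norm x" using M that by (intro mult_right_mono) force+
    finally show ?thesis .
  qed
  then show ?thesis using that[of "\<bar>M\<bar>"] by simp
qed

lemma filterlim_abs_diff_at_right_0: "filterlim (\<lambda>s. \<bar>s - t\<bar>) (at_right 0) (at t within U)" for t :: real
  unfolding filterlim_at
proof
  show "\<forall>\<^sub>F s in at t within U. \<bar>s - t\<bar> \<in> {0<..} \<and> \<bar>s - t\<bar> \<noteq> 0"
    by (simp add: eventually_at_filter)
  have "((\<lambda>s. \<bar>s - t\<bar>) \<longlongrightarrow> \<bar>t - t\<bar>) (at t within U)" by (intro tendsto_intros)
  then show "((\<lambda>s. \<bar>s - t\<bar>) \<longlongrightarrow> 0) (at t within U)" by simp
qed

lemma eventually_within_less: "\<forall>\<^sub>F s in at t within {0..}. s \<in> {0..} \<and> s \<noteq> t \<and> s \<le> t + (1::real)"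
proof -
  have "\<forall>\<^sub>F s in at t within {0..}. s < t + 1"
    by (rule order_tendstoD(2)[OF tendsto_ident_at]) simp
  moreover have "\<forall>\<^sub>F s in at t within {0..}. s \<in> {0..} \<and> s \<noteq> t" by (simp add: eventually_at_filter)
  ultimately show ?thesis by eventually_elim auto
qed

lemma T_split:
  assumes "s \<ge> 0" "t \<ge> 0"
  shows "T (max s t) x = T (min s t) (T \<bar>s - t\<bar> x)"
proof -
  have "max s t = min s t + \<bar>s - t\<bar>" by (auto simp: max_def min_def)
  then show ?thesis using T_add[of "min s t" "\<bar>s - t\<bar>"] assms by simp
qed

lemma T_continuous: "continuous_on {0..} (\<lambda>t. T t x)"
  unfolding continuous_on_def
proof
  fix t :: real assume t: "t \<in> {0..}"
  obtain M where M: "M \<ge> 0" "\<And>r y. 0 \<le> r \<Longrightarrow> r \<le> t + 1 \<Longrightarrow> norm (T r y) \<le> M * norm y"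
    using T_bound[of "t + 1"] by blast
  have "((\<lambda>s. T \<bar>s - t\<bar> x - x) \<longlongrightarrow> 0) (at t within {0..})"
    using filterlim_compose[OF semigroup(3) filterlim_abs_diff_at_right_0] by (simp add: LIM_zero_iff)
  then have lim: "((\<lambda>s. M * norm (T \<bar>s - t\<bar> x - x)) \<longlongrightarrow> 0) (at t within {0..})"
    by (intro tendsto_mult_right_zero tendsto_norm_zero)
  have "\<forall>\<^sub>F s in at t within {0..}. norm (T s x - T t x) \<le> M * norm (T \<bar>s - t\<bar> x - x)"
    using eventually_within_less
  proof eventually_elim
    case (elim s)
    have "norm (T s x - T t x) = norm (T (max s t) x - T (min s t) x)"
      by (auto simp: max_def min_def norm_minus_commute)
    also have "T (max s t) x - T (min s t) x = T (min s t) (T \<bar>s - t\<bar> x - x)"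
      using T_split[of s t x] elim t by (simp add: blinfun.diff_right)
    also have "norm \<dots> \<le> M * norm (T \<bar>s - t\<bar> x - x)" using elim t by (intro M(2)) auto
    finally show ?case .
  qed
  then have "((\<lambda>s. T s x - T t x) \<longlongrightarrow> 0) (at t within {0..})"
    using lim by (rule Lim_null_comparison)
  then show "((\<lambda>s. T s x) \<longlongrightarrow> T t x) (at t within {0..})" by (simp add: LIM_zero_iff)
qed

text \<open>Joint continuity in time and space, from strong continuity and local boundedness.\<close>

lemma T_joint:
  assumes p: "(p \<longlongrightarrow> r) F" "\<forall>\<^sub>F n in F. p n \<ge> 0" and r: "r \<ge> 0" and u: "(u \<longlongrightarrow> x) F"
  shows "((\<lambda>n. T (p n) (u n)) \<longlongrightarrow> T r x) F"
proof -
  obtain M where M: "M \<ge> 0" "\<And>s y. 0 \<le> s \<Longrightarrow> s \<le> r + 1 \<Longrightarrow> norm (T s y) \<le> M * norm y"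
    using T_bound[of "r + 1"] by blast
  have "((\<lambda>n. T (p n) x) \<longlongrightarrow> T r x) F"
    by (rule continuous_on_tendsto_compose[OF T_continuous p(1)]) (use p r in auto)
  then have "((\<lambda>n. M * norm (u n - x) + norm (T (p n) x - T r x)) \<longlongrightarrow> M * 0 + 0) F"
    using u by (intro tendsto_add tendsto_mult tendsto_const tendsto_norm_zero LIM_zero)
  then have lim: "((\<lambda>n. M * norm (u n - x) + norm (T (p n) x - T r x)) \<longlongrightarrow> 0) F" by simp
  have "\<forall>\<^sub>F n in F. p n < r + 1" by (rule order_tendstoD(2)[OF p(1)]) simp
  with p(2) have "\<forall>\<^sub>F n in F. norm (T (p n) (u n) - T r x) \<le> M * norm (u n - x) + norm (T (p n) x - T r x)"
  proof eventually_elim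
    case (elim n)
    have "T (p n) (u n) - T r x = T (p n) (u n - x) + (T (p n) x - T r x)"
      by (simp add: blinfun.diff_right)
    also have "norm \<dots> \<le> norm (T (p n) (u n - x)) + norm (T (p n) x - T r x)"
      by (rule norm_triangle_ineq)
    also have "\<dots> \<le> M * norm (u n - x) + norm (T (p n) x - T r x)"
      using M(2)[of "p n" "u n - x"] elim by simp
    finally show ?case .
  qed
  then have "((\<lambda>n. T (p n) (u n) - T r x) \<longlongrightarrow> 0) F" using lim by (rule Lim_null_comparison)
  then show ?thesis by (simp add: LIM_zero_iff)
qed

lemma T_near_id:
  assumes "e > 0"
  shows "\<exists>d>0. \<forall>r x. 0 \<le> r \<and> r < d \<and> norm (x - y) < d \<longrightarrow> norm (T r x - y) < e"
proof -
  obtain M where M: "M \<ge> 0" "\<And>s y. 0 \<le> s \<Longrightarrow> s \<le> 1 \<Longrightarrow> norm (T s y) \<le> M * norm y"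
    using T_bound[of 1] by blast
  have "\<forall>\<^sub>F r in at 0 within {0..}. norm (T r y - T 0 y) < e / 2"
    using T_continuous[of y] tendstoD[of _ "T 0 y" "at 0 within {0..}" "e/2"] assms
    by (auto simp: continuous_on_def dist_norm)
  then obtain d where d0: "d > 0" "\<And>r. r \<ge> 0 \<Longrightarrow> r \<noteq> 0 \<Longrightarrow> r < d \<Longrightarrow> norm (T r y - y) < e / 2"
    unfolding eventually_at by (auto simp: T_0)
  have d: "d > 0" "\<And>r. r \<ge> 0 \<Longrightarrow> r < d \<Longrightarrow> norm (T r y - y) < e / 2"
    using d0 assms by (metis T_0 cancel_comm_monoid_add_class.diff_cancel half_gt_zero norm_zero)+
  define d' where "d' = min (min d 1) (e / (2 * (M + 1)))"
  have "norm (T r x - y) < e" if "0 \<le> r" "r < d'" "norm (x - y) < d'" for r x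
  proof -
    have "norm (T r x - y) \<le> norm (T r (x - y)) + norm (T r y - y)"
      using norm_triangle_ineq[of "T r (x - y)" "T r y - y"] by (simp add: blinfun.diff_right)
    also have "norm (T r (x - y)) \<le> M * norm (x - y)" using that by (intro M) (auto simp: d'_def)
    also have "\<dots> \<le> M * (e / (2 * (M + 1)))" using that M by (intro mult_left_mono) (auto simp: d'_def)
    also have "\<dots> \<le> e / 2" using M(1) assms by (simp add: field_simps)
    finally show ?thesis using d(2)[of r] that by (auto simp: d'_def)
  qed
  moreover have "d' > 0" using d assms M by (simp add: d'_def)
  ultimately show ?thesis by blast
qed

lemma T_domain:
  assumes "x \<in> carr E1" "t \<ge> 0"
  shows "T t x \<in> carr E1" "S (T t x) = T t (S x)"
  using generator_commutes[OF gen assms] by auto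

lemma L_T: "x \<in> carr E1 \<Longrightarrow> t \<ge> 0 \<Longrightarrow> L (T t x) = T t (L x)"
  by (simp add: L_def T_domain blinfun.diff_right blinfun.scaleR_right)

lemma T_R: "t \<ge> 0 \<Longrightarrow> T t (R y) = R (T t y)"
  by (metis L_T L_R R_L R_carr T_domain(1))

lemma T_has_derivative:
  assumes x: "x \<in> carr E1" and t: "t \<ge> 0"
  shows "((\<lambda>r. T r x) has_vector_derivative T t (S x)) (at t within {0..})"
  unfolding has_vector_derivative_iff_slope
proof -
  have lim: "((\<lambda>h. (T h x - x) /\<^sub>R h) \<longlongrightarrow> S x) (at_right 0)"
    using gen x unfolding generates_def by blast
  have "((\<lambda>s. min s t) \<longlongrightarrow> min t t) (at t within {0..})" by (intro tendsto_intros)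
  then have "((\<lambda>s. T (min s t) ((T \<bar>s - t\<bar> x - x) /\<^sub>R \<bar>s - t\<bar>)) \<longlongrightarrow> T t (S x)) (at t within {0..})"
    by (intro T_joint filterlim_compose[OF lim filterlim_abs_diff_at_right_0])
      (use t in \<open>auto simp: eventually_at_filter\<close>)
  moreover have "\<forall>\<^sub>F s in at t within {0..}. T (min s t) ((T \<bar>s - t\<bar> x - x) /\<^sub>R \<bar>s - t\<bar>) = (T s x - T t x) /\<^sub>R (s - t)"
    using eventually_within_less
  proof eventually_elim
    case (elim s)
    have "T (min s t) ((T \<bar>s - t\<bar> x - x) /\<^sub>R \<bar>s - t\<bar>) = (T (max s t) x - T (min s t) x) /\<^sub>R \<bar>s - t\<bar>"
      using T_split[of s t x] elim t by (simp add: blinfun.diff_right blinfun.scaleR_right)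
    also have "\<dots> = (T s x - T t x) /\<^sub>R (s - t)"
    proof (cases "s \<le> t")
      case True
      then have "\<bar>s - t\<bar> = - (s - t)" by simp
      then show ?thesis using True by (simp only: inverse_minus_eq) (simp add: max_def min_def scaleR_right_diff_distrib)
    qed (simp add: max_def min_def)
    finally show ?case .
  qed
  ultimately show "((\<lambda>r. (T r x - T t x) /\<^sub>R (r - t)) \<longlongrightarrow> T t (S x)) (at t within {0..})"
    by (rule Lim_transform_eventually)
qed

text \<open>A first order Taylor estimate, in which \<open>y\<close> is to be thought of as close to \<open>S x\<close>.\<close>

lemma T_taylor:
  assumes x: "x \<in> carr E1" and h: "h \<ge> 0" and e: "\<And>r. 0 \<le> r \<Longrightarrow> r \<le> h \<Longrightarrow> norm (T r (S x) - y) \<le> e"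
  shows "norm (T h x - x - h *\<^sub>R y) \<le> h * e"
proof -
  have "((\<lambda>r. T r (S x)) has_integral (T h x - T 0 x)) {0..h}"
    by (rule fundamental_theorem_of_calculus[OF h])
      (use has_vector_derivative_within_subset[OF T_has_derivative[OF x]] in auto)
  then have hi: "((\<lambda>r. T r (S x) - y) has_integral (T h x - T 0 x - measure lborel {0..h} *\<^sub>R y)) {0..h}"
    by (intro has_integral_diff has_integral_const_real)
  have "0 \<le> e" using order_trans[OF norm_ge_zero e[of 0]] h by simp
  then have "norm (T h x - T 0 x - measure lborel {0..h} *\<^sub>R y) \<le> e * measure lborel {0..h}"
    by (rule has_integral_bound_real[OF _ finite.emptyI hi]) (use e in auto)
  then show ?thesis using h by (simp add: T_0 mult.commute)
qed

lemma T_R_continuous: "continuous_on I F \<Longrightarrow> I \<subseteq> {..t} \<Longrightarrow> continuous_on I (\<lambda>s. T (t - s) (F s))"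
  unfolding continuous_on_def
  by (intro ballI T_joint) (auto intro!: tendsto_intros always_eventually simp: eventually_at_filter subset_iff)

section \<open>The inhomogeneous linear problem\<close>

lemma E_continuous: "ncont E I F \<Longrightarrow> continuous_on I F"
  by (rule ncont_imp_continuous_on[OF E _ E_embeds])

text \<open>The variation of constants formula, by differentiating \<open>T (t - s) (z s)\<close> in \<open>s\<close>.\<close>

lemma duhamel:
  assumes z: "strict_solution E1 S F z" and F: "ncont E {0..} F" and t: "t \<ge> 0"
  shows "((\<lambda>s. T (t - s) (F s)) has_integral (z t - T t (z 0))) {0..t}"
proof -
  have zc: "z s \<in> carr E1" if "s \<ge> 0" for s using z that by (auto simp: strict_solution_def ncont_def)
  have "((\<lambda>s. T (t - s) (z s)) has_vector_derivative T (t - s) (F s)) (at s within {0..t})"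
    if s: "s \<in> {0..t}" for s
  proof -
    have 1: "((\<lambda>r. (z r - z s) /\<^sub>R (r - s)) \<longlongrightarrow> S (z s) + F s) (at s within {0..t})"
      using z s unfolding strict_solution_def has_vector_derivative_iff_slope[symmetric]
      by (auto intro: has_vector_derivative_within_subset)
    have "((\<lambda>r. t - r) \<longlongrightarrow> t - s) (at s within {0..t})" by (intro tendsto_intros)
    then have 2: "((\<lambda>r. T (t - r) ((z r - z s) /\<^sub>R (r - s))) \<longlongrightarrow> T (t - s) (S (z s) + F s)) (at s within {0..t})"
      by (rule T_joint[OF _ _ _ 1]) (use s in \<open>auto simp: eventually_at_filter\<close>)
    have "((\<lambda>r. t - r) has_vector_derivative - 1) (at s within {0..t})"
      by (auto intro!: derivative_eq_intros)
    moreover have "((\<lambda>r. T r (z s)) has_vector_derivative T (t - s) (S (z s))) (at (t - s) within (\<lambda>r. t - r) ` {0..t})"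
      by (rule has_vector_derivative_within_subset[OF T_has_derivative]) (use s zc in auto)
    ultimately have "(((\<lambda>r. T r (z s)) \<circ> (\<lambda>r. t - r)) has_vector_derivative (- 1) *\<^sub>R T (t - s) (S (z s))) (at s within {0..t})"
      by (rule vector_diff_chain_within)
    then have "((\<lambda>r. (T (t - r) (z s) - T (t - s) (z s)) /\<^sub>R (r - s)) \<longlongrightarrow> - T (t - s) (S (z s))) (at s within {0..t})"
      unfolding has_vector_derivative_iff_slope by (simp add: o_def)
    from tendsto_add[OF 2 this]
    have "((\<lambda>r. T (t - r) ((z r - z s) /\<^sub>R (r - s)) + (T (t - r) (z s) - T (t - s) (z s)) /\<^sub>R (r - s))
        \<longlongrightarrow> T (t - s) (F s)) (at s within {0..t})"
      by (simp add: blinfun.add_right)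
    moreover have "T (t - r) ((z r - z s) /\<^sub>R (r - s)) + (T (t - r) (z s) - T (t - s) (z s)) /\<^sub>R (r - s)
        = (T (t - r) (z r) - T (t - s) (z s)) /\<^sub>R (r - s)" for r
      by (simp add: blinfun.scaleR_right blinfun.diff_right scaleR_right_diff_distrib)
    ultimately show ?thesis unfolding has_vector_derivative_iff_slope by simp
  qed
  then have "((\<lambda>s. T (t - s) (F s)) has_integral (T (t - t) (z t) - T (t - 0) (z 0))) {0..t}"
    by (rule fundamental_theorem_of_calculus[OF t])
  then show ?thesis by (simp add: T_0)
qed

text \<open>The integrand of the convolution under \<open>L\<close>, which is singular at \<open>s = t\<close>; there it gets the value \<open>0\<close>.\<close>

definition G where "G F t s = (if s < t then L (T (t - s) (F s)) else 0)"

lemma R_G: "s < t \<Longrightarrow> F s \<in> carr E \<Longrightarrow> R (G F t s) = T (t - s) (F s)"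
  using R_L smoothing[of "t - s" "F s"] by (simp add: G_def)

lemma nrm_R_G:
  assumes "s \<le> t" "F s \<in> carr E"
  shows "nrm E1 (R (G F t s)) \<le> C * (t - s) powr (a - 1) * exp (w * (t - s)) * nrm E (F s)"
proof (cases "s < t")
  case True then show ?thesis using smoothing[of "t - s" "F s"] R_G[of s t F] assms by simp
next
  case False then show ?thesis using assms by (simp add: G_def R.zero nrm_zero[OF E1])
qed

lemma norm_G:
  assumes "s \<le> t" "F s \<in> carr E" "nrm E (F s) \<le> K" "t - s \<le> \<tau>"
  shows "norm (G F t s) \<le> c2 * C * K * exp (\<bar>w\<bar> * \<tau>) * (t - s) powr (a - 1)"
proof -
  have K: "0 \<le> nrm E (F s)" using normed_nspaceD(2)[OF E assms(2)] .
  have "w * (t - s) \<le> \<bar>w\<bar> * \<tau>" using assms by (intro mult_mono) auto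
  then have "exp (w * (t - s)) * nrm E (F s) \<le> exp (\<bar>w\<bar> * \<tau>) * K"
    using K assms(3) by (intro mult_mono) auto
  then have "C * (t - s) powr (a - 1) * (exp (w * (t - s)) * nrm E (F s)) \<le> C * (t - s) powr (a - 1) * (exp (\<bar>w\<bar> * \<tau>) * K)"
    using pos by (intro mult_left_mono) auto
  then have "nrm E1 (R (G F t s)) \<le> C * (t - s) powr (a - 1) * (exp (\<bar>w\<bar> * \<tau>) * K)"
    using nrm_R_G[of s t F] assms(1,2) by (simp add: mult_ac)
  then have "c2 * nrm E1 (R (G F t s)) \<le> c2 * (C * (t - s) powr (a - 1) * (exp (\<bar>w\<bar> * \<tau>) * K))"
    using pos by (intro mult_left_mono) auto
  then show ?thesis using E1_norm(2)[OF R_carr[of "G F t s"]] by (simp add: L_R mult_ac)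
qed

lemma G_semigroup:
  assumes "s < c" "c \<le> t" "F s \<in> carr E"
  shows "G F t s = T (t - c) (G F c s)"
proof -
  have "T (t - s) (F s) = T (t - c) (T (c - s) (F s))"
    using T_add[of "t - c" "c - s"] assms by simp
  then show ?thesis using assms smoothing[of "c - s" "F s"] by (simp add: G_def L_T)
qed

text \<open>Below the singularity the semigroup smooths during a short time \<open>\<rho>\<close>, and the rest of the time it is only
  strongly continuous.\<close>

lemma G_continuous:
  assumes F: "ncont E {0..} F"
  shows "continuous_on {0..<t} (G F t)"
  unfolding continuous_on_def
proof
  fix s assume s: "s \<in> {0..<t}"
  define \<rho> where "\<rho> = (t - s) / 2"
  have \<rho>: "\<rho> > 0" "s + \<rho> < t" using s by (auto simp: \<rho>_def field_simps)
  have Fc: "F r \<in> carr E" if "r \<ge> 0" for r using F that by (auto simp: ncont_def)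
  have Tc: "T \<rho> (F r) \<in> carr E1" if "r \<ge> 0" for r using smoothing[OF \<rho>(1) Fc[OF that]] by simp
  let ?k = "c2 * (C * \<rho> powr (a - 1) * exp (w * \<rho>))"
  have lip: "norm (L (T \<rho> (F r)) - L (T \<rho> (F s))) \<le> ?k * nrm E (F r - F s)" if "r \<ge> 0" for r
  proof -
    have d: "F r - F s \<in> carr E" using Fc that s nspace_carr(3)[OF E] by auto
    have "L (T \<rho> (F r)) - L (T \<rho> (F s)) = L (T \<rho> (F r - F s))"
      using Tc that s by (simp add: L_diff blinfun.diff_right)
    also have "norm \<dots> \<le> c2 * nrm E1 (T \<rho> (F r - F s))" using smoothing[OF \<rho>(1) d] by (intro E1_norm) auto
    also have "\<dots> \<le> c2 * (C * \<rho> powr (a - 1) * exp (w * \<rho>) * nrm E (F r - F s))"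
      using smoothing[OF \<rho>(1) d] pos by (intro mult_left_mono) auto
    finally show ?thesis by (simp add: mult_ac)
  qed
  have ev: "\<forall>\<^sub>F r in at s within {0..<t}. r \<ge> 0 \<and> r + \<rho> < t"
  proof -
    have "\<forall>\<^sub>F r in at s within {0..<t}. r < t - \<rho>"
      by (rule order_tendstoD(2)[OF tendsto_ident_at]) (use \<rho> in simp)
    moreover have "\<forall>\<^sub>F r in at s within {0..<t}. r \<in> {0..<t}" by (simp add: eventually_at_filter)
    ultimately show ?thesis by eventually_elim auto
  qed
  have s0: "s \<in> {0..}" using s by simp
  have lim0: "((\<lambda>r. ?k * nrm E (F r - F s)) \<longlongrightarrow> 0) (at s within {0..<t})"
    using tendsto_mult_right_zero[OF ncontD(2)[OF ncont_subset[OF F] s], of ?k] by fastforce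
  have "((\<lambda>r. L (T \<rho> (F r)) - L (T \<rho> (F s))) \<longlongrightarrow> 0) (at s within {0..<t})"
    by (rule Lim_null_comparison[OF _ lim0], use ev in eventually_elim) (rule lip, simp)
  then have 1: "((\<lambda>r. L (T \<rho> (F r))) \<longlongrightarrow> L (T \<rho> (F s))) (at s within {0..<t})" by (simp add: LIM_zero_iff)
  have "((\<lambda>r. t - r - \<rho>) \<longlongrightarrow> t - s - \<rho>) (at s within {0..<t})" by (intro tendsto_intros)
  then have "((\<lambda>r. T (t - r - \<rho>) (L (T \<rho> (F r)))) \<longlongrightarrow> T (t - s - \<rho>) (L (T \<rho> (F s)))) (at s within {0..<t})"
    by (rule T_joint[OF _ _ _ 1]) (use \<rho> ev in \<open>auto elim!: eventually_mono\<close>)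
  moreover have *: "T (t - r - \<rho>) (L (T \<rho> (F r))) = G F t r" if "r \<ge> 0" "r + \<rho> < t" for r
  proof -
    have "T (t - r) (F r) = T (t - r - \<rho>) (T \<rho> (F r))" using T_add[of "t - r - \<rho>" \<rho>] that \<rho> by simp
    then show ?thesis using that \<rho> Tc by (simp add: G_def L_T)
  qed
  ultimately show "(G F t \<longlongrightarrow> G F t s) (at s within {0..<t})"
    using *[of s] s \<rho> ev by (auto elim!: Lim_transform_eventually eventually_mono)
qed

lemma F_bounded:
  assumes F: "ncont E {0..} F"
  obtains K where "K \<ge> 0" "\<And>s. 0 \<le> s \<Longrightarrow> s \<le> t \<Longrightarrow> nrm E (F s) \<le> K"
proof -
  have "continuous_on {0..t} (\<lambda>s. nrm E (F s))"
    by (rule continuous_on_nrm[OF E ncont_subset[OF F]]) auto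
  then have "bounded ((\<lambda>s. nrm E (F s)) ` {0..t})"
    by (intro compact_imp_bounded compact_continuous_image compact_Icc)
  then obtain K where K: "\<forall>s\<in>{0..t}. norm (nrm E (F s)) \<le> K" by (auto simp: bounded_iff)
  show ?thesis by (rule that[of "\<bar>K\<bar>"]) (use K in force)+
qed

lemma G_integrable:
  assumes F: "ncont E {0..} F" and t: "t \<ge> 0"
  shows "G F t integrable_on {0..t}"
proof (cases "t = 0")
  case False
  obtain K where K: "K \<ge> 0" "\<And>s. 0 \<le> s \<Longrightarrow> s \<le> t \<Longrightarrow> nrm E (F s) \<le> K" using F_bounded[OF F] by blast
  have "((\<lambda>r. r powr (a - 1)) has_integral (t powr (a - 1 + 1) / (a - 1 + 1))) {0..t - 0}"
    using has_integral_powr_from_0[of "a - 1" t] pos t by simp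
  from has_integral_reverse[OF this t]
  have m: "(\<lambda>s. c2 * C * K * exp (\<bar>w\<bar> * t) * (t - s) powr (a - 1)) integrable_on {0..t}"
    by (intro integrable_on_mult_right) blast
  show ?thesis
    by (rule integrable_dominated_continuous[OF _ G_continuous[OF F] m])
      (use t False K F norm_G[of _ t F K t] in \<open>auto simp: ncont_def\<close>)
qed (use has_integral_refl(2) in \<open>auto simp: integrable_on_def\<close>)

text \<open>The convolution \<open>\<integral>\<^sub>0\<^sup>t T (t - s) (F s) ds\<close> under \<open>L\<close>.\<close>

definition conv where "conv F t = integral {0..t} (G F t)"

lemma R_conv:
  assumes F: "ncont E {0..} F" and t: "t \<ge> 0"
  shows "((\<lambda>s. T (t - s) (F s)) has_integral R (conv F t)) {0..t}"
proof -
  have "((R \<circ> G F t) has_integral R (conv F t)) {0..t}"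
    unfolding conv_def by (intro has_integral_linear integrable_integral G_integrable F t R_lin)
  then show ?thesis
    by (rule has_integral_spike_finite[of "{t}", rotated 2]) (use R_G[of _ t F] F in \<open>auto simp: ncont_def\<close>)
qed

lemma strict_solution_eq:
  assumes z: "strict_solution E1 S F z" and F: "ncont E {0..} F" and t: "t \<ge> 0"
  shows "z t = T t (z 0) + R (conv F t)"
  using has_integral_unique[OF duhamel[OF assms] R_conv[OF F t]] by (simp add: algebra_simps)

lemma conv_bound:
  assumes F: "ncont E {0..} F" and t: "t \<ge> 0" and m: "(m has_integral I) {0..t}"
    and le: "\<And>r. r \<in> {0..t} \<Longrightarrow> C * r powr (a - 1) * exp (w * r) * nrm E (F (t - r)) \<le> m r"
  shows "nrm E1 (R (conv F t)) \<le> I"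
proof (rule has_integral_seminorm_bound[where q = "\<lambda>x. nrm E1 (R x)" and c = c1])
  show "(G F t has_integral conv F t) {0..t}"
    unfolding conv_def by (intro integrable_integral G_integrable F t)
  show "((\<lambda>s. m (t - s)) has_integral I) {0..t}" by (rule has_integral_reverse) (use m t in auto)
  show "nrm E1 (R (G F t s)) \<le> m (t - s)" if "s \<in> {0..t}" for s
    using nrm_R_G[of s t F] le[of "t - s"] F that by (auto simp: ncont_def)
  show "nrm E1 (R (x + y)) \<le> nrm E1 (R x) + nrm E1 (R y)" for x y
    using normed_nspaceD(5)[OF E1 R_carr R_carr] by (simp add: R.add)
  show "nrm E1 (R (a *\<^sub>R x)) = \<bar>a\<bar> * nrm E1 (R x)" for a x
    using normed_nspaceD(4)[OF E1 R_carr] by (simp add: R.scaleR)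
  show "nrm E1 (R x) \<le> c1 * norm x" for x using E1_norm(1)[OF R_carr] by (simp add: L_R)
qed

lemma strict_solution_bound:
  assumes z: "strict_solution E1 S F z" and F: "ncont E {0..} F" and t: "t \<ge> 0"
    and m: "(m has_integral I) {0..t}"
    and le: "\<And>r. r \<in> {0..t} \<Longrightarrow> C * r powr (a - 1) * exp (w * r) * nrm E (F (t - r)) \<le> m r"
  shows "nrm E1 (z t - T t (z 0)) \<le> I"
  using conv_bound[OF F t m le] strict_solution_eq[OF z F t] by simp

text \<open>The convolution at time \<open>s\<close> is its value at time \<open>c\<close>, transported by the semigroup, up to the
  contribution of \<open>[c,s]\<close>.\<close>

lemma conv_increment:
  assumes F: "ncont E {0..} F"
  obtains K where "K \<ge> 0"
    "\<And>c s. 0 \<le> c \<Longrightarrow> c \<le> s \<Longrightarrow> s \<le> \<tau> \<Longrightarrow> norm (conv F s - T (s - c) (conv F c)) \<le> K * (s - c) powr a"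
proof -
  obtain K where K: "K \<ge> 0" "\<And>s. 0 \<le> s \<Longrightarrow> s \<le> \<tau> \<Longrightarrow> nrm E (F s) \<le> K" using F_bounded[OF F] by blast
  let ?k = "c2 * C * K * exp (\<bar>w\<bar> * \<tau>)"
  have "norm (conv F s - T (s - c) (conv F c)) \<le> ?k / a * (s - c) powr a"
    if c: "0 \<le> c" "c \<le> s" "s \<le> \<tau>" for c s
  proof -
    have "((T (s - c) \<circ> G F c) has_integral T (s - c) (conv F c)) {0..c}"
      unfolding conv_def by (intro has_integral_linear integrable_integral G_integrable F c blinfun.bounded_linear_right)
    then have 1: "(G F s has_integral T (s - c) (conv F c)) {0..c}"
      by (rule has_integral_spike_finite[of "{c}", rotated 2])
        (use G_semigroup[of _ c s F] F c in \<open>auto simp: ncont_def\<close>)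
    have "G F s integrable_on {c..s}"
      by (rule integrable_on_subinterval[OF G_integrable[OF F, of s]]) (use c in auto)
    then have 2: "(G F s has_integral integral {c..s} (G F s)) {c..s}" by (rule integrable_integral)
    have "((\<lambda>r. r powr (a - 1)) has_integral ((s - c) powr (a - 1 + 1) / (a - 1 + 1))) {0..s - c}"
      by (rule has_integral_powr_from_0) (use pos c in auto)
    from has_integral_mult_right[OF has_integral_reverse[OF this c(2)], of ?k]
    have m: "((\<lambda>r. ?k * (s - r) powr (a - 1)) has_integral (?k * ((s - c) powr a / a))) {c..s}" by simp
    have "norm (integral {c..s} (G F s)) \<le> ?k * ((s - c) powr a / a)"
      by (rule has_integral_seminorm_bound[OF 2 m, where q = norm and c = 1])
        (use norm_G[of _ s F K \<tau>] F K c in \<open>auto simp: ncont_def norm_triangle_ineq\<close>)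
    moreover have "conv F s = T (s - c) (conv F c) + integral {c..s} (G F s)"
      unfolding conv_def[of F s] by (rule integral_unique[OF has_integral_combine[OF c(1,2) 1 2]])
    ultimately show ?thesis by simp
  qed
  moreover have "?k / a \<ge> 0" using K pos by simp
  ultimately show ?thesis using that by blast
qed

lemma conv_continuous:
  assumes F: "ncont E {0..} F"
  shows "continuous_on {0..} (conv F)"
  unfolding continuous_on_def
proof
  fix t :: real assume "t \<in> {0..}" then have t: "t \<ge> 0" by simp
  show "(conv F \<longlongrightarrow> conv F t) (at t within {0..})"
  proof (rule tendstoI)
    fix e :: real assume e: "e > 0"
    obtain K where K: "K \<ge> 0"
      "\<And>c s. 0 \<le> c \<Longrightarrow> c \<le> s \<Longrightarrow> s \<le> t + 1 \<Longrightarrow> norm (conv F s - T (s - c) (conv F c)) \<le> K * (s - c) powr a"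
      using conv_increment[OF F] by blast
    have "((\<lambda>d. K * (2 * d) powr a) \<longlongrightarrow> K * (2 * 0) powr a) (at_right 0)"
      by (intro tendsto_intros tendsto_powr2) (use pos in \<open>auto simp: eventually_at_filter\<close>)
    then have "((\<lambda>d. K * (2 * d) powr a) \<longlongrightarrow> 0) (at_right 0)" by simp
    then have "\<forall>\<^sub>F d in at_right 0. K * (2 * d) powr a < e / 3"
      by (rule order_tendstoD(2)) (use e in simp)
    moreover have "\<forall>\<^sub>F d in at_right 0. d \<in> {0<..<1::real}" by (rule eventually_at_rightI[of 0 1]) auto
    ultimately have "\<forall>\<^sub>F d in at_right 0. K * (2 * d) powr a < e / 3 \<and> d \<in> {0<..<1}" by (rule eventually_conj)
    from eventually_happens'[OF trivial_limit_at_right_real this]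
    obtain d where d: "K * (2 * d) powr a < e / 3" "0 < d" "d < 1" by auto
    \<comment> \<open>all times close to \<open>t\<close> are compared with the same earlier time \<open>c\<close>, so that no uniform continuity of
      \<open>F\<close> is needed\<close>
    define c where "c = max 0 (t - d)"
    have c: "0 \<le> c" "c \<le> t" "t - c \<le> d" using t d by (auto simp: c_def)
    have near: "norm (conv F s - T (s - c) (conv F c)) < e / 3" if "0 \<le> s" "\<bar>s - t\<bar> < d" for s
    proof -
      have cs: "c \<le> s" "s - c \<le> 2 * d" using that d by (auto simp: c_def)
      have "norm (conv F s - T (s - c) (conv F c)) \<le> K * (s - c) powr a"
        using K(2)[of c s] c cs that d by auto
      also have "\<dots> \<le> K * (2 * d) powr a" using cs K pos by (intro mult_left_mono powr_mono2) auto
      finally show ?thesis using d by simp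
    qed
    have "((\<lambda>s. max 0 (s - c)) \<longlongrightarrow> max 0 (t - c)) (at t within {0..})" by (intro tendsto_intros)
    then have "((\<lambda>s. T (max 0 (s - c)) (conv F c)) \<longlongrightarrow> T (max 0 (t - c)) (conv F c)) (at t within {0..})"
      by (intro T_joint) auto
    then have "\<forall>\<^sub>F s in at t within {0..}. norm (T (max 0 (s - c)) (conv F c) - T (t - c) (conv F c)) < e / 3"
      using tendstoD[of _ "T (t - c) (conv F c)" _ "e / 3"] c e by (simp add: dist_norm)
    moreover have "\<forall>\<^sub>F s in at t within {0..}. \<bar>s - t\<bar> < d \<and> s \<ge> 0"
    proof -
      have "((\<lambda>s. \<bar>s - t\<bar>) \<longlongrightarrow> \<bar>t - t\<bar>) (at t within {0..})" by (intro tendsto_intros)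
      then have "\<forall>\<^sub>F s in at t within {0..}. \<bar>s - t\<bar> < d" by (rule order_tendstoD(2)) (use d in simp)
      moreover have "\<forall>\<^sub>F s in at t within {0..}. s \<in> {0..}" by (simp add: eventually_at_filter)
      ultimately show ?thesis by eventually_elim auto
    qed
    ultimately show "\<forall>\<^sub>F s in at t within {0..}. dist (conv F s) (conv F t) < e"
    proof eventually_elim
      case (elim s)
      have "max 0 (s - c) = s - c" using elim d by (auto simp: c_def)
      then have "norm (T (s - c) (conv F c) - T (t - c) (conv F c)) < e / 3" using elim(1) by simp
      moreover have "norm (conv F s - T (s - c) (conv F c)) < e / 3" using near[of s] elim by simp
      moreover have "norm (conv F t - T (t - c) (conv F c)) < e / 3" using near[of t] t d by simp
      moreover have "norm (conv F s - conv F t) \<le> norm (conv F s - T (s - c) (conv F c)) +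
          norm (T (s - c) (conv F c) - T (t - c) (conv F c)) + norm (conv F t - T (t - c) (conv F c))"
        using order_trans[OF norm_triangle_ineq4 add_right_mono[OF norm_triangle_ineq],
          of "conv F s - T (s - c) (conv F c)" "T (s - c) (conv F c) - T (t - c) (conv F c)"
             "conv F t - T (t - c) (conv F c)"] by simp
      ultimately show ?case unfolding dist_norm by linarith
    qed
  qed
qed

text \<open>Existence of a strict solution: the mild solution is continuous into the domain, hence
  differentiable.\<close>

lemma strict_solution_exists:
  assumes z0: "z0 \<in> carr E1" and F: "ncont E {0..} F"
  shows "\<exists>z. z 0 = z0 \<and> strict_solution E1 S F z"
proof -
  define z where "z t = T t z0 + R (conv F t)" for t
  have zc: "z t \<in> carr E1" if "t \<ge> 0" for t
    unfolding z_def using T_domain(1)[OF z0 that] R_carr nspace_carr(2)[OF E1] by blast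
  have Lz: "L (z t) = T t (L z0) + conv F t" if "t \<ge> 0" for t
    using T_domain(1)[OF z0 that] R_carr that z0 by (simp add: z_def L_add L_T L_R)
  have Lz_cont: "continuous_on {0..} (\<lambda>t. L (z t))"
  proof -
    have "continuous_on {0..} (\<lambda>t. T t (L z0) + conv F t)"
      by (intro continuous_intros T_continuous conv_continuous F)
    then show ?thesis by (rule continuous_on_eq) (simp add: Lz)
  qed
  have z_ncont: "ncont E1 {0..} z" unfolding ncont_def
  proof (intro conjI ballI)
    fix t :: real assume t: "t \<in> {0..}"
    have "((\<lambda>s. L (z s)) \<longlongrightarrow> L (z t)) (at t within {0..})" using Lz_cont t by (auto simp: continuous_on_def)
    then have lim: "((\<lambda>s. c1 * norm (L (z s) - L (z t))) \<longlongrightarrow> 0) (at t within {0..})"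
      by (intro tendsto_mult_right_zero tendsto_norm_zero LIM_zero)
    have zd: "z s - z t \<in> carr E1" if "s \<ge> 0" for s using nspace_carr(3)[OF E1 zc zc] that t by simp
    show "((\<lambda>s. nrm E1 (z s - z t)) \<longlongrightarrow> 0) (at t within {0..})"
      by (rule tendsto_nrm_0[OF E1 _ lim])
        (use zd E1_norm(1)[OF zd] zc t in \<open>auto simp: eventually_at_filter L_diff\<close>)
  qed (use zc in auto)
  have Sz_cont: "continuous_on {0..} (\<lambda>t. S (z t))"
  proof -
    obtain c where "\<forall>x\<in>carr E1. norm x \<le> c * nrm E1 x" using norm_le_E1 by blast
    then have "continuous_on {0..} z" using ncont_imp_continuous_on[OF E1 z_ncont] by blast
    then have "continuous_on {0..} (\<lambda>t. L (z t) + lam *\<^sub>R z t)"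
      by (intro continuous_intros Lz_cont)
    then show ?thesis by (rule continuous_on_eq) (rule S_eq[symmetric])
  qed
  have F_cont: "continuous_on {0..} F" by (rule E_continuous[OF F])
  have step: "((\<lambda>r. T (t - r) (F r)) has_integral (z t - T (t - s) (z s))) {s..t}" if s: "0 \<le> s" "s \<le> t" for s t
  proof -
    have "T (t - s) (z s) = T t z0 + R (T (t - s) (conv F s))"
      using s T_add[of "t - s" s z0] by (simp add: z_def blinfun.add_right T_R)
    have "((T (t - s) \<circ> (\<lambda>r. T (s - r) (F r))) has_integral T (t - s) (R (conv F s))) {0..s}"
      by (intro has_integral_linear R_conv F s blinfun.bounded_linear_right)
    then have 1: "((\<lambda>r. T (t - r) (F r)) has_integral T (t - s) (R (conv F s))) {0..s}"
    proof (rule has_integral_eq[rotated])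
      show "(T (t - s) \<circ> (\<lambda>r. T (s - r) (F r))) r = T (t - r) (F r)" if "r \<in> {0..s}" for r
        using T_add[of "t - s" "s - r" "F r"] that s by simp
    qed
    have "continuous_on {s..t} (\<lambda>r. T (t - r) (F r))"
      by (rule T_R_continuous) (use F_cont s in \<open>auto intro: continuous_on_subset\<close>)
    then have 2: "((\<lambda>r. T (t - r) (F r)) has_integral integral {s..t} (\<lambda>r. T (t - r) (F r))) {s..t}"
      by (intro integrable_integral integrable_continuous_real)
    have "R (conv F t) = T (t - s) (R (conv F s)) + integral {s..t} (\<lambda>r. T (t - r) (F r))"
      by (rule has_integral_unique[OF R_conv[OF F] has_integral_combine[OF s 1 2]]) (use s in simp)
    then have "z t - T (t - s) (z s) = integral {s..t} (\<lambda>r. T (t - r) (F r))"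
      using s T_add[of "t - s" s z0] by (simp add: z_def blinfun.add_right)
    then show ?thesis using 2 by simp
  qed
  have "(z has_vector_derivative S (z t) + F t) (at t within {0..})" if t: "t \<ge> 0" for t
  proof (rule has_vector_derivative_withinI)
    fix e :: real assume "e > 0"
    then have e: "e / 2 > 0" by simp
    obtain d1 where d1: "d1 > 0" "\<And>r x. 0 \<le> r \<Longrightarrow> r < d1 \<Longrightarrow> norm (x - S (z t)) < d1 \<Longrightarrow> norm (T r x - S (z t)) < e / 2"
      using T_near_id[OF e] by metis
    obtain d2 where d2: "d2 > 0" "\<And>r x. 0 \<le> r \<Longrightarrow> r < d2 \<Longrightarrow> norm (x - F t) < d2 \<Longrightarrow> norm (T r x - F t) < e / 2"
      using T_near_id[OF e] by metis
    obtain d3 where d3: "d3 > 0" "\<And>s. s \<ge> 0 \<Longrightarrow> \<bar>s - t\<bar> < d3 \<Longrightarrow> norm (S (z s) - S (z t)) < d1"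
      using Sz_cont t d1(1) unfolding continuous_on_iff by (metis atLeast_iff dist_norm real_norm_def)
    obtain d4 where d4: "d4 > 0" "\<And>s. s \<ge> 0 \<Longrightarrow> \<bar>s - t\<bar> < d4 \<Longrightarrow> norm (F s - F t) < d2"
      using F_cont t d2(1) unfolding continuous_on_iff by (metis atLeast_iff dist_norm real_norm_def)
    define d where "d = min (min d1 d2) (min d3 d4)"
    have d: "d > 0" "d \<le> d1" "d \<le> d2" "d \<le> d3" "d \<le> d4" using d1 d2 d3 d4 by (auto simp: d_def)
    \<comment> \<open>intervals around \<open>t\<close>, which covers the derivatives from both sides: on \<open>[p,q]\<close> the solution restarts
      from \<open>z p\<close>, which lies in the domain\<close>
    have key: "norm (z q - z p - (q - p) *\<^sub>R (S (z t) + F t)) \<le> e * (q - p)"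
      if pq: "0 \<le> p" "p \<le> t" "t \<le> q" "q - p < d" for p q
    proof -
      have "norm (T (q - p) (z p) - z p - (q - p) *\<^sub>R S (z t)) \<le> (q - p) * (e / 2)"
      proof (rule T_taylor)
        show "norm (T r (S (z p)) - S (z t)) \<le> e / 2" if "0 \<le> r" "r \<le> q - p" for r
          using d1(2)[of r "S (z p)"] d3(2)[of p] pq that d by auto
      qed (use pq zc in auto)
      moreover have "norm (z q - T (q - p) (z p) - (q - p) *\<^sub>R F t) \<le> e / 2 * measure lborel {p..q}"
      proof (rule has_integral_bound_real[OF _ finite.emptyI])
        have "((\<lambda>r. T (q - r) (F r) - F t) has_integral (z q - T (q - p) (z p) - measure lborel {p..q} *\<^sub>R F t)) {p..q}"
          by (intro has_integral_diff step has_integral_const_real) (use pq in auto)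
        then show "((\<lambda>r. T (q - r) (F r) - F t) has_integral (z q - T (q - p) (z p) - (q - p) *\<^sub>R F t)) {p..q}"
          using pq by simp
        show "norm (T (q - r) (F r) - F t) \<le> e / 2" if "r \<in> {p..q} - {}" for r
        proof -
          from that show "norm (T (q - r) (F r) - F t) \<le> e / 2"
            using d2(2)[of "q - r" "F r"] d4(2)[of r] pq d by auto
        qed
      qed (use e in auto)
      moreover have "norm (z q - z p - (q - p) *\<^sub>R (S (z t) + F t)) \<le>
          norm (T (q - p) (z p) - z p - (q - p) *\<^sub>R S (z t)) + norm (z q - T (q - p) (z p) - (q - p) *\<^sub>R F t)"
        using norm_triangle_ineq[of "T (q - p) (z p) - z p - (q - p) *\<^sub>R S (z t)" "z q - T (q - p) (z p) - (q - p) *\<^sub>R F t"]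
        by (simp add: scaleR_right_distrib add_diff_add[symmetric] diff_diff_eq2)
      moreover have "e / 2 * measure lborel {p..q} = e / 2 * (q - p)" using pq by simp
      ultimately have "norm (z q - z p - (q - p) *\<^sub>R (S (z t) + F t)) \<le> (q - p) * (e / 2) + e / 2 * (q - p)"
        by linarith
      also have "\<dots> = e * (q - p)" by (simp add: field_simps)
      finally show ?thesis .
    qed
    show "\<exists>d>0. \<forall>s\<in>{0..}. \<bar>s - t\<bar> < d \<longrightarrow> norm (z s - z t - (s - t) *\<^sub>R (S (z t) + F t)) \<le> e * \<bar>s - t\<bar>"
    proof (intro exI[of _ d] conjI ballI impI d(1))
      fix s :: real assume s: "s \<in> {0..}" "\<bar>s - t\<bar> < d"
      show "norm (z s - z t - (s - t) *\<^sub>R (S (z t) + F t)) \<le> e * \<bar>s - t\<bar>"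
      proof (cases "s \<le> t")
        case True
        have "z s - z t - (s - t) *\<^sub>R (S (z t) + F t) = - (z t - z s - (t - s) *\<^sub>R (S (z t) + F t))"
          by (simp add: algebra_simps)
        then have "norm (z s - z t - (s - t) *\<^sub>R (S (z t) + F t)) = norm (z t - z s - (t - s) *\<^sub>R (S (z t) + F t))"
          by (metis norm_minus_cancel)
        then show ?thesis using key[of s t] True s t by simp
      next
        case False then show ?thesis using key[of t s] s t by auto
      qed
    qed
  qed
  moreover have "z 0 = z0" by (simp add: z_def T_0 conv_def R.zero)
  ultimately show ?thesis using z_ncont by (auto simp: strict_solution_def)
qed

end

subsection \<open>Weighted bounds\<close>

context smoothing_semigroup
begin

text \<open>The bound for an inhomogeneity with an exponentially weighted part and a part that decays from its initial
  value; the free parameter \<open>d\<close> is a splitting point of the singular kernel.\<close>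

lemma strict_solution_bound_exp2:
  assumes z: "strict_solution E1 S F z" and F: "ncont E {0..} F" and t: "t \<ge> 0"
    and \<mu>: "\<mu> > w" "N = 0 \<or> \<mu> \<ge> 0" and b: "b > 0" "d > 0" and N: "N \<ge> 0" "M \<ge> 0"
    and le: "\<And>s. 0 \<le> s \<Longrightarrow> s \<le> t \<Longrightarrow> nrm E (F s) \<le> M * exp (\<mu> * s) + N * exp (- (b * s))"
  shows "nrm E1 (z t - T t (z 0)) \<le>
    C * (M * kernel_const a (\<mu> - w) + N * (d powr a / a + d powr (a - 1) * (1 / b))) * exp (\<mu> * t)"
proof -
  have pos': "\<mu> - w > 0" using \<mu> by simp
  obtain m1 I1 where m1: "(m1 has_integral I1) {0..t}" "I1 \<le> kernel_const a (\<mu> - w)"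
      "\<forall>r\<in>{0..t}. r powr (a - 1) * exp (- ((\<mu> - w) * r)) \<le> m1 r"
    using exp_kernel_majorant[OF pos(1,2) pos' t] by blast
  obtain m2 I2 where m2: "(m2 has_integral I2) {0..t}" "I2 \<le> d powr a / a + d powr (a - 1) * (1 / b)"
      "\<forall>r\<in>{0..t}. r powr (a - 1) * exp (- (b * (t - r))) \<le> m2 r"
    using exp_kernel_majorant_reversed[OF pos(1,2) b(1) t b(2)] by blast
  let ?e = "exp (\<mu> * t)"
  have "nrm E1 (z t - T t (z 0)) \<le> C * M * ?e * I1 + C * N * ?e * I2"
  proof (rule strict_solution_bound[OF z F t])
    show "((\<lambda>r. C * M * ?e * m1 r + C * N * ?e * m2 r) has_integral (C * M * ?e * I1 + C * N * ?e * I2)) {0..t}"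
      by (intro has_integral_add has_integral_mult_right m1 m2)
    fix r assume r: "r \<in> {0..t}"
    let ?k = "C * r powr (a - 1)"
    have k: "0 \<le> ?k * exp (w * r)" using pos by simp
    have "?k * exp (w * r) * nrm E (F (t - r)) \<le> ?k * exp (w * r) * (M * exp (\<mu> * (t - r)) + N * exp (- (b * (t - r))))"
      by (rule mult_left_mono[OF le k]) (use r in auto)
    also have "\<dots> = C * M * (r powr (a - 1) * (exp (w * r) * exp (\<mu> * (t - r))))
        + C * N * (exp (w * r) * (r powr (a - 1) * exp (- (b * (t - r)))))" by (simp add: algebra_simps)
    also have "exp (w * r) * exp (\<mu> * (t - r)) = ?e * exp (- ((\<mu> - w) * r))"
      by (simp add: exp_add[symmetric] algebra_simps)
    also have "C * M * (r powr (a - 1) * (?e * exp (- ((\<mu> - w) * r)))) \<le> C * M * ?e * m1 r"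
      using m1(3)[rule_format, OF r] pos N by (simp add: mult_ac mult_left_mono)
    also have "C * N * (exp (w * r) * (r powr (a - 1) * exp (- (b * (t - r))))) \<le> C * N * (?e * m2 r)"
    proof (cases "N = 0")
      case False
      then have "0 \<le> \<mu>" using \<mu>(2) by simp
      have "w * r \<le> \<mu> * r" using \<mu>(1) r by (intro mult_right_mono) auto
      also have "\<dots> \<le> \<mu> * t" using \<open>0 \<le> \<mu>\<close> r by (intro mult_left_mono) auto
      finally have "exp (w * r) \<le> ?e" by simp
      then show ?thesis using m2(3) r pos N by (intro mult_left_mono mult_mono) auto
    qed simp
    finally show "?k * exp (w * r) * nrm E (F (t - r)) \<le> C * M * ?e * m1 r + C * N * ?e * m2 r"
      by (simp add: mult_ac)
  qed
  also have "\<dots> \<le> C * M * ?e * kernel_const a (\<mu> - w) + C * N * ?e * (d powr a / a + d powr (a - 1) * (1 / b))"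
    using pos N by (intro add_mono mult_left_mono m1 m2) auto
  finally show ?thesis by (simp add: algebra_simps)
qed

lemma strict_solution_bound_exp:
  assumes z: "strict_solution E1 S F z" and F: "ncont E {0..} F" and t: "t \<ge> 0"
    and \<mu>: "\<mu> > w"
    and le: "\<And>s. 0 \<le> s \<Longrightarrow> s \<le> t \<Longrightarrow> nrm E (F s) \<le> M * exp (\<mu> * s)"
  shows "nrm E1 (z t - T t (z 0)) \<le> C * M * kernel_const a (\<mu> - w) * exp (\<mu> * t)"
proof -
  have M: "M \<ge> 0"
    using le[of 0] t normed_nspaceD(2)[OF E, of "F 0"] F by (auto simp: ncont_def)
  show ?thesis
    using strict_solution_bound_exp2[OF z F t \<mu>, of 0 1 1 M] M le by simp
qed

lemma S_diff: "x \<in> carr E1 \<Longrightarrow> y \<in> carr E1 \<Longrightarrow> S (x - y) = S x - S y"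
  using L_diff[of x y] by (simp add: L_def scaleR_right_diff_distrib)

end

section \<open>Semilinear problems\<close>

text \<open>What the contraction argument needs from the linear problem: unique solvability and a bound
  whose constant becomes small in strongly weighted norms. This notion is stable under products.\<close>

definition well_posed ::
  "'z::real_normed_vector nspace \<Rightarrow> 'z nspace \<Rightarrow> ('z \<Rightarrow> 'z) \<Rightarrow> bool" where
  "well_posed E1 E S \<longleftrightarrow> normed_nspace E1 \<and> normed_nspace E \<and> geo_complete E1 \<and>
     (\<forall>x\<in>carr E1. \<forall>y\<in>carr E1. S (x - y) = S x - S y) \<and>
     (\<forall>z0\<in>carr E1. \<forall>F. ncont E {0..} F \<longrightarrow> (\<exists>z. z 0 = z0 \<and> strict_solution E1 S F z)) \<and>
     (\<forall>\<eta>>0. \<exists>\<mu>0. \<forall>\<mu>\<ge>\<mu>0. \<forall>F z t M. strict_solution E1 S F z \<and> ncont E {0..} F \<and> z 0 = 0 \<and> t \<ge> 0 \<and>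
        (\<forall>s\<in>{0..t}. nrm E (F s) \<le> M * exp (\<mu> * s)) \<longrightarrow> nrm E1 (z t) \<le> \<eta> * M * exp (\<mu> * t))"

lemma (in smoothing_semigroup) well_posed:
  assumes "geo_complete E1" shows "well_posed E1 E S"
  unfolding well_posed_def
proof (intro conjI ballI allI impI)
  fix \<eta> :: real assume "\<eta> > 0"
  \<comment> \<open>the weight has to exceed the growth rate of the semigroup by a distance that makes the kernel small\<close>
  have "((\<lambda>x. C * kernel_const a x) \<longlongrightarrow> 0) at_top"
    using tendsto_mult_right_zero[OF kernel_const_tendsto_0[OF pos(1)]] .
  then have "\<forall>\<^sub>F x in at_top. C * kernel_const a x < \<eta>" by (rule order_tendstoD(2)) fact
  then obtain x0 where x0: "\<And>x. x \<ge> x0 \<Longrightarrow> C * kernel_const a x < \<eta>"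
    unfolding eventually_at_top_linorder by blast
  show "\<exists>\<mu>0. \<forall>\<mu>\<ge>\<mu>0. \<forall>F z t M. strict_solution E1 S F z \<and> ncont E {0..} F \<and> z 0 = 0 \<and> 0 \<le> t \<and>
      (\<forall>s\<in>{0..t}. nrm E (F s) \<le> M * exp (\<mu> * s)) \<longrightarrow> nrm E1 (z t) \<le> \<eta> * M * exp (\<mu> * t)"
  proof (intro exI[of _ "w + max x0 1"] allI impI; elim conjE)
    fix \<mu> F z t M assume \<mu>: "w + max x0 1 \<le> \<mu>" and z: "strict_solution E1 S F z" "z 0 = 0"
      and F: "ncont E {0..} F" and t: "(0::real) \<le> t" and le: "\<forall>s\<in>{0..t}. nrm E (F s) \<le> M * exp (\<mu> * s)"
    have M: "M \<ge> 0" using le[rule_format, of 0] t normed_nspaceD(2)[OF E, of "F 0"] F by (auto simp: ncont_def)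
    have "nrm E1 (z t - T t (z 0)) \<le> C * M * kernel_const a (\<mu> - w) * exp (\<mu> * t)"
      by (rule strict_solution_bound_exp[OF z(1) F t]) (use le \<mu> in auto)
    also have "\<dots> = (C * kernel_const a (\<mu> - w)) * M * exp (\<mu> * t)" by simp
    also have "\<dots> \<le> \<eta> * M * exp (\<mu> * t)"
      using less_imp_le[OF x0[of "\<mu> - w"]] \<mu> M by (intro mult_right_mono) auto
    finally show "nrm E1 (z t) \<le> \<eta> * M * exp (\<mu> * t)" using z(2) by (simp add: blinfun.zero_right)
  qed
qed (use assms E1 E S_diff strict_solution_exists in auto)

lemma strict_solution_cong:
  assumes "\<And>t. t \<ge> 0 \<Longrightarrow> F t = F' t" shows "strict_solution E1 S F z \<longleftrightarrow> strict_solution E1 S F' z"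
  using assms by (simp add: strict_solution_def)

lemma strict_solution_diff:
  assumes "normed_nspace E1" and S: "\<And>x y. x \<in> carr E1 \<Longrightarrow> y \<in> carr E1 \<Longrightarrow> S (x - y) = S x - S y"
    and z1: "strict_solution E1 S F1 z1" and z2: "strict_solution E1 S F2 z2"
  shows "strict_solution E1 S (\<lambda>t. F1 t - F2 t) (\<lambda>t. z1 t - z2 t)"
  unfolding strict_solution_def
proof (intro conjI allI impI)
  show "ncont E1 {0..} (\<lambda>t. z1 t - z2 t)" using z1 z2 by (intro ncont_diff assms(1)) (auto simp: strict_solution_def)
  fix t :: real assume t: "0 \<le> t"
  have c: "z1 t \<in> carr E1" "z2 t \<in> carr E1" using z1 z2 t by (auto simp: strict_solution_def ncont_def)
  have "((\<lambda>t. z1 t - z2 t) has_vector_derivative (S (z1 t) + F1 t) - (S (z2 t) + F2 t)) (at t within {0..})"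
    using z1 z2 t by (intro has_vector_derivative_diff) (auto simp: strict_solution_def)
  then show "((\<lambda>t. z1 t - z2 t) has_vector_derivative S (z1 t - z2 t) + (F1 t - F2 t)) (at t within {0..})"
    unfolding S[OF c] by (simp add: algebra_simps)
qed

lemma well_posed_exists:
  assumes "well_posed E1 E S" "z0 \<in> carr E1" "ncont E {0..} F"
  obtains z where "z 0 = z0" "strict_solution E1 S F z"
proof -
  have "\<exists>z. z 0 = z0 \<and> strict_solution E1 S F z"
    using assms by (simp add: well_posed_def)
  then show ?thesis using that by blast
qed

lemma well_posed_bound:
  assumes "well_posed E1 E S" "\<eta> > 0"
  obtains \<mu>0 where "\<And>\<mu> F z t M. \<mu>0 \<le> \<mu> \<Longrightarrow> strict_solution E1 S F z \<Longrightarrow> ncont E {0..} F \<Longrightarrow> z 0 = 0 \<Longrightarrow> 0 \<le> t \<Longrightarrow>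
    (\<And>s. s \<in> {0..t} \<Longrightarrow> nrm E (F s) \<le> M * exp (\<mu> * s)) \<Longrightarrow> nrm E1 (z t) \<le> \<eta> * M * exp (\<mu> * t)"
proof -
  have "\<exists>\<mu>0. \<forall>\<mu>\<ge>\<mu>0. \<forall>F z t M. strict_solution E1 S F z \<and> ncont E {0..} F \<and> z 0 = 0 \<and> t \<ge> 0 \<and>
      (\<forall>s\<in>{0..t}. nrm E (F s) \<le> M * exp (\<mu> * s)) \<longrightarrow> nrm E1 (z t) \<le> \<eta> * M * exp (\<mu> * t)"
    using assms by (simp add: well_posed_def)
  then show ?thesis using that by blast
qed

lemma has_vector_derivative_Pair_iff:
  "((\<lambda>t. (u t, v t)) has_vector_derivative (a, b)) (at t within S) \<longleftrightarrow>
    (u has_vector_derivative a) (at t within S) \<and> (v has_vector_derivative b) (at t within S)"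
proof
  assume d: "((\<lambda>t. (u t, v t)) has_vector_derivative (a, b)) (at t within S)"
  from bounded_linear.has_vector_derivative[OF bounded_linear_fst d] bounded_linear.has_vector_derivative[OF bounded_linear_snd d]
  show "(u has_vector_derivative a) (at t within S) \<and> (v has_vector_derivative b) (at t within S)" by simp
qed (auto intro: has_vector_derivative_Pair)

lemma well_posed_nprod:
  assumes A: "well_posed E1 E S" and B: "well_posed F1 F U"
  shows "well_posed (nprod E1 F1) (nprod E F) (\<lambda>p. (S (fst p), U (snd p)))"
proof -
  let ?S = "\<lambda>p. (S (fst p), U (snd p))"
  from A have nA: "normed_nspace E1" "normed_nspace E" "geo_complete E1" by (auto simp: well_posed_def)
  from B have nB: "normed_nspace F1" "normed_nspace F" "geo_complete F1" by (auto simp: well_posed_def)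
  have nc: "ncont (nprod E' F') {0..} h \<longleftrightarrow> ncont E' {0..} (\<lambda>s. fst (h s)) \<and> ncont F' {0..} (\<lambda>s. snd (h s))"
    if "normed_nspace E'" "normed_nspace F'" for E' :: "'a nspace" and F' :: "'b nspace" and h
    using ncont_nprod[OF that, of "{0..}" "\<lambda>s. fst (h s)" "\<lambda>s. snd (h s)"] by simp
  have ss: "strict_solution (nprod E1 F1) ?S H z \<longleftrightarrow>
      strict_solution E1 S (\<lambda>t. fst (H t)) (\<lambda>t. fst (z t)) \<and> strict_solution F1 U (\<lambda>t. snd (H t)) (\<lambda>t. snd (z t))"
    for H z
  proof -
    have "(z has_vector_derivative ?S (z t) + H t) (at t within {0..}) \<longleftrightarrow>
        ((\<lambda>t. fst (z t)) has_vector_derivative S (fst (z t)) + fst (H t)) (at t within {0..}) \<and>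
        ((\<lambda>t. snd (z t)) has_vector_derivative U (snd (z t)) + snd (H t)) (at t within {0..})" for t
      using has_vector_derivative_Pair_iff[of "\<lambda>t. fst (z t)" "\<lambda>t. snd (z t)"] by (simp add: plus_prod_def)
    then show ?thesis unfolding strict_solution_def nc[OF nA(1) nB(1)] by auto
  qed
  show ?thesis unfolding well_posed_def
  proof (intro conjI ballI allI impI)
    show "normed_nspace (nprod E1 F1)" "normed_nspace (nprod E F)" "geo_complete (nprod E1 F1)"
      using nA nB by (auto intro: normed_nprod geo_complete_nprod)
  next
    fix x y assume "x \<in> carr (nprod E1 F1)" "y \<in> carr (nprod E1 F1)"
    then show "?S (x - y) = ?S x - ?S y" using A B by (auto simp: well_posed_def)
  next
    fix z0 H assume z0: "z0 \<in> carr (nprod E1 F1)" and H: "ncont (nprod E F) {0..} H"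
    obtain u where "u 0 = fst z0" "strict_solution E1 S (\<lambda>t. fst (H t)) u"
      by (rule well_posed_exists[OF A]) (use z0 H nc[OF nA(2) nB(2)] in \<open>auto simp: mem_Times_iff\<close>)
    moreover obtain v where "v 0 = snd z0" "strict_solution F1 U (\<lambda>t. snd (H t)) v"
      by (rule well_posed_exists[OF B]) (use z0 H nc[OF nA(2) nB(2)] in \<open>auto simp: mem_Times_iff\<close>)
    ultimately show "\<exists>z. z 0 = z0 \<and> strict_solution (nprod E1 F1) ?S H z"
      by (intro exI[of _ "\<lambda>t. (u t, v t)"]) (simp add: ss)
  next
    fix \<eta> :: real assume "\<eta> > 0"
    then have "\<eta> / 2 > 0" by simp
    from well_posed_bound[OF A this]
    obtain m1 where m1: "\<And>\<mu> H z t M. m1 \<le> \<mu> \<Longrightarrow> strict_solution E1 S H z \<Longrightarrow> ncont E {0..} H \<Longrightarrow> z 0 = 0 \<Longrightarrow> 0 \<le> t \<Longrightarrow>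
        (\<And>s. s \<in> {0..t} \<Longrightarrow> nrm E (H s) \<le> M * exp (\<mu> * s)) \<Longrightarrow> nrm E1 (z t) \<le> \<eta> / 2 * M * exp (\<mu> * t)"
      by blast
    from well_posed_bound[OF B \<open>\<eta> / 2 > 0\<close>]
    obtain m2 where m2: "\<And>\<mu> H z t M. m2 \<le> \<mu> \<Longrightarrow> strict_solution F1 U H z \<Longrightarrow> ncont F {0..} H \<Longrightarrow> z 0 = 0 \<Longrightarrow> 0 \<le> t \<Longrightarrow>
        (\<And>s. s \<in> {0..t} \<Longrightarrow> nrm F (H s) \<le> M * exp (\<mu> * s)) \<Longrightarrow> nrm F1 (z t) \<le> \<eta> / 2 * M * exp (\<mu> * t)"
      by blast
    show "\<exists>\<mu>0. \<forall>\<mu>\<ge>\<mu>0. \<forall>H z t M. strict_solution (nprod E1 F1) ?S H z \<and> ncont (nprod E F) {0..} H \<and> z 0 = 0 \<and> 0 \<le> t \<and>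
        (\<forall>s\<in>{0..t}. nrm (nprod E F) (H s) \<le> M * exp (\<mu> * s)) \<longrightarrow> nrm (nprod E1 F1) (z t) \<le> \<eta> * M * exp (\<mu> * t)"
    proof (intro exI[of _ "max m1 m2"] allI impI; elim conjE)
      fix \<mu> H z t M assume \<mu>: "max m1 m2 \<le> \<mu>" and z: "strict_solution (nprod E1 F1) ?S H z" "z 0 = 0"
        and H: "ncont (nprod E F) {0..} H" and t: "(0::real) \<le> t"
        and le: "\<forall>s\<in>{0..t}. nrm (nprod E F) (H s) \<le> M * exp (\<mu> * s)"
      have Hc: "ncont E {0..} (\<lambda>s. fst (H s))" "ncont F {0..} (\<lambda>s. snd (H s))"
        using H unfolding nc[OF nA(2) nB(2)] by auto
      have le2: "nrm E (fst (H s)) \<le> M * exp (\<mu> * s)" "nrm F (snd (H s)) \<le> M * exp (\<mu> * s)" if "s \<in> {0..t}" for s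
      proof -
        have "0 \<le> nrm E (fst (H s))" "0 \<le> nrm F (snd (H s))"
          using Hc that normed_nspaceD(2)[OF nA(2)] normed_nspaceD(2)[OF nB(2)] by (auto simp: ncont_def)
        then show "nrm E (fst (H s)) \<le> M * exp (\<mu> * s)" "nrm F (snd (H s)) \<le> M * exp (\<mu> * s)"
          using le that by (auto simp: nrm_nprod dest!: bspec[of _ _ s])
      qed
      have "nrm E1 (fst (z t)) \<le> \<eta> / 2 * M * exp (\<mu> * t)"
        by (rule m1[of _ "\<lambda>s. fst (H s)" "\<lambda>s. fst (z s)"]) (use \<mu> z t Hc le2 in \<open>auto simp: ss\<close>)
      moreover have "nrm F1 (snd (z t)) \<le> \<eta> / 2 * M * exp (\<mu> * t)"
        by (rule m2[of _ "\<lambda>s. snd (H s)" "\<lambda>s. snd (z s)"]) (use \<mu> z t Hc le2 in \<open>auto simp: ss\<close>)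
      ultimately show "nrm (nprod E1 F1) (z t) \<le> \<eta> * M * exp (\<mu> * t)"
        by (simp add: nrm_nprod)
    qed
  qed
qed

text \<open>A Gronwall-type lemma: if every exponential bound of \<open>\<phi>\<close> improves by the factor \<open>\<theta> < 1\<close> up to
  \<open>A\<close>, the best one is at most \<open>A / (1 - \<theta>)\<close>.\<close>

lemma exponential_gronwall:
  fixes \<phi> :: "real \<Rightarrow> real"
  assumes cont: "continuous_on {0..\<tau>} \<phi>" and \<tau>: "\<tau> \<ge> 0" and \<theta>: "\<theta> < 1"
    and step: "\<And>t M. 0 \<le> t \<Longrightarrow> t \<le> \<tau> \<Longrightarrow> (\<And>s. 0 \<le> s \<Longrightarrow> s \<le> t \<Longrightarrow> \<phi> s \<le> M * exp (\<mu> * s)) \<Longrightarrow>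
      \<phi> t \<le> (A + \<theta> * M) * exp (\<mu> * t)"
  shows "\<phi> \<tau> \<le> A / (1 - \<theta>) * exp (\<mu> * \<tau>)"
proof -
  have "continuous_on {0..\<tau>} (\<lambda>t. \<phi> t * exp (- \<mu> * t))" by (intro continuous_intros cont)
  then obtain t where t: "t \<in> {0..\<tau>}" and max: "\<And>s. s \<in> {0..\<tau>} \<Longrightarrow> \<phi> s * exp (- \<mu> * s) \<le> \<phi> t * exp (- \<mu> * t)"
    using continuous_attains_sup[of "{0..\<tau>}"] \<tau> by force
  define M where "M = \<phi> t * exp (- \<mu> * t)"
  have le: "\<phi> s \<le> M * exp (\<mu> * s)" if "0 \<le> s" "s \<le> \<tau>" for s
  proof -
    have "\<phi> s = \<phi> s * exp (- \<mu> * s) * exp (\<mu> * s)" by (simp add: exp_minus)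
    also have "\<dots> \<le> M * exp (\<mu> * s)" unfolding M_def using that by (intro mult_right_mono max) auto
    finally show ?thesis .
  qed
  have "\<phi> t \<le> (A + \<theta> * M) * exp (\<mu> * t)" by (rule step) (use t le in auto)
  then have "M \<le> (A + \<theta> * M) * exp (\<mu> * t) * exp (- \<mu> * t)"
    unfolding M_def by (intro mult_right_mono) auto
  then have "M \<le> A + \<theta> * M" by (simp add: exp_minus mult.assoc)
  then have "M \<le> A / (1 - \<theta>)" using \<theta> by (simp add: field_simps)
  have "\<phi> \<tau> \<le> M * exp (\<mu> * \<tau>)" by (rule le) (use \<tau> in auto)
  also have "\<dots> \<le> A / (1 - \<theta>) * exp (\<mu> * \<tau>)" using \<open>M \<le> A / (1 - \<theta>)\<close> by (intro mult_right_mono) auto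
  finally show ?thesis .
qed

lemma exp_times_le: "0 \<le> s \<Longrightarrow> s \<le> t \<Longrightarrow> exp (\<mu> * s) \<le> exp (\<bar>\<mu>\<bar> * t)" for \<mu> :: real
  by (simp add: mult_mono)

lemma semilinear_contraction:
  assumes wp: "well_posed E1 E S"
    and lip: "\<And>t x y. t \<ge> 0 \<Longrightarrow> x \<in> carr E1 \<Longrightarrow> y \<in> carr E1 \<Longrightarrow> nrm E (N t x - N t y) \<le> K * nrm E1 (x - y)"
    and N: "\<And>z. ncont E1 {0..} z \<Longrightarrow> ncont E {0..} (\<lambda>t. N t (z t))"
  obtains \<mu> where "\<And>u v y z t M. ncont E1 {0..} u \<Longrightarrow> ncont E1 {0..} v \<Longrightarrow>
    strict_solution E1 S (\<lambda>t. N t (u t)) y \<Longrightarrow> strict_solution E1 S (\<lambda>t. N t (v t)) z \<Longrightarrow> y 0 = z 0 \<Longrightarrow> t \<ge> 0 \<Longrightarrow>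
    (\<And>s. 0 \<le> s \<Longrightarrow> s \<le> t \<Longrightarrow> nrm E1 (u s - v s) \<le> M * exp (\<mu> * s)) \<Longrightarrow>
    nrm E1 (y t - z t) \<le> 1 / 2 * M * exp (\<mu> * t)"
proof -
  from wp have E1: "normed_nspace E1" and E: "normed_nspace E" by (auto simp: well_posed_def)
  have "0 < 1 / (2 * (\<bar>K\<bar> + 1))" by simp
  from well_posed_bound[OF wp this]
  obtain \<mu> where \<mu>: "\<And>H z t M. strict_solution E1 S H z \<Longrightarrow> ncont E {0..} H \<Longrightarrow> z 0 = 0 \<Longrightarrow> 0 \<le> t \<Longrightarrow>
      (\<And>s. s \<in> {0..t} \<Longrightarrow> nrm E (H s) \<le> M * exp (\<mu> * s)) \<Longrightarrow> nrm E1 (z t) \<le> 1 / (2 * (\<bar>K\<bar> + 1)) * M * exp (\<mu> * t)"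
    by (metis order_refl)
  have "nrm E1 (y t - z t) \<le> 1 / 2 * M * exp (\<mu> * t)"
    if u: "ncont E1 {0..} u" and v: "ncont E1 {0..} v" and y: "strict_solution E1 S (\<lambda>t. N t (u t)) y"
      and z: "strict_solution E1 S (\<lambda>t. N t (v t)) z" and init: "y 0 = z 0" and t: "t \<ge> 0"
      and le: "\<And>s. 0 \<le> s \<Longrightarrow> s \<le> t \<Longrightarrow> nrm E1 (u s - v s) \<le> M * exp (\<mu> * s)" for u v y z t M
  proof -
    have c: "u s \<in> carr E1" "v s \<in> carr E1" if "s \<ge> 0" for s using u v that by (auto simp: ncont_def)
    have nn: "0 \<le> nrm E1 (u s - v s)" if "s \<ge> 0" for s
      using normed_nspaceD(2)[OF E1 nspace_carr(3)[OF E1 c[OF that]]] .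
    have M: "M \<ge> 0" using le[of 0] nn[of 0] t by simp
    have "nrm E1 (y t - z t) \<le> 1 / (2 * (\<bar>K\<bar> + 1)) * (\<bar>K\<bar> * M) * exp (\<mu> * t)"
    proof (rule \<mu>[of "\<lambda>s. N s (u s) - N s (v s)" "\<lambda>s. y s - z s"])
      show "strict_solution E1 S (\<lambda>s. N s (u s) - N s (v s)) (\<lambda>s. y s - z s)"
        by (rule strict_solution_diff[OF E1 _ y z]) (use wp in \<open>auto simp: well_posed_def\<close>)
      show "ncont E {0..} (\<lambda>s. N s (u s) - N s (v s))" by (intro ncont_diff E N u v)
      fix s assume "s \<in> {0..t}"
      then have s: "0 \<le> s" "s \<le> t" by auto
      have "nrm E (N s (u s) - N s (v s)) \<le> \<bar>K\<bar> * nrm E1 (u s - v s)"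
        by (rule le_abs_mult[OF lip[OF s(1) c[OF s(1)]] nn[OF s(1)]])
      also have "\<dots> \<le> \<bar>K\<bar> * (M * exp (\<mu> * s))" by (intro mult_left_mono le s) auto
      finally show "nrm E (N s (u s) - N s (v s)) \<le> \<bar>K\<bar> * M * exp (\<mu> * s)" by simp
    qed (use init t in auto)
    also have "1 / (2 * (\<bar>K\<bar> + 1)) * (\<bar>K\<bar> * M) \<le> 1 / 2 * M" using M by (simp add: field_simps)
    finally show ?thesis by (simp add: mult_right_mono)
  qed
  then show ?thesis using that by blast
qed

lemma semilinear_unique:
  assumes wp: "well_posed E1 E S"
    and lip: "\<And>t x y. t \<ge> 0 \<Longrightarrow> x \<in> carr E1 \<Longrightarrow> y \<in> carr E1 \<Longrightarrow> nrm E (N t x - N t y) \<le> K * nrm E1 (x - y)"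
    and N: "\<And>z. ncont E1 {0..} z \<Longrightarrow> ncont E {0..} (\<lambda>t. N t (z t))"
    and z: "strict_solution E1 S (\<lambda>t. N t (z t)) z" "strict_solution E1 S (\<lambda>t. N t (y t)) y" "z 0 = y 0"
    and t: "t \<ge> 0"
  shows "z t = y t"
proof -
  from wp have E1: "normed_nspace E1" by (auto simp: well_posed_def)
  have zc: "ncont E1 {0..} z" "ncont E1 {0..} y" using z by (auto simp: strict_solution_def)
  have d: "z t - y t \<in> carr E1" using ncontD(1)[OF zc(1)] ncontD(1)[OF zc(2)] nspace_carr(3)[OF E1] t by simp
  obtain \<mu> where \<mu>: "\<And>t M. t \<ge> 0 \<Longrightarrow> (\<And>s. 0 \<le> s \<Longrightarrow> s \<le> t \<Longrightarrow> nrm E1 (z s - y s) \<le> M * exp (\<mu> * s)) \<Longrightarrow>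
      nrm E1 (z t - y t) \<le> 1 / 2 * M * exp (\<mu> * t)"
  proof (rule semilinear_contraction[OF wp lip N], goal_cases)
    case (5 \<mu>)
    show ?case by (rule that[OF 5(2)[OF zc z]])
  qed
  have "nrm E1 (z t - y t) \<le> 0 / (1 - 1 / 2) * exp (\<mu> * t)"
  proof (rule exponential_gronwall[where \<phi> = "\<lambda>s. nrm E1 (z s - y s)"])
    show "continuous_on {0..t} (\<lambda>s. nrm E1 (z s - y s))"
      by (rule continuous_on_nrm[OF E1 ncont_subset[OF ncont_diff[OF E1 zc]]]) auto
  qed (use t \<mu> in auto)
  then have "nrm E1 (z t - y t) = 0" using normed_nspaceD(2)[OF E1 d] by simp
  then show ?thesis using normed_nspaceD(3)[OF E1 d] by simp
qed

lemma semilinear_exists: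
  assumes wp: "well_posed E1 E S" and z0: "z0 \<in> carr E1"
    and lip: "\<And>t x y. t \<ge> 0 \<Longrightarrow> x \<in> carr E1 \<Longrightarrow> y \<in> carr E1 \<Longrightarrow> nrm E (N t x - N t y) \<le> K * nrm E1 (x - y)"
    and N: "\<And>z. ncont E1 {0..} z \<Longrightarrow> ncont E {0..} (\<lambda>t. N t (z t))"
  shows "\<exists>z. z 0 = z0 \<and> strict_solution E1 S (\<lambda>t. N t (z t)) z"
proof -
  from wp have E1: "normed_nspace E1" and E: "normed_nspace E" and comp: "geo_complete E1"
    by (auto simp: well_posed_def)
  define sol where "sol F = (SOME z. z 0 = z0 \<and> strict_solution E1 S F z)" for F
  have sol: "sol F 0 = z0" "strict_solution E1 S F (sol F)" if "ncont E {0..} F" for F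
  proof -
    have "\<exists>z. z 0 = z0 \<and> strict_solution E1 S F z" using wp z0 that by (auto simp: well_posed_def)
    from someI_ex[OF this] show "sol F 0 = z0" "strict_solution E1 S F (sol F)" by (auto simp: sol_def)
  qed
  have solc: "ncont E1 {0..} (sol F)" if "ncont E {0..} F" for F
    using sol[OF that] by (simp add: strict_solution_def)
  obtain \<mu> where contr: "\<And>u v t M. ncont E1 {0..} u \<Longrightarrow> ncont E1 {0..} v \<Longrightarrow> t \<ge> 0 \<Longrightarrow>
      (\<And>s. 0 \<le> s \<Longrightarrow> s \<le> t \<Longrightarrow> nrm E1 (u s - v s) \<le> M * exp (\<mu> * s)) \<Longrightarrow>
      nrm E1 (sol (\<lambda>t. N t (u t)) t - sol (\<lambda>t. N t (v t)) t) \<le> 1 / 2 * M * exp (\<mu> * t)"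
  proof (rule semilinear_contraction[OF wp lip N], goal_cases)
    case (5 \<mu>)
    show ?case
    proof (rule that)
      fix u v t M
      assume a: "ncont E1 {0..} u" "ncont E1 {0..} v" "(0::real) \<le> t"
        and le: "\<And>s. 0 \<le> s \<Longrightarrow> s \<le> t \<Longrightarrow> nrm E1 (u s - v s) \<le> M * exp (\<mu> * s)"
      show "nrm E1 (sol (\<lambda>t. N t (u t)) t - sol (\<lambda>t. N t (v t)) t) \<le> 1 / 2 * M * exp (\<mu> * t)"
        by (rule 5(2)[OF a(1,2) sol(2)[OF N[OF a(1)]] sol(2)[OF N[OF a(2)]] _ a(3) le]) (simp_all add: sol(1) N a)
    qed
  qed
  define u where "u k = ((\<lambda>u. sol (\<lambda>t. N t (u t))) ^^ k) (\<lambda>t. z0)" for k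
  have u0: "u 0 = (\<lambda>t. z0)" and uS: "u (Suc k) = sol (\<lambda>t. N t (u k t))" for k by (simp_all add: u_def)
  have uc: "ncont E1 {0..} (u k)" for k
    by (induction k) (simp_all add: u0 uS ncont_const[OF E1 z0] solc N)
  \<comment> \<open>nothing is known about the growth of the first increment, hence bounds \<open>M s\<close> for each interval \<open>[0,s]\<close>\<close>
  define D where "D s = nrm E1 (u 1 s - u 0 s) * exp (- \<mu> * s)" for s
  define M where "M s = (SUP r\<in>{0..max 0 s}. D r)" for s
  have D_cont: "continuous_on {0..s} D" for s
    unfolding D_def by (intro continuous_intros continuous_on_nrm[OF E1 ncont_subset[OF ncont_diff[OF E1 uc uc]]]) auto
  have bdd: "bdd_above (D ` {0..s})" for s
    by (intro bounded_imp_bdd_above compact_imp_bounded compact_continuous_image D_cont compact_Icc)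
  have M_mono: "M s \<le> M s'" if "s \<le> s'" for s s'
    unfolding M_def by (rule cSUP_subset_mono[OF _ bdd]) (use that in auto)
  have inc0: "nrm E1 (u 1 r - u 0 r) \<le> M s * exp (\<mu> * r)" if "0 \<le> r" "r \<le> s" for r s
  proof -
    have "D r \<le> M s" unfolding M_def by (rule cSUP_upper[OF _ bdd]) (use that in auto)
    then show ?thesis by (simp add: D_def exp_minus field_simps)
  qed
  have inc: "nrm E1 (u (Suc k) r - u k r) \<le> M s * (1 / 2) ^ k * exp (\<mu> * r)" if "0 \<le> r" "r \<le> s" for k r s
    using that
  proof (induction k arbitrary: r)
    case 0 then show ?case using inc0 by simp
  next
    case (Suc k)
    have "nrm E1 (u (Suc (Suc k)) r - u (Suc k) r) \<le> 1 / 2 * (M s * (1 / 2) ^ k) * exp (\<mu> * r)"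
      unfolding uS[of "Suc k"] uS[of k]
      by (rule contr[OF _ _ Suc.prems(1)]) (use Suc uc in \<open>auto simp: uS[symmetric]\<close>)
    then show ?case by simp
  qed
  have M_nn: "0 \<le> M s" for s
  proof -
    have "0 \<le> D 0" using uc[of 0] uc[of 1] normed_nspaceD(2)[OF E1 nspace_carr(3)[OF E1]]
      by (auto simp: D_def ncont_def)
    also have "\<dots> \<le> M s" unfolding M_def by (rule cSUP_upper[OF _ bdd]) auto
    finally show ?thesis .
  qed
  define P where "P s = M s * exp (\<bar>\<mu>\<bar> * max 0 s)" for s
  have P_mono: "P s \<le> P s'" if "s \<le> s'" for s s'
    unfolding P_def using that M_nn M_mono[OF that] by (intro mult_mono) (auto intro!: mult_left_mono)
  have incP: "nrm E1 (u (Suc k) s - u k s) \<le> P s * (1 / 2) ^ k" if "s \<in> {0..}" for k s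
  proof -
    have "nrm E1 (u (Suc k) s - u k s) \<le> M s * (1 / 2) ^ k * exp (\<mu> * s)" using inc that by simp
    also have "\<dots> \<le> M s * (1 / 2) ^ k * exp (\<bar>\<mu>\<bar> * max 0 s)"
      using that M_nn[of s] by (intro mult_left_mono exp_times_le) auto
    finally show ?thesis by (simp add: P_def mult_ac)
  qed
  obtain W where W: "ncont E1 {0..} W" and uW: "\<And>k s. s \<in> {0..} \<Longrightarrow> nrm E1 (u k s - W s) \<le> P s * (1 / 2) ^ k / (1 - 1 / 2)"
    by (rule ncont_geometric_limit[where I = "{0..}" and w = u and M = P and c = "1/2", OF E1 comp uc _ _ P_mono incP]) auto
  define y where "y = sol (\<lambda>t. N t (W t))"
  have yc: "ncont E1 {0..} y" unfolding y_def by (intro solc N W)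
  have Wy: "W t = y t" if t: "t \<ge> 0" for t
  proof -
    have c: "W t \<in> carr E1" "y t \<in> carr E1" "\<And>k. u k t \<in> carr E1" using W yc uc t by (auto simp: ncont_def)
    have P_nn: "0 \<le> P s" for s using M_nn by (simp add: P_def)
    have 1: "nrm E1 (u (Suc k) t - y t) \<le> 1 / 2 * (2 * P t * (1 / 2) ^ k * exp (\<bar>\<mu>\<bar> * t)) * exp (\<mu> * t)" for k
      unfolding uS y_def
    proof (rule contr[OF uc W t])
      fix s assume s: "0 \<le> s" "s \<le> t"
      have "nrm E1 (u k s - W s) \<le> 2 * P s * (1 / 2) ^ k" using uW[of s k] s by simp
      also have "\<dots> \<le> 2 * P t * (1 / 2) ^ k * 1" using P_mono[OF s(2)] by (simp add: mult_right_mono)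
      also have "\<dots> \<le> 2 * P t * (1 / 2) ^ k * (exp (\<bar>\<mu>\<bar> * t) * exp (\<mu> * s))"
      proof (rule mult_left_mono)
        have "exp (- \<mu> * s) \<le> exp (\<bar>- \<mu>\<bar> * t)" by (rule exp_times_le[OF s])
        then have "1 \<le> exp (\<bar>\<mu>\<bar> * t) * exp (\<mu> * s)" by (simp add: exp_minus field_simps)
        then show "1 \<le> exp (\<bar>\<mu>\<bar> * t) * exp (\<mu> * s)" .
      qed (use P_nn[of t] in auto)
      finally show "nrm E1 (u k s - W s) \<le> 2 * P t * (1 / 2) ^ k * exp (\<bar>\<mu>\<bar> * t) * exp (\<mu> * s)" by (simp add: mult.assoc)
    qed
    have 2: "nrm E1 (W t - y t) \<le> (P t + P t * exp (\<bar>\<mu>\<bar> * t) * exp (\<mu> * t)) * (1 / 2) ^ k" for k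
    proof -
      have "nrm E1 (W t - y t) \<le> nrm E1 (u (Suc k) t - W t) + nrm E1 (u (Suc k) t - y t)"
        using nrm_triangle[OF E1 c(1) c(3)[of "Suc k"] c(2)] nrm_minus_commute[OF E1 c(1) c(3)[of "Suc k"]] by simp
      then show ?thesis using 1[of k] uW[of t "Suc k"] t by (simp add: algebra_simps)
    qed
    have "(\<lambda>k. (P t + P t * exp (\<bar>\<mu>\<bar> * t) * exp (\<mu> * t)) * (1 / 2) ^ k) \<longlonglongrightarrow> 0"
      by (intro tendsto_mult_right_zero LIMSEQ_realpow_zero) auto
    then have "nrm E1 (W t - y t) \<le> 0" by (rule LIMSEQ_le_const) (use 2 in auto)
    then have "nrm E1 (W t - y t) = 0" using normed_nspaceD(2)[OF E1 nspace_carr(3)[OF E1 c(1,2)]] by simp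
    then show ?thesis using normed_nspaceD(3)[OF E1 nspace_carr(3)[OF E1 c(1,2)]] by simp
  qed
  have "strict_solution E1 S (\<lambda>t. N t (W t)) y" unfolding y_def by (rule sol(2)[OF N[OF W]])
  then have "strict_solution E1 S (\<lambda>t. N t (y t)) y"
    by (subst strict_solution_cong[of _ "\<lambda>t. N t (W t)"]) (simp_all add: Wy)
  moreover have "y 0 = z0" unfolding y_def by (rule sol(1)[OF N[OF W]])
  ultimately show ?thesis by blast
qed

section \<open>Interpolation-extrapolation scales\<close>

text \<open>A space that is the isometric image of a Banach space is complete.\<close>

lemma banach_nspaceI_isometry:
  fixes \<phi> :: "'z::banach \<Rightarrow> 'e::real_vector"
  assumes lin: "linear \<phi>" and inj: "inj \<phi>" and c: "carr E = range \<phi>"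
    and n: "\<And>z. nrm E (\<phi> z) = norm z"
  shows "banach_nspace E"
proof -
  have sub: "subspace (range \<phi>)" by (rule linear_subspace_image[OF lin subspace_UNIV])
  interpret linear \<phi> by (rule lin)
  have E: "normed_nspace E" unfolding normed_nspace_def c
  proof (intro conjI ballI allI)
    show "subspace (range \<phi>)" by (rule sub)
    fix x assume "x \<in> range \<phi>"
    then obtain z where z: "x = \<phi> z" by blast
    show "0 \<le> nrm E x" by (simp add: z n)
    show "(nrm E x = 0) = (x = 0)" using inj by (auto simp: z n zero dest: injD[of _ z 0])
    show "nrm E (a *\<^sub>R x) = \<bar>a\<bar> * nrm E x" for a using n[of "a *\<^sub>R z"] by (simp add: z n scaleR)
    show "nrm E (x + y) \<le> nrm E x + nrm E y" if y: "y \<in> range \<phi>" for y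
    proof -
      obtain z' where "y = \<phi> z'" using y by blast
      then show ?thesis using n[of "z + z'"] by (simp add: z n add norm_triangle_ineq)
    qed
  qed
  interpret M: Metric_space "carr E" "ndist E" by (rule Metric_space_ndist[OF E])
  have d: "ndist E (\<phi> y) (\<phi> z) = norm (y - z)" for y z using n[of "y - z"] by (simp add: ndist_def c diff)
  have "M.mcomplete" unfolding M.mcomplete_def
  proof (intro allI impI)
    fix \<sigma> assume \<sigma>: "M.MCauchy \<sigma>"
    then have "range \<sigma> \<subseteq> carr E" and \<sigma>2: "\<forall>e>0. \<exists>N. \<forall>n n'. N \<le> n \<longrightarrow> N \<le> n' \<longrightarrow> ndist E (\<sigma> n) (\<sigma> n') < e"
      unfolding M.MCauchy_def by blast+
    then have "\<forall>n. \<exists>y. \<sigma> n = \<phi> y" unfolding c by blast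
    then obtain y where y: "\<And>n. \<sigma> n = \<phi> (y n)" by metis
    have "Cauchy y" using \<sigma>2 unfolding y d Cauchy_def dist_norm by blast
    then obtain l where "y \<longlonglongrightarrow> l" using Cauchy_convergent_iff convergent_def by blast
    then have "(\<lambda>n. norm (y n - l)) \<longlonglongrightarrow> 0" by (intro tendsto_norm_zero LIM_zero)
    moreover have "nrm E (\<sigma> n - \<phi> l) = norm (y n - l)" for n using n[of "y n - l"] by (simp add: y diff)
    ultimately have "limitin (ntop E) \<sigma> (\<phi> l) sequentially"
      unfolding limitin_ntop[OF E] by (simp add: c y)
    then show "\<exists>x. limitin M.mtopology \<sigma> x sequentially" unfolding ntop_def by blast
  qed
  then show ?thesis using E by (simp add: banach_nspace_def)
qed

lemma embedsE:
  assumes "embeds E F" "normed_nspace E"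
  obtains c where "c \<ge> 0" "\<And>x. x \<in> carr E \<Longrightarrow> x \<in> carr F" "\<And>x. x \<in> carr E \<Longrightarrow> nrm F x \<le> c * nrm E x"
proof -
  obtain c where c: "\<forall>x\<in>carr E. nrm F x \<le> c * nrm E x" "carr E \<subseteq> carr F" using assms by (auto simp: embeds_def)
  have "nrm F x \<le> \<bar>c\<bar> * nrm E x" if "x \<in> carr E" for x
    using le_abs_mult c(1) that normed_nspaceD(2)[OF assms(2) that] by blast
  then show ?thesis using that[of "\<bar>c\<bar>"] c by auto
qed

lemma embeds_trans:
  assumes "embeds E F" "embeds F G" "normed_nspace F"
  shows "embeds E G"
proof -
  obtain c where c: "c \<ge> 0" "\<And>x. x \<in> carr F \<Longrightarrow> x \<in> carr G" "\<And>x. x \<in> carr F \<Longrightarrow> nrm G x \<le> c * nrm F x"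
    by (rule embedsE[OF assms(2,3)]) blast
  obtain d where d: "\<forall>x\<in>carr E. nrm F x \<le> d * nrm E x" "carr E \<subseteq> carr F" using assms(1) by (auto simp: embeds_def)
  have "nrm G x \<le> c * d * nrm E x" if "x \<in> carr E" for x
    using c(3)[of x] mult_left_mono[of "nrm F x" "d * nrm E x" c] d c(1) that by (auto simp: mult.assoc)
  then show ?thesis using c(2) d(2) unfolding embeds_def by blast
qed

lemma op_norm_le_embeds:
  assumes "op_norm_le E' F' U c" "embeds E E'" "embeds F' F" "normed_nspace E" "normed_nspace F'" "c \<ge> 0"
  shows "\<exists>c'\<ge>0. op_norm_le E F U c'"
proof -
  obtain d where d: "d \<ge> 0" "\<And>x. x \<in> carr E \<Longrightarrow> x \<in> carr E'" "\<And>x. x \<in> carr E \<Longrightarrow> nrm E' x \<le> d * nrm E x"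
    by (rule embedsE[OF assms(2,4)]) blast
  obtain e where e: "e \<ge> 0" "\<And>x. x \<in> carr F' \<Longrightarrow> x \<in> carr F" "\<And>x. x \<in> carr F' \<Longrightarrow> nrm F x \<le> e * nrm F' x"
    by (rule embedsE[OF assms(3,5)]) blast
  have U: "U x \<in> carr F'" "nrm F' (U x) \<le> c * nrm E' x" if "x \<in> carr E" for x
    using assms(1) d(2)[OF that] by (auto simp: op_norm_le_def)
  have "nrm F (U x) \<le> e * (c * (d * nrm E x))" if x: "x \<in> carr E" for x
  proof -
    have "nrm F (U x) \<le> e * nrm F' (U x)" by (rule e(3)[OF U(1)[OF x]])
    also have "\<dots> \<le> e * (c * nrm E' x)" by (rule mult_left_mono[OF U(2)[OF x] e(1)])
    also have "\<dots> \<le> e * (c * (d * nrm E x))" using e(1) assms(6) d(3)[OF x] by (intro mult_left_mono) auto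
    finally show ?thesis .
  qed
  then have "op_norm_le E F U (e * c * d)" using U(1) e(2) by (auto simp: op_norm_le_def mult.assoc)
  then show ?thesis using d e assms(6) by (intro exI[of _ "e * c * d"]) auto
qed

text \<open>Below any number exceeding the operator norm there is a bound of the operator.\<close>

lemma op_norm_lessE:
  assumes "L * op_norm E F U < 1" "L > 0" "\<exists>c\<ge>0. op_norm_le E F U c"
  obtains c where "c \<ge> 0" "op_norm_le E F U c" "L * c < 1"
proof -
  have "Inf {c. 0 \<le> c \<and> op_norm_le E F U c} < 1 / L"
    using assms(1,2) by (simp add: op_norm_def field_simps)
  then obtain c where "0 \<le> c" "op_norm_le E F U c" "c < 1 / L"
    using cInf_lessD[of "{c. 0 \<le> c \<and> op_norm_le E F U c}"] assms(3) by blast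
  then show ?thesis using that assms(2) by (auto simp: field_simps)
qed

text \<open>For an ordered couple, the sum is the larger space and the intersection is the smaller one.\<close>

lemma embeds_nspace_sum:
  assumes E0: "normed_nspace E0" and E1: "normed_nspace E1" and e: "embeds E1 E0"
  shows "embeds (nspace_sum E0 E1) E0"
proof -
  obtain c where c: "c \<ge> 0" "\<And>x. x \<in> carr E1 \<Longrightarrow> x \<in> carr E0" "\<And>x. x \<in> carr E1 \<Longrightarrow> nrm E0 x \<le> c * nrm E1 x"
    by (rule embedsE[OF e E1]) blast
  have "nrm E0 z \<le> (1 + c) * nrm (nspace_sum E0 E1) z" if z: "z \<in> carr (nspace_sum E0 E1)" for z
  proof -
    let ?S = "{nrm E0 x + nrm E1 y | x y. x \<in> carr E0 \<and> y \<in> carr E1 \<and> z = x + y}"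
    have "nrm E0 z / (1 + c) \<le> Inf ?S"
    proof (rule cInf_greatest)
      show "?S \<noteq> {}" using z by (auto simp: nspace_sum_def)
      fix r assume "r \<in> ?S"
      then obtain x y where xy: "x \<in> carr E0" "y \<in> carr E1" "z = x + y" "r = nrm E0 x + nrm E1 y" by blast
      have "nrm E0 z \<le> nrm E0 x + nrm E0 y" using normed_nspaceD(5)[OF E0 xy(1) c(2)[OF xy(2)]] xy by simp
      also have "\<dots> \<le> nrm E0 x + c * nrm E1 y" using c(3)[OF xy(2)] by simp
      also have "\<dots> \<le> (1 + c) * r"
        using normed_nspaceD(2)[OF E0 xy(1)] normed_nspaceD(2)[OF E1 xy(2)] c(1) xy(4) by (simp add: algebra_simps)
      finally show "nrm E0 z / (1 + c) \<le> r" using c(1) by (simp add: field_simps)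
    qed
    then show ?thesis using c(1) by (simp add: nspace_sum_def field_simps)
  qed
  moreover have "carr (nspace_sum E0 E1) \<subseteq> carr E0"
    using nspace_carr(2)[OF E0] c(2) by (auto simp: nspace_sum_def)
  ultimately show ?thesis unfolding embeds_def by blast
qed

lemma embeds_nspace_int:
  assumes E1: "normed_nspace E1" and e: "embeds E1 E0"
  shows "embeds E1 (nspace_int E0 E1)"
proof -
  obtain c where c: "c \<ge> 0" "\<And>x. x \<in> carr E1 \<Longrightarrow> x \<in> carr E0" "\<And>x. x \<in> carr E1 \<Longrightarrow> nrm E0 x \<le> c * nrm E1 x"
    by (rule embedsE[OF e E1]) blast
  have "nrm (nspace_int E0 E1) x \<le> (1 + c) * nrm E1 x" if "x \<in> carr E1" for x
  proof -
    have "0 \<le> c * nrm E1 x" "0 \<le> nrm E1 x" using c(1) normed_nspaceD(2)[OF E1 that] by auto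
    then show ?thesis using c(3)[OF that] by (simp add: nspace_int_def algebra_simps)
  qed
  moreover have "carr E1 \<subseteq> carr (nspace_int E0 E1)" using c(2) by (auto simp: nspace_int_def)
  ultimately show ?thesis unfolding embeds_def by blast
qed

lemma embeds_refl: "embeds E E"
  unfolding embeds_def by (auto intro!: exI[of _ 1])

text \<open>An interpolation-extrapolation scale, of which the spaces with exponents in \<open>[-1,1]\<close> are studied.\<close>

locale interpolation_scale =
  fixes D :: "'z::banach set" and S :: "'z \<Rightarrow> 'z" and j :: "'z \<Rightarrow> 'e::banach" and Z :: "real \<Rightarrow> 'e nspace"
  assumes scale: "interpolation_extrapolation_scale D S j Z"
begin

text \<open>The inverse of \<open>S\<close>.\<close>

definition R where "R = inv_into D S"

lemma R_props: "bounded_linear R" "R y \<in> D" "S (R y) = y" "x \<in> D \<Longrightarrow> R (S x) = x"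
proof -
  have b: "bij_betw S D UNIV" and bl: "bounded_linear (inv_into D S)"
    using scale by (auto simp: interpolation_extrapolation_scale_def resolvent_set_def)
  show "bounded_linear R" using bl by (simp add: R_def)
  show "R y \<in> D" "S (R y) = y" using b inv_into_into[of y S D] f_inv_into_f[of y S D]
    by (auto simp: R_def bij_betw_def)
  show "R (S x) = x" if "x \<in> D" using b that by (auto simp: R_def bij_betw_def)
qed

sublocale R: bounded_linear R by (rule R_props(1))

lemma R_inj: "R y = R z \<Longrightarrow> y = z"
  by (metis R_props(3))

lemma j: "linear j" "norm (j z) = norm (R z)" "closure (range j) = UNIV"
  using scale by (auto simp: interpolation_extrapolation_scale_def extrapolation_space_def R_def)

lemma R_K: obtains K where "K \<ge> 0" "\<And>x. norm (R x) \<le> K * norm x"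
  using R.nonneg_bounded by (metis mult.commute)

lemma j_inj: "inj j"
  unfolding linear_injective_0[OF j(1)]
proof (intro allI impI)
  fix v assume "j v = 0"
  then have "R v = R 0" using j(2)[of v] by (simp add: R.zero)
  then show "v = 0" by (rule R_inj)
qed

lemma inv_j [simp]: "inv j (j z) = z"
  using j_inj by simp

sublocale j: bounded_linear j
proof -
  obtain K where K: "\<And>x. norm (R x) \<le> K * norm x" using R_K by blast
  show "bounded_linear j"
    using bounded_linear_intro[of j K] j(1,2) K by (simp add: linear_add linear_cmul mult.commute)
qed

text \<open>The spaces of the scale with integer exponents.\<close>

abbreviation I where "I \<equiv> integer_space D S j"

lemma I_simps: "I (-1) = whole_space" "carr (I 0) = range j" "nrm (I 0) (j z) = norm z"
  "carr (I 1) = j ` D" "nrm (I 1) (j z) = norm (S z)"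
  by (simp_all add: integer_space_def)

lemma banach_I: "banach_nspace (I (-1))" "banach_nspace (I 0)" "banach_nspace (I 1)"
proof -
  show "banach_nspace (I (-1))"
    by (rule banach_nspaceI_isometry[of "\<lambda>x. x"]) (auto simp: I_simps whole_space_def linear_iff)
  show "banach_nspace (I 0)"
    by (rule banach_nspaceI_isometry[OF j(1) j_inj]) (auto simp: I_simps)
  have "range (j \<circ> R) = j ` D"
    using R_props by (auto simp: image_iff) metis
  then show "banach_nspace (I 1)"
    by (intro banach_nspaceI_isometry[of "j \<circ> R"] linear_compose j(1) R.linear inj_compose j_inj)
      (auto simp: I_simps R_props intro: injI R_inj)
qed

lemma normed_I: "normed_nspace (I (-1))" "normed_nspace (I 0)" "normed_nspace (I 1)"
  using banach_I by (auto simp: banach_nspace_def)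

lemma embeds_I: "embeds (I 0) (I (-1))" "embeds (I 1) (I 0)" "embeds (I 1) (I (-1))"
proof -
  obtain K where K: "\<And>x. norm (R x) \<le> K * norm x" using R_K by blast
  show 1: "embeds (I 0) (I (-1))" unfolding embeds_def
    using K j(2) by (auto simp: I_simps whole_space_def intro!: exI[of _ K])
  show 2: "embeds (I 1) (I 0)" unfolding embeds_def
  proof (intro conjI exI[of _ K] ballI)
    fix e assume "e \<in> carr (I 1)"
    then obtain x where "x \<in> D" "e = j x" by (auto simp: I_simps)
    then show "nrm (I 0) e \<le> K * nrm (I 1) e" using K[of "S x"] R_props(4)[of x] by (simp add: I_simps)
  qed (auto simp: I_simps)
  show "embeds (I 1) (I (-1))" by (rule embeds_trans[OF 2 1 normed_I(2)])
qed

lemma couples: "banach_couple (I (-1)) (I 0)" "banach_couple (I 0) (I 1)"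
  using banach_I embeds_I embeds_refl by (auto simp: banach_couple_def I_simps(1))

lemma functors:
  obtains \<F> where "\<And>\<theta>. 0 < \<theta> \<Longrightarrow> \<theta> < 1 \<Longrightarrow> exact_interpolation_functor (\<F> \<theta>)"
    and "equivalent_nspaces (Z 0) (I 0)" "equivalent_nspaces (Z 1) (I 1)"
    "\<And>\<theta>. 0 < \<theta> \<Longrightarrow> \<theta> < 1 \<Longrightarrow> equivalent_nspaces (Z \<theta>) (\<F> \<theta> (I 0) (I 1))"
    "\<And>\<theta>. 0 < \<theta> \<Longrightarrow> \<theta> < 1 \<Longrightarrow> equivalent_nspaces (Z (\<theta> - 1)) (\<F> \<theta> (I (-1)) (I 0))"
proof -
  obtain \<F> where F: "\<And>\<theta>. \<theta> \<in> {0<..<1} \<Longrightarrow> exact_interpolation_functor (\<F> \<theta>)"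
    and eq: "\<And>\<alpha>. \<alpha> \<ge> -1 \<Longrightarrow> equivalent_nspaces (Z \<alpha>) (scale_space \<F> D S j \<alpha>)"
    using scale unfolding interpolation_extrapolation_scale_def by blast
  have 1: "scale_space \<F> D S j \<theta> = \<F> \<theta> (I 0) (I 1)" if "0 < \<theta>" "\<theta> < 1" for \<theta>
  proof -
    have "\<lfloor>\<theta>\<rfloor> = 0" using that by linarith
    moreover have "\<theta> \<notin> \<int>" using that by (auto elim!: Ints_cases)
    ultimately show ?thesis by (simp add: scale_space_def frac_def)
  qed
  have 2: "scale_space \<F> D S j (\<theta> - 1) = \<F> \<theta> (I (-1)) (I 0)" if "0 < \<theta>" "\<theta> < 1" for \<theta>
  proof -
    have "\<lfloor>\<theta> - 1\<rfloor> = - 1" using that by linarith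
    moreover have "\<theta> - 1 \<notin> \<int>"
    proof
      assume "\<theta> - 1 \<in> \<int>"
      then obtain n where "\<theta> - 1 = of_int n" by (rule Ints_cases)
      then have "-1 < n" "n < 0" using that by linarith+
      then show False by simp
    qed
    ultimately show ?thesis by (simp add: scale_space_def frac_def)
  qed
  show ?thesis
  proof (rule that[of \<F>])
    show "equivalent_nspaces (Z 0) (I 0)" "equivalent_nspaces (Z 1) (I 1)"
      using eq[of 0] eq[of 1] by (simp_all add: scale_space_def)
    show "equivalent_nspaces (Z \<theta>) (\<F> \<theta> (I 0) (I 1))" if "0 < \<theta>" "\<theta> < 1" for \<theta>
      using eq[of \<theta>] 1[OF that] that by simp
    show "equivalent_nspaces (Z (\<theta> - 1)) (\<F> \<theta> (I (-1)) (I 0))" if "0 < \<theta>" "\<theta> < 1" for \<theta>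
      using eq[of "\<theta> - 1"] 2[OF that] that by simp
  qed (use F in auto)
qed

lemma normed_Z: "\<alpha> \<ge> -1 \<Longrightarrow> normed_nspace (Z \<alpha>)"
  using scale by (auto simp: interpolation_extrapolation_scale_def)

lemma functor_props:
  assumes "exact_interpolation_functor \<F>" "banach_couple E0 E1" "embeds E1 E0"
  shows "banach_nspace (\<F> E0 E1)" "embeds (\<F> E0 E1) E0" "embeds E1 (\<F> E0 E1)"
proof -
  have E: "normed_nspace E0" "normed_nspace E1" using assms(2) by (auto simp: banach_couple_def banach_nspace_def)
  show "banach_nspace (\<F> E0 E1)" using assms(1,2) unfolding exact_interpolation_functor_def by blast
  have s: "embeds (\<F> E0 E1) (nspace_sum E0 E1)" and i: "embeds (nspace_int E0 E1) (\<F> E0 E1)"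
    using assms(1,2) unfolding exact_interpolation_functor_def by blast+
  have "embeds (nspace_sum E0 E1) E0" by (rule embeds_nspace_sum[OF E assms(3)])
  then obtain c where c: "\<forall>x\<in>carr (nspace_sum E0 E1). nrm E0 x \<le> c * nrm (nspace_sum E0 E1) x"
    "carr (nspace_sum E0 E1) \<subseteq> carr E0" by (auto simp: embeds_def)
  show "embeds (\<F> E0 E1) E0"
  proof -
    obtain d where d: "\<forall>x\<in>carr (\<F> E0 E1). nrm (nspace_sum E0 E1) x \<le> d * nrm (\<F> E0 E1) x"
      "carr (\<F> E0 E1) \<subseteq> carr (nspace_sum E0 E1)" using s by (auto simp: embeds_def)
    have nn: "0 \<le> nrm (nspace_sum E0 E1) x" if "x \<in> carr (nspace_sum E0 E1)" for x
      unfolding nspace_sum_def nspace.sel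
      by (rule cInf_greatest)
        (use that normed_nspaceD(2)[OF E(1)] normed_nspaceD(2)[OF E(2)] in
          \<open>auto simp: nspace_sum_def intro!: add_nonneg_nonneg\<close>)
    have "nrm E0 x \<le> \<bar>c\<bar> * d * nrm (\<F> E0 E1) x" if x: "x \<in> carr (\<F> E0 E1)" for x
    proof -
      have xs: "x \<in> carr (nspace_sum E0 E1)" using x d(2) by blast
      have "nrm E0 x \<le> \<bar>c\<bar> * nrm (nspace_sum E0 E1) x" by (rule le_abs_mult) (use c xs nn in auto)
      also have "\<dots> \<le> \<bar>c\<bar> * (d * nrm (\<F> E0 E1) x)" using d x by (intro mult_left_mono) auto
      finally show ?thesis by (simp add: mult.assoc)
    qed
    then show ?thesis unfolding embeds_def using c(2) d(2) by blast
  qed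
  have "normed_nspace (nspace_int E0 E1)"
    unfolding normed_nspace_def nspace_int_def
    using normed_nspaceD[OF E(1)] normed_nspaceD[OF E(2)]
    by (auto simp: subspace_inter max_def mult_left_mono intro: add_mono order_trans)
       (smt (verit) mult_left_mono abs_ge_zero)+
  then show "embeds E1 (\<F> E0 E1)" by (rule embeds_trans[OF embeds_nspace_int[OF E(2) assms(3)] i])
qed

lemma Z_between:
  assumes "0 \<le> \<alpha>" "\<alpha> \<le> 1"
  shows "embeds (Z \<alpha>) (I 0)" "embeds (I 1) (Z \<alpha>)" "geo_complete (Z \<alpha>)"
proof -
  obtain \<F> where F: "\<And>\<theta>. 0 < \<theta> \<Longrightarrow> \<theta> < 1 \<Longrightarrow> exact_interpolation_functor (\<F> \<theta>)"
    and Z0: "equivalent_nspaces (Z 0) (I 0)" and Z1: "equivalent_nspaces (Z 1) (I 1)"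
    and Zt: "\<And>\<theta>. 0 < \<theta> \<Longrightarrow> \<theta> < 1 \<Longrightarrow> equivalent_nspaces (Z \<theta>) (\<F> \<theta> (I 0) (I 1))"
    using functors by metis
  have "\<exists>E. banach_nspace E \<and> equivalent_nspaces (Z \<alpha>) E \<and> embeds E (I 0) \<and> embeds (I 1) E"
  proof -
    consider "\<alpha> = 0" | "\<alpha> = 1" | "0 < \<alpha>" "\<alpha> < 1" using assms by linarith
    then show ?thesis
    proof cases
      case 1 then show ?thesis using Z0 banach_I embeds_I embeds_refl by blast
    next
      case 2 then show ?thesis using Z1 banach_I embeds_I embeds_refl by blast
    next
      case 3 then show ?thesis using Zt functor_props[OF F couples(2) embeds_I(2)] by blast
    qed
  qed
  then obtain E where E: "banach_nspace E" "equivalent_nspaces (Z \<alpha>) E" "embeds E (I 0)" "embeds (I 1) E" by blast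
  have n: "normed_nspace E" "normed_nspace (Z \<alpha>)" using E(1) normed_Z[of \<alpha>] assms by (auto simp: banach_nspace_def)
  from E(2) have e: "embeds (Z \<alpha>) E" "embeds E (Z \<alpha>)" by (auto simp: equivalent_nspaces_def)
  show "embeds (Z \<alpha>) (I 0)" by (rule embeds_trans[OF e(1) E(3) n(1)])
  show "embeds (I 1) (Z \<alpha>)" by (rule embeds_trans[OF E(4) e(2) n(1)])
  show "geo_complete (Z \<alpha>)"
    by (rule geo_complete_equivalent[OF n(2,1) banach_nspace_geo_complete[OF E(1)] E(2)])
qed

lemma Z_range: "0 \<le> \<alpha> \<Longrightarrow> \<alpha> \<le> 1 \<Longrightarrow> carr (Z \<alpha>) \<subseteq> range j"
  using Z_between(1)[of \<alpha>] by (simp add: embeds_def I_simps)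

lemma pullback_simps: "carr (pullback j E) = j -` carr E" "nrm (pullback j E) x = nrm E (j x)"
  by (simp_all add: pullback_def)

lemma normed_pullback:
  assumes "normed_nspace E" shows "normed_nspace (pullback j E)"
proof -
  have j0: "j x = 0 \<longleftrightarrow> x = 0" for x using j_inj by (metis inv_j j.zero)
  show ?thesis
    unfolding normed_nspace_def pullback_simps
    using normed_nspaceD[OF assms]
    by (auto simp: j.add j.scaleR j0 j.zero subspace_def)
qed

lemma geo_complete_pullback:
  assumes \<alpha>: "0 \<le> \<alpha>" "\<alpha> \<le> 1" shows "geo_complete (pullback j (Z \<alpha>))"
  unfolding geo_complete_def
proof (intro allI impI; elim conjE)
  fix x M and c :: real assume x: "\<forall>k. x k \<in> carr (pullback j (Z \<alpha>))" and c: "0 \<le> c" "c < 1"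
    and inc: "\<forall>k. nrm (pullback j (Z \<alpha>)) (x (Suc k) - x k) \<le> M * c ^ k"
  obtain l where l: "l \<in> carr (Z \<alpha>)" "\<And>k. nrm (Z \<alpha>) (j (x k) - l) \<le> M * c ^ k / (1 - c)"
    by (rule geo_completeD[OF Z_between(3)[OF \<alpha>], of "\<lambda>k. j (x k)" c M])
      (use x c inc in \<open>auto simp: pullback_simps j.diff\<close>)
  obtain l' where "l = j l'" using l(1) Z_range[OF \<alpha>] by blast
  then show "\<exists>l\<in>carr (pullback j (Z \<alpha>)). \<forall>k. nrm (pullback j (Z \<alpha>)) (x k - l) \<le> M * c ^ k / (1 - c)"
    using l by (intro bexI[of _ l']) (auto simp: pullback_simps j.diff)
qed

lemma pullback_embeds:
  assumes \<alpha>: "0 \<le> \<alpha>" "\<alpha> \<le> 1"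
  obtains c where "c \<ge> 0" "\<And>x. x \<in> carr (pullback j (Z \<alpha>)) \<Longrightarrow> norm x \<le> c * nrm (pullback j (Z \<alpha>)) x"
proof -
  have "normed_nspace (Z \<alpha>)" using normed_Z \<alpha> by simp
  then obtain c where c: "c \<ge> 0" "\<And>x. x \<in> carr (Z \<alpha>) \<Longrightarrow> nrm (I 0) x \<le> c * nrm (Z \<alpha>) x"
    by (rule embedsE[OF Z_between(1)[OF \<alpha>]]) blast
  show ?thesis by (rule that[OF c(1)]) (use c(2) in \<open>force simp: pullback_simps I_simps\<close>)
qed

lemma pullback_1:
  obtains c1 c2 where "c1 \<ge> 0" "c2 \<ge> 0" "carr (pullback j (Z 1)) = D"
    "\<And>x. x \<in> D \<Longrightarrow> nrm (pullback j (Z 1)) x \<le> c1 * norm (S x)"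
    "\<And>x. x \<in> D \<Longrightarrow> norm (S x) \<le> c2 * nrm (pullback j (Z 1)) x"
proof -
  have e: "embeds (Z 1) (I 1)" "embeds (I 1) (Z 1)"
    using functors by (metis equivalent_nspaces_def)+
  have n: "normed_nspace (Z 1)" using normed_Z by simp
  obtain c where c: "c \<ge> 0" "\<And>x. x \<in> carr (Z 1) \<Longrightarrow> nrm (I 1) x \<le> c * nrm (Z 1) x"
    by (rule embedsE[OF e(1) n]) blast
  obtain d where d: "d \<ge> 0" "\<And>x. x \<in> carr (I 1) \<Longrightarrow> nrm (Z 1) x \<le> d * nrm (I 1) x"
    by (rule embedsE[OF e(2) normed_I(3)]) blast
  have C: "carr (Z 1) = j ` D" using e by (auto simp: embeds_def I_simps)
  have "j -` (j ` D) = D" using j_inj by (auto simp: inj_def)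
  then show ?thesis
    using c(2)[of "j _"] d(2)[of "j _"]
    by (intro that[OF d(1) c(1)]) (auto simp: C pullback_simps I_simps)
qed

lemma pullback_1_embeds:
  assumes \<alpha>: "0 \<le> \<alpha>" "\<alpha> \<le> 1"
  obtains c where "c \<ge> 0" "\<And>x. x \<in> carr (pullback j (Z 1)) \<Longrightarrow> x \<in> carr (pullback j (Z \<alpha>))"
    "\<And>x. x \<in> carr (pullback j (Z 1)) \<Longrightarrow> nrm (pullback j (Z \<alpha>)) x \<le> c * nrm (pullback j (Z 1)) x"
proof -
  have "embeds (Z 1) (I 1)" using functors by (metis equivalent_nspaces_def)
  then have "embeds (Z 1) (Z \<alpha>)" by (rule embeds_trans[OF _ Z_between(2)[OF \<alpha>] normed_I(3)])
  moreover have "normed_nspace (Z 1)" using normed_Z by simp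
  ultimately obtain c where "c \<ge> 0" "\<And>x. x \<in> carr (Z 1) \<Longrightarrow> x \<in> carr (Z \<alpha>)"
     "\<And>x. x \<in> carr (Z 1) \<Longrightarrow> nrm (Z \<alpha>) x \<le> c * nrm (Z 1) x" by (rule embedsE) blast
  then show ?thesis by (intro that[of c]) (auto simp: pullback_simps)
qed

subsection \<open>The inverse on the extrapolation space\<close>

lemma dense_seq: obtains z where "(\<lambda>n. j (z n)) \<longlonglongrightarrow> e"
proof -
  have "e \<in> closure (range j)" using j(3) by simp
  then obtain y where y: "\<And>n. y n \<in> range j" "y \<longlonglongrightarrow> e" unfolding closure_sequential by blast
  then have "\<forall>n. \<exists>z. y n = j z" by blast
  then obtain z where "\<And>n. y n = j (z n)" by metis
  then have "y = (\<lambda>n. j (z n))" by auto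
  then show ?thesis using that y(2) by blast
qed

text \<open>The extension by density of the inverse to the extrapolation space.\<close>

lemma extrapolated_inverse_exists: "\<exists>Q :: 'e \<Rightarrow>\<^sub>L 'e. \<forall>z. blinfun_apply Q (j z) = j (R z)"
proof -
  obtain K where K: "K \<ge> 0" "\<And>x. norm (R x) \<le> K * norm x" using R_K by blast
  define f where "f e = j (R (inv j e))" for e
  have f: "f (j z) = j (R z)" for z by (simp add: f_def)
  have lip: "dist (f x) (f y) \<le> K * dist x y" if "x \<in> range j" "y \<in> range j" for x y
  proof -
    obtain u v where uv: "x = j u" "y = j v" using \<open>x \<in> range j\<close> \<open>y \<in> range j\<close> by blast
    have "dist (f x) (f y) = norm (R (R (u - v)))"
      by (simp add: uv f dist_norm R.diff j(2) j.diff[symmetric])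
    also have "\<dots> \<le> K * norm (R (u - v))" by (rule K(2))
    also have "norm (R (u - v)) = dist x y" by (simp add: uv dist_norm j(2) j.diff[symmetric])
    finally show ?thesis .
  qed
  have "uniformly_continuous_on (range j) f"
    unfolding uniformly_continuous_on_def
  proof (intro allI impI)
    fix e :: real assume "e > 0"
    show "\<exists>d>0. \<forall>x\<in>range j. \<forall>x'\<in>range j. dist x' x < d \<longrightarrow> dist (f x') (f x) < e"
    proof (intro exI[of _ "e / (K + 1)"] conjI ballI impI)
      fix x x' assume x: "x \<in> range j" "x' \<in> range j" "dist x' x < e / (K + 1)"
      have "dist (f x') (f x) \<le> K * dist x' x" by (rule lip[OF x(2,1)])
      also have "\<dots> \<le> K * (e / (K + 1))" using x(3) K(1) by (intro mult_left_mono) auto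
      also have "\<dots> < e" using \<open>e > 0\<close> K(1) by (simp add: field_simps)
      finally show "dist (f x') (f x) < e" .
    qed (use \<open>e > 0\<close> K(1) in auto)
  qed
  then obtain g where g: "uniformly_continuous_on (closure (range j)) g" "\<And>x. x \<in> range j \<Longrightarrow> f x = g x"
    by (rule uniformly_continuous_on_extension_on_closure) blast
  have gc: "continuous_on UNIV g" using uniformly_continuous_imp_continuous[OF g(1)] j(3) by simp
  have gj: "g (j z) = j (R z)" for z using g(2)[of "j z"] f by simp
  have lim: "(\<lambda>n. g (h n)) \<longlonglongrightarrow> g x" if "h \<longlonglongrightarrow> x" for h x
    using continuous_on_tendsto_compose[OF gc that] by simp
  have "bounded_linear g"
  proof (rule bounded_linear_intro)
    fix x y :: 'e and r :: real
    obtain u where u: "(\<lambda>n. j (u n)) \<longlonglongrightarrow> x" by (rule dense_seq)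
    obtain v where v: "(\<lambda>n. j (v n)) \<longlonglongrightarrow> y" by (rule dense_seq)
    have "(\<lambda>n. g (j (u n) + j (v n))) \<longlonglongrightarrow> g (x + y)" by (intro lim tendsto_intros u v)
    moreover have "g (j (u n) + j (v n)) = g (j (u n)) + g (j (v n))" for n
      using gj[of "u n + v n"] gj[of "u n"] gj[of "v n"] by (simp add: j.add R.add)
    moreover have "(\<lambda>n. g (j (u n)) + g (j (v n))) \<longlonglongrightarrow> g x + g y" by (intro tendsto_intros lim u v)
    ultimately show "g (x + y) = g x + g y" by (simp add: LIMSEQ_unique)
    have "(\<lambda>n. g (r *\<^sub>R j (u n))) \<longlonglongrightarrow> g (r *\<^sub>R x)" by (intro lim tendsto_intros u)
    moreover have "g (r *\<^sub>R j (u n)) = r *\<^sub>R g (j (u n))" for n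
      using gj[of "r *\<^sub>R u n"] gj[of "u n"] by (simp add: j.scaleR R.scaleR)
    moreover have "(\<lambda>n. r *\<^sub>R g (j (u n))) \<longlonglongrightarrow> r *\<^sub>R g x" by (intro tendsto_intros lim u)
    ultimately show "g (r *\<^sub>R x) = r *\<^sub>R g x" by (simp add: LIMSEQ_unique)
    have "(\<lambda>n. norm (g (j (u n)))) \<longlonglongrightarrow> norm (g x)" by (intro tendsto_norm lim u)
    moreover have "(\<lambda>n. norm (j (u n)) * K) \<longlonglongrightarrow> norm x * K" by (intro tendsto_intros u)
    moreover have "norm (g (j (u n))) \<le> norm (j (u n)) * K" for n
      using K(2)[of "R (u n)"] by (simp add: gj j(2) mult.commute)
    ultimately show "norm (g x) \<le> norm x * K" by (meson LIMSEQ_le)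
  qed
  then show ?thesis using gj by (intro exI[of _ "Blinfun g"]) (simp add: bounded_linear_Blinfun_apply)
qed

text \<open>The inverse of \<open>S\<close> on the extrapolation space.\<close>

definition Q where "Q = blinfun_apply (extrapolated_inverse D S j)"

lemma Q_j: "Q (j z) = j (R z)"
proof -
  have "\<exists>!Q :: 'e \<Rightarrow>\<^sub>L 'e. \<forall>z. blinfun_apply Q (j z) = j (inv_into D S z)"
  proof (rule ex_ex1I)
    show "\<exists>Q :: 'e \<Rightarrow>\<^sub>L 'e. \<forall>z. blinfun_apply Q (j z) = j (inv_into D S z)"
      using extrapolated_inverse_exists by (simp add: R_def)
    fix P Q :: "'e \<Rightarrow>\<^sub>L 'e"
    assume P: "\<forall>z. blinfun_apply P (j z) = j (inv_into D S z)" and Q: "\<forall>z. blinfun_apply Q (j z) = j (inv_into D S z)"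
    show "P = Q"
    proof (rule blinfun_eqI)
      fix e obtain u where u: "(\<lambda>n. j (u n)) \<longlonglongrightarrow> e" by (rule dense_seq)
      have "(\<lambda>n. blinfun_apply P (j (u n))) \<longlonglongrightarrow> blinfun_apply P e" "(\<lambda>n. blinfun_apply Q (j (u n))) \<longlonglongrightarrow> blinfun_apply Q e"
        by (intro tendsto_intros u)+
      then show "blinfun_apply P e = blinfun_apply Q e" using P Q by (simp add: LIMSEQ_unique)
    qed
  qed
  from theI'[OF this] show ?thesis by (simp add: Q_def extrapolated_inverse_def R_def)
qed

lemma Q_whole: "op_norm_le (I (-1)) (I 0) Q 1"
  unfolding op_norm_le_def
proof
  fix e
  obtain u where u: "(\<lambda>n. j (u n)) \<longlonglongrightarrow> e" by (rule dense_seq)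
  have "Cauchy (\<lambda>n. R (u n))"
  proof -
    have "dist (R (u m)) (R (u n)) = dist (j (u m)) (j (u n))" for m n
      by (simp add: dist_norm R.diff[symmetric] j.diff[symmetric] j(2))
    then show ?thesis using LIMSEQ_imp_Cauchy[OF u] by (simp add: Cauchy_def)
  qed
  then obtain q where q: "(\<lambda>n. R (u n)) \<longlonglongrightarrow> q" using Cauchy_convergent_iff convergent_def by blast
  have "(\<lambda>n. Q (j (u n))) \<longlonglongrightarrow> Q e" unfolding Q_def by (intro tendsto_intros u)
  moreover have "(\<lambda>n. Q (j (u n))) \<longlonglongrightarrow> j q" unfolding Q_j by (intro j.tendsto q)
  ultimately have Qe: "Q e = j q" by (rule LIMSEQ_unique)
  have "(\<lambda>n. norm (R (u n))) \<longlonglongrightarrow> norm e" using tendsto_norm[OF u] by (simp add: j(2))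
  moreover have "(\<lambda>n. norm (R (u n))) \<longlonglongrightarrow> norm q" by (intro tendsto_norm q)
  ultimately have "norm e = norm q" by (rule LIMSEQ_unique)
  then show "Q e \<in> carr (I 0) \<and> nrm (I 0) (Q e) \<le> 1 * nrm (I (-1)) e"
    by (simp add: Qe I_simps whole_space_def)
qed

lemma Q_01: "op_norm_le (I 0) (I 1) Q 1"
  unfolding op_norm_le_def by (auto simp: I_simps Q_j R_props)

lemma Q_bound_1:
  assumes "0 \<le> \<alpha>" "\<alpha> \<le> 1" shows "\<exists>c\<ge>0. op_norm_le (Z \<alpha>) (Z 1) Q c"
  by (rule op_norm_le_embeds[OF Q_01 Z_between(1)[OF assms] Z_between(2)[of 1]])
    (use normed_Z[of \<alpha>] normed_I assms in auto)

text \<open>The extended inverse gains one exponent on the integer spaces, by construction, and hence on the interpolation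
  spaces between them, by exactness of the functor.\<close>

lemma Q_bound_shift:
  assumes \<delta>: "0 < \<delta>" "\<delta> \<le> 1" shows "\<exists>c\<ge>0. op_norm_le (Z (\<delta> - 1)) (Z \<delta>) Q c"
proof (cases "\<delta> = 1")
  case True
  then show ?thesis using Q_bound_1[of 0] by simp
next
  case False
  then have d: "0 < \<delta>" "\<delta> < 1" using \<delta> by auto
  obtain \<F> where F: "\<And>\<theta>. 0 < \<theta> \<Longrightarrow> \<theta> < 1 \<Longrightarrow> exact_interpolation_functor (\<F> \<theta>)"
    and Zt: "\<And>\<theta>. 0 < \<theta> \<Longrightarrow> \<theta> < 1 \<Longrightarrow> equivalent_nspaces (Z \<theta>) (\<F> \<theta> (I 0) (I 1))"
    and Zm: "\<And>\<theta>. 0 < \<theta> \<Longrightarrow> \<theta> < 1 \<Longrightarrow> equivalent_nspaces (Z (\<theta> - 1)) (\<F> \<theta> (I (-1)) (I 0))"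
    using functors by metis
  have "lin_on (carr (nspace_sum (I (-1)) (I 0))) Q"
    by (simp add: lin_on_def Q_def blinfun.add_right blinfun.scaleR_right)
  then have "op_norm_le (\<F> \<delta> (I (-1)) (I 0)) (\<F> \<delta> (I 0) (I 1)) Q 1"
    using F[OF d] couples Q_whole Q_01 unfolding exact_interpolation_functor_def by blast
  moreover have "embeds (Z (\<delta> - 1)) (\<F> \<delta> (I (-1)) (I 0))" "embeds (\<F> \<delta> (I 0) (I 1)) (Z \<delta>)"
    using Zm[OF d] Zt[OF d] by (auto simp: equivalent_nspaces_def)
  moreover have "normed_nspace (\<F> \<delta> (I 0) (I 1))"
    using functor_props(1)[OF F[OF d] couples(2) embeds_I(2)] by (simp add: banach_nspace_def)
  ultimately show ?thesis using normed_Z[of "\<delta> - 1"] \<delta> by (intro op_norm_le_embeds) auto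
qed

end

section \<open>Continuously differentiable curves in a normed space carried by a set\<close>

text \<open>A curve together with its continuous derivative on \<open>[0,t]\<close>.\<close>

definition C1_with :: "'a::real_vector nspace \<Rightarrow> real \<Rightarrow> (real \<Rightarrow> 'a) \<Rightarrow> (real \<Rightarrow> 'a) \<Rightarrow> bool" where
  "C1_with E t w w' \<longleftrightarrow> ncont E {0..t} w \<and> ncont E {0..t} w' \<and>
     (\<forall>s\<in>{0..t}. ((\<lambda>r. nrm E ((w r - w s) /\<^sub>R (r - s) - w' s)) \<longlongrightarrow> 0) (at s within {0..t}))"

lemma C1_withD:
  assumes "C1_with E t w w'" "s \<in> {0..t}"
  shows "w s \<in> carr E" "w' s \<in> carr E"
    "((\<lambda>r. nrm E ((w r - w s) /\<^sub>R (r - s) - w' s)) \<longlongrightarrow> 0) (at s within {0..t})"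
  using assms by (auto simp: C1_with_def ncont_def)

lemma at_within_interval_not_bot: "0 < t \<Longrightarrow> s \<in> {0..t} \<Longrightarrow> at s within {0..t::real} \<noteq> bot"
  by (auto simp: trivial_limit_within intro!: islimpt_closure_open[of _ "{0<..<t}"])

lemma has_curve_deriv_iff:
  assumes E: "normed_nspace E" and w: "ncont E {0..t} w" and s: "s \<in> {0..t}"
  shows "has_curve_deriv E t w s d \<longleftrightarrow> d \<in> carr E \<and>
    ((\<lambda>r. nrm E ((w r - w s) /\<^sub>R (r - s) - d)) \<longlongrightarrow> 0) (at s within {0..t})"
proof -
  have "\<forall>\<^sub>F r in at s within {0..t}. (w r - w s) /\<^sub>R (r - s) \<in> carr E"
    using w s nspace_carr[OF E] by (auto simp: eventually_at_filter ncont_def)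
  then show ?thesis unfolding has_curve_deriv_def limitin_ntop[OF E] by blast
qed

lemma C1_curve_iff:
  assumes E: "normed_nspace E"
  shows "C1_curve E t w \<longleftrightarrow> (\<exists>w'. C1_with E t w w')"
  unfolding C1_curve_def C1_with_def C0_curve_def continuous_map_ntop_iff[OF E]
  using has_curve_deriv_iff[OF E, of t w] by (auto simp: ncont_def; metis)

lemma curve_deriv_eq:
  assumes E: "normed_nspace E" and w: "C1_with E t w w'" and t: "t > 0" and s: "s \<in> {0..t}"
  shows "curve_deriv E t w s = w' s"
proof -
  have wc: "ncont E {0..t} w" using w by (simp add: C1_with_def)
  have d: "has_curve_deriv E t w s (w' s)"
    using C1_withD[OF w s] has_curve_deriv_iff[OF E wc s] by simp
  interpret Metric_space "carr E" "ndist E" by (rule Metric_space_ndist[OF E])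
  have "d' = w' s" if "has_curve_deriv E t w s d'" for d'
    using limitin_metric_unique that d at_within_interval_not_bot[OF t s]
    unfolding has_curve_deriv_def ntop_def by blast
  then show ?thesis unfolding curve_deriv_def using d by blast
qed

lemma SUP_nrm:
  assumes E: "normed_nspace E" and w: "ncont E {0..t} w" and s: "s \<in> {0..t}"
  shows "nrm E (w s) \<le> (SUP s\<in>{0..t}. nrm E (w s))"
proof (rule cSUP_upper[OF s])
  show "bdd_above ((\<lambda>s. nrm E (w s)) ` {0..t})"
    by (intro bounded_imp_bdd_above compact_imp_bounded compact_continuous_image continuous_on_nrm[OF E w] compact_Icc)
qed

lemma C1_norm_eq:
  assumes "normed_nspace E" "C1_with E t w w'" "t > 0"
  shows "C1_norm E t w = (SUP s\<in>{0..t}. nrm E (w s)) + (SUP s\<in>{0..t}. nrm E (w' s))"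
  unfolding C1_norm_def using curve_deriv_eq[OF assms] by simp

lemma C1_norm_ge:
  assumes "normed_nspace E" "C1_with E t w w'" "t > 0" "s \<in> {0..t}"
  shows "nrm E (w s) \<le> C1_norm E t w" "nrm E (w' s) \<le> C1_norm E t w"
proof -
  have c: "ncont E {0..t} w" "ncont E {0..t} w'" using assms(2) by (auto simp: C1_with_def)
  have nn: "0 \<le> nrm E (w s)" "0 \<le> nrm E (w' s)"
    using normed_nspaceD(2)[OF assms(1)] C1_withD(1,2)[OF assms(2,4)] by auto
  show "nrm E (w s) \<le> C1_norm E t w" "nrm E (w' s) \<le> C1_norm E t w"
    using SUP_nrm[OF assms(1) c(1) assms(4)] SUP_nrm[OF assms(1) c(2) assms(4)] nn
    unfolding C1_norm_eq[OF assms(1-3)] by linarith+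
qed

lemma C1_norm_le:
  assumes "normed_nspace E" "C1_with E t w w'" "t > 0"
    and "\<And>s. s \<in> {0..t} \<Longrightarrow> nrm E (w s) \<le> a" "\<And>s. s \<in> {0..t} \<Longrightarrow> nrm E (w' s) \<le> b"
  shows "C1_norm E t w \<le> a + b"
  unfolding C1_norm_eq[OF assms(1-3)]
  by (intro add_mono cSUP_least) (use assms in auto)

lemma C1_with_diff:
  assumes E: "normed_nspace E" and w: "C1_with E t w w'" and u: "C1_with E t u u'"
  shows "C1_with E t (\<lambda>s. w s - u s) (\<lambda>s. w' s - u' s)"
  unfolding C1_with_def
proof (intro conjI ballI)
  show "ncont E {0..t} (\<lambda>s. w s - u s)" "ncont E {0..t} (\<lambda>s. w' s - u' s)"
    using w u by (auto simp: C1_with_def intro: ncont_diff[OF E])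
  fix s assume s: "s \<in> {0..t}"
  let ?q = "\<lambda>w r. (w r - w s) /\<^sub>R (r - s)"
  have ev: "\<forall>\<^sub>F r in at s within {0..t}. ?q w r - w' s \<in> carr E \<and> ?q u r - u' s \<in> carr E"
    using C1_withD(1,2)[OF w] C1_withD(1,2)[OF u] s nspace_carr[OF E] by (auto simp: eventually_at_filter)
  have eq: "?q (\<lambda>s. w s - u s) r - (w' s - u' s) = (?q w r - w' s) - (?q u r - u' s)" for r
    by (simp add: algebra_simps)
  show "((\<lambda>r. nrm E (?q (\<lambda>s. w s - u s) r - (w' s - u' s))) \<longlongrightarrow> 0) (at s within {0..t})"
    unfolding eq
    by (rule tendsto_nrm_0[OF E _ tendsto_add_zero[OF C1_withD(3)[OF w s] C1_withD(3)[OF u s]]])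
      (use ev nspace_carr(3)[OF E] nrm_triangle_diff[OF E] in \<open>auto elim!: eventually_mono\<close>)
qed

lemma C1_with_const: "normed_nspace E \<Longrightarrow> x \<in> carr E \<Longrightarrow> C1_with E t (\<lambda>s. x) (\<lambda>s. 0)"
  by (auto simp: C1_with_def nrm_zero intro: ncont_const nspace_carr)

text \<open>Bounded linear maps between two such spaces preserve \<open>C\<^sup>1\<close> curves.\<close>

lemma C1_with_linear:
  assumes E: "normed_nspace E" and F: "normed_nspace F" and U: "op_norm_le E F U c" and lin: "linear U"
    and w: "C1_with E t w w'"
  shows "C1_with F t (\<lambda>s. U (w s)) (\<lambda>s. U (w' s))"
proof -
  interpret linear U by (rule lin)
  have Uc: "U x \<in> carr F" "nrm F (U x) \<le> c * nrm E x" if "x \<in> carr E" for x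
    using U that by (auto simp: op_norm_le_def)
  have nc: "ncont F {0..t} (\<lambda>s. U (h s))" if h: "ncont E {0..t} h" for h
  proof (rule ncont_lipschitz[OF h F, where c = c])
    show "nrm F (U (h r) - U (h s)) \<le> c * nrm E (h r - h s)" if "r \<in> {0..t}" "s \<in> {0..t}" for r s
      using Uc(2)[OF nspace_carr(3)[OF E ncontD(1)[OF h that(1)] ncontD(1)[OF h that(2)]]] by (simp add: diff)
  qed (use Uc h in \<open>auto simp: ncont_def\<close>)
  show ?thesis unfolding C1_with_def
  proof (intro conjI ballI nc)
    show "ncont E {0..t} w" "ncont E {0..t} w'" using w by (auto simp: C1_with_def)
    fix s assume s: "s \<in> {0..t}"
    let ?q = "\<lambda>w r. (w r - w s) /\<^sub>R (r - s)"
    have eq: "?q (\<lambda>s. U (w s)) r - U (w' s) = U (?q w r - w' s)" for r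
      by (simp add: diff scaleR)
    have ev: "\<forall>\<^sub>F r in at s within {0..t}. ?q w r - w' s \<in> carr E"
      using C1_withD(1,2)[OF w] s nspace_carr[OF E] by (auto simp: eventually_at_filter)
    show "((\<lambda>r. nrm F (?q (\<lambda>s. U (w s)) r - U (w' s))) \<longlongrightarrow> 0) (at s within {0..t})"
      unfolding eq
      by (rule tendsto_nrm_0[OF F _ tendsto_mult_right_zero[OF C1_withD(3)[OF w s]]])
        (use ev Uc in \<open>auto elim!: eventually_mono\<close>)
  qed
qed

lemma C1_norm_linear:
  assumes E: "normed_nspace E" and F: "normed_nspace F" and U: "op_norm_le E F U c" and lin: "linear U"
    and w: "C1_with E t w w'" and t: "t > 0" and c: "c \<ge> 0"
  shows "C1_norm F t (\<lambda>s. U (w s)) \<le> c * C1_norm E t w"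
proof -
  have wc: "ncont E {0..t} w" "ncont E {0..t} w'" using w by (auto simp: C1_with_def)
  have "C1_norm F t (\<lambda>s. U (w s)) \<le> c * (SUP s\<in>{0..t}. nrm E (w s)) + c * (SUP s\<in>{0..t}. nrm E (w' s))"
  proof (rule C1_norm_le[OF F C1_with_linear[OF assms(1-5)] t])
    fix s assume s: "s \<in> {0..t}"
    show "nrm F (U (w s)) \<le> c * (SUP s\<in>{0..t}. nrm E (w s))"
      using U C1_withD(1)[OF w s] mult_left_mono[OF SUP_nrm[OF E wc(1) s] c] by (force simp: op_norm_le_def)
    show "nrm F (U (w' s)) \<le> c * (SUP s\<in>{0..t}. nrm E (w' s))"
      using U C1_withD(2)[OF w s] mult_left_mono[OF SUP_nrm[OF E wc(2) s] c] by (force simp: op_norm_le_def)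
  qed
  then show ?thesis by (simp add: C1_norm_eq[OF E w t] algebra_simps)
qed

lemma (in interpolation_scale) C1_with_pullback:
  assumes \<alpha>: "0 \<le> \<alpha>" "\<alpha> \<le> 1" and w: "C1_with (Z \<alpha>) t (\<lambda>s. j (u s)) w'"
  shows "C1_with (pullback j (Z \<alpha>)) t u (\<lambda>s. inv j (w' s))"
proof -
  have *: "j (inv j (w' s)) = w' s" if "s \<in> {0..t}" for s
    using C1_withD(2)[OF w that] Z_range[OF \<alpha>] by (auto simp: f_inv_into_f)
  have nc: "ncont (pullback j (Z \<alpha>)) {0..t} h \<longleftrightarrow> ncont (Z \<alpha>) {0..t} (\<lambda>s. j (h s))" for h
    unfolding ncont_def by (simp add: pullback_simps j.diff)
  have nw: "ncont (Z \<alpha>) {0..t} (\<lambda>s. j (inv j (w' s)))"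
    using w ncont_cong[of "{0..t}" "\<lambda>s. j (inv j (w' s))" w'] * by (auto simp: C1_with_def)
  show ?thesis
    using w nw unfolding C1_with_def nc
    by (simp add: pullback_simps j.diff j.scaleR *)
qed

text \<open>The mean value inequality, by Bolzano bisection: the bound with the constant \<open>M + e\<close> holds on all short
  intervals around each point and is additive.\<close>

lemma C1_with_mean_value:
  assumes E: "normed_nspace E" and w: "C1_with E t w w'" and M: "\<And>s. s \<in> {0..t} \<Longrightarrow> nrm E (w' s) \<le> M"
    and ab: "0 \<le> a" "a \<le> b" "b \<le> t"
  shows "nrm E (w b - w a) \<le> M * (b - a)"
proof (rule field_le_epsilon)
  fix e0 :: real assume "e0 > 0"
  define e where "e = e0 / (t + 1)"
  have e: "e > 0" using \<open>e0 > 0\<close> ab by (simp add: e_def)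
  have wc: "w s \<in> carr E" "w' s \<in> carr E" if "s \<in> {0..t}" for s using C1_withD(1,2)[OF w that] by auto
  define P where "P x y \<longleftrightarrow> (0 \<le> x \<longrightarrow> x \<le> y \<longrightarrow> y \<le> t \<longrightarrow> nrm E (w y - w x) \<le> (M + e) * (y - x))" for x y
  have "P a b"
  proof (rule Bolzano[OF ab(2)])
    fix x y z assume xyz: "P x y" "P y z" "x \<le> y" "y \<le> z"
    show "P x z" unfolding P_def
    proof (intro impI)
      assume b: "0 \<le> x" "x \<le> z" "z \<le> t"
      have "nrm E (w z - w x) \<le> nrm E (w z - w y) + nrm E (w y - w x)"
        by (rule nrm_triangle[OF E]) (use wc xyz b in auto)
      also have "\<dots> \<le> (M + e) * (z - y) + (M + e) * (y - x)"
        using xyz b by (intro add_mono) (auto simp: P_def)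
      finally show "nrm E (w z - w x) \<le> (M + e) * (z - x)" by (simp add: algebra_simps)
    qed
  next
    fix x assume x: "a \<le> x" "x \<le> b"
    then have xt: "x \<in> {0..t}" using ab by auto
    have "\<forall>\<^sub>F r in at x within {0..t}. nrm E ((w r - w x) /\<^sub>R (r - x) - w' x) < e"
      by (rule order_tendstoD(2)[OF C1_withD(3)[OF w xt] e])
    then obtain d where d: "d > 0" "\<And>r. r \<in> {0..t} \<Longrightarrow> r \<noteq> x \<Longrightarrow> dist r x < d \<Longrightarrow>
        nrm E ((w r - w x) /\<^sub>R (r - x) - w' x) < e"
      unfolding eventually_at by blast
    have near: "nrm E (w r - w x) \<le> (M + e) * \<bar>r - x\<bar>" if r: "r \<in> {0..t}" "\<bar>r - x\<bar> < d" for r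
    proof (cases "r = x")
      case False
      let ?q = "(w r - w x) /\<^sub>R (r - x)"
      have q: "?q \<in> carr E" using wc r xt nspace_carr[OF E] by auto
      have "nrm E ?q \<le> nrm E (?q - w' x) + nrm E (w' x)"
        using normed_nspaceD(5)[OF E nspace_carr(3)[OF E q wc(2)[OF xt]] wc(2)[OF xt]] by simp
      also have "\<dots> \<le> e + M" using d(2)[OF r(1) False] r(2) M[OF xt] by (simp add: dist_real_def)
      finally have "\<bar>r - x\<bar> * nrm E ?q \<le> \<bar>r - x\<bar> * (e + M)" by (intro mult_left_mono) auto
      moreover have "\<bar>r - x\<bar> * nrm E ?q = nrm E (w r - w x)"
        using normed_nspaceD(4)[OF E q, of "r - x"] False by simp
      ultimately show ?thesis by (simp add: algebra_simps)
    qed (simp add: nrm_zero[OF E])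
    show "\<exists>d>0. \<forall>a b. a \<le> x \<and> x \<le> b \<and> b - a < d \<longrightarrow> P a b"
    proof (intro exI[of _ d] conjI allI impI d(1); elim conjE)
      fix p q assume pq: "p \<le> x" "x \<le> q" "q - p < d"
      show "P p q" unfolding P_def
      proof (intro impI)
        assume b: "0 \<le> p" "p \<le> q" "q \<le> t"
        have "nrm E (w q - w p) \<le> nrm E (w q - w x) + nrm E (w p - w x)"
          using nrm_triangle[OF E wc(1) wc(1) wc(1), of q x p] nrm_minus_commute[OF E wc(1) wc(1), of x p] b pq by auto
        also have "\<dots> \<le> (M + e) * \<bar>q - x\<bar> + (M + e) * \<bar>p - x\<bar>"
          using b pq by (intro add_mono near) auto
        also have "\<dots> = (M + e) * (q - p)" using pq by (simp add: algebra_simps)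
        finally show "nrm E (w q - w p) \<le> (M + e) * (q - p)" .
      qed
    qed
  qed
  then have "nrm E (w b - w a) \<le> (M + e) * (b - a)" using ab by (simp add: P_def)
  also have "\<dots> \<le> M * (b - a) + e * (t + 1)"
    using ab mult_left_mono[of "b - a" "t + 1" e] e by (simp add: distrib_right)
  finally show "nrm E (w b - w a) \<le> M * (b - a) + e0" using ab by (simp add: e_def)
qed

text \<open>Uniform limits of \<open>C\<^sup>1\<close> curves whose derivatives converge uniformly. The estimate \<open>step\<close> of the increments
  of \<open>W - w n\<close> is the mean value inequality for \<open>w (n + m) - w n\<close> in the limit of large \<open>m\<close>.\<close>

lemma C1_with_geometric_limit:
  assumes E: "normed_nspace E" "geo_complete E" and w: "\<And>k. C1_with E t (w k) (w' k)"
    and c: "0 \<le> c" "c < 1"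
    and inc: "\<And>k s. s \<in> {0..t} \<Longrightarrow> nrm E (w (Suc k) s - w k s) \<le> M * c ^ k"
    and inc': "\<And>k s. s \<in> {0..t} \<Longrightarrow> nrm E (w' (Suc k) s - w' k s) \<le> M * c ^ k"
  obtains W W' where "C1_with E t W W'"
    "\<And>k s. s \<in> {0..t} \<Longrightarrow> nrm E (w k s - W s) \<le> M * c ^ k / (1 - c)"
    "\<And>k s. s \<in> {0..t} \<Longrightarrow> nrm E (w' k s - W' s) \<le> M * c ^ k / (1 - c)"
proof -
  have wn: "ncont E {0..t} (w k)" "ncont E {0..t} (w' k)" for k using w by (auto simp: C1_with_def)
  obtain W where W: "ncont E {0..t} W" "\<And>k s. s \<in> {0..t} \<Longrightarrow> nrm E (w k s - W s) \<le> M * c ^ k / (1 - c)"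
    by (rule ncont_geometric_limit[where I = "{0..t}" and w = w and M = "\<lambda>_. M" and c = c, OF E wn(1) c]) (use inc in auto)
  obtain W' where W': "ncont E {0..t} W'" "\<And>k s. s \<in> {0..t} \<Longrightarrow> nrm E (w' k s - W' s) \<le> M * c ^ k / (1 - c)"
    by (rule ncont_geometric_limit[where I = "{0..t}" and w = w' and M = "\<lambda>_. M" and c = c, OF E wn(2) c]) (use inc' in auto)
  have wc: "w k s \<in> carr E" "w' k s \<in> carr E" "W s \<in> carr E" "W' s \<in> carr E" if "s \<in> {0..t}" for k s
    using C1_withD(1,2)[OF w that] W(1) W'(1) that by (auto simp: ncont_def)
  have step: "nrm E ((W r - W s) - (w n r - w n s)) \<le> M * c ^ n / (1 - c) * \<bar>r - s\<bar>"
    if r: "r \<in> {0..t}" and s: "s \<in> {0..t}" for r s n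
  proof -
    have fin: "nrm E ((w (n + m) r - w (n + m) s) - (w n r - w n s)) \<le> M * c ^ n / (1 - c) * \<bar>r - s\<bar>" for m
    proof -
      define D where "D s = w (n + m) s - w n s" for s
      have D: "C1_with E t D (\<lambda>s. w' (n + m) s - w' n s)" unfolding D_def by (rule C1_with_diff[OF E(1) w w])
      have b: "nrm E (w' (n + m) s - w' n s) \<le> M * c ^ n / (1 - c)" if "s \<in> {0..t}" for s
        by (rule geometric_increments[OF E(1) wc(2)[OF that] c inc'[OF that]])
      have Dc: "D r \<in> carr E" "D s \<in> carr E" using C1_withD(1)[OF D] r s by auto
      have "nrm E (D r - D s) \<le> M * c ^ n / (1 - c) * \<bar>r - s\<bar>"
      proof (cases "s \<le> r")
        case True
        then show ?thesis using C1_with_mean_value[OF E(1) D b, of s r] r s by auto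
      next
        case False
        then show ?thesis using C1_with_mean_value[OF E(1) D b, of r s] nrm_minus_commute[OF E(1) Dc] r s by auto
      qed
      moreover have "D r - D s = (w (n + m) r - w (n + m) s) - (w n r - w n s)" by (simp add: D_def)
      ultimately show ?thesis by simp
    qed
    have "nrm E ((W r - W s) - (w n r - w n s)) \<le> M * c ^ n / (1 - c) * \<bar>r - s\<bar> + 2 * (M * c ^ (m + n) / (1 - c))" for m
    proof -
      let ?a = "W r - W s" and ?b = "w (n + m) r - w (n + m) s" and ?c = "w n r - w n s"
      have cc: "?a \<in> carr E" "?b \<in> carr E" "?c \<in> carr E" "w (n + m) r - W r \<in> carr E" "w (n + m) s - W s \<in> carr E"
        using wc r s nspace_carr(3)[OF E(1)] by auto
      have "nrm E (?a - ?c) \<le> nrm E (?a - ?b) + nrm E (?b - ?c)" by (rule nrm_triangle[OF E(1) cc(1-3)])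
      moreover have "nrm E (?a - ?b) = nrm E (?b - ?a)" by (rule nrm_minus_commute[OF E(1) cc(1,2)])
      moreover have "nrm E (?b - ?a) \<le> nrm E (w (n + m) r - W r) + nrm E (w (n + m) s - W s)"
      proof -
        have "(w (n + m) r - W r) - (w (n + m) s - W s) = ?b - ?a" by simp
        then show ?thesis using nrm_triangle_diff[OF E(1) cc(4,5)] by (simp only:)
      qed
      ultimately have "nrm E (?a - ?c) \<le> M * c ^ n / (1 - c) * \<bar>r - s\<bar> + 2 * (M * c ^ (n + m) / (1 - c))"
        using W(2)[OF r, of "n + m"] W(2)[OF s, of "n + m"] fin[of m] by linarith
      then show ?thesis by (simp only: add.commute)
    qed
    moreover have "(\<lambda>m. M * c ^ n / (1 - c) * \<bar>r - s\<bar> + 2 * (M * c ^ (m + n) / (1 - c))) \<longlonglongrightarrow> M * c ^ n / (1 - c) * \<bar>r - s\<bar> + 2 * 0"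
      by (intro tendsto_add tendsto_mult tendsto_const LIMSEQ_ignore_initial_segment[OF geometric_tendsto_0[OF c]])
    ultimately show ?thesis using LIMSEQ_le_const[of _ "M * c ^ n / (1 - c) * \<bar>r - s\<bar> + 2 * 0"] by simp
  qed
  have "C1_with E t W W'" unfolding C1_with_def
  proof (intro conjI ballI W(1) W'(1))
    fix s assume s: "s \<in> {0..t}"
    let ?q = "\<lambda>w r. (w r - w s) /\<^sub>R (r - s)"
    show "((\<lambda>r. nrm E (?q W r - W' s)) \<longlongrightarrow> 0) (at s within {0..t})"
    proof (rule tendstoI)
      fix e :: real assume e: "e > 0"
      then obtain n where n: "M * c ^ n / (1 - c) < e / 3"
        using order_tendstoD(2)[OF geometric_tendsto_0[OF c], of "e/3" M] by (auto simp: eventually_sequentially)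
      have "\<forall>\<^sub>F r in at s within {0..t}. nrm E (?q (w n) r - w' n s) < e / 3"
        by (rule order_tendstoD(2)[OF C1_withD(3)[OF w s]]) (use e in simp)
      moreover have "\<forall>\<^sub>F r in at s within {0..t}. r \<in> {0..t} \<and> r \<noteq> s" by (simp add: eventually_at_filter)
      ultimately show "\<forall>\<^sub>F r in at s within {0..t}. dist (nrm E (?q W r - W' s)) 0 < e"
      proof eventually_elim
        case (elim r)
        then have r: "r \<in> {0..t}" "r \<noteq> s" by auto
        have qc: "?q W r \<in> carr E" "?q (w n) r \<in> carr E" using wc r s nspace_carr[OF E(1)] by auto
        let ?d = "(W r - W s) - (w n r - w n s)"
        have dc: "?d \<in> carr E" using wc r s nspace_carr[OF E(1)] by auto
        have "nrm E (?q W r - ?q (w n) r) = nrm E (?d /\<^sub>R (r - s))"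
          by (simp add: scaleR_right_diff_distrib)
        also have "\<dots> = nrm E ?d / \<bar>r - s\<bar>"
          using normed_nspaceD(4)[OF E(1) dc, of "inverse (r - s)"] by (simp add: divide_inverse_commute)
        also have "\<dots> \<le> M * c ^ n / (1 - c)" using step[OF r(1) s, of n] r(2) by (simp add: pos_divide_le_eq)
        finally have 1: "nrm E (?q W r - ?q (w n) r) < e / 3" using n by (rule le_less_trans)
        have 2: "nrm E (w' n s - W' s) < e / 3" by (rule le_less_trans[OF W'(2)[OF s] n])
        have "nrm E (?q W r - W' s) \<le> nrm E (?q W r - ?q (w n) r) + (nrm E (?q (w n) r - w' n s) + nrm E (w' n s - W' s))"
          using nrm_triangle[OF E(1) qc wc(4)[OF s]] nrm_triangle[OF E(1) qc(2) wc(2)[OF s] wc(4)[OF s], of n] by simp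
        then have "nrm E (?q W r - W' s) < e" using 1 2 elim by simp
        then show ?case using normed_nspaceD(2)[OF E(1) nspace_carr(3)[OF E(1) qc(1) wc(4)[OF s]]] by simp
      qed
    qed
  qed
  then show ?thesis using that W(2) W'(2) by blast
qed

text \<open>The contraction principle in \<open>C\<^sup>1([0,t];E)\<close>, with a bound of the derivative of the fixed point.\<close>

lemma C1_fixed_point:
  assumes E: "normed_nspace E" "geo_complete E" and t: "t > 0" and q: "0 \<le> q" "q < 1"
    and map: "\<And>w. C1_curve E t w \<Longrightarrow> C1_curve E t (\<Phi> w)"
    and contr: "\<And>w u. C1_curve E t w \<Longrightarrow> C1_curve E t u \<Longrightarrow>
      C1_norm E t (\<lambda>s. \<Phi> w s - \<Phi> u s) \<le> q * C1_norm E t (\<lambda>s. w s - u s)"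
    and init: "C1_norm E t (\<Phi> (\<lambda>s. 0)) \<le> V"
  obtains W W' where "C1_with E t W W'" "\<And>s. s \<in> {0..t} \<Longrightarrow> \<Phi> W s = W s"
    "\<And>s. s \<in> {0..t} \<Longrightarrow> nrm E (W' s) \<le> V / (1 - q)"
proof -
  define w where "w k = (\<Phi> ^^ k) (\<lambda>s. 0)" for k
  have w0: "w 0 = (\<lambda>s. 0)" and wS: "w (Suc k) = \<Phi> (w k)" for k by (simp_all add: w_def)
  have "C1_curve E t (\<lambda>s. 0)" using C1_with_const[OF E(1) nspace_carr(1)[OF E(1)]] C1_curve_iff[OF E(1)] by blast
  then have wC: "C1_curve E t (w k)" for k by (induction k) (simp_all add: w0 wS map)
  then have "\<forall>k. \<exists>w'. C1_with E t (w k) w'" using C1_curve_iff[OF E(1)] by blast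
  then obtain wp where wp: "\<And>k. C1_with E t (w k) (wp k)" by metis
  \<comment> \<open>the derivative of the initial iterate is chosen to be \<open>0\<close>, so that the rate of convergence bounds the
    derivative of the limit\<close>
  define w' where "w' k = (case k of 0 \<Rightarrow> (\<lambda>s. 0) | Suc n \<Rightarrow> wp k)" for k
  have ww': "C1_with E t (w k) (w' k)" for k
    using wp C1_with_const[OF E(1) nspace_carr(1)[OF E(1)]] by (auto simp: w'_def w0 split: nat.split)
  have inc: "C1_norm E t (\<lambda>s. w (Suc k) s - w k s) \<le> V * q ^ k" for k
  proof (induction k)
    case 0 then show ?case using init by (simp add: w0 wS)
  next
    case (Suc k)
    have "C1_norm E t (\<lambda>s. w (Suc (Suc k)) s - w (Suc k) s) \<le> q * C1_norm E t (\<lambda>s. w (Suc k) s - w k s)"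
      unfolding wS[of "Suc k"] by (subst (2) wS, rule contr[OF wC wC])
    also have "\<dots> \<le> q * (V * q ^ k)" by (rule mult_left_mono[OF Suc q(1)])
    finally show ?case by (simp add: mult_ac)
  qed
  have d: "C1_with E t (\<lambda>s. w (Suc k) s - w k s) (\<lambda>s. w' (Suc k) s - w' k s)" for k
    by (rule C1_with_diff[OF E(1) ww' ww'])
  have i1: "nrm E (w (Suc k) s - w k s) \<le> V * q ^ k" "nrm E (w' (Suc k) s - w' k s) \<le> V * q ^ k" if "s \<in> {0..t}" for k s
    using C1_norm_ge[OF E(1) d t that, of k] inc[of k] by linarith+
  obtain W W' where W: "C1_with E t W W'"
    and lim: "\<And>k s. s \<in> {0..t} \<Longrightarrow> nrm E (w k s - W s) \<le> V * q ^ k / (1 - q)"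
    and lim': "\<And>k s. s \<in> {0..t} \<Longrightarrow> nrm E (w' k s - W' s) \<le> V * q ^ k / (1 - q)"
    by (rule C1_with_geometric_limit[OF E ww' q i1]) blast+
  have WC: "C1_curve E t W" using W C1_curve_iff[OF E(1)] by blast
  have fix_pt: "\<Phi> W s = W s" if s: "s \<in> {0..t}" for s
  proof -
    obtain P' where P': "C1_with E t (\<Phi> W) P'" using map[OF WC] C1_curve_iff[OF E(1)] by blast
    have c: "W s \<in> carr E" "\<Phi> W s \<in> carr E" "\<And>k. w k s \<in> carr E"
      using C1_withD(1)[OF W s] C1_withD(1)[OF P' s] C1_withD(1)[OF ww' s] by auto
    have "nrm E (\<Phi> W s - W s) \<le> 3 * (V * q ^ k / (1 - q))" for k
    proof -
      have "nrm E (w (Suc k) s - \<Phi> W s) \<le> C1_norm E t (\<lambda>s. w (Suc k) s - \<Phi> W s)"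
        by (rule C1_norm_ge(1)[OF E(1) C1_with_diff[OF E(1) ww' P'] t s])
      also have "\<dots> \<le> q * C1_norm E t (\<lambda>s. w k s - W s)" unfolding wS by (rule contr[OF wC WC])
      also have "C1_norm E t (\<lambda>s. w k s - W s) \<le> V * q ^ k / (1 - q) + V * q ^ k / (1 - q)"
        by (rule C1_norm_le[OF E(1) C1_with_diff[OF E(1) ww' W] t lim lim'])
      finally have 1: "nrm E (w (Suc k) s - \<Phi> W s) \<le> q * (2 * (V * q ^ k / (1 - q)))"
        using q by (simp add: mult_left_mono)
      have nn: "0 \<le> V * q ^ k / (1 - q)"
        using lim[OF s, of k] normed_nspaceD(2)[OF E(1) nspace_carr(3)[OF E(1) c(3) c(1)]] order_trans by blast
      have "q * (2 * (V * q ^ k / (1 - q))) \<le> 1 * (2 * (V * q ^ k / (1 - q)))"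
        by (rule mult_right_mono) (use nn q in auto)
      moreover have "V * q ^ Suc k / (1 - q) \<le> 1 * (V * q ^ k / (1 - q))"
        using mult_right_mono[of q 1 "V * q ^ k / (1 - q)"] nn q by (simp add: mult_ac)
      moreover have "nrm E (\<Phi> W s - W s) \<le> nrm E (w (Suc k) s - \<Phi> W s) + nrm E (w (Suc k) s - W s)"
        using nrm_triangle[OF E(1) c(2) c(3)[of "Suc k"] c(1)] nrm_minus_commute[OF E(1) c(2) c(3)[of "Suc k"]] by simp
      ultimately show ?thesis using 1 lim[OF s, of "Suc k"] by simp
    qed
    moreover have "(\<lambda>k. 3 * (V * q ^ k / (1 - q))) \<longlonglongrightarrow> 0"
      by (intro tendsto_mult_right_zero geometric_tendsto_0 q)
    ultimately have "nrm E (\<Phi> W s - W s) \<le> 0" using LIMSEQ_le_const[of _ 0] by blast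
    then have "nrm E (\<Phi> W s - W s) = 0" using normed_nspaceD(2)[OF E(1) nspace_carr(3)[OF E(1) c(2,1)]] by simp
    then show ?thesis using normed_nspaceD(3)[OF E(1) nspace_carr(3)[OF E(1) c(2,1)]] by simp
  qed
  have "nrm E (W' s) \<le> V / (1 - q)" if s: "s \<in> {0..t}" for s
    using lim'[OF s, of 0] nrm_uminus[OF E(1) C1_withD(2)[OF W s]] by (simp add: w'_def)
  then show ?thesis using that W fix_pt by blast
qed

section \<open>The fast-slow system\<close>

text \<open>The semigroup in slow time \<open>t\<close>, which is the fast time \<open>t / \<epsilon>\<close> of the original one.\<close>

lemma smoothing_semigroup_rescale:
  assumes "smoothing_semigroup S T E1 E R 0 c1 c2 cE C a w" and \<epsilon>: "\<epsilon> > 0"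
  shows "smoothing_semigroup (\<lambda>x. S x /\<^sub>R \<epsilon>) (\<lambda>t. T (t / \<epsilon>)) E1 E (\<lambda>y. R (\<epsilon> *\<^sub>R y)) 0
    (c1 * \<epsilon>) (c2 / \<epsilon>) cE (C * \<epsilon> powr (1 - a)) a (w / \<epsilon>)"
proof -
  interpret smoothing_semigroup S T E1 E R 0 c1 c2 cE C a w by (rule assms(1))
  interpret R: bounded_linear R by (rule R_lin)
  have fl: "filterlim (\<lambda>t. t / \<epsilon>) (at_right 0) (at_right 0)" "filterlim (\<lambda>t. \<epsilon> * t) (at_right 0) (at_right 0)"
    unfolding filterlim_at using \<epsilon>
    by (auto intro!: tendsto_eq_intros simp: eventually_at_filter)
  let ?T = "\<lambda>t. T (t / \<epsilon>)"
  have lim_iff: "((\<lambda>h. (T h x - x) /\<^sub>R h) \<longlongrightarrow> \<epsilon> *\<^sub>R y) (at_right 0) \<longleftrightarrow> ((\<lambda>h. (?T h x - x) /\<^sub>R h) \<longlongrightarrow> y) (at_right 0)" for x y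
  proof
    assume "((\<lambda>h. (T h x - x) /\<^sub>R h) \<longlongrightarrow> \<epsilon> *\<^sub>R y) (at_right 0)"
    from tendsto_scaleR[OF tendsto_const[of "inverse \<epsilon>"] filterlim_compose[OF this fl(1)]]
    show "((\<lambda>h. (?T h x - x) /\<^sub>R h) \<longlongrightarrow> y) (at_right 0)" using \<epsilon> by (simp add: field_simps)
  next
    assume "((\<lambda>h. (?T h x - x) /\<^sub>R h) \<longlongrightarrow> y) (at_right 0)"
    from tendsto_scaleR[OF tendsto_const[of \<epsilon>] filterlim_compose[OF this fl(2)]]
    show "((\<lambda>h. (T h x - x) /\<^sub>R h) \<longlongrightarrow> \<epsilon> *\<^sub>R y) (at_right 0)" using \<epsilon> by (simp add: field_simps)
  qed
  show ?thesis
  proof (rule smoothing_semigroup.intro)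
    show "generates (carr E1) (\<lambda>x. S x /\<^sub>R \<epsilon>) ?T"
      unfolding generates_def c0_semigroup_def
    proof (intro conjI allI impI ballI)
      have D: "carr E1 = {x. \<exists>y. ((\<lambda>h. (T h x - x) /\<^sub>R h) \<longlongrightarrow> y) (at_right 0)}"
        and S: "\<And>x. x \<in> carr E1 \<Longrightarrow> ((\<lambda>h. (T h x - x) /\<^sub>R h) \<longlongrightarrow> S x) (at_right 0)"
        using gen by (auto simp: generates_def)
      show "?T 0 = id_blinfun" using semigroup(1) by simp
      show "?T (s + t) = ?T s o\<^sub>L ?T t" if "0 \<le> s" "0 \<le> t" for s t
        using semigroup(2)[of "s / \<epsilon>" "t / \<epsilon>"] that \<epsilon> by (simp add: add_divide_distrib)
      show "((\<lambda>t. ?T t x) \<longlongrightarrow> x) (at_right 0)" for x by (rule filterlim_compose[OF semigroup(3) fl(1)])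
      show "carr E1 = {x. \<exists>y. ((\<lambda>h. (?T h x - x) /\<^sub>R h) \<longlongrightarrow> y) (at_right 0)}"
      proof -
        have "(\<exists>y. ((\<lambda>h. (T h x - x) /\<^sub>R h) \<longlongrightarrow> y) (at_right 0)) \<longleftrightarrow> (\<exists>y. ((\<lambda>h. (?T h x - x) /\<^sub>R h) \<longlongrightarrow> y) (at_right 0))" for x
        proof
          assume "\<exists>y. ((\<lambda>h. (T h x - x) /\<^sub>R h) \<longlongrightarrow> y) (at_right 0)"
          then obtain y where "((\<lambda>h. (T h x - x) /\<^sub>R h) \<longlongrightarrow> \<epsilon> *\<^sub>R (y /\<^sub>R \<epsilon>)) (at_right 0)" using \<epsilon> by auto
          then show "\<exists>y. ((\<lambda>h. (?T h x - x) /\<^sub>R h) \<longlongrightarrow> y) (at_right 0)" unfolding lim_iff by blast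
        next
          assume "\<exists>y. ((\<lambda>h. (?T h x - x) /\<^sub>R h) \<longlongrightarrow> y) (at_right 0)"
          then show "\<exists>y. ((\<lambda>h. (T h x - x) /\<^sub>R h) \<longlongrightarrow> y) (at_right 0)" unfolding lim_iff[symmetric] by blast
        qed
        then show ?thesis unfolding D by simp
      qed
      show "((\<lambda>h. (?T h x - x) /\<^sub>R h) \<longlongrightarrow> S x /\<^sub>R \<epsilon>) (at_right 0)" if "x \<in> carr E1" for x
        unfolding lim_iff[symmetric] using S[OF that] \<epsilon> by simp
    qed
    show "bounded_linear (\<lambda>y. R (\<epsilon> *\<^sub>R y))"
      by (rule bounded_linear_compose[OF R_lin bounded_linear_scaleR_right])
    show "S (R (\<epsilon> *\<^sub>R y)) /\<^sub>R \<epsilon> - 0 *\<^sub>R R (\<epsilon> *\<^sub>R y) = y" for y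
      using R_right[of "\<epsilon> *\<^sub>R y"] \<epsilon> by simp
    show "R (\<epsilon> *\<^sub>R (S x /\<^sub>R \<epsilon> - 0 *\<^sub>R x)) = x" if "x \<in> carr E1" for x
      using R_left[OF that] \<epsilon> by simp
    show "nrm E1 x \<le> c1 * \<epsilon> * norm (S x /\<^sub>R \<epsilon> - 0 *\<^sub>R x)" if "x \<in> carr E1" for x
      using E1_upper[OF that] \<epsilon> by (simp add: field_simps)
    show "norm (S x /\<^sub>R \<epsilon> - 0 *\<^sub>R x) \<le> c2 / \<epsilon> * nrm E1 x" if "x \<in> carr E1" for x
      using E1_lower[OF that] \<epsilon> by (simp add: field_simps)
    show "\<exists>M. \<forall>r\<in>{0..t}. norm (T (r / \<epsilon>)) \<le> M" for t
    proof -
      obtain M where "\<forall>r\<in>{0..t / \<epsilon>}. norm (T r) \<le> M" using T_bdd by blast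
      then show ?thesis using \<epsilon> by (intro exI[of _ M]) (auto simp: divide_right_mono)
    qed
    show "T (r / \<epsilon>) x \<in> carr E1 \<and> nrm E1 (T (r / \<epsilon>) x) \<le>
        C * \<epsilon> powr (1 - a) * r powr (a - 1) * exp (w / \<epsilon> * r) * nrm E x" if "0 < r" "x \<in> carr E" for r x
    proof -
      have "(r / \<epsilon>) powr (a - 1) = \<epsilon> powr (1 - a) * r powr (a - 1)"
        using that \<epsilon> powr_minus_divide[of \<epsilon> "a - 1"] by (simp add: powr_divide)
      then show ?thesis using smoothing[of "r / \<epsilon>" x] that \<epsilon> by (simp add: mult_ac)
    qed
  qed (use E1 E R_carr E_embeds pos \<epsilon> in auto)
qed

lemma nspace_fixed_point:
  assumes E: "normed_nspace E" "geo_complete E" and q: "0 \<le> q" "q < 1"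
    and map: "\<And>x. x \<in> carr E \<Longrightarrow> \<Phi> x \<in> carr E"
    and contr: "\<And>x y. x \<in> carr E \<Longrightarrow> y \<in> carr E \<Longrightarrow> nrm E (\<Phi> x - \<Phi> y) \<le> q * nrm E (x - y)"
  shows "\<exists>x\<in>carr E. \<Phi> x = x"
proof -
  define x where "x k = (\<Phi> ^^ k) 0" for k
  have xS: "x (Suc k) = \<Phi> (x k)" for k by (simp add: x_def)
  have x: "x k \<in> carr E" for k by (induction k) (simp_all add: xS map, simp add: x_def nspace_carr(1)[OF E(1)])
  have "nrm E (x (Suc k) - x k) \<le> nrm E (x 1 - x 0) * q ^ k" for k
  proof (induction k)
    case (Suc k)
    have "nrm E (x (Suc (Suc k)) - x (Suc k)) \<le> q * nrm E (x (Suc k) - x k)"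
      unfolding xS[of "Suc k"] by (subst (2) xS, rule contr[OF x x])
    also have "\<dots> \<le> q * (nrm E (x 1 - x 0) * q ^ k)" by (rule mult_left_mono[OF Suc q(1)])
    finally show ?case by (simp add: mult_ac)
  qed simp
  from geo_completeD[OF E(2) x q this]
  obtain l where l: "l \<in> carr E" "\<And>k. nrm E (x k - l) \<le> nrm E (x 1 - x 0) * q ^ k / (1 - q)" by blast
  have \<Phi>l: "\<Phi> l \<in> carr E" by (rule map[OF l(1)])
  let ?e = "\<lambda>k. nrm E (x 1 - x 0) * q ^ k / (1 - q)"
  have "nrm E (\<Phi> l - l) \<le> q * ?e k + ?e (Suc k)" for k
  proof -
    have "nrm E (\<Phi> l - l) \<le> nrm E (\<Phi> l - x (Suc k)) + nrm E (x (Suc k) - l)"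
      by (rule nrm_triangle[OF E(1) \<Phi>l x l(1)])
    also have "nrm E (\<Phi> l - x (Suc k)) = nrm E (\<Phi> (x k) - \<Phi> l)"
      unfolding xS by (rule nrm_minus_commute[OF E(1) \<Phi>l map[OF x]])
    also have "\<dots> \<le> q * nrm E (x k - l)" by (rule contr[OF x l(1)])
    also have "\<dots> \<le> q * ?e k" by (rule mult_left_mono[OF l(2) q(1)])
    finally show ?thesis using l(2)[of "Suc k"] by linarith
  qed
  moreover have "(\<lambda>k. q * ?e k + ?e (Suc k)) \<longlonglongrightarrow> 0"
    by (intro tendsto_add_zero tendsto_mult_right_zero LIMSEQ_Suc geometric_tendsto_0 q)
  ultimately have "nrm E (\<Phi> l - l) \<le> 0" using LIMSEQ_le_const[of _ 0] by blast
  then have "nrm E (\<Phi> l - l) = 0" using normed_nspaceD(2)[OF E(1) nspace_carr(3)[OF E(1) \<Phi>l l(1)]] by simp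
  then show ?thesis using normed_nspaceD(3)[OF E(1) nspace_carr(3)[OF E(1) \<Phi>l l(1)]] l(1) by auto
qed

lemma (in smoothing_semigroup) strict_rhs_continuous:
  assumes z: "ncont E1 {0..} z" and F: "continuous_on {0..} F"
  shows "continuous_on {0..} (\<lambda>t. S (z t) + F t)"
proof -
  have "continuous_on {0..} (\<lambda>t. L (z t))" unfolding continuous_on_def
  proof
    fix t :: real assume t: "t \<in> {0..}"
    have ev: "\<forall>\<^sub>F s in at t within {0..}. norm (L (z s) - L (z t)) \<le> c2 * nrm E1 (z s - z t)"
      using ncontD(1)[OF z] t E1_norm(2)[OF nspace_carr(3)[OF E1]] by (auto simp: eventually_at_filter L_diff[symmetric])
    have "((\<lambda>s. L (z s) - L (z t)) \<longlongrightarrow> 0) (at t within {0..})"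
      by (rule Lim_null_comparison[OF ev tendsto_mult_right_zero[OF ncontD(2)[OF z t]]])
    then show "((\<lambda>t. L (z t)) \<longlongrightarrow> L (z t)) (at t within {0..})" by (simp add: LIM_zero_iff)
  qed
  moreover have "continuous_on {0..} z"
    using norm_le_E1 ncont_imp_continuous_on[OF E1 z] by blast
  ultimately have "continuous_on {0..} (\<lambda>t. L (z t) + lam *\<^sub>R z t + F t)" by (intro continuous_intros F)
  then show ?thesis by (rule continuous_on_eq) (simp add: L_def)
qed

text \<open>The abstract content of the hypotheses. \<open>Xg\<close>, \<open>Xd\<close> and \<open>Yd\<close> are the spaces of the exponents
  \<open>\<gamma>\<close>, \<open>\<delta>\<close> and \<open>\<beta>\<close>; \<open>R\<close> is the inverse of \<open>A\<close>. The last assumption says that the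
  solutions \<open>W\<close> of the equation \<open>x = - R (f x (v s))\<close> of the critical manifold along a \<open>C\<^sup>1\<close> curve \<open>v\<close> form a
  \<open>C\<^sup>1\<close> curve in \<open>Xd\<close>.\<close>

locale fast_slow =
  Xg: smoothing_semigroup A TA X1 Xg R 0 c1 c2 cg CA \<gamma> \<omega>A +
  Xd: smoothing_semigroup A TA X1 Xd R 0 c1 c2 cd CA \<delta> \<omega>A +
  Y: smoothing_semigroup B TB Y1 Yd RB \<mu>B d1 d2 ce CB \<beta> \<omega>B
  for A :: "'x::banach \<Rightarrow> 'x" and TA X1 Xg Xd R c1 c2 cg cd CA \<gamma> \<delta> \<omega>A
    and B :: "'y::banach \<Rightarrow> 'y" and TB Y1 Yd RB \<mu>B d1 d2 ce CB \<beta> \<omega>B +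
  fixes f :: "'x \<Rightarrow> 'y \<Rightarrow> 'x" and g :: "'x \<Rightarrow> 'y \<Rightarrow> 'y" and Lf Lg MA MB cA KH :: real
  assumes complete: "geo_complete X1" "geo_complete Y1"
    and f_range: "\<And>x y. x \<in> carr X1 \<Longrightarrow> y \<in> carr Y1 \<Longrightarrow> f x y \<in> carr Xg"
    and g_range: "\<And>x y. x \<in> carr X1 \<Longrightarrow> y \<in> carr Y1 \<Longrightarrow> g x y \<in> carr Yd"
    and f_lip: "\<And>x x' y y'. x \<in> carr X1 \<Longrightarrow> x' \<in> carr X1 \<Longrightarrow> y \<in> carr Y1 \<Longrightarrow> y' \<in> carr Y1 \<Longrightarrow>
      nrm Xg (f x y - f x' y') \<le> Lf * (nrm X1 (x - x') + nrm Y1 (y - y'))"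
    and g_lip: "\<And>x x' y y'. x \<in> carr X1 \<Longrightarrow> x' \<in> carr X1 \<Longrightarrow> y \<in> carr Y1 \<Longrightarrow> y' \<in> carr Y1 \<Longrightarrow>
      nrm Yd (g x y - g x' y') \<le> Lg * (nrm X1 (x - x') + nrm Y1 (y - y'))"
    and zero: "f 0 0 = 0" "g 0 0 = 0"
    and lip_pos: "Lf > 0" "Lg > 0"
    and TA_X1: "\<And>t x. t \<ge> 0 \<Longrightarrow> x \<in> carr X1 \<Longrightarrow> nrm X1 (TA t x) \<le> MA * exp (\<omega>A * t) * nrm X1 x"
    and TB_Y1: "\<And>t y. t \<ge> 0 \<Longrightarrow> y \<in> carr Y1 \<Longrightarrow> nrm Y1 (TB t y) \<le> MB * exp (\<omega>B * t) * nrm Y1 y"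
    and MAB: "MA \<ge> 0" "MB \<ge> 0" and \<omega>A: "\<omega>A < 0"
    and cA: "cA \<ge> 0" "\<And>x. x \<in> carr Xg \<Longrightarrow> nrm X1 (R x) \<le> cA * nrm Xg x" "Lf * cA < 1"
    and gap: "CA * Lf * kernel_const \<gamma> (- \<omega>A) < 1"
    and KH: "KH \<ge> 0"
    and critical_C1: "\<And>t v v' V W. t > 0 \<Longrightarrow> C1_with whole_space t v v' \<Longrightarrow> ncont Y1 {0..t} v \<Longrightarrow>
      (\<And>s. s \<in> {0..t} \<Longrightarrow> norm (v s) \<le> V \<and> norm (v' s) \<le> V) \<Longrightarrow>
      (\<And>s x. s \<in> {0..t} \<Longrightarrow> x \<in> carr X1 \<Longrightarrow> x = - R (f x (v s)) \<Longrightarrow> x = W s) \<Longrightarrow>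
      \<exists>d. C1_with Xd t W d \<and> (\<forall>s\<in>{0..t}. nrm Xd (d s) \<le> KH * V)"
begin

lemmas nX1 = Xg.E1 and nXg = Xg.E and nXd = Xd.E and nY1 = Y.E1 and nYd = Y.E

subsection \<open>The critical manifold\<close>

text \<open>The critical manifold is the graph of \<open>h\<^sup>0\<close>.\<close>

abbreviation h0 where "h0 \<equiv> critical_map A f X1"

lemma A_R: "A (R y) = y" and R_A: "x \<in> carr X1 \<Longrightarrow> R (A x) = x"
  using Xg.R_right[of y] Xg.R_left[of x] by auto

lemma R_uminus: "R (- y) = - R y" and R_diff: "R (x - y) = R x - R y"
  using Xg.R_lin by (simp_all add: linear_simps)

lemma critical_ex1:
  assumes y: "y \<in> carr Y1" shows "\<exists>!x. x \<in> carr X1 \<and> 0 = A x + f x y"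
proof -
  have eq: "0 = A x + f x y \<longleftrightarrow> - R (f x y) = x" if "x \<in> carr X1" for x
  proof
    assume "0 = A x + f x y"
    then have "A x = - f x y" by (simp add: eq_neg_iff_add_eq_0)
    then show "- R (f x y) = x" using R_A[OF that] R_uminus by metis
  next
    assume "- R (f x y) = x"
    then have "A x = - f x y" using A_R R_uminus by metis
    then show "0 = A x + f x y" by simp
  qed
  have contr: "nrm X1 (- R (f x y) - - R (f x' y)) \<le> (Lf * cA) * nrm X1 (x - x')"
    if "x \<in> carr X1" "x' \<in> carr X1" for x x'
  proof -
    have fx: "f x' y - f x y \<in> carr Xg" using f_range that y nspace_carr(3)[OF nXg] by auto
    have "- R (f x y) - - R (f x' y) = R (f x' y - f x y)" by (simp add: R_diff)
    then have "nrm X1 (- R (f x y) - - R (f x' y)) \<le> cA * nrm Xg (f x' y - f x y)" using cA(2)[OF fx] by simp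
    also have "\<dots> \<le> cA * (Lf * (nrm X1 (x' - x) + nrm Y1 (y - y)))" by (intro mult_left_mono f_lip cA that y)
    finally show ?thesis using nrm_zero[OF nY1] nrm_minus_commute[OF nX1 that] by (simp add: mult_ac)
  qed
  have q: "0 \<le> Lf * cA" using lip_pos cA by simp
  obtain x where x: "x \<in> carr X1" "- R (f x y) = x"
    using nspace_fixed_point[OF nX1 complete(1) q cA(3) _ contr] Xg.R_carr nspace_carr(5)[OF nX1] by blast
  show ?thesis
  proof (rule ex1I[of _ x])
    show "x \<in> carr X1 \<and> 0 = A x + f x y" using x eq by blast
    fix x' assume x': "x' \<in> carr X1 \<and> 0 = A x' + f x' y"
    then have "- R (f x' y) = x'" using eq by blast
    then have "nrm X1 (x' - x) \<le> (Lf * cA) * nrm X1 (x' - x)" using contr[of x' x] x x' by simp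
    moreover have "0 \<le> nrm X1 (x' - x)" using normed_nspaceD(2)[OF nX1] nspace_carr(3)[OF nX1] x x' by blast
    ultimately have "nrm X1 (x' - x) = 0" using cA(3) by (smt (verit) mult_le_cancel_right1)
    then show "x' = x" using normed_nspaceD(3)[OF nX1 nspace_carr(3)[OF nX1, of x' x]] x x' by auto
  qed
qed

lemma h0: "y \<in> carr Y1 \<Longrightarrow> h0 y \<in> carr X1" "y \<in> carr Y1 \<Longrightarrow> A (h0 y) = - f (h0 y) y"
  and h0_unique: "y \<in> carr Y1 \<Longrightarrow> x \<in> carr X1 \<Longrightarrow> 0 = A x + f x y \<Longrightarrow> x = h0 y"
proof -
  assume y: "y \<in> carr Y1"
  note * = theI'[OF critical_ex1[OF y], folded critical_map_def]
  show "h0 y \<in> carr X1" using * by blast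
  show "A (h0 y) = - f (h0 y) y" using * by (metis eq_neg_iff_add_eq_0)
  show "x = h0 y" if "x \<in> carr X1" "0 = A x + f x y" using * critical_ex1[OF y] that by blast
qed

lemma h0_R: "y \<in> carr Y1 \<Longrightarrow> R (f (h0 y) y) = - h0 y"
  using h0 R_A by (metis R_uminus add.inverse_inverse)

lemma h0_zero: "h0 0 = 0"
proof -
  have "A 0 = 0" using A_R[of 0] linear_0[OF bounded_linear.linear[OF Xg.R_lin]] by simp
  then show ?thesis
    using h0_unique[of 0 0] nspace_carr(1)[OF nX1] nspace_carr(1)[OF nY1] zero by simp
qed

text \<open>The Lipschitz constant of \<open>h\<^sup>0\<close>, from the contraction constant \<open>Lf * cA\<close> of its fixed point equation.\<close>

definition Kh where "Kh = Lf * cA / (1 - Lf * cA)"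

lemma Kh_nonneg: "0 \<le> Kh" using lip_pos cA by (simp add: Kh_def)

lemma h0_lip:
  assumes y: "y \<in> carr Y1" "y' \<in> carr Y1"
  shows "nrm X1 (h0 y - h0 y') \<le> Kh * nrm Y1 (y - y')"
proof -
  note h = h0(1)[OF y(1)] h0(1)[OF y(2)]
  have fx: "f (h0 y') y' - f (h0 y) y \<in> carr Xg" using f_range h y nspace_carr(3)[OF nXg] by auto
  have "h0 y - h0 y' = R (f (h0 y') y' - f (h0 y) y)" using h0_R[OF y(1)] h0_R[OF y(2)] by (simp add: R_diff)
  then have "nrm X1 (h0 y - h0 y') \<le> cA * nrm Xg (f (h0 y') y' - f (h0 y) y)" using cA(2)[OF fx] by simp
  also have "\<dots> \<le> cA * (Lf * (nrm X1 (h0 y' - h0 y) + nrm Y1 (y' - y)))" by (intro mult_left_mono f_lip cA h y)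
  finally have "nrm X1 (h0 y - h0 y') \<le> Lf * cA * (nrm X1 (h0 y - h0 y') + nrm Y1 (y - y'))"
    using nrm_minus_commute[OF nX1 h] nrm_minus_commute[OF nY1 y] by (simp add: mult_ac)
  then have "(1 - Lf * cA) * nrm X1 (h0 y - h0 y') \<le> Lf * cA * nrm Y1 (y - y')" by (simp add: algebra_simps)
  then show ?thesis using cA(3) by (simp add: Kh_def field_simps)
qed

lemma h0_ncont: "ncont Y1 I v \<Longrightarrow> ncont X1 I (\<lambda>s. h0 (v s))"
  by (rule ncont_lipschitz[OF _ nX1 _ h0_lip]) (auto simp: ncont_def h0)

lemma f_ncont: "ncont X1 I u \<Longrightarrow> ncont Y1 I v \<Longrightarrow> ncont Xg I (\<lambda>s. f (u s) (v s))"
  by (rule ncont_lipschitz2[OF _ _ nXg _ f_lip]) (auto simp: ncont_def f_range)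

lemma g_ncont: "ncont X1 I u \<Longrightarrow> ncont Y1 I v \<Longrightarrow> ncont Yd I (\<lambda>s. g (u s) (v s))"
  by (rule ncont_lipschitz2[OF _ _ nYd _ g_lip]) (auto simp: ncont_def g_range)

subsection \<open>Well-posedness\<close>

text \<open>The generator in slow time.\<close>

abbreviation Ae where "Ae \<epsilon> x \<equiv> A x /\<^sub>R \<epsilon>"

lemma Xg_rescaled: "\<epsilon> > 0 \<Longrightarrow> smoothing_semigroup (Ae \<epsilon>) (\<lambda>t. TA (t / \<epsilon>)) X1 Xg (\<lambda>y. R (\<epsilon> *\<^sub>R y)) 0
    (c1 * \<epsilon>) (c2 / \<epsilon>) cg (CA * \<epsilon> powr (1 - \<gamma>)) \<gamma> (\<omega>A / \<epsilon>)"
  by (rule smoothing_semigroup_rescale[OF Xg.smoothing_semigroup_axioms])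

lemma Xd_rescaled: "\<epsilon> > 0 \<Longrightarrow> smoothing_semigroup (Ae \<epsilon>) (\<lambda>t. TA (t / \<epsilon>)) X1 Xd (\<lambda>y. R (\<epsilon> *\<^sub>R y)) 0
    (c1 * \<epsilon>) (c2 / \<epsilon>) cd (CA * \<epsilon> powr (1 - \<delta>)) \<delta> (\<omega>A / \<epsilon>)"
  by (rule smoothing_semigroup_rescale[OF Xd.smoothing_semigroup_axioms])

lemma wpX: "\<epsilon> > 0 \<Longrightarrow> well_posed X1 Xg (Ae \<epsilon>)"
  by (rule smoothing_semigroup.well_posed[OF Xg_rescaled complete(1)])

lemma wpY: "well_posed Y1 Yd B"
  by (rule Y.well_posed[OF complete(2)])

lemma nrm_scale: "normed_nspace E \<Longrightarrow> \<epsilon> > 0 \<Longrightarrow> x \<in> carr E \<Longrightarrow> nrm E (x /\<^sub>R \<epsilon>) = nrm E x / \<epsilon>"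
  using normed_nspaceD(4)[of E x "inverse \<epsilon>"] by (simp add: divide_inverse mult.commute)

text \<open>The two halves of the fast-slow system as strict solutions.\<close>

definition fs_strict where
  "fs_strict \<epsilon> u v \<longleftrightarrow> strict_solution X1 (Ae \<epsilon>) (\<lambda>t. f (u t) (v t) /\<^sub>R \<epsilon>) u \<and>
     strict_solution Y1 B (\<lambda>t. g (u t) (v t)) v"

lemma fast_slow_solution_iff:
  assumes \<epsilon>: "\<epsilon> > 0"
  shows "fast_slow_solution A B f g X1 Y1 \<epsilon> u0 v0 u v \<longleftrightarrow> u 0 = u0 \<and> v 0 = v0 \<and> fs_strict \<epsilon> u v"
proof
  assume s: "fast_slow_solution A B f g X1 Y1 \<epsilon> u0 v0 u v"
  then obtain u' v' where d: "\<And>t. t \<ge> 0 \<Longrightarrow> (u has_vector_derivative u' t) (at t within {0..}) \<and>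
      (v has_vector_derivative v' t) (at t within {0..}) \<and> \<epsilon> *\<^sub>R u' t = A (u t) + f (u t) (v t) \<and>
      v' t = B (v t) + g (u t) (v t)" unfolding fast_slow_solution_def by blast
  have "u' t = Ae \<epsilon> (u t) + f (u t) (v t) /\<^sub>R \<epsilon>" if "t \<ge> 0" for t
  proof -
    have "u' t = (\<epsilon> *\<^sub>R u' t) /\<^sub>R \<epsilon>" using \<epsilon> by simp
    then show ?thesis using d[OF that] by (simp add: scaleR_right_distrib)
  qed
  then show "u 0 = u0 \<and> v 0 = v0 \<and> fs_strict \<epsilon> u v"
    using s d unfolding fast_slow_solution_def fs_strict_def strict_solution_def
      continuous_map_ntop_iff[OF nX1] continuous_map_ntop_iff[OF nY1] by auto
next
  assume s: "u 0 = u0 \<and> v 0 = v0 \<and> fs_strict \<epsilon> u v"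
  then have c: "ncont X1 {0..} u" "ncont Y1 {0..} v" by (auto simp: fs_strict_def strict_solution_def)
  have "continuous_on {0..} (\<lambda>t. Ae \<epsilon> (u t) + f (u t) (v t) /\<^sub>R \<epsilon>)"
    by (intro smoothing_semigroup.strict_rhs_continuous[OF Xg_rescaled[OF \<epsilon>] c(1)] continuous_intros
        Xg.E_continuous f_ncont c)
  moreover have "continuous_on {0..} (\<lambda>t. B (v t) + g (u t) (v t))"
    by (rule Y.strict_rhs_continuous[OF c(2) Y.E_continuous[OF g_ncont[OF c]]])
  ultimately show "fast_slow_solution A B f g X1 Y1 \<epsilon> u0 v0 u v"
    using s c \<epsilon> unfolding fast_slow_solution_def fs_strict_def strict_solution_def
      continuous_map_ntop_iff[OF nX1] continuous_map_ntop_iff[OF nY1]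
    by (intro conjI exI[of _ "\<lambda>t. Ae \<epsilon> (u t) + f (u t) (v t) /\<^sub>R \<epsilon>"] exI[of _ "\<lambda>t. B (v t) + g (u t) (v t)"])
      (auto simp: scaleR_right_distrib)
qed

lemma fs_strict_iff:
  "fs_strict \<epsilon> u v \<longleftrightarrow> strict_solution (nprod X1 Y1) (\<lambda>p. (Ae \<epsilon> (fst p), B (snd p)))
     (\<lambda>t. (\<lambda>t p. (f (fst p) (snd p) /\<^sub>R \<epsilon>, g (fst p) (snd p))) t (u t, v t)) (\<lambda>t. (u t, v t))"
  unfolding fs_strict_def strict_solution_def ncont_nprod[OF nX1 nY1]
  by (auto simp: has_vector_derivative_Pair_iff)

lemma fs_ex1:
  assumes \<epsilon>: "\<epsilon> > 0" and u0: "u0 \<in> carr X1" and v0: "v0 \<in> carr Y1"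
  shows "\<exists>u v. u 0 = u0 \<and> v 0 = v0 \<and> fs_strict \<epsilon> u v"
    and "fs_strict \<epsilon> u v \<Longrightarrow> fs_strict \<epsilon> u2 v2 \<Longrightarrow> u 0 = u2 0 \<Longrightarrow> v 0 = v2 0 \<Longrightarrow> t \<ge> 0 \<Longrightarrow> u t = u2 t \<and> v t = v2 t"
proof -
  let ?N = "\<lambda>(t::real) p. (f (fst p) (snd p) /\<^sub>R \<epsilon>, g (fst p) (snd p))"
  have wp: "well_posed (nprod X1 Y1) (nprod Xg Yd) (\<lambda>p. (Ae \<epsilon> (fst p), B (snd p)))"
    by (rule well_posed_nprod[OF wpX[OF \<epsilon>] wpY])
  have lip: "nrm (nprod Xg Yd) (?N t p - ?N t p') \<le> (Lf / \<epsilon> + Lg) * nrm (nprod X1 Y1) (p - p')"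
    if "p \<in> carr (nprod X1 Y1)" "p' \<in> carr (nprod X1 Y1)" for t p p'
  proof -
    obtain x y x' y' where p: "p = (x, y)" "p' = (x', y')" by force
    then have c: "x \<in> carr X1" "y \<in> carr Y1" "x' \<in> carr X1" "y' \<in> carr Y1" using that by auto
    have "nrm Xg (f x y /\<^sub>R \<epsilon> - f x' y' /\<^sub>R \<epsilon>) = nrm Xg (f x y - f x' y') / \<epsilon>"
      using nrm_scale[OF nXg \<epsilon> nspace_carr(3)[OF nXg f_range[OF c(1,2)] f_range[OF c(3,4)]]]
      by (simp add: scaleR_right_diff_distrib)
    also have "\<dots> \<le> Lf * (nrm X1 (x - x') + nrm Y1 (y - y')) / \<epsilon>"
      using f_lip[OF c(1,3,2,4)] \<epsilon> by (intro divide_right_mono) auto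
    finally show ?thesis using g_lip[OF c(1,3,2,4)] by (simp add: p nrm_nprod algebra_simps add_divide_distrib)
  qed
  have nc: "ncont (nprod Xg Yd) {0..} (\<lambda>t. ?N t (z t))" if "ncont (nprod X1 Y1) {0..} z" for z
  proof -
    have c: "ncont X1 {0..} (\<lambda>t. fst (z t))" "ncont Y1 {0..} (\<lambda>t. snd (z t))"
      using that ncont_nprod[OF nX1 nY1, of "{0..}" "\<lambda>t. fst (z t)" "\<lambda>t. snd (z t)"] by auto
    show ?thesis unfolding ncont_nprod[OF nXg nYd]
      by (intro conjI ncont_scaleR nXg f_ncont g_ncont c)
  qed
  have "\<exists>z. z 0 = (u0, v0) \<and> strict_solution (nprod X1 Y1) (\<lambda>p. (Ae \<epsilon> (fst p), B (snd p))) (\<lambda>t. ?N t (z t)) z"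
    by (rule semilinear_exists[OF wp _ lip nc]) (use u0 v0 in auto)
  then obtain z where z: "z 0 = (u0, v0)"
    "strict_solution (nprod X1 Y1) (\<lambda>p. (Ae \<epsilon> (fst p), B (snd p))) (\<lambda>t. ?N t (z t)) z" by blast
  have "fs_strict \<epsilon> (\<lambda>t. fst (z t)) (\<lambda>t. snd (z t))" unfolding fs_strict_iff using z(2) by simp
  then show "\<exists>u v. u 0 = u0 \<and> v 0 = v0 \<and> fs_strict \<epsilon> u v"
    using z(1) by (intro exI[of _ "\<lambda>t. fst (z t)"] exI[of _ "\<lambda>t. snd (z t)"]) simp
  assume a: "fs_strict \<epsilon> u v" "fs_strict \<epsilon> u2 v2" and i: "u 0 = u2 0" "v 0 = v2 0" and t: "t \<ge> 0"
  have "(\<lambda>t. (u t, v t)) t = (\<lambda>t. (u2 t, v2 t)) t"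
    by (rule semilinear_unique[where N = ?N, OF wp lip nc a[unfolded fs_strict_iff] _ t]) (simp_all add: i)
  then show "u t = u2 t \<and> v t = v2 t" by simp
qed

lemma fast_slow_flow_eq:
  assumes \<epsilon>: "\<epsilon> > 0" and c: "u0 \<in> carr X1" "v0 \<in> carr Y1"
    and uv: "u 0 = u0" "v 0 = v0" "fs_strict \<epsilon> u v" and t: "t \<ge> 0"
  shows "fast_slow_flow A B f g X1 Y1 \<epsilon> t (u0, v0) = (u t, v t)"
  unfolding fast_slow_flow_def fst_conv snd_conv fast_slow_solution_iff[OF \<epsilon>]
proof (rule the_equality)
  show "\<exists>u' v'. (u' 0 = u0 \<and> v' 0 = v0 \<and> fs_strict \<epsilon> u' v') \<and> (u t, v t) = (u' t, v' t)" using uv by blast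
  fix q assume "\<exists>u' v'. (u' 0 = u0 \<and> v' 0 = v0 \<and> fs_strict \<epsilon> u' v') \<and> q = (u' t, v' t)"
  then obtain u' v' where *: "u' 0 = u0" "v' 0 = v0" "fs_strict \<epsilon> u' v'" "q = (u' t, v' t)" by blast
  then show "q = (u t, v t)" using fs_ex1(2)[OF \<epsilon> c *(3) uv(3) _ _ t] uv by simp
qed

text \<open>The slow flow on the critical manifold.\<close>

definition slow_strict where "slow_strict v \<longleftrightarrow> strict_solution Y1 B (\<lambda>t. g (h0 (v t)) (v t)) v"

lemma slow_lip:
  assumes "y \<in> carr Y1" "y' \<in> carr Y1"
  shows "nrm Yd (g (h0 y) y - g (h0 y') y') \<le> (Lg * (Kh + 1)) * nrm Y1 (y - y')"
proof -
  have "nrm Yd (g (h0 y) y - g (h0 y') y') \<le> Lg * (nrm X1 (h0 y - h0 y') + nrm Y1 (y - y'))"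
    by (intro g_lip h0 assms)
  also have "\<dots> \<le> Lg * (Kh * nrm Y1 (y - y') + nrm Y1 (y - y'))"
    using lip_pos h0_lip[OF assms] by (intro mult_left_mono add_mono) auto
  finally show ?thesis by (simp add: algebra_simps)
qed

lemma slow_ncont: "ncont Y1 {0..} v \<Longrightarrow> ncont Yd {0..} (\<lambda>t. g (h0 (v t)) (v t))"
  by (intro g_ncont h0_ncont)

lemma slow_exists: "v0 \<in> carr Y1 \<Longrightarrow> \<exists>v. v 0 = v0 \<and> slow_strict v"
  unfolding slow_strict_def
  by (rule semilinear_exists[where N = "\<lambda>_ y. g (h0 y) y", OF wpY _ slow_lip slow_ncont])

lemma slow_unique: "slow_strict v \<Longrightarrow> slow_strict v2 \<Longrightarrow> v 0 = v2 0 \<Longrightarrow> t \<ge> 0 \<Longrightarrow> v t = v2 t"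
  unfolding slow_strict_def
  by (rule semilinear_unique[where N = "\<lambda>_ y. g (h0 y) y", OF wpY slow_lip slow_ncont])

text \<open>Along a slow trajectory \<open>v\<close>, the curve \<open>h\<^sup>0(v)\<close> is continuously differentiable with values in \<open>Xd\<close>, and its
  derivative is controlled by \<open>v\<close>. The derivative at time \<open>t\<close> is obtained on the interval \<open>[0,t+1]\<close>, in which
  \<open>t\<close> is not the right end.\<close>

lemma slow_C1:
  "\<exists>K\<ge>0. \<forall>v. slow_strict v \<longrightarrow> (\<exists>d. ncont Xd {0..} d \<and>
     (\<forall>t\<ge>0. ((\<lambda>s. h0 (v s)) has_vector_derivative d t) (at t within {0..})) \<and>
     (\<forall>t\<ge>0. \<forall>V. (\<forall>s\<in>{0..t + 1}. nrm Y1 (v s) \<le> V) \<longrightarrow> nrm Xd (d t) \<le> K * V))"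
proof -
  obtain cY where cY: "cY \<ge> 0" "\<And>x. x \<in> carr Y1 \<Longrightarrow> norm x \<le> cY * nrm Y1 x" using Y.norm_le_E1 by blast
  \<comment> \<open>\<open>k\<close> bounds \<open>v\<close> and \<open>v'\<close> in the ambient norm by the norm of \<open>v\<close> in \<open>Y1\<close>\<close>
  define k where "k = d2 + \<bar>\<mu>B\<bar> * cY + \<bar>ce\<bar> * (Lg * (Kh + 1)) + cY"
  have k: "k \<ge> 0" using Y.pos cY lip_pos Kh_nonneg by (simp add: k_def)
  show ?thesis
  proof (intro exI[of _ "KH * k"] conjI allI impI)
    show "0 \<le> KH * k" using KH k by simp
    fix v assume v: "slow_strict v"
    let ?h = "\<lambda>s. h0 (v s)" and ?v' = "\<lambda>s. B (v s) + g (h0 (v s)) (v s)"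
    have vc: "ncont Y1 {0..} v" and vd: "\<And>t. t \<ge> 0 \<Longrightarrow> (v has_vector_derivative ?v' t) (at t within {0..})"
      using v by (auto simp: slow_strict_def strict_solution_def)
    have v1: "v s \<in> carr Y1" if "s \<ge> 0" for s using vc that by (auto simp: ncont_def)
    have wn: "ncont (whole_space :: 'y nspace) {0..t} z" if "continuous_on {0..} z" for z t
      unfolding ncont_def whole_space_def
    proof (intro conjI ballI)
      fix s assume s: "s \<in> {0..t}"
      have "(z \<longlongrightarrow> z s) (at s within {0..t})"
        using that s by (auto simp: continuous_on_def intro: tendsto_within_subset)
      then show "((\<lambda>r. nrm (NSpace UNIV norm) (z r - z s)) \<longlongrightarrow> 0) (at s within {0..t})"
        by (auto intro: tendsto_norm_zero LIM_zero)
    qed simp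
    have C1v: "C1_with whole_space t v ?v'" for t
      unfolding C1_with_def
    proof (intro conjI ballI wn)
      show "continuous_on {0..} v" by (rule ncont_imp_continuous_on[OF nY1 vc cY(2)])
      show "continuous_on {0..} ?v'"
        by (intro Y.strict_rhs_continuous vc Y.E_continuous slow_ncont)
      fix s assume s: "s \<in> {0..t}"
      have "(v has_vector_derivative ?v' s) (at s within {0..t})"
        by (rule has_vector_derivative_within_subset[OF vd]) (use s in auto)
      then show "((\<lambda>r. nrm whole_space ((v r - v s) /\<^sub>R (r - s) - ?v' s)) \<longlongrightarrow> 0) (at s within {0..t})"
        unfolding has_vector_derivative_iff_slope whole_space_def by (auto intro: tendsto_norm_zero LIM_zero)
    qed
    have bd: "norm (v s) \<le> k * nrm Y1 (v s) \<and> norm (?v' s) \<le> k * nrm Y1 (v s)" if s: "s \<ge> 0" for s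
    proof -
      let ?n = "nrm Y1 (v s)"
      have n: "0 \<le> ?n" using normed_nspaceD(2)[OF nY1 v1[OF s]] .
      have gd: "g (h0 (v s)) (v s) \<in> carr Yd" by (intro g_range h0 v1 s)
      have "norm (g (h0 (v s)) (v s)) \<le> \<bar>ce\<bar> * nrm Yd (g (h0 (v s)) (v s))"
        by (rule le_abs_mult[OF Y.E_embeds[OF gd] normed_nspaceD(2)[OF nYd gd]])
      also have "\<dots> \<le> \<bar>ce\<bar> * (Lg * (Kh + 1) * ?n)"
        using slow_lip[OF v1[OF s] nspace_carr(1)[OF nY1]] by (intro mult_left_mono) (simp_all add: h0_zero zero)
      finally have 1: "norm (g (h0 (v s)) (v s)) \<le> \<bar>ce\<bar> * (Lg * (Kh + 1)) * ?n" by (simp add: mult.assoc)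
      have "norm (B (v s)) \<le> norm (B (v s) - \<mu>B *\<^sub>R v s) + norm (\<mu>B *\<^sub>R v s)"
        using norm_triangle_ineq[of "B (v s) - \<mu>B *\<^sub>R v s" "\<mu>B *\<^sub>R v s"] by simp
      also have "\<dots> \<le> d2 * ?n + \<bar>\<mu>B\<bar> * (cY * ?n)"
        using Y.E1_lower[OF v1[OF s]] mult_left_mono[OF cY(2)[OF v1[OF s]], of "\<bar>\<mu>B\<bar>"] by (intro add_mono) auto
      finally have 2: "norm (B (v s)) \<le> (d2 + \<bar>\<mu>B\<bar> * cY) * ?n" by (simp add: algebra_simps)
      have "norm (?v' s) \<le> norm (B (v s)) + norm (g (h0 (v s)) (v s))" by (rule norm_triangle_ineq)
      also have "\<dots> \<le> (d2 + \<bar>\<mu>B\<bar> * cY + \<bar>ce\<bar> * (Lg * (Kh + 1))) * ?n" using 1 2 by (simp add: algebra_simps)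
      also have "\<dots> \<le> k * ?n" using n cY(1) by (intro mult_right_mono) (auto simp: k_def)
      finally have 3: "norm (?v' s) \<le> k * ?n" .
      have "norm (v s) \<le> cY * ?n" by (rule cY(2)[OF v1[OF s]])
      also have "\<dots> \<le> k * ?n" using n Y.pos lip_pos Kh_nonneg cY(1) by (intro mult_right_mono) (auto simp: k_def)
      finally show ?thesis using 3 by simp
    qed
    have loc: "\<exists>d. C1_with Xd (t + 1) ?h d \<and> (\<forall>V. (\<forall>s\<in>{0..t + 1}. nrm Y1 (v s) \<le> V) \<longrightarrow> (\<forall>s\<in>{0..t + 1}. nrm Xd (d s) \<le> KH * k * V))"
      if t: "t \<ge> 0" for t
    proof -
      have vt: "ncont Y1 {0..t + 1} v" by (rule ncont_subset[OF vc]) auto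
      let ?top = "SUP s\<in>{0..t + 1}. nrm Y1 (v s)"
      have "norm (v s) \<le> k * ?top \<and> norm (?v' s) \<le> k * ?top" if s: "s \<in> {0..t + 1}" for s
        using bd[of s] mult_left_mono[OF SUP_nrm[OF nY1 vt s] k] s by force
      moreover have "x = h0 (v s)" if "s \<in> {0..t + 1}" "x \<in> carr X1" "x = - R (f x (v s))" for s x
      proof (rule h0_unique)
        have "A x = - f x (v s)" using that(3) A_R R_uminus by metis
        then show "0 = A x + f x (v s)" by simp
      qed (use that v1 in auto)
      ultimately obtain d where d: "C1_with Xd (t + 1) ?h d" "\<forall>s\<in>{0..t + 1}. nrm Xd (d s) \<le> KH * (k * ?top)"
        using critical_C1[of "t + 1" v ?v' "k * ?top" ?h, OF _ C1v vt] t by auto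
      have "nrm Xd (d s) \<le> KH * k * V" if V: "\<forall>s\<in>{0..t + 1}. nrm Y1 (v s) \<le> V" and s: "s \<in> {0..t + 1}" for V s
      proof -
        have "?top \<le> V" by (rule cSUP_least) (use V t in auto)
        then have "KH * (k * ?top) \<le> KH * (k * V)" by (intro mult_left_mono KH k)
        then show ?thesis using d(2) s by (force simp: mult.assoc)
      qed
      then show ?thesis using d(1) by blast
    qed
    define d where "d t = (SOME d. C1_with Xd (t + 1) ?h d \<and> (\<forall>V. (\<forall>s\<in>{0..t + 1}. nrm Y1 (v s) \<le> V) \<longrightarrow> (\<forall>s\<in>{0..t + 1}. nrm Xd (d s) \<le> KH * k * V)))" for t
    have d: "C1_with Xd (t + 1) ?h (d t)"
      "\<And>V s. (\<forall>s\<in>{0..t + 1}. nrm Y1 (v s) \<le> V) \<Longrightarrow> s \<in> {0..t + 1} \<Longrightarrow> nrm Xd (d t s) \<le> KH * k * V" if "t \<ge> 0" for t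
      using someI_ex[OF loc[OF that]] unfolding d_def by blast+
    have at_eq: "at s within {0..t + 1} = at s within {0..}" if "0 \<le> s" "s < t + 1" for s t :: real
      by (rule at_within_nhd[of s "{..<t + 1}"]) (use that in auto)
    have der: "(?h has_vector_derivative d t s) (at s within {0..})" if "0 \<le> s" "s < t + 1" "t \<ge> 0" for s t
    proof -
      have st: "s \<in> {0..t + 1}" using that by auto
        note C = C1_withD[OF d(1)[OF that(3)]]
        have "\<forall>\<^sub>F r in at s within {0..t + 1}. norm ((?h r - ?h s) /\<^sub>R (r - s) - d t s)
            \<le> cd * nrm Xd ((?h r - ?h s) /\<^sub>R (r - s) - d t s)"
          using C(1,2) st Xd.E_embeds nspace_carr[OF nXd] by (auto simp: eventually_at_filter)
        from Lim_null_comparison[OF this tendsto_mult_right_zero[OF C(3)[OF st]]]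
        have "(?h has_vector_derivative d t s) (at s within {0..t + 1})"
          unfolding has_vector_derivative_iff_slope by (simp add: LIM_zero_iff)
        then show ?thesis by (simp only: at_eq[OF that(1,2)])
    qed
    have nb: "at s within {0..} \<noteq> bot" if "s \<ge> 0" for s :: real
      using at_within_interval_not_bot[of "s + 1" s] that by (simp add: at_eq)
    have uniq: "d t s = d s s" if "0 \<le> s" "s < t + 1" "t \<ge> 0" for s t
      by (rule vector_derivative_unique_within[OF nb der der]) (use that in auto)
    show "\<exists>d. ncont Xd {0..} d \<and> (\<forall>t\<ge>0. (?h has_vector_derivative d t) (at t within {0..})) \<and>
       (\<forall>t\<ge>0. \<forall>V. (\<forall>s\<in>{0..t + 1}. nrm Y1 (v s) \<le> V) \<longrightarrow> nrm Xd (d t) \<le> KH * k * V)"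
    proof (intro exI[of _ "\<lambda>s. d s s"] conjI allI impI)
      show "ncont Xd {0..} (\<lambda>s. d s s)" unfolding ncont_def
      proof (intro conjI ballI)
        fix t :: real assume "t \<in> {0..}"
        then have t: "t \<ge> 0" by simp
        show "d t t \<in> carr Xd" using C1_withD(2)[OF d(1)[OF t], of t] t by simp
        have "((\<lambda>s. nrm Xd (d t s - d t t)) \<longlongrightarrow> 0) (at t within {0..t + 1})"
          using d(1)[OF t] t by (auto simp: C1_with_def ncont_def)
        then have "((\<lambda>s. nrm Xd (d t s - d t t)) \<longlongrightarrow> 0) (at t within {0..})" using at_eq[of t t] t by simp
        moreover have "\<forall>\<^sub>F s in at t within {0..}. nrm Xd (d t s - d t t) = nrm Xd (d s s - d t t)"
        proof -
          have "\<forall>\<^sub>F s in at t within {0..}. s < t + 1" by (rule order_tendstoD(2)[OF tendsto_ident_at]) simp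
          moreover have "\<forall>\<^sub>F s in at t within {0..}. s \<in> {0..}" by (simp add: eventually_at_filter)
          ultimately show ?thesis
          proof eventually_elim
            case (elim s) then show ?case using uniq[of s t] t by simp
          qed
        qed
        ultimately show "((\<lambda>s. nrm Xd (d s s - d t t)) \<longlongrightarrow> 0) (at t within {0..})"
          by (rule Lim_transform_eventually)
      qed
      show "(?h has_vector_derivative d t t) (at t within {0..})" if "0 \<le> t" for t using der[of t t] that by simp
      show "nrm Xd (d t t) \<le> KH * k * V" if "0 \<le> t" "\<forall>s\<in>{0..t + 1}. nrm Y1 (v s) \<le> V" for t V
        using d(2)[OF that(1,2), of t] that by simp
    qed
  qed
qed

end

context fast_slow
begin

subsection \<open>The extended slow system\<close>

lemma inv_into_A: "y \<in> carr Y1 \<Longrightarrow> inv_into (carr X1) A (f (h0 y) y) = - h0 y"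
proof (rule inv_into_f_eq)
  assume y: "y \<in> carr Y1"
  show "inj_on A (carr X1)" by (rule inj_on_inverseI[of _ R]) (rule R_A)
  show "- h0 y \<in> carr X1" using nspace_carr(5)[OF nX1 h0(1)[OF y]] .
  show "A (- h0 y) = f (h0 y) y" using A_R[of "f (h0 y) y"] h0_R[OF y] by simp
qed

text \<open>The deviation \<open>u - h\<^sup>0(v)\<close> from the critical manifold solves a semilinear problem without the
  derivative of the inhomogeneity.\<close>

definition dev_strict where
  "dev_strict \<epsilon> v w \<longleftrightarrow> strict_solution X1 (Ae \<epsilon>) (\<lambda>t. (f (w t + h0 (v t)) (v t) - f (h0 (v t)) (v t)) /\<^sub>R \<epsilon>) w"

lemma dev_problem:
  assumes \<epsilon>: "\<epsilon> > 0" and v: "ncont Y1 {0..} v"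
  defines "N \<equiv> \<lambda>t w. (f (w + h0 (v t)) (v t) - f (h0 (v t)) (v t)) /\<^sub>R \<epsilon>"
  shows "\<And>t x y. t \<ge> 0 \<Longrightarrow> x \<in> carr X1 \<Longrightarrow> y \<in> carr X1 \<Longrightarrow> nrm Xg (N t x - N t y) \<le> Lf / \<epsilon> * nrm X1 (x - y)"
    and "\<And>z. ncont X1 {0..} z \<Longrightarrow> ncont Xg {0..} (\<lambda>t. N t (z t))"
    and "\<And>t. N t 0 = 0" and "\<And>t x. t \<ge> 0 \<Longrightarrow> x \<in> carr X1 \<Longrightarrow> N t x \<in> carr Xg"
proof -
  have vc: "v t \<in> carr Y1" "h0 (v t) \<in> carr X1" if "t \<ge> 0" for t using v that h0(1) by (auto simp: ncont_def)
  have fc: "f (x + h0 (v t)) (v t) \<in> carr Xg" if "t \<ge> 0" "x \<in> carr X1" for x t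
    using f_range nspace_carr(2)[OF nX1] vc that by auto
  show "nrm Xg (N t x - N t y) \<le> Lf / \<epsilon> * nrm X1 (x - y)" if t: "t \<ge> 0" and xy: "x \<in> carr X1" "y \<in> carr X1" for t x y
  proof -
    have "N t x - N t y = (f (x + h0 (v t)) (v t) - f (y + h0 (v t)) (v t)) /\<^sub>R \<epsilon>"
      by (simp add: N_def scaleR_right_diff_distrib)
    then have "nrm Xg (N t x - N t y) = nrm Xg (f (x + h0 (v t)) (v t) - f (y + h0 (v t)) (v t)) / \<epsilon>"
      using nrm_scale[OF nXg \<epsilon> nspace_carr(3)[OF nXg fc[OF t xy(1)] fc[OF t xy(2)]]] by simp
    also have "\<dots> \<le> Lf * (nrm X1 (x + h0 (v t) - (y + h0 (v t))) + nrm Y1 (v t - v t)) / \<epsilon>"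
      using \<epsilon> vc[OF t] xy nspace_carr(2)[OF nX1] by (intro divide_right_mono f_lip) auto
    finally show ?thesis by (simp add: nrm_zero[OF nY1])
  qed
  show "ncont Xg {0..} (\<lambda>t. N t (z t))" if "ncont X1 {0..} z" for z
    unfolding N_def
    by (intro ncont_scaleR ncont_diff nXg f_ncont ncont_add nX1 h0_ncont v that)
  show "N t 0 = 0" for t by (simp add: N_def)
  show "N t x \<in> carr Xg" if "t \<ge> 0" "x \<in> carr X1" for t x
    using fc[OF that] fc[OF that(1) nspace_carr(1)[OF nX1]] nspace_carr[OF nXg] by (simp add: N_def)
qed

lemma dev_exists:
  assumes "\<epsilon> > 0" "ncont Y1 {0..} v" "w0 \<in> carr X1"
  shows "\<exists>w. w 0 = w0 \<and> dev_strict \<epsilon> v w"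
  unfolding dev_strict_def
  by (rule semilinear_exists[where N = "\<lambda>t w. (f (w + h0 (v t)) (v t) - f (h0 (v t)) (v t)) /\<^sub>R \<epsilon>",
      OF wpX[OF assms(1)] assms(3) dev_problem(1,2)[OF assms(1,2)]])

lemma dev_unique:
  assumes "\<epsilon> > 0" "ncont Y1 {0..} v" "dev_strict \<epsilon> v w" "dev_strict \<epsilon> v w2" "w 0 = w2 0" "t \<ge> 0"
  shows "w t = w2 t"
  by (rule semilinear_unique[where N = "\<lambda>t w. (f (w + h0 (v t)) (v t) - f (h0 (v t)) (v t)) /\<^sub>R \<epsilon>",
      OF wpX[OF assms(1)] dev_problem(1,2)[OF assms(1,2)] assms(3,4)[unfolded dev_strict_def] assms(5,6)])

lemma extended_slow_solution_iff:
  assumes \<epsilon>: "\<epsilon> > 0" and v: "slow_strict v" and d: "ncont Xd {0..} d"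
    and hd: "\<And>t. t \<ge> 0 \<Longrightarrow> ((\<lambda>s. h0 (v s)) has_vector_derivative d t) (at t within {0..})"
  shows "extended_slow_solution A B f g X1 Y1 \<epsilon> u0 v0 u v \<longleftrightarrow>
    u 0 = u0 \<and> v 0 = v0 \<and> dev_strict \<epsilon> v (\<lambda>t. u t - h0 (v t))"
proof -
  let ?h = "\<lambda>s. h0 (v s)" and ?w = "\<lambda>t. u t - h0 (v t)"
  have vn: "ncont Y1 {0..} v" and vd: "\<And>t. t \<ge> 0 \<Longrightarrow> (v has_vector_derivative B (v t) + g (h0 (v t)) (v t)) (at t within {0..})"
    using v by (auto simp: slow_strict_def strict_solution_def)
  have vc: "v t \<in> carr Y1" if "t \<ge> 0" for t using vn that by (auto simp: ncont_def)
  have hn: "ncont X1 {0..} ?h" by (rule h0_ncont[OF vn])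
  have kd: "((\<lambda>s. inv_into (carr X1) A (f (h0 (v s)) (v s))) has_vector_derivative - d t) (at t within {0..})" if "t \<ge> 0" for t
    by (rule has_vector_derivative_transform[OF _ _ has_vector_derivative_minus[OF hd[OF that]]])
      (use that inv_into_A vc in auto)
  have nb: "at t within {0..} \<noteq> bot" if "t \<ge> 0" for t :: real
    using at_within_interval_not_bot[of "t + 1" t] at_le[of "{0..t+1}" "{0..}" t] that
    by (auto simp: bot_unique)
  have Ah: "Ae \<epsilon> (u t - ?h t) + (f (u t - ?h t + ?h t) (v t) - f (?h t) (v t)) /\<^sub>R \<epsilon> = Ae \<epsilon> (u t) + f (u t) (v t) /\<^sub>R \<epsilon>"
    if "u t \<in> carr X1" "t \<ge> 0" for t
    using Xg.S_diff[OF that(1) h0(1)[OF vc[OF that(2)]]] h0(2)[OF vc[OF that(2)]]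
    by (simp add: scaleR_right_distrib scaleR_right_diff_distrib)
  show ?thesis
  proof
    assume s: "extended_slow_solution A B f g X1 Y1 \<epsilon> u0 v0 u v"
    then obtain u' v' k' where eq: "\<And>t. t \<ge> 0 \<Longrightarrow> (u has_vector_derivative u' t) (at t within {0..}) \<and>
        ((\<lambda>s. inv_into (carr X1) A (f (h0 (v s)) (v s))) has_vector_derivative k' t) (at t within {0..}) \<and>
        \<epsilon> *\<^sub>R u' t = A (u t) + f (u t) (v t) - \<epsilon> *\<^sub>R k' t"
      unfolding extended_slow_solution_def by blast
    have un: "ncont X1 {0..} u" using s by (simp add: extended_slow_solution_def continuous_map_ntop_iff[OF nX1])
    have "dev_strict \<epsilon> v ?w" unfolding dev_strict_def strict_solution_def
    proof (intro conjI allI impI)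
      show "ncont X1 {0..} ?w" by (rule ncont_diff[OF nX1 un hn])
      fix t :: real assume t: "0 \<le> t"
      have uc: "u t \<in> carr X1" using un t by (auto simp: ncont_def)
      have k: "k' t = - d t"
        using vector_derivative_unique_within[OF nb[OF t]] eq[OF t] kd[OF t] by blast
      have "u' t = (\<epsilon> *\<^sub>R u' t) /\<^sub>R \<epsilon>" using \<epsilon> by simp
      also have "\<dots> = Ae \<epsilon> (u t) + f (u t) (v t) /\<^sub>R \<epsilon> + d t"
        using eq[OF t] k \<epsilon> by (simp add: scaleR_right_distrib)
      finally have "u' t - d t = Ae \<epsilon> (u t) + f (u t) (v t) /\<^sub>R \<epsilon>" by simp
      moreover have "(?w has_vector_derivative u' t - d t) (at t within {0..})"
        using eq[OF t] hd[OF t] by (intro has_vector_derivative_diff) auto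
      ultimately show "(?w has_vector_derivative Ae \<epsilon> (?w t) + (f (?w t + ?h t) (v t) - f (?h t) (v t)) /\<^sub>R \<epsilon>) (at t within {0..})"
        using Ah[OF uc t] by simp
    qed
    then show "u 0 = u0 \<and> v 0 = v0 \<and> dev_strict \<epsilon> v ?w" using s by (simp add: extended_slow_solution_def)
  next
    assume s: "u 0 = u0 \<and> v 0 = v0 \<and> dev_strict \<epsilon> v ?w"
    then have w: "ncont X1 {0..} ?w"
      and wd: "\<And>t. t \<ge> 0 \<Longrightarrow> (?w has_vector_derivative Ae \<epsilon> (?w t) + (f (?w t + ?h t) (v t) - f (?h t) (v t)) /\<^sub>R \<epsilon>) (at t within {0..})"
      by (auto simp: dev_strict_def strict_solution_def)
    have un: "ncont X1 {0..} u" using ncont_add[OF nX1 w hn] by simp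
    have fn: "continuous_on {0..} (\<lambda>t. f (u t) (v t))" by (intro Xg.E_continuous f_ncont un vn)
    let ?u' = "\<lambda>t. Ae \<epsilon> (u t) + f (u t) (v t) /\<^sub>R \<epsilon> + d t"
    have c: "continuous_on {0..} (\<lambda>t. Ae \<epsilon> (u t) + f (u t) (v t) /\<^sub>R \<epsilon>)"
      by (intro smoothing_semigroup.strict_rhs_continuous[OF Xg_rescaled[OF \<epsilon>] un] continuous_intros fn)
    have u': "continuous_on {0..} ?u'" by (intro continuous_on_add c Xd.E_continuous d)
    have v': "continuous_on {0..} (\<lambda>t. B (v t) + g (h0 (v t)) (v t))"
      by (intro Y.strict_rhs_continuous vn Y.E_continuous slow_ncont)
    have ud: "(u has_vector_derivative ?u' t) (at t within {0..})" if t: "t \<ge> 0" for t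
    proof -
      have uc: "u t \<in> carr X1" using un t by (auto simp: ncont_def)
      have "((\<lambda>t. ?w t + ?h t) has_vector_derivative ?u' t) (at t within {0..})"
        unfolding Ah[OF uc t, symmetric] by (intro has_vector_derivative_add wd hd t)
      then show ?thesis by simp
    qed
    have eq: "\<epsilon> *\<^sub>R ?u' t = A (u t) + f (u t) (v t) - \<epsilon> *\<^sub>R (- d t)" for t
      using \<epsilon> by (simp add: scaleR_right_distrib)
    have "\<exists>u' v' k'. continuous_on {0..} u' \<and> continuous_on {0..} v' \<and>
        (\<forall>t\<ge>0. (u has_vector_derivative u' t) (at t within {0..}) \<and>
               (v has_vector_derivative v' t) (at t within {0..}) \<and>
               ((\<lambda>s. inv_into (carr X1) A (f (h0 (v s)) (v s))) has_vector_derivative k' t) (at t within {0..}) \<and>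
               \<epsilon> *\<^sub>R u' t = A (u t) + f (u t) (v t) - \<epsilon> *\<^sub>R k' t \<and>
               v' t = B (v t) + g (h0 (v t)) (v t))"
      by (rule exI[of _ ?u'], rule exI[of _ "\<lambda>t. B (v t) + g (h0 (v t)) (v t)"], rule exI[of _ "\<lambda>t. - d t"])
        (use u' v' ud vd kd eq in blast)
    then show "extended_slow_solution A B f g X1 Y1 \<epsilon> u0 v0 u v"
      using un vn s unfolding extended_slow_solution_def continuous_map_ntop_iff[OF nX1] continuous_map_ntop_iff[OF nY1]
      by blast
  qed
qed

lemma extended_imp_slow: "extended_slow_solution A B f g X1 Y1 \<epsilon> u0 v0 u v \<Longrightarrow> slow_strict v \<and> v 0 = v0"
  unfolding extended_slow_solution_def slow_strict_def strict_solution_def continuous_map_ntop_iff[OF nY1]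
  by auto

lemma extended_slow_flow_eq:
  assumes \<epsilon>: "\<epsilon> > 0" and v: "slow_strict v" and d: "ncont Xd {0..} d"
    and hd: "\<And>t. t \<ge> 0 \<Longrightarrow> ((\<lambda>s. h0 (v s)) has_vector_derivative d t) (at t within {0..})"
    and w: "dev_strict \<epsilon> v w" and t: "t \<ge> 0"
  shows "extended_slow_flow A B f g X1 Y1 \<epsilon> t (w 0 + h0 (v 0), v 0) = (w t + h0 (v t), v t)"
  unfolding extended_slow_flow_def fst_conv snd_conv
proof (rule the_equality)
  note iff = extended_slow_solution_iff[OF \<epsilon> v d hd]
  have vn: "ncont Y1 {0..} v" using v by (simp add: slow_strict_def strict_solution_def)
  have "extended_slow_solution A B f g X1 Y1 \<epsilon> (w 0 + h0 (v 0)) (v 0) (\<lambda>t. w t + h0 (v t)) v"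
    by (rule iff[THEN iffD2]) (use w in simp_all)
  then show "\<exists>u' v'. extended_slow_solution A B f g X1 Y1 \<epsilon> (w 0 + h0 (v 0)) (v 0) u' v' \<and> (w t + h0 (v t), v t) = (u' t, v' t)"
    by (intro exI[of _ "\<lambda>t. w t + h0 (v t)"] exI[of _ v]) simp
  fix q assume "\<exists>u' v'. extended_slow_solution A B f g X1 Y1 \<epsilon> (w 0 + h0 (v 0)) (v 0) u' v' \<and> q = (u' t, v' t)"
  then obtain u' v' where *: "extended_slow_solution A B f g X1 Y1 \<epsilon> (w 0 + h0 (v 0)) (v 0) u' v'" "q = (u' t, v' t)" by blast
  have v': "slow_strict v'" "v' 0 = v 0" using extended_imp_slow[OF *(1)] by auto
  have vv: "v' s = v s" if "s \<ge> 0" for s using slow_unique[OF v'(1) v v'(2) that] .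
  have vn': "ncont Y1 {0..} v'" using v' by (simp add: slow_strict_def strict_solution_def)
  have hd': "((\<lambda>s. h0 (v' s)) has_vector_derivative d s) (at s within {0..})" if "s \<ge> 0" for s
    by (rule has_vector_derivative_transform[OF _ _ hd[OF that]]) (use that vv in auto)
  have u': "u' 0 = w 0 + h0 (v 0)" and dv: "dev_strict \<epsilon> v' (\<lambda>t. u' t - h0 (v' t))"
    using extended_slow_solution_iff[OF \<epsilon> v'(1) d hd', THEN iffD1, OF _ *(1)] by auto
  have "dev_strict \<epsilon> v' w"
    using w unfolding dev_strict_def by (subst strict_solution_cong) (use vv in auto)
  then have "w t = u' t - h0 (v' t)" by (rule dev_unique[OF \<epsilon> vn' _ dv _ t]) (use u' vv in auto)
  then show "q = (w t + h0 (v t), v t)" using *(2) vv[OF t] by simp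
qed

subsection \<open>Estimates\<close>

lemma slow_growth:
  assumes v: "slow_strict v" and \<mu>: "\<mu> > \<omega>B" and small: "CB * (Lg * (Kh + 1)) * kernel_const \<beta> (\<mu> - \<omega>B) \<le> 1 / 2"
    and t: "t \<ge> 0"
  shows "nrm Y1 (v t) \<le> 2 * MB * nrm Y1 (v 0) * exp (\<mu> * t)"
proof -
  let ?F = "\<lambda>t. g (h0 (v t)) (v t)"
  have vn: "ncont Y1 {0..} v" and vs: "strict_solution Y1 B ?F v" using v by (auto simp: slow_strict_def strict_solution_def)
  have vc: "v s \<in> carr Y1" if "s \<ge> 0" for s using vn that by (auto simp: ncont_def)
  have v0: "0 \<le> nrm Y1 (v 0)" using normed_nspaceD(2)[OF nY1 vc] by simp
  have "nrm Y1 (v t) \<le> (MB * nrm Y1 (v 0)) / (1 - 1 / 2) * exp (\<mu> * t)"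
  proof (rule exponential_gronwall[where \<phi> = "\<lambda>s. nrm Y1 (v s)"])
    show "continuous_on {0..t} (\<lambda>s. nrm Y1 (v s))" by (rule continuous_on_nrm[OF nY1 ncont_subset[OF vn]]) auto
    fix r M assume r: "0 \<le> r" "r \<le> t" and le: "\<And>s. 0 \<le> s \<Longrightarrow> s \<le> r \<Longrightarrow> nrm Y1 (v s) \<le> M * exp (\<mu> * s)"
    have M: "M \<ge> 0" using le[of 0] v0 r by simp
    have "nrm Yd (?F s) \<le> Lg * (Kh + 1) * M * exp (\<mu> * s)" if "0 \<le> s" "s \<le> r" for s
    proof -
      have "nrm Yd (?F s) \<le> Lg * (Kh + 1) * nrm Y1 (v s)"
        using slow_lip[OF vc[OF that(1)] nspace_carr(1)[OF nY1]] by (simp add: h0_zero zero)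
      also have "\<dots> \<le> Lg * (Kh + 1) * (M * exp (\<mu> * s))"
        using lip_pos Kh_nonneg by (intro mult_left_mono le that) auto
      finally show ?thesis by (simp add: mult_ac)
    qed
    then have "nrm Y1 (v r - TB r (v 0)) \<le> CB * (Lg * (Kh + 1) * M) * kernel_const \<beta> (\<mu> - \<omega>B) * exp (\<mu> * r)"
      by (rule Y.strict_solution_bound_exp[OF vs slow_ncont[OF vn] r(1) \<mu>])
    also have "\<dots> = (CB * (Lg * (Kh + 1)) * kernel_const \<beta> (\<mu> - \<omega>B)) * M * exp (\<mu> * r)" by simp
    also have "\<dots> \<le> 1 / 2 * M * exp (\<mu> * r)" using M by (intro mult_right_mono small) auto
    finally have 1: "nrm Y1 (v r - TB r (v 0)) \<le> 1 / 2 * M * exp (\<mu> * r)" .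
    have Tc: "TB r (v 0) \<in> carr Y1" using Y.T_domain(1)[OF vc r(1)] by simp
    have "nrm Y1 (TB r (v 0)) \<le> MB * exp (\<omega>B * r) * nrm Y1 (v 0)" using TB_Y1[OF r(1) vc] by simp
    also have "\<dots> \<le> MB * exp (\<mu> * r) * nrm Y1 (v 0)"
      using MAB v0 \<mu> r by (intro mult_right_mono mult_left_mono) (auto intro: mult_right_mono)
    finally have 2: "nrm Y1 (TB r (v 0)) \<le> MB * nrm Y1 (v 0) * exp (\<mu> * r)" by (simp add: mult_ac)
    have "nrm Y1 (v r) \<le> nrm Y1 (v r - TB r (v 0)) + nrm Y1 (TB r (v 0))"
      using normed_nspaceD(5)[OF nY1 nspace_carr(3)[OF nY1 vc[OF r(1)] Tc] Tc] by simp
    then show "nrm Y1 (v r) \<le> (MB * nrm Y1 (v 0) + 1 / 2 * M) * exp (\<mu> * r)" using 1 2 by (simp add: algebra_simps)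
  qed (use t in auto)
  then show ?thesis by simp
qed

text \<open>The scaling of the kernel constant cancels the powers of \<open>\<epsilon>\<close> that come from slow time.\<close>

lemma rescaled_const:
  assumes "\<epsilon> > 0" "b \<ge> 0" shows "C * \<epsilon> powr (1 - a) * (M / \<epsilon>) * kernel_const a (b / \<epsilon>) = C * M * kernel_const a b"
proof -
  have "\<epsilon> powr (1 - a) * \<epsilon> powr a = \<epsilon>" using assms by (simp add: powr_add[symmetric])
  then show ?thesis using assms by (simp add: kernel_const_scale field_simps)
qed

text \<open>Fast decay of the deviation from the critical manifold.\<close>

lemma dev_decay:
  assumes \<epsilon>: "\<epsilon> > 0" and v: "ncont Y1 {0..} v" and w: "dev_strict \<epsilon> v w"
    and \<kappa>: "\<kappa> > 0" "\<kappa> < - \<omega>A" and \<theta>: "\<theta> = CA * Lf * kernel_const \<gamma> (- \<omega>A - \<kappa>)" "\<theta> < 1" and t: "t \<ge> 0"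
  shows "nrm X1 (w t) \<le> MA / (1 - \<theta>) * nrm X1 (w 0) * exp (- (\<kappa> / \<epsilon>) * t)"
proof -
  interpret Xe: smoothing_semigroup "Ae \<epsilon>" "\<lambda>t. TA (t / \<epsilon>)" X1 Xg "\<lambda>y. R (\<epsilon> *\<^sub>R y)" 0
    "c1 * \<epsilon>" "c2 / \<epsilon>" cg "CA * \<epsilon> powr (1 - \<gamma>)" \<gamma> "\<omega>A / \<epsilon>"
    by (rule Xg_rescaled[OF \<epsilon>])
  let ?N = "\<lambda>t w. (f (w + h0 (v t)) (v t) - f (h0 (v t)) (v t)) /\<^sub>R \<epsilon>"
  let ?\<mu> = "- (\<kappa> / \<epsilon>)"
  note N = dev_problem[OF \<epsilon> v]
  have wn: "ncont X1 {0..} w" and ws: "strict_solution X1 (Ae \<epsilon>) (\<lambda>t. ?N t (w t)) w"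
    using w by (auto simp: dev_strict_def strict_solution_def)
  have wc: "w s \<in> carr X1" if "s \<ge> 0" for s using wn that by (auto simp: ncont_def)
  have w0: "0 \<le> nrm X1 (w 0)" using normed_nspaceD(2)[OF nX1 wc] by simp
  have \<mu>: "\<omega>A / \<epsilon> < ?\<mu>" using \<kappa> \<epsilon> by (simp add: field_simps)
  have "nrm X1 (w t) \<le> (MA * nrm X1 (w 0)) / (1 - \<theta>) * exp (?\<mu> * t)"
  proof (rule exponential_gronwall[where \<phi> = "\<lambda>s. nrm X1 (w s)"])
    show "continuous_on {0..t} (\<lambda>s. nrm X1 (w s))" by (rule continuous_on_nrm[OF nX1 ncont_subset[OF wn]]) auto
    fix r M assume r: "0 \<le> r" "r \<le> t" and le: "\<And>s. 0 \<le> s \<Longrightarrow> s \<le> r \<Longrightarrow> nrm X1 (w s) \<le> M * exp (?\<mu> * s)"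
    have "nrm Xg (?N s (w s)) \<le> Lf * M / \<epsilon> * exp (?\<mu> * s)" if "0 \<le> s" "s \<le> r" for s
    proof -
      have "nrm Xg (?N s (w s)) \<le> Lf / \<epsilon> * nrm X1 (w s)"
        using N(1)[OF that(1) wc[OF that(1)] nspace_carr(1)[OF nX1]] by simp
      also have "\<dots> \<le> Lf / \<epsilon> * (M * exp (?\<mu> * s))" using lip_pos \<epsilon> by (intro mult_left_mono le that) auto
      finally show ?thesis by simp
    qed
    then have "nrm X1 (w r - TA (r / \<epsilon>) (w 0)) \<le> CA * \<epsilon> powr (1 - \<gamma>) * (Lf * M / \<epsilon>) * kernel_const \<gamma> (?\<mu> - \<omega>A / \<epsilon>) * exp (?\<mu> * r)"
      by (rule Xe.strict_solution_bound_exp[OF ws N(2)[OF wn] r(1) \<mu>])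
    also have "?\<mu> - \<omega>A / \<epsilon> = (- \<omega>A - \<kappa>) / \<epsilon>" by (simp add: diff_divide_distrib)
    also have "CA * \<epsilon> powr (1 - \<gamma>) * (Lf * M / \<epsilon>) * kernel_const \<gamma> ((- \<omega>A - \<kappa>) / \<epsilon>) = CA * (Lf * M) * kernel_const \<gamma> (- \<omega>A - \<kappa>)"
      using \<kappa> by (intro rescaled_const \<epsilon>) auto
    finally have 1: "nrm X1 (w r - TA (r / \<epsilon>) (w 0)) \<le> \<theta> * M * exp (?\<mu> * r)" by (simp add: \<theta>(1) mult_ac)
    have r\<epsilon>: "r / \<epsilon> \<ge> 0" using r \<epsilon> by simp
    have Tc: "TA (r / \<epsilon>) (w 0) \<in> carr X1" using Xg.T_domain(1)[OF wc r\<epsilon>] by simp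
    have "nrm X1 (TA (r / \<epsilon>) (w 0)) \<le> MA * exp (\<omega>A * (r / \<epsilon>)) * nrm X1 (w 0)" using TA_X1[OF r\<epsilon> wc] by simp
    also have "\<dots> \<le> MA * exp (?\<mu> * r) * nrm X1 (w 0)"
    proof (intro mult_right_mono mult_left_mono MAB w0)
      have "\<omega>A / \<epsilon> * r \<le> ?\<mu> * r" using \<mu> r by (intro mult_right_mono) auto
      then show "exp (\<omega>A * (r / \<epsilon>)) \<le> exp (?\<mu> * r)" by simp
    qed
    finally have 2: "nrm X1 (TA (r / \<epsilon>) (w 0)) \<le> MA * nrm X1 (w 0) * exp (?\<mu> * r)" by (simp add: mult_ac)
    have "nrm X1 (w r) \<le> nrm X1 (w r - TA (r / \<epsilon>) (w 0)) + nrm X1 (TA (r / \<epsilon>) (w 0))"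
      using normed_nspaceD(5)[OF nX1 nspace_carr(3)[OF nX1 wc[OF r(1)] Tc] Tc] by simp
    then show "nrm X1 (w r) \<le> (MA * nrm X1 (w 0) + \<theta> * M) * exp (?\<mu> * r)" using 1 2 by (simp add: algebra_simps)
  qed (use t \<theta> in auto)
  then show ?thesis by (simp add: mult_ac)
qed

text \<open>The comparison. The difference of the fast components is split into the part driven by the
  difference of the nonlinearities, which is contracted because of the gap condition, and the part
  driven by the derivative of \<open>h\<^sup>0(v)\<close>, which is of order \<open>\<epsilon>\<close>.\<close>

lemma comparison:
  assumes \<epsilon>: "\<epsilon> > 0" "\<epsilon> \<le> 1" and UV: "fs_strict \<epsilon> U V" and v: "slow_strict v" and w: "dev_strict \<epsilon> v w"
    and d: "ncont Xd {0..} d"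
    and hd: "\<And>t. t \<ge> 0 \<Longrightarrow> ((\<lambda>s. h0 (v s)) has_vector_derivative d t) (at t within {0..})"
    and init: "U 0 = w 0 + h0 (v 0)" "V 0 = v 0"
    and \<mu>: "\<mu> > \<omega>B" "\<mu> \<ge> 0" and \<kappa>: "\<kappa> > 0"
    and d_le: "\<And>t. t \<ge> 0 \<Longrightarrow> nrm Xd (d t) \<le> Kd * exp (\<mu> * t)"
    and w_le: "\<And>t. t \<ge> 0 \<Longrightarrow> nrm X1 (w t) \<le> Kw * exp (- (\<kappa> / \<epsilon>) * t)" and Kw: "Kw \<ge> 0"
    and \<theta>: "\<theta> = CA * Lf * kernel_const \<gamma> (- \<omega>A) + CB * Lg * kernel_const \<beta> (\<mu> - \<omega>B)" "\<theta> < 1" and t: "t \<ge> 0"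
  shows "nrm X1 (U t - (w t + h0 (v t))) + nrm Y1 (V t - v t) \<le>
    (\<epsilon> * (CA * Kd * kernel_const \<delta> (- \<omega>A)) + \<epsilon> powr \<beta> * (CB * Lg * Kw * (1 / \<beta> + 1 / \<kappa>))) / (1 - \<theta>) * exp (\<mu> * t)"
proof -
  interpret Xe: smoothing_semigroup "Ae \<epsilon>" "\<lambda>t. TA (t / \<epsilon>)" X1 Xg "\<lambda>y. R (\<epsilon> *\<^sub>R y)" 0
    "c1 * \<epsilon>" "c2 / \<epsilon>" cg "CA * \<epsilon> powr (1 - \<gamma>)" \<gamma> "\<omega>A / \<epsilon>"
    by (rule Xg_rescaled[OF \<epsilon>(1)])
  interpret Xde: smoothing_semigroup "Ae \<epsilon>" "\<lambda>t. TA (t / \<epsilon>)" X1 Xd "\<lambda>y. R (\<epsilon> *\<^sub>R y)" 0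
    "c1 * \<epsilon>" "c2 / \<epsilon>" cd "CA * \<epsilon> powr (1 - \<delta>)" \<delta> "\<omega>A / \<epsilon>"
    by (rule Xd_rescaled[OF \<epsilon>(1)])
  let ?h = "\<lambda>t. h0 (v t)" and ?u = "\<lambda>t. w t + h0 (v t)"
  let ?p = "\<lambda>t. U t - ?u t" and ?q = "\<lambda>t. V t - v t"
  have n: "ncont X1 {0..} U" "ncont Y1 {0..} V" "ncont Y1 {0..} v" "ncont X1 {0..} w"
    using UV v w by (auto simp: fs_strict_def slow_strict_def dev_strict_def strict_solution_def)
  have hn: "ncont X1 {0..} ?h" by (rule h0_ncont[OF n(3)])
  have un: "ncont X1 {0..} ?u" by (rule ncont_add[OF nX1 n(4) hn])
  have pn: "ncont X1 {0..} ?p" and qn: "ncont Y1 {0..} ?q" by (intro ncont_diff nX1 nY1 n un)+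
  have c: "U s \<in> carr X1" "V s \<in> carr Y1" "v s \<in> carr Y1" "w s \<in> carr X1" "?h s \<in> carr X1" "?u s \<in> carr X1"
    "?p s \<in> carr X1" "?q s \<in> carr Y1" if "s \<ge> 0" for s
    using n hn un pn qn that by (auto simp: ncont_def)
  have nn: "0 \<le> nrm X1 (?p s)" "0 \<le> nrm Y1 (?q s)" "0 \<le> nrm X1 (w s)" if "s \<ge> 0" for s
    using normed_nspaceD(2)[OF nX1] normed_nspaceD(2)[OF nY1] c[OF that] by auto
  let ?F = "\<lambda>t. (f (U t) (V t) - f (?u t) (v t)) /\<^sub>R \<epsilon>"
  let ?G = "\<lambda>t. g (U t) (V t) - g (?h t) (v t)"
  have Fn: "ncont Xg {0..} ?F" by (intro ncont_scaleR ncont_diff nXg f_ncont n un)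
  have Gn: "ncont Yd {0..} ?G" by (intro ncont_diff nYd g_ncont n hn)
  have dn: "ncont Xd {0..} (\<lambda>t. - d t)" using ncont_scaleR[OF nXd d, of "- 1"] by simp
  \<comment> \<open>\<open>z\<close> is the part of the fast difference that is driven by the derivative of \<open>h\<^sup>0(v)\<close>\<close>
  obtain z where z: "z 0 = 0" "strict_solution X1 (Ae \<epsilon>) (\<lambda>t. - d t) z"
    using Xde.strict_solution_exists[OF nspace_carr(1)[OF nX1] dn] by blast
  have zn: "ncont X1 {0..} z" using z by (simp add: strict_solution_def)
  have zc: "z s \<in> carr X1" if "s \<ge> 0" for s using zn that by (auto simp: ncont_def)
  have pd: "(?p has_vector_derivative Ae \<epsilon> (?p t) + (?F t + - d t)) (at t within {0..})" if t: "t \<ge> 0" for t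
  proof -
    have D: "(?p has_vector_derivative (Ae \<epsilon> (U t) + f (U t) (V t) /\<^sub>R \<epsilon>)
        - (Ae \<epsilon> (w t) + (f (?u t) (v t) - f (?h t) (v t)) /\<^sub>R \<epsilon> + d t)) (at t within {0..})"
      using UV w hd[OF t] t unfolding fs_strict_def dev_strict_def strict_solution_def
      by (intro has_vector_derivative_diff has_vector_derivative_add) auto
    have E: "Ae \<epsilon> (?p t) = Ae \<epsilon> (U t) - Ae \<epsilon> (w t) + f (?h t) (v t) /\<^sub>R \<epsilon>"
    proof -
      have "A (?p t) = A (U t) - A (?u t)" by (rule Xg.S_diff) (use c t in auto)
      moreover have "A (?u t - ?h t) = A (?u t) - A (?h t)" by (rule Xg.S_diff) (use c t in auto)
      moreover have "A (?h t) = - f (?h t) (v t)" by (rule h0(2)) (use c t in auto)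
      ultimately have "A (?p t) = A (U t) - A (w t) + f (?h t) (v t)" by (simp add: algebra_simps)
      then show ?thesis by (simp add: scaleR_right_distrib scaleR_right_diff_distrib)
    qed
    show ?thesis unfolding E using D by (simp add: scaleR_right_diff_distrib algebra_simps)
  qed
  have ps: "strict_solution X1 (Ae \<epsilon>) (\<lambda>t. ?F t + - d t) ?p"
    unfolding strict_solution_def using pn pd by blast
  have "strict_solution X1 (Ae \<epsilon>) (\<lambda>t. ?F t + - d t - - d t) (\<lambda>t. ?p t - z t)"
    by (rule strict_solution_diff[OF nX1 Xe.S_diff ps z(2)])
  then have p1: "strict_solution X1 (Ae \<epsilon>) ?F (\<lambda>t. ?p t - z t)" by simp
  have qs: "strict_solution Y1 B ?G ?q"
    using UV v strict_solution_diff[OF nY1 Y.S_diff] unfolding fs_strict_def slow_strict_def by blast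
  have TA0: "TA s 0 = 0" and TB0: "TB s 0 = 0" for s by (simp_all add: blinfun.zero_right)
  have mu_e: "\<omega>A / \<epsilon> < \<mu>" using \<mu> \<omega>A \<epsilon> by (meson divide_neg_pos less_le_trans)
  have b: "\<mu> - \<omega>A / \<epsilon> = (\<epsilon> * \<mu> - \<omega>A) / \<epsilon>" "0 \<le> \<epsilon> * \<mu> - \<omega>A" "- \<omega>A \<le> \<epsilon> * \<mu> - \<omega>A" "0 < - \<omega>A"
  proof -
    have "0 \<le> \<epsilon> * \<mu>" using \<epsilon> \<mu>(2) by simp
    then show "0 \<le> \<epsilon> * \<mu> - \<omega>A" "- \<omega>A \<le> \<epsilon> * \<mu> - \<omega>A" "0 < - \<omega>A" using \<omega>A by linarith+
  qed (use \<epsilon> in \<open>simp add: diff_divide_distrib\<close>)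
  have Kd: "0 \<le> Kd"
    using d_le[of 0] normed_nspaceD(2)[OF nXd, of "d 0"] d by (auto simp: ncont_def)
  let ?z = "\<epsilon> * (CA * Kd * kernel_const \<delta> (- \<omega>A))"
  have z_le: "nrm X1 (z s) \<le> ?z * exp (\<mu> * s)" if s: "s \<ge> 0" for s
  proof -
    have "nrm X1 (z s - TA (s / \<epsilon>) (z 0)) \<le> CA * \<epsilon> powr (1 - \<delta>) * Kd * kernel_const \<delta> (\<mu> - \<omega>A / \<epsilon>) * exp (\<mu> * s)"
    proof (rule Xde.strict_solution_bound_exp[OF z(2) dn s mu_e])
      fix r :: real assume "0 \<le> r"
      then show "nrm Xd (- d r) \<le> Kd * exp (\<mu> * r)"
        using d_le nrm_uminus[OF nXd] d by (auto simp: ncont_def)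
    qed
    also have "CA * \<epsilon> powr (1 - \<delta>) * Kd * kernel_const \<delta> (\<mu> - \<omega>A / \<epsilon>)
        = CA * \<epsilon> powr (1 - \<delta>) * (\<epsilon> * Kd / \<epsilon>) * kernel_const \<delta> ((\<epsilon> * \<mu> - \<omega>A) / \<epsilon>)"
      using \<epsilon> by (simp add: b(1))
    also have "\<dots> = CA * (\<epsilon> * Kd) * kernel_const \<delta> (\<epsilon> * \<mu> - \<omega>A)" by (rule rescaled_const[OF \<epsilon>(1) b(2)])
    also have "\<dots> \<le> CA * (\<epsilon> * Kd) * kernel_const \<delta> (- \<omega>A)"
      using Xd.pos \<epsilon> Kd b by (intro mult_left_mono kernel_const_antimono) auto
    finally show ?thesis using z(1) by (simp add: TA0 mult_ac mult_right_mono)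
  qed
  let ?slow = "\<epsilon> powr \<beta> * (CB * Lg * Kw * (1 / \<beta> + 1 / \<kappa>))"
  have "nrm X1 (?p t) + nrm Y1 (?q t) \<le> (?z + ?slow) / (1 - \<theta>) * exp (\<mu> * t)"
  proof (rule exponential_gronwall[where \<phi> = "\<lambda>s. nrm X1 (?p s) + nrm Y1 (?q s)"])
    show "continuous_on {0..t} (\<lambda>s. nrm X1 (?p s) + nrm Y1 (?q s))"
      by (intro continuous_on_add continuous_on_nrm[OF nX1 ncont_subset[OF pn]] continuous_on_nrm[OF nY1 ncont_subset[OF qn]]) auto
    fix r M assume r: "0 \<le> r" "r \<le> t"
      and le: "\<And>s. 0 \<le> s \<Longrightarrow> s \<le> r \<Longrightarrow> nrm X1 (?p s) + nrm Y1 (?q s) \<le> M * exp (\<mu> * s)"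
    have M: "M \<ge> 0" using le[of 0] nn[of 0] r by simp
    have "nrm Xg (?F s) \<le> Lf * M / \<epsilon> * exp (\<mu> * s)" if s: "0 \<le> s" "s \<le> r" for s
    proof -
      have "nrm Xg (?F s) = nrm Xg (f (U s) (V s) - f (?u s) (v s)) / \<epsilon>"
        by (rule nrm_scale[OF nXg \<epsilon>(1)]) (use c s in \<open>auto intro!: nspace_carr(3)[OF nXg] f_range\<close>)
      also have "\<dots> \<le> Lf * (nrm X1 (?p s) + nrm Y1 (?q s)) / \<epsilon>"
        using \<epsilon> c s by (intro divide_right_mono f_lip) auto
      also have "\<dots> \<le> Lf * (M * exp (\<mu> * s)) / \<epsilon>"
        using \<epsilon> lip_pos by (intro divide_right_mono mult_left_mono le s) auto
      finally show ?thesis by simp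
    qed
    then have "nrm X1 (?p r - z r - TA (r / \<epsilon>) (?p 0 - z 0)) \<le>
        CA * \<epsilon> powr (1 - \<gamma>) * (Lf * M / \<epsilon>) * kernel_const \<gamma> (\<mu> - \<omega>A / \<epsilon>) * exp (\<mu> * r)"
      by (rule Xe.strict_solution_bound_exp[OF p1 Fn r(1) mu_e])
    also have "CA * \<epsilon> powr (1 - \<gamma>) * (Lf * M / \<epsilon>) * kernel_const \<gamma> (\<mu> - \<omega>A / \<epsilon>) = CA * (Lf * M) * kernel_const \<gamma> (\<epsilon> * \<mu> - \<omega>A)"
      unfolding b(1) by (rule rescaled_const[OF \<epsilon>(1) b(2)])
    also have "\<dots> \<le> CA * (Lf * M) * kernel_const \<gamma> (- \<omega>A)"
      using Xg.pos lip_pos M b by (intro mult_left_mono kernel_const_antimono) auto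
    finally have 1: "nrm X1 (?p r - z r) \<le> (CA * Lf * kernel_const \<gamma> (- \<omega>A) * M) * exp (\<mu> * r)"
      using z(1) init by (simp add: TA0 mult_ac mult_right_mono)
    have "nrm X1 (?p r) \<le> nrm X1 (?p r - z r) + nrm X1 (z r)"
      using normed_nspaceD(5)[OF nX1 nspace_carr(3)[OF nX1 c(7)[OF r(1)] zc[OF r(1)]] zc[OF r(1)]] by simp
    then have p_le: "nrm X1 (?p r) \<le> (CA * Lf * kernel_const \<gamma> (- \<omega>A) * M + ?z) * exp (\<mu> * r)"
      using 1 z_le[OF r(1)] by (simp add: distrib_right)
    have "nrm Yd (?G s) \<le> Lg * M * exp (\<mu> * s) + Lg * Kw * exp (- (\<kappa> / \<epsilon> * s))" if s: "0 \<le> s" "s \<le> r" for s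
    proof -
      have "nrm Yd (?G s) \<le> Lg * (nrm X1 (U s - ?h s) + nrm Y1 (?q s))" by (intro g_lip c s)
      also have "nrm X1 (U s - ?h s) \<le> nrm X1 (?p s) + nrm X1 (w s)"
        using normed_nspaceD(5)[OF nX1 c(7,4)[OF s(1)]] by (simp add: algebra_simps)
      also have "Lg * (nrm X1 (?p s) + nrm X1 (w s) + nrm Y1 (?q s)) \<le> Lg * (M * exp (\<mu> * s) + Kw * exp (- (\<kappa> / \<epsilon>) * s))"
        using le[OF s] w_le[OF s(1)] lip_pos by (intro mult_left_mono) auto
      finally show ?thesis using lip_pos by (simp add: algebra_simps)
    qed
    then have "nrm Y1 (?q r - TB r (?q 0)) \<le> CB * (Lg * M * kernel_const \<beta> (\<mu> - \<omega>B) +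
        Lg * Kw * (\<epsilon> powr \<beta> / \<beta> + \<epsilon> powr (\<beta> - 1) * (1 / (\<kappa> / \<epsilon>)))) * exp (\<mu> * r)"
      by (intro Y.strict_solution_bound_exp2[OF qs Gn r(1) \<mu>(1) disjI2[OF \<mu>(2)]]) (use \<kappa> \<epsilon> lip_pos Kw M in auto)
    also have "\<epsilon> powr (\<beta> - 1) * (1 / (\<kappa> / \<epsilon>)) = \<epsilon> powr \<beta> / \<kappa>" using \<epsilon> by (simp add: powr_diff)
    finally have "nrm Y1 (?q r) \<le> CB * (Lg * M * kernel_const \<beta> (\<mu> - \<omega>B) + Lg * Kw * (\<epsilon> powr \<beta> / \<beta> + \<epsilon> powr \<beta> / \<kappa>)) * exp (\<mu> * r)"
      using init by (simp add: TB0)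
    also have "\<dots> = (CB * Lg * kernel_const \<beta> (\<mu> - \<omega>B) * M + ?slow) * exp (\<mu> * r)" by (simp add: algebra_simps)
    finally show "nrm X1 (?p r) + nrm Y1 (?q r) \<le> ((?z + ?slow) + \<theta> * M) * exp (\<mu> * r)"
      using p_le by (simp add: \<theta>(1) algebra_simps)
  qed (use t \<theta> in auto)
  then show ?thesis .
qed

text \<open>The constants: \<open>\<kappa>\<close> is a rate at which the deviation from the critical manifold still decays, by continuity of
  the gap condition, and the weight \<open>\<mu> = \<omega>B + c\<close> is large enough for the slow equation.\<close>

theorem flow_comparison:
  "\<exists>C>0. \<exists>c>0. \<forall>u0\<in>carr X1. \<forall>v0\<in>carr Y1. \<forall>t\<ge>0. \<forall>\<epsilon>\<in>{0<..1}.
    nrm (nprod X1 Y1) (fast_slow_flow A B f g X1 Y1 \<epsilon> t (u0, v0) - extended_slow_flow A B f g X1 Y1 \<epsilon> t (u0, v0))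
    \<le> C * exp ((\<omega>B + c) * t) * (\<epsilon> * nrm Y1 v0 + \<epsilon> powr \<beta> * nrm X1 (u0 - h0 v0))"
proof -
  define \<theta>1 where "\<theta>1 = CA * Lf * kernel_const \<gamma> (- \<omega>A)"
  have \<theta>1: "\<theta>1 < 1" using gap by (simp add: \<theta>1_def)
  obtain \<kappa> where \<kappa>: "\<kappa> > 0" "\<kappa> < - \<omega>A" "CA * Lf * kernel_const \<gamma> (- \<omega>A - \<kappa>) < 1"
  proof -
    have "((\<lambda>k. - \<omega>A - k) \<longlongrightarrow> - \<omega>A - 0) (at_right 0)" by (intro tendsto_intros)
    then have "((\<lambda>k. CA * Lf * kernel_const \<gamma> (- \<omega>A - k)) \<longlongrightarrow> CA * Lf * kernel_const \<gamma> (- \<omega>A)) (at_right 0)"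
      unfolding kernel_const_def using \<omega>A by (intro tendsto_mult tendsto_const tendsto_powr) auto
    then have "\<forall>\<^sub>F k in at_right 0. CA * Lf * kernel_const \<gamma> (- \<omega>A - k) < 1" by (rule order_tendstoD(2)) (rule gap)
    moreover have "\<forall>\<^sub>F k in at_right 0. k \<in> {0<..<- \<omega>A}" by (rule eventually_at_rightI[of 0 "- \<omega>A"]) (use \<omega>A in auto)
    ultimately have "\<forall>\<^sub>F k in at_right 0. CA * Lf * kernel_const \<gamma> (- \<omega>A - k) < 1 \<and> k \<in> {0<..<- \<omega>A}" by (rule eventually_conj)
    from eventually_happens'[OF trivial_limit_at_right_real this] show ?thesis using that by auto
  qed
  \<comment> \<open>the weight \<open>\<mu>\<close> makes the slow equation contract by the factor \<open>1/2\<close> and leaves room for the fast one\<close>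
  define \<eta> where "\<eta> = min (1 / 2) ((1 - \<theta>1) / 2)"
  have \<eta>: "\<eta> > 0" using \<theta>1 by (simp add: \<eta>_def)
  have "((\<lambda>x. CB * (Lg * (Kh + 1)) * kernel_const \<beta> x) \<longlongrightarrow> 0) at_top"
    using tendsto_mult_right_zero[OF kernel_const_tendsto_0[OF Y.pos(1)]] .
  then have "\<forall>\<^sub>F x in at_top. CB * (Lg * (Kh + 1)) * kernel_const \<beta> x < \<eta>" by (rule order_tendstoD(2)) (rule \<eta>)
  then obtain x0 where x0: "\<And>x. x \<ge> x0 \<Longrightarrow> CB * (Lg * (Kh + 1)) * kernel_const \<beta> x < \<eta>"
    unfolding eventually_at_top_linorder by blast
  define \<mu> where "\<mu> = \<bar>\<omega>B\<bar> + max x0 1"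
  have \<mu>: "\<mu> > \<omega>B" "\<mu> \<ge> 0" "\<mu> - \<omega>B \<ge> x0" by (auto simp: \<mu>_def)
  have small: "CB * (Lg * (Kh + 1)) * kernel_const \<beta> (\<mu> - \<omega>B) < \<eta>" by (rule x0[OF \<mu>(3)])
  define \<theta> where "\<theta> = CA * Lf * kernel_const \<gamma> (- \<omega>A) + CB * Lg * kernel_const \<beta> (\<mu> - \<omega>B)"
  have \<theta>: "\<theta> < 1"
  proof -
    have "CB * Lg * kernel_const \<beta> (\<mu> - \<omega>B) * 1 \<le> CB * Lg * kernel_const \<beta> (\<mu> - \<omega>B) * (Kh + 1)"
      using Y.pos lip_pos Kh_nonneg kernel_const_nonneg by (intro mult_left_mono) auto
    then have "CB * Lg * kernel_const \<beta> (\<mu> - \<omega>B) < (1 - \<theta>1) / 2" using small by (simp add: \<eta>_def mult_ac)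
    moreover have "b < (1 - a) / 2 \<Longrightarrow> a < 1 \<Longrightarrow> a + b < 1" for a b :: real by simp
    ultimately show ?thesis using \<theta>1 unfolding \<theta>_def \<theta>1_def by blast
  qed
  obtain K where K: "K \<ge> 0" and slow: "\<And>v. slow_strict v \<Longrightarrow> \<exists>d. ncont Xd {0..} d \<and>
     (\<forall>t\<ge>0. ((\<lambda>s. h0 (v s)) has_vector_derivative d t) (at t within {0..})) \<and>
     (\<forall>t\<ge>0. \<forall>V. (\<forall>s\<in>{0..t + 1}. nrm Y1 (v s) \<le> V) \<longrightarrow> nrm Xd (d t) \<le> K * V)"
    using slow_C1 by blast
  define Kd where "Kd = K * (2 * MB * exp \<mu>)"
  define \<theta>w where "\<theta>w = CA * Lf * kernel_const \<gamma> (- \<omega>A - \<kappa>)"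
  define Kw where "Kw = MA / (1 - \<theta>w)"
  define C1 where "C1 = CA * Kd * kernel_const \<delta> (- \<omega>A)"
  define C2 where "C2 = CB * Lg * Kw * (1 / \<beta> + 1 / \<kappa>)"
  have \<theta>w: "\<theta>w < 1" using \<kappa>(3) by (simp add: \<theta>w_def)
  have nn: "Kd \<ge> 0" "Kw \<ge> 0" using K MAB \<theta>w by (auto simp: Kd_def Kw_def)
  have C12: "C1 \<ge> 0" "C2 \<ge> 0"
    using nn Xd.pos Y.pos lip_pos \<kappa> kernel_const_nonneg by (auto simp: C1_def C2_def)
  define C where "C = (C1 + C2 + 1) / (1 - \<theta>)"
  have C: "C > 0" using C12 \<theta> by (simp add: C_def)
  have main: "nrm (nprod X1 Y1) (fast_slow_flow A B f g X1 Y1 \<epsilon> t (u0, v0) - extended_slow_flow A B f g X1 Y1 \<epsilon> t (u0, v0))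
    \<le> C * exp (\<mu> * t) * (\<epsilon> * nrm Y1 v0 + \<epsilon> powr \<beta> * nrm X1 (u0 - h0 v0))"
    if u0: "u0 \<in> carr X1" and v0: "v0 \<in> carr Y1" and t: "t \<ge> 0" and \<epsilon>: "\<epsilon> > 0" "\<epsilon> \<le> 1" for u0 v0 t \<epsilon>
  proof -
    obtain U V where UV: "U 0 = u0" "V 0 = v0" "fs_strict \<epsilon> U V" using fs_ex1(1)[OF \<epsilon>(1) u0 v0] by blast
    obtain v where v: "v 0 = v0" "slow_strict v" using slow_exists[OF v0] by blast
    have vn: "ncont Y1 {0..} v" using v by (simp add: slow_strict_def strict_solution_def)
    obtain d where d: "ncont Xd {0..} d"
        "\<And>t. t \<ge> 0 \<Longrightarrow> ((\<lambda>s. h0 (v s)) has_vector_derivative d t) (at t within {0..})"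
        "\<And>t V. t \<ge> 0 \<Longrightarrow> (\<forall>s\<in>{0..t + 1}. nrm Y1 (v s) \<le> V) \<Longrightarrow> nrm Xd (d t) \<le> K * V"
      using slow[OF v(2)] by blast
    have w0: "u0 - h0 v0 \<in> carr X1" by (intro nspace_carr(3)[OF nX1] u0 h0 v0)
    obtain w where w: "w 0 = u0 - h0 v0" "dev_strict \<epsilon> v w" using dev_exists[OF \<epsilon>(1) vn w0] by blast
    let ?n = "nrm Y1 v0" and ?m = "nrm X1 (u0 - h0 v0)"
    have nm: "?n \<ge> 0" "?m \<ge> 0" using normed_nspaceD(2)[OF nY1 v0] normed_nspaceD(2)[OF nX1 w0] by auto
    have d_le: "nrm Xd (d s) \<le> (Kd * ?n) * exp (\<mu> * s)" if s: "s \<ge> 0" for s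
    proof -
      have "\<forall>r\<in>{0..s + 1}. nrm Y1 (v r) \<le> 2 * MB * ?n * exp (\<mu> * (s + 1))"
      proof
        fix r assume r: "r \<in> {0..s + 1}"
        have "nrm Y1 (v r) \<le> 2 * MB * ?n * exp (\<mu> * r)"
          using slow_growth[OF v(2) \<mu>(1) _, of r] small r v(1) by (simp add: \<eta>_def)
        also have "\<dots> \<le> 2 * MB * ?n * exp (\<mu> * (s + 1))"
          using r MAB nm \<mu>(2) by (intro mult_left_mono) (auto intro: mult_left_mono)
        finally show "nrm Y1 (v r) \<le> 2 * MB * ?n * exp (\<mu> * (s + 1))" .
      qed
      from d(3)[OF s this] show ?thesis by (simp add: Kd_def distrib_left exp_add mult_ac)
    qed
    have w_le: "nrm X1 (w s) \<le> (Kw * ?m) * exp (- (\<kappa> / \<epsilon>) * s)" if "s \<ge> 0" for s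
      using dev_decay[OF \<epsilon>(1) vn w(2) \<kappa>(1,2) \<theta>w_def \<theta>w that] w(1) by (simp add: Kw_def)
    have "nrm X1 (U t - (w t + h0 (v t))) + nrm Y1 (V t - v t) \<le>
        (\<epsilon> * (CA * (Kd * ?n) * kernel_const \<delta> (- \<omega>A)) + \<epsilon> powr \<beta> * (CB * Lg * (Kw * ?m) * (1 / \<beta> + 1 / \<kappa>))) / (1 - \<theta>) * exp (\<mu> * t)"
      by (rule comparison[OF \<epsilon> UV(3) v(2) w(2) d(1,2) _ _ \<mu>(1,2) \<kappa>(1) d_le w_le _ \<theta>_def \<theta> t])
        (use UV v w nn nm in auto)
    also have "\<dots> = (C1 * (\<epsilon> * ?n) + C2 * (\<epsilon> powr \<beta> * ?m)) / (1 - \<theta>) * exp (\<mu> * t)"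
      by (simp add: C1_def C2_def mult_ac)
    also have "\<dots> \<le> ((C1 + C2 + 1) * (\<epsilon> * ?n) + (C1 + C2 + 1) * (\<epsilon> powr \<beta> * ?m)) / (1 - \<theta>) * exp (\<mu> * t)"
      using C12 nm \<epsilon> \<theta> by (intro mult_right_mono divide_right_mono add_mono) auto
    also have "\<dots> = C * exp (\<mu> * t) * (\<epsilon> * ?n + \<epsilon> powr \<beta> * ?m)"
      by (simp add: C_def distrib_left[symmetric])
    finally have "nrm X1 (U t - (w t + h0 (v t))) + nrm Y1 (V t - v t) \<le> C * exp (\<mu> * t) * (\<epsilon> * ?n + \<epsilon> powr \<beta> * ?m)" .
    moreover have "fast_slow_flow A B f g X1 Y1 \<epsilon> t (u0, v0) = (U t, V t)"
      by (rule fast_slow_flow_eq[OF \<epsilon>(1) u0 v0 UV t])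
    moreover have "extended_slow_flow A B f g X1 Y1 \<epsilon> t (u0, v0) = (w t + h0 (v t), v t)"
      using extended_slow_flow_eq[OF \<epsilon>(1) v(2) d(1,2) w(2) t] w(1) v(1) by simp
    ultimately show ?thesis by (simp add: nrm_nprod)
  qed
  have "\<mu> - \<omega>B > 0" "\<omega>B + (\<mu> - \<omega>B) = \<mu>" using \<mu> by auto
  then show ?thesis
    by (intro exI[of "\<lambda>C. C > 0 \<and> _ C" C] conjI C exI[of "\<lambda>c. c > 0 \<and> _ c" "\<mu> - \<omega>B"]) (use main in auto)
qed

end

section \<open>The critical manifold along slow curves\<close>

lemma C1_with_cong:
  assumes "\<And>s. s \<in> {0..t} \<Longrightarrow> w s = u s" shows "C1_with E t w w' \<longleftrightarrow> C1_with E t u w'"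
proof -
  have "ncont E {0..t} w \<longleftrightarrow> ncont E {0..t} u" by (rule ncont_cong) (rule assms)
  moreover have "((\<lambda>r. nrm E ((w r - w s) /\<^sub>R (r - s) - w' s)) \<longlongrightarrow> 0) (at s within {0..t}) \<longleftrightarrow>
      ((\<lambda>r. nrm E ((u r - u s) /\<^sub>R (r - s) - w' s)) \<longlongrightarrow> 0) (at s within {0..t})" if "s \<in> {0..t}" for s
    by (rule tendsto_cong) (use assms that in \<open>auto simp: eventually_at_filter\<close>)
  ultimately show ?thesis unfolding C1_with_def by blast
qed

lemma (in interpolation_scale) C1_norm_pullback:
  assumes \<alpha>: "0 \<le> \<alpha>" "\<alpha> \<le> 1" and t: "t > 0" and w: "C1_with (Z \<alpha>) t (\<lambda>s. j (u s)) w'"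
  shows "C1_norm (pullback j (Z \<alpha>)) t u = C1_norm (Z \<alpha>) t (\<lambda>s. j (u s))"
proof -
  have n: "normed_nspace (Z \<alpha>)" using normed_Z \<alpha> by simp
  have "j (inv j (w' s)) = w' s" if "s \<in> {0..t}" for s
    using C1_withD(2)[OF w that] Z_range[OF \<alpha>] by (auto simp: f_inv_into_f)
  then show ?thesis
    unfolding C1_norm_eq[OF n w t] C1_norm_eq[OF normed_pullback[OF n] C1_with_pullback[OF \<alpha> w] t]
    by (simp add: pullback_simps)
qed

text \<open>If the equation \<open>x = - S\<^sup>-\<^sup>1 f(x, y)\<close> is uniquely solvable for all values \<open>y\<close> of a \<open>C\<^sup>1\<close> curve, the
  solutions form a \<open>C\<^sup>1\<close> curve, by the contraction principle in the space of \<open>C\<^sup>1\<close> curves.\<close>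

lemma (in interpolation_scale) fixed_point_curve_C1:
  fixes f :: "'z \<Rightarrow> 'y::real_normed_vector \<Rightarrow> 'z" and Yn :: "'y nspace"
  assumes \<delta>: "0 < \<delta>" "\<delta> \<le> 1" and c: "c \<ge> 0" "op_norm_le (Z (\<delta> - 1)) (Z \<delta>) Q c" and Lf: "Lf > 0" "Lf * c < 1"
    and Yn: "normed_nspace Yn" and f0: "f 0 0 = 0"
    and f_C1: "\<And>u v. C1_curve (pullback j (Z \<delta>)) t u \<Longrightarrow> C1_curve whole_space t v \<Longrightarrow> C0_curve Yn t v \<Longrightarrow>
      C1_curve (Z (\<delta> - 1)) t (\<lambda>s. j (f (u s) (v s)))"
    and f_lip: "\<And>u1 u2 v1 v2. C1_curve (pullback j (Z \<delta>)) t u1 \<Longrightarrow> C1_curve (pullback j (Z \<delta>)) t u2 \<Longrightarrow>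
      C1_curve whole_space t v1 \<Longrightarrow> C0_curve Yn t v1 \<Longrightarrow> C1_curve whole_space t v2 \<Longrightarrow> C0_curve Yn t v2 \<Longrightarrow>
      C1_norm (Z (\<delta> - 1)) t (\<lambda>s. j (f (u1 s) (v1 s)) - j (f (u2 s) (v2 s)))
        \<le> Lf * (C1_norm (pullback j (Z \<delta>)) t (\<lambda>s. u1 s - u2 s) + C1_norm whole_space t (\<lambda>s. v1 s - v2 s))"
    and t: "t > 0" and v: "C1_with whole_space t v v'" "ncont Yn {0..t} v"
    and V: "\<And>s. s \<in> {0..t} \<Longrightarrow> norm (v s) \<le> V \<and> norm (v' s) \<le> V"
    and unique: "\<And>s x. s \<in> {0..t} \<Longrightarrow> x \<in> D \<Longrightarrow> x = - R (f x (v s)) \<Longrightarrow> x = W s"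
  shows "\<exists>d. C1_with (pullback j (Z \<delta>)) t W d \<and>
    (\<forall>s\<in>{0..t}. nrm (pullback j (Z \<delta>)) (d s) \<le> 2 * (Lf * c) / (1 - Lf * c) * V)"
proof -
  let ?E = "pullback j (Z \<delta>)" and ?F = "Z (\<delta> - 1)" and ?U = "\<lambda>e. - Q e"
  have d01: "0 \<le> \<delta>" using \<delta> by simp
  have nZ: "normed_nspace (Z \<delta>)" and nF: "normed_nspace ?F" using normed_Z \<delta> by auto
  have E: "normed_nspace ?E" "geo_complete ?E" using normed_pullback[OF nZ] geo_complete_pullback[OF d01 \<delta>(2)] by auto
  have nW: "normed_nspace (whole_space :: 'y nspace)" by (rule normed_whole_space)
  have linU: "linear ?U" by (rule linearI) (simp_all add: Q_def blinfun.add_right blinfun.scaleR_right)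
  have U: "op_norm_le ?F (Z \<delta>) ?U c"
    using c(2) nspace_carr(5)[OF nZ] nrm_uminus[OF nZ] by (simp add: op_norm_le_def)
  have Uj: "?U (j x) = j (- R x)" for x by (simp add: Q_j j.neg)
  define \<Phi> where "\<Phi> y w s = - R (f (w s) (y s))" for y :: "real \<Rightarrow> 'y" and w s
  have v_ok: "C1_curve whole_space t v" "C0_curve Yn t v"
    using v C1_curve_iff[OF nW] by (auto simp: C0_curve_def continuous_map_ntop_iff[OF Yn])
  have zero_W: "C1_with (whole_space :: 'y nspace) t (\<lambda>s. 0) (\<lambda>s. 0)"
    by (rule C1_with_const[OF nW nspace_carr(1)[OF nW]])
  have z_ok: "C1_curve (whole_space :: 'y nspace) t (\<lambda>s. 0)" "C0_curve Yn t (\<lambda>s. 0)"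
    using zero_W C1_curve_iff[OF nW] ncont_const[OF Yn nspace_carr(1)[OF Yn]]
    unfolding C0_curve_def continuous_map_ntop_iff[OF Yn] by blast+
  have zE: "C1_curve ?E t (\<lambda>s. 0)"
    using C1_with_const[OF E(1) nspace_carr(1)[OF E(1)]] C1_curve_iff[OF E(1)] by blast
  have map: "C1_curve ?E t (\<Phi> y w)" if wy: "C1_curve ?E t w" "C1_curve whole_space t y" "C0_curve Yn t y" for y w
  proof -
    obtain F' where "C1_with ?F t (\<lambda>s. j (f (w s) (y s))) F'"
      using f_C1[OF wy] C1_curve_iff[OF nF] by blast
    from C1_with_linear[OF nF nZ U linU this]
    have "C1_with (Z \<delta>) t (\<lambda>s. j (\<Phi> y w s)) (\<lambda>s. ?U (F' s))" unfolding Uj \<Phi>_def .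
    from C1_with_pullback[OF d01 \<delta>(2) this] show ?thesis using C1_curve_iff[OF E(1)] by blast
  qed
  have lip: "C1_norm ?E t (\<lambda>s. \<Phi> y1 w1 s - \<Phi> y2 w2 s) \<le>
      Lf * c * (C1_norm ?E t (\<lambda>s. w1 s - w2 s) + C1_norm whole_space t (\<lambda>s. y1 s - y2 s))"
    if w: "C1_curve ?E t w1" "C1_curve ?E t w2" and y: "C1_curve whole_space t y1" "C0_curve Yn t y1"
       "C1_curve whole_space t y2" "C0_curve Yn t y2" for y1 y2 w1 w2
  proof -
    let ?P = "\<lambda>s. j (f (w1 s) (y1 s)) - j (f (w2 s) (y2 s))"
    obtain F1 F2 where "C1_with ?F t (\<lambda>s. j (f (w1 s) (y1 s))) F1" "C1_with ?F t (\<lambda>s. j (f (w2 s) (y2 s))) F2"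
      using f_C1[OF w(1) y(1,2)] f_C1[OF w(2) y(3,4)] C1_curve_iff[OF nF] by blast
    then have P: "C1_with ?F t ?P (\<lambda>s. F1 s - F2 s)" by (rule C1_with_diff[OF nF])
    have eq: "(\<lambda>s. j (\<Phi> y1 w1 s - \<Phi> y2 w2 s)) = (\<lambda>s. ?U (?P s))"
      by (simp add: \<Phi>_def fun_eq_iff j.diff j.neg Q_j linear_diff[OF linU, simplified])
    have "C1_norm ?E t (\<lambda>s. \<Phi> y1 w1 s - \<Phi> y2 w2 s) = C1_norm (Z \<delta>) t (\<lambda>s. ?U (?P s))"
      using C1_norm_pullback[OF d01 \<delta>(2) t, of "\<lambda>s. \<Phi> y1 w1 s - \<Phi> y2 w2 s"] C1_with_linear[OF nF nZ U linU P]
      unfolding eq by blast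
    also have "\<dots> \<le> c * C1_norm ?F t ?P" by (rule C1_norm_linear[OF nF nZ U linU P t c(1)])
    also have "\<dots> \<le> c * (Lf * (C1_norm ?E t (\<lambda>s. w1 s - w2 s) + C1_norm whole_space t (\<lambda>s. y1 s - y2 s)))"
      by (intro mult_left_mono f_lip w y c(1))
    finally show ?thesis by (simp add: mult_ac)
  qed
  have zero_norm: "C1_norm (whole_space :: 'y nspace) t (\<lambda>s. 0) \<le> 0 + 0"
    by (rule C1_norm_le[OF nW zero_W t]) (simp_all add: whole_space_def)
  have zero_normE: "C1_norm ?E t (\<lambda>s. 0) \<le> 0 + 0"
    by (rule C1_norm_le[OF E(1) C1_with_const[OF E(1) nspace_carr(1)[OF E(1)]] t]) (simp_all add: nrm_zero[OF E(1)])
  have q: "0 \<le> Lf * c" using Lf c by simp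
  obtain W0 W' where W0: "C1_with ?E t W0 W'" "\<And>s. s \<in> {0..t} \<Longrightarrow> \<Phi> v W0 s = W0 s"
      "\<And>s. s \<in> {0..t} \<Longrightarrow> nrm ?E (W' s) \<le> (Lf * c * (2 * V)) / (1 - Lf * c)"
  proof (rule C1_fixed_point[OF E t q Lf(2), of "\<Phi> v" "Lf * c * (2 * V)"])
    show "C1_curve ?E t (\<Phi> v w)" if "C1_curve ?E t w" for w by (rule map[OF that v_ok])
    show "C1_norm ?E t (\<lambda>s. \<Phi> v w s - \<Phi> v u s) \<le> Lf * c * C1_norm ?E t (\<lambda>s. w s - u s)"
      if "C1_curve ?E t w" "C1_curve ?E t u" for w u
      using lip[OF that v_ok v_ok] zero_norm mult_left_mono[OF zero_norm q] by (simp add: algebra_simps)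
    have "C1_norm whole_space t v \<le> V + V" by (rule C1_norm_le[OF nW v(1) t]) (use V in \<open>auto simp: whole_space_def\<close>)
    then have "Lf * c * (C1_norm ?E t (\<lambda>s. 0) + C1_norm whole_space t v) \<le> Lf * c * (2 * V)"
      using zero_normE by (intro mult_left_mono q) simp
    moreover have "\<Phi> (\<lambda>s. 0) (\<lambda>s. 0) = (\<lambda>s. 0)" by (simp add: \<Phi>_def f0 R.zero fun_eq_iff)
    ultimately show "C1_norm ?E t (\<Phi> v (\<lambda>s. 0)) \<le> Lf * c * (2 * V)"
      using lip[OF zE zE v_ok z_ok] by simp
  qed blast
  have "W0 s = W s" if s: "s \<in> {0..t}" for s
  proof (rule unique[OF s])
    show eq: "W0 s = - R (f (W0 s) (v s))" using W0(2)[OF s] by (simp add: \<Phi>_def)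
    show "W0 s \<in> D" by (subst eq) (simp add: R_props(2) R.neg[symmetric])
  qed
  then have "C1_with ?E t W W'" using W0(1) C1_with_cong[of t W0 W] by blast
  then show ?thesis using W0(3) by (intro exI[of _ W']) (simp add: mult_ac)
qed

section \<open>Comparison of the flows\<close>

text \<open>Local boundedness of the semigroup is inherited from its restriction to the domain, which is
  isomorphic to the whole space through \<open>S - lam\<close>.\<close>

lemma semigroup_locally_bounded:
  assumes gen: "generates (carr E1) S T" and E1: "normed_nspace E1"
    and R: "\<And>y. R y \<in> carr E1" "\<And>y. S (R y) - lam *\<^sub>R R y = y"
    and c1: "\<And>x. x \<in> carr E1 \<Longrightarrow> nrm E1 x \<le> c1 * norm (S x - lam *\<^sub>R x)"
    and c2: "\<And>x. x \<in> carr E1 \<Longrightarrow> norm (S x - lam *\<^sub>R x) \<le> c2 * nrm E1 x" and c: "c1 \<ge> 0" "c2 \<ge> 0"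
    and M: "\<And>r. r > 0 \<Longrightarrow> op_norm_le E1 E1 (T r) (M * exp (w * r))" "M \<ge> 0"
  shows "\<exists>K. \<forall>r\<in>{0..t}. norm (T r) \<le> K"
proof -
  define K where "K = c2 * (M * exp (\<bar>w\<bar> * t)) * c1"
  have K: "K \<ge> 0" using c M by (simp add: K_def)
  have T0: "T 0 = id_blinfun" using gen by (simp add: generates_def c0_semigroup_def)
  have "norm (T r) \<le> max 1 K" if r: "r \<in> {0..t}" for r
  proof (cases "r = 0")
    case True
    have "norm (T 0) \<le> 1" unfolding T0 by (rule norm_blinfun_id_le)
    then show ?thesis using True by simp
  next
    case False
    then have r0: "r > 0" using r by simp
    have "norm (T r) \<le> K"
    proof (rule norm_blinfun_bound[OF K])
      fix y
      have x: "R y \<in> carr E1" by (rule R)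
      note Tx = generator_commutes[OF gen x less_imp_le[OF r0]]
      have "T r y = S (T r (R y)) - lam *\<^sub>R T r (R y)"
        using R(2)[of y] Tx(2) by (metis blinfun.diff_right blinfun.scaleR_right)
      then have "norm (T r y) \<le> c2 * nrm E1 (T r (R y))" using c2[OF Tx(1)] by simp
      also have "\<dots> \<le> c2 * (M * exp (w * r) * nrm E1 (R y))"
        using M(1)[OF r0] x c by (intro mult_left_mono) (auto simp: op_norm_le_def)
      also have "\<dots> \<le> c2 * (M * exp (\<bar>w\<bar> * t) * nrm E1 (R y))"
        using exp_times_le[of r t w] r c M normed_nspaceD(2)[OF E1 x] by (intro mult_left_mono mult_right_mono) auto
      also have "\<dots> \<le> c2 * (M * exp (\<bar>w\<bar> * t) * (c1 * norm y))"
        using c1[OF x] R(2)[of y] c M by (intro mult_left_mono) auto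
      finally show "norm (T r y) \<le> K * norm y" by (simp add: K_def mult_ac)
    qed
    then show ?thesis by simp
  qed
  then show ?thesis by blast
qed

text \<open>The condition \<open>\<omega>\<^sub>f < 0\<close> is the contraction condition for the fast equation.\<close>

lemma gap_condition:
  assumes \<gamma>: "0 < \<gamma>" "\<gamma> \<le> 1" and pos: "CA > 0" "Lf > 0" "\<omega>A < 0"
    and 1: "\<gamma> < 1 \<longrightarrow> \<omega>f = \<omega>A + (2 * CA * Lf) powr (1 / \<gamma>) * (1 / \<gamma>) powr ((1 - \<gamma>) / \<gamma>)"
    and 2: "\<gamma> = 1 \<longrightarrow> \<omega>f > \<omega>A + CA * Lf" and 3: "\<omega>f < 0"
  shows "CA * Lf * kernel_const \<gamma> (- \<omega>A) < 1"
proof (cases "\<gamma> = 1")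
  case True
  then have "CA * Lf < - \<omega>A" using 2 3 by simp
  then show ?thesis using True pos by (simp add: kernel_const_def powr_minus field_simps)
next
  case False
  then have "(2 * CA * Lf) powr (1 / \<gamma>) * (1 / \<gamma>) powr ((1 - \<gamma>) / \<gamma>) < - \<omega>A" using 1 3 \<gamma> by simp
  then have "((2 * CA * Lf) powr (1 / \<gamma>) * (1 / \<gamma>) powr ((1 - \<gamma>) / \<gamma>)) powr \<gamma> < (- \<omega>A) powr \<gamma>"
    by (intro powr_less_mono2) (use \<gamma> in auto)
  moreover have "((2 * CA * Lf) powr (1 / \<gamma>) * (1 / \<gamma>) powr ((1 - \<gamma>) / \<gamma>)) powr \<gamma> = 2 * CA * Lf * \<gamma> powr (\<gamma> - 1)"
  proof -
    have "(1 / \<gamma>) powr (1 - \<gamma>) = \<gamma> powr (\<gamma> - 1)"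
      using \<gamma> powr_minus_divide[of \<gamma> "1 - \<gamma>"] by (simp add: powr_divide)
    then show ?thesis using \<gamma> pos by (simp add: powr_mult powr_powr)
  qed
  ultimately have "2 * CA * Lf * \<gamma> powr (\<gamma> - 1) < (- \<omega>A) powr \<gamma>" by simp
  then show ?thesis using False pos by (simp add: kernel_const_def powr_minus field_simps)
qed

theorem theorem4p13:
  fixes A :: "'x::banach \<Rightarrow> 'x" and DA :: "'x set" and TA :: "real \<Rightarrow> 'x \<Rightarrow>\<^sub>L 'x"
    and B :: "'y::banach \<Rightarrow> 'y" and DB :: "'y set" and TB :: "real \<Rightarrow> 'y \<Rightarrow>\<^sub>L 'y"
    and jX :: "'x \<Rightarrow> 'xe::banach" and XE :: "real \<Rightarrow> 'xe nspace" and X :: "real \<Rightarrow> 'x nspace"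
    and jY :: "'y \<Rightarrow> 'ye::banach" and YE :: "real \<Rightarrow> 'ye nspace" and Y :: "real \<Rightarrow> 'y nspace"
    and f :: "'x \<Rightarrow> 'y \<Rightarrow> 'x" and g :: "'x \<Rightarrow> 'y \<Rightarrow> 'y"
    and \<mu>B \<gamma>X \<delta>X \<delta>Y Lf Lg MA MB CA CB \<omega>A \<omega>B \<omega>f :: real
  assumes A: "closed_op DA A" "generates DA A TA" "exponentially_stable TA"
    and B: "closed_op DB B" "generates DB B TB"
    and scale_X: "interpolation_extrapolation_scale DA A jX XE"
      "X = (\<lambda>\<alpha>. pullback jX (XE \<alpha>))"
    and scale_Y: "\<mu>B \<in> resolvent_set DB B" "0 \<in> resolvent_set DB B \<longrightarrow> \<mu>B = 0"
      "interpolation_extrapolation_scale DB (\<lambda>y. B y - \<mu>B *\<^sub>R y) jY YE"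
      "Y = (\<lambda>\<alpha>. pullback jY (YE \<alpha>))"
    and \<gamma>X: "\<gamma>X \<in> {0<..1}" "\<not> holomorphic_semigroup TA \<longrightarrow> \<gamma>X = 1"
    and \<delta>X: "\<delta>X \<in> {1 - \<gamma>X..1}" "\<delta>X > 0"
    and \<delta>Y: "\<delta>Y \<in> {0<..1}" "\<not> holomorphic_semigroup TB \<longrightarrow> \<delta>Y = 1"
    and f_cont: "continuous_map (prod_topology (ntop (X \<delta>X)) (ntop (Y (1 - \<delta>X)))) euclidean
      (\<lambda>(x, y). f x y)"
    and g_cont: "continuous_map (prod_topology (ntop (X 1)) (ntop (Y 1))) (ntop (Y \<delta>Y))
      (\<lambda>(x, y). g x y)"
    and fg_zero: "f 0 0 = 0" "g 0 0 = 0"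
    and f_range: "\<forall>x\<in>carr (X 1). \<forall>y\<in>carr (Y 1). f x y \<in> carr (X \<gamma>X)"
    and g_range: "\<forall>x\<in>carr (X 1). \<forall>y\<in>carr (Y 1). g x y \<in> carr (Y \<delta>Y)"
    and f_C1: "\<forall>t>0. \<forall>u v. C1_curve (X \<delta>X) t u \<and>
      C1_curve whole_space t v \<and> C0_curve (Y (1 - \<delta>X)) t v \<longrightarrow>
      C1_curve (XE (\<delta>X - 1)) t (\<lambda>s. jX (f (u s) (v s)))"
    and L_pos: "Lf > 0" "Lg > 0"
    and f_lipschitz: "\<forall>x1\<in>carr (X 1). \<forall>x2\<in>carr (X 1). \<forall>y1\<in>carr (Y 1). \<forall>y2\<in>carr (Y 1).
      nrm (X \<gamma>X) (f x1 y1 - f x2 y2) \<le> Lf * (nrm (X 1) (x1 - x2) + nrm (Y 1) (y1 - y2))"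
    and f_C1_lipschitz: "\<forall>t>0. \<forall>u1 u2 v1 v2.
      C1_curve (X \<delta>X) t u1 \<and> C1_curve (X \<delta>X) t u2 \<and>
      C1_curve whole_space t v1 \<and> C0_curve (Y (1 - \<delta>X)) t v1 \<and>
      C1_curve whole_space t v2 \<and> C0_curve (Y (1 - \<delta>X)) t v2 \<longrightarrow>
      C1_norm (XE (\<delta>X - 1)) t (\<lambda>s. jX (f (u1 s) (v1 s)) - jX (f (u2 s) (v2 s)))
        \<le> Lf * (C1_norm (X \<delta>X) t (\<lambda>s. u1 s - u2 s) + C1_norm whole_space t (\<lambda>s. v1 s - v2 s))"
    and g_lipschitz: "\<forall>x1\<in>carr (X 1). \<forall>x2\<in>carr (X 1). \<forall>y1\<in>carr (Y 1). \<forall>y2\<in>carr (Y 1).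
      nrm (Y \<delta>Y) (g x1 y1 - g x2 y2) \<le> Lg * (nrm (X 1) (x1 - x2) + nrm (Y 1) (y1 - y2))"
    and pos_constants: "MA > 0" "MB > 0" "CA > 0" "CB > 0" "\<omega>A < 0"
    and TA_bounds: "\<forall>t>0. op_norm_le (X 1) (X 1) (TA t) (MA * exp (\<omega>A * t))"
      "\<forall>t>0. op_norm_le (X \<gamma>X) (X 1) (TA t) (CA * t powr (\<gamma>X - 1) * exp (\<omega>A * t))"
      "\<forall>t>0. op_norm_le (X \<delta>X) (X 1) (TA t) (CA * t powr (\<delta>X - 1) * exp (\<omega>A * t))"
    and TB_bounds: "\<forall>t>0. op_norm_le (Y 1) (Y 1) (TB t) (MB * exp (\<omega>B * t))"
      "\<forall>t>0. op_norm_le (Y \<delta>Y) (Y 1) (TB t) (CB * t powr (\<delta>Y - 1) * exp (\<omega>B * t))"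
    and \<omega>f: "\<gamma>X < 1 \<longrightarrow>
        \<omega>f = \<omega>A + (2 * CA * Lf) powr (1 / \<gamma>X) * (1 / \<gamma>X) powr ((1 - \<gamma>X) / \<gamma>X)"
      "\<gamma>X = 1 \<longrightarrow> \<omega>f > \<omega>A + CA * Lf"
      "\<omega>f < 0"
    and Lf_small: "Lf * max (op_norm (XE \<gamma>X) (XE 1) (extrapolated_inverse DA A jX))
      (op_norm (XE (\<delta>X - 1)) (XE \<delta>X) (extrapolated_inverse DA A jX)) < 1"
  shows "\<exists>C>0. \<exists>c>0. \<forall>u0\<in>carr (X 1). \<forall>v0\<in>carr (Y 1). \<forall>t\<ge>0. \<forall>\<epsilon>\<in>{0<..1}.
    nrm (nprod (X 1) (Y 1))
      (fast_slow_flow A B f g (X 1) (Y 1) \<epsilon> t (u0, v0)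
        - extended_slow_flow A B f g (X 1) (Y 1) \<epsilon> t (u0, v0))
    \<le> C * exp ((\<omega>B + c) * t) *
      (\<epsilon> * nrm (Y 1) v0 + \<epsilon> powr \<delta>Y * nrm (X 1) (u0 - critical_map A f (X 1) v0))"
proof -
  interpret XS: interpolation_scale DA A jX XE by unfold_locales (rule scale_X(1))
  interpret YS: interpolation_scale DB "\<lambda>y. B y - \<mu>B *\<^sub>R y" jY YE by unfold_locales (rule scale_Y(3))
  have XE: "X \<alpha> = pullback jX (XE \<alpha>)" and YE: "Y \<alpha> = pullback jY (YE \<alpha>)" for \<alpha>
    using scale_X(2) scale_Y(4) by auto
  have g: "0 \<le> \<gamma>X" "\<gamma>X \<le> 1" "0 < \<gamma>X" and d: "0 \<le> \<delta>X" "\<delta>X \<le> 1" "0 < \<delta>X" and b: "0 \<le> \<delta>Y" "\<delta>Y \<le> 1" "0 < \<delta>Y"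
    and d': "0 \<le> 1 - \<delta>X" "1 - \<delta>X \<le> 1"
    using \<gamma>X(1) \<delta>X \<delta>Y(1) by auto
  have nX: "normed_nspace (X \<alpha>)" and nY: "normed_nspace (Y \<alpha>)" if "0 \<le> \<alpha>" for \<alpha>
    unfolding XE YE using that XS.normed_pullback[OF XS.normed_Z, of \<alpha>] YS.normed_pullback[OF YS.normed_Z, of \<alpha>]
    by simp_all
  obtain c1 c2 where c: "c1 \<ge> 0" "c2 \<ge> 0" and X1: "carr (X 1) = DA"
    and c1: "\<And>x. x \<in> DA \<Longrightarrow> nrm (X 1) x \<le> c1 * norm (A x)"
    and c2: "\<And>x. x \<in> DA \<Longrightarrow> norm (A x) \<le> c2 * nrm (X 1) x"
    unfolding XE by (rule XS.pullback_1) blast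
  obtain d1 d2 where dd: "d1 \<ge> 0" "d2 \<ge> 0" and Y1: "carr (Y 1) = DB"
    and d1: "\<And>y. y \<in> DB \<Longrightarrow> nrm (Y 1) y \<le> d1 * norm (B y - \<mu>B *\<^sub>R y)"
    and d2: "\<And>y. y \<in> DB \<Longrightarrow> norm (B y - \<mu>B *\<^sub>R y) \<le> d2 * nrm (Y 1) y"
    unfolding YE by (rule YS.pullback_1) blast
  obtain cg where cg: "\<And>x. x \<in> carr (X \<gamma>X) \<Longrightarrow> norm x \<le> cg * nrm (X \<gamma>X) x"
    unfolding XE by (rule XS.pullback_embeds[OF g(1,2)]) blast
  obtain cd where cd: "\<And>x. x \<in> carr (X \<delta>X) \<Longrightarrow> norm x \<le> cd * nrm (X \<delta>X) x"
    unfolding XE by (rule XS.pullback_embeds[OF d(1,2)]) blast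
  obtain ce where ce: "\<And>y. y \<in> carr (Y \<delta>Y) \<Longrightarrow> norm y \<le> ce * nrm (Y \<delta>Y) y"
    unfolding YE by (rule YS.pullback_embeds[OF b(1,2)]) blast
  have genA: "generates (carr (X 1)) A TA" and genB: "generates (carr (Y 1)) B TB"
    using A(2) B(2) X1 Y1 by auto
  have n1: "normed_nspace (X 1)" "normed_nspace (Y 1)" using nX nY by auto
  have TA_bdd: "\<exists>K. \<forall>r\<in>{0..t}. norm (TA r) \<le> K" for t
    by (rule semigroup_locally_bounded[where R = XS.R and lam = 0, OF genA n1(1) _ _ _ _ c, where M = MA and w = \<omega>A])
      (use X1 XS.R_props c1 c2 TA_bounds(1) pos_constants in auto)
  have TB_bdd: "\<exists>K. \<forall>r\<in>{0..t}. norm (TB r) \<le> K" for t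
    by (rule semigroup_locally_bounded[where R = YS.R and lam = \<mu>B, OF genB n1(2) _ _ _ _ dd, where M = MB and w = \<omega>B])
      (use Y1 YS.R_props d1 d2 TB_bounds(1) pos_constants in auto)
  have smX: "smoothing_semigroup A TA (X 1) (X \<gamma>X) XS.R 0 c1 c2 cg CA \<gamma>X \<omega>A"
    by (rule smoothing_semigroup.intro)
      (use genA n1 nX[OF g(1)] XS.R_props X1 c1 c2 c cg TA_bdd TA_bounds(2) g pos_constants in \<open>auto simp: op_norm_le_def\<close>)
  have smD: "smoothing_semigroup A TA (X 1) (X \<delta>X) XS.R 0 c1 c2 cd CA \<delta>X \<omega>A"
    by (rule smoothing_semigroup.intro)
      (use genA n1 nX[OF d(1)] XS.R_props X1 c1 c2 c cd TA_bdd TA_bounds(3) d pos_constants in \<open>auto simp: op_norm_le_def\<close>)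
  have smY: "smoothing_semigroup B TB (Y 1) (Y \<delta>Y) YS.R \<mu>B d1 d2 ce CB \<delta>Y \<omega>B"
    by (rule smoothing_semigroup.intro)
      (use genB n1 nY[OF b(1)] YS.R_props Y1 d1 d2 dd ce TB_bdd TB_bounds(2) b pos_constants in \<open>auto simp: op_norm_le_def\<close>)
  have Q: "blinfun_apply (extrapolated_inverse DA A jX) = XS.Q" by (simp add: XS.Q_def)
  have small: "Lf * op_norm (XE \<gamma>X) (XE 1) XS.Q < 1" "Lf * op_norm (XE (\<delta>X - 1)) (XE \<delta>X) XS.Q < 1"
    using Lf_small L_pos(1) unfolding Q
    by (auto intro: le_less_trans[OF mult_left_mono[OF max.cobounded1]] le_less_trans[OF mult_left_mono[OF max.cobounded2]])
  \<comment> \<open>the smallness condition for operator norms yields actual bounds, since the operators are bounded\<close>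
  obtain cA where cA: "cA \<ge> 0" "op_norm_le (XE \<gamma>X) (XE 1) XS.Q cA" "Lf * cA < 1"
    by (rule op_norm_lessE[OF small(1) L_pos(1) XS.Q_bound_1[OF g(1,2)]]) blast
  obtain cD where cD: "cD \<ge> 0" "op_norm_le (XE (\<delta>X - 1)) (XE \<delta>X) XS.Q cD" "Lf * cD < 1"
    by (rule op_norm_lessE[OF small(2) L_pos(1) XS.Q_bound_shift[OF d(3,2)]]) blast
  obtain cY where cY: "cY \<ge> 0" "\<And>y. y \<in> carr (Y 1) \<Longrightarrow> y \<in> carr (Y (1 - \<delta>X))"
    "\<And>y. y \<in> carr (Y 1) \<Longrightarrow> nrm (Y (1 - \<delta>X)) y \<le> cY * nrm (Y 1) y"
    unfolding YE by (rule YS.pullback_1_embeds[OF d']) blast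
  have complete: "geo_complete (X 1)" "geo_complete (Y 1)"
    unfolding XE YE by (simp_all add: XS.geo_complete_pullback YS.geo_complete_pullback)
  \<comment> \<open>the bounds are given for positive times only, and at time \<open>0\<close> the constant has to be at least \<open>1\<close>\<close>
  have TA_le: "nrm (X 1) (TA t x) \<le> max 1 MA * exp (\<omega>A * t) * nrm (X 1) x" if "t \<ge> 0" "x \<in> carr (X 1)" for t x
  proof (cases "t = 0")
    case True
    then show ?thesis using smoothing_semigroup.T_0[OF smX] normed_nspaceD(2)[OF n1(1) that(2)]
      mult_right_mono[of 1 "max 1 MA" "nrm (X 1) x"] by simp
  next
    case False
    then have "nrm (X 1) (TA t x) \<le> MA * exp (\<omega>A * t) * nrm (X 1) x"
      using TA_bounds(1) that by (auto simp: op_norm_le_def)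
    also have "\<dots> \<le> max 1 MA * exp (\<omega>A * t) * nrm (X 1) x"
      using normed_nspaceD(2)[OF n1(1) that(2)] by (intro mult_right_mono) auto
    finally show ?thesis .
  qed
  have TB_le: "nrm (Y 1) (TB t y) \<le> max 1 MB * exp (\<omega>B * t) * nrm (Y 1) y" if "t \<ge> 0" "y \<in> carr (Y 1)" for t y
  proof (cases "t = 0")
    case True
    then show ?thesis using smoothing_semigroup.T_0[OF smY] normed_nspaceD(2)[OF n1(2) that(2)]
      mult_right_mono[of 1 "max 1 MB" "nrm (Y 1) y"] by simp
  next
    case False
    then have "nrm (Y 1) (TB t y) \<le> MB * exp (\<omega>B * t) * nrm (Y 1) y"
      using TB_bounds(1) that by (auto simp: op_norm_le_def)
    also have "\<dots> \<le> max 1 MB * exp (\<omega>B * t) * nrm (Y 1) y"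
      using normed_nspaceD(2)[OF n1(2) that(2)] by (intro mult_right_mono) auto
    finally show ?thesis .
  qed
  have R_le: "nrm (X 1) (XS.R x) \<le> cA * nrm (X \<gamma>X) x" if "x \<in> carr (X \<gamma>X)" for x
    using cA(2) that unfolding op_norm_le_def XE by (auto simp: XS.pullback_simps XS.Q_j)
  define KH where "KH = 2 * (Lf * cD) / (1 - Lf * cD)"
  have KH: "KH \<ge> 0" using L_pos cD by (simp add: KH_def)
  have h_C1: "\<exists>e. C1_with (X \<delta>X) t W e \<and> (\<forall>s\<in>{0..t}. nrm (X \<delta>X) (e s) \<le> KH * V)"
    if t: "t > 0" and v: "C1_with whole_space t v v'" "ncont (Y 1) {0..t} v"
      and V: "\<And>s. s \<in> {0..t} \<Longrightarrow> norm (v s) \<le> V \<and> norm (v' s) \<le> V"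
      and W: "\<And>s x. s \<in> {0..t} \<Longrightarrow> x \<in> carr (X 1) \<Longrightarrow> x = - XS.R (f x (v s)) \<Longrightarrow> x = W s" for t v v' V W
    unfolding XE[of \<delta>X] KH_def
  proof (rule XS.fixed_point_curve_C1[where f = f and v = v and v' = v' and V = V and W = W and t = t, OF d(3,2) cD(1,2) L_pos(1) cD(3) nY[OF d'(1)] fg_zero(1) _ _ t v(1) _ V W[unfolded X1]])
    show "ncont (Y (1 - \<delta>X)) {0..t} v"
      by (rule ncont_lipschitz[OF v(2) nY[OF d'(1)], where c = cY])
        (use cY v(2) nspace_carr(3)[OF n1(2)] in \<open>auto simp: ncont_def\<close>)
    show "C1_curve (XE (\<delta>X - 1)) t (\<lambda>s. jX (f (u s) (v s)))"
      if "C1_curve (pullback jX (XE \<delta>X)) t u" "C1_curve whole_space t v" "C0_curve (Y (1 - \<delta>X)) t v" for u v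
      using f_C1 t that unfolding XE by blast
    show "C1_norm (XE (\<delta>X - 1)) t (\<lambda>s. jX (f (u1 s) (v1 s)) - jX (f (u2 s) (v2 s)))
        \<le> Lf * (C1_norm (pullback jX (XE \<delta>X)) t (\<lambda>s. u1 s - u2 s) + C1_norm whole_space t (\<lambda>s. v1 s - v2 s))"
      if "C1_curve (pullback jX (XE \<delta>X)) t u1" "C1_curve (pullback jX (XE \<delta>X)) t u2"
        "C1_curve whole_space t v1" "C0_curve (Y (1 - \<delta>X)) t v1" "C1_curve whole_space t v2" "C0_curve (Y (1 - \<delta>X)) t v2"
      for u1 u2 v1 v2
      using f_C1_lipschitz t that unfolding XE by blast
  qed
  interpret FS: fast_slow A TA "X 1" "X \<gamma>X" "X \<delta>X" XS.R c1 c2 cg cd CA \<gamma>X \<delta>X \<omega>A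
      B TB "Y 1" "Y \<delta>Y" YS.R \<mu>B d1 d2 ce CB \<delta>Y \<omega>B f g Lf Lg "max 1 MA" "max 1 MB" cA KH
    by (intro fast_slow.intro fast_slow_axioms.intro smX smD smY complete TA_le TB_le R_le cA KH h_C1 fg_zero L_pos)
      (use f_range g_range f_lipschitz g_lipschitz pos_constants gap_condition[OF g(3,2) _ _ _ \<omega>f] L_pos in auto)
  show ?thesis by (rule FS.flow_comparison)
qed

end
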